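(* For large real $\tau$ we have $$ \mathbb{P}(\gamma_{\mathbb{Q}(\sqrt{\mathbb{X}})}>\tau)=\exp\left(-\frac{e^{\tau-A_1}}{\tau}\left(1+ O\left(\frac{\log\tau}{\tau}\right)\right)\right),$$ and $$ \mathbb{P}(\gamma_{\mathbb{Q}(\sqrt{\mathbb{X}})}<-\tau)=\exp\left(-\frac{e^{\tau-A_2}}{\tau}\left(1+O\left(\frac{\log\tau}{\tau}\right)\right)\right),$$ where $A_1:=A_0+2\frac{\zeta'(2)}{\zeta(2)}$, $A_2:=A_0-2\gamma$, and $$ A_0:= \int_0^1\frac{\tanh(t)}{t}dt + \int_1^{\infty}\frac{\tanh(t)-1}{t}dt.$$
   Context: $\gamma$ is the Euler–Mascheroni constant and $\zeta$ the Riemann zeta function. Let $\{X(p)\}_{p}$ be independent random variables indexed by primes with $\mathbb{P}(X(p)=1)=\mathbb{P}(X(p)=-1)=\frac{p}{2(p+1)}$ and $\mathbb{P}(X(p)=0)=\frac{1}{p+1}$, and define the (almost surely convergent) random variable $\gamma_{\mathbb{Q}(\sqrt{\mathbb{X}})}:=\gamma-\sum_{p}\frac{(\log p)X(p)}{p-X(p)}$. *)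

theory Defs
  imports
    "HOL-Probability.Probability"
    "HOL-Computational_Algebra.Primes"
    "HOL-Library.Landau_Symbols"
begin

(* The Dirichlet series on the real half-line s > 1, the only range on which the value
   is meaningful; the value and the derivative at 2 are all that is needed. *)
definition zeta :: "real \<Rightarrow> real" where
  "zeta s = (\<Sum>n. 1 / real (Suc n) powr s)"

(* The sum over primes converges almost surely but only conditionally, so it is taken in
   increasing order of p.  On the null set where it diverges the value is
   an unspecified constant. *)
definition gamma_rand :: "(nat \<Rightarrow> 'a \<Rightarrow> real) \<Rightarrow> 'a \<Rightarrow> real" where
  "gamma_rand X \<omega> = euler_mascheroni -
     (\<Sum>p. if prime p then ln (real p) * X p \<omega> / (real p - X p \<omega>) else 0)"

(* The integrand of the first integral is bounded; its value at t = 0 is irrelevant. *)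
definition A0 :: real where
  "A0 = integral {0..1} (\<lambda>t::real. tanh t / t) + integral {1..} (\<lambda>t::real. (tanh t - 1) / t)"

definition A1 :: real where
  "A1 = A0 + 2 * (deriv zeta 2 / zeta 2)"

definition A2 :: real where
  "A2 = A0 - 2 * euler_mascheroni"

end

(* Write gamma_rand as a constant plus a sum of independent variables Y p, with cumulant generating function K.
   Then K'(s) is a sum over primes which, up to summable corrections, equals
     sum (ln p / p) tanh (s ln p / p),
   and this is close to the same sum with tanh (y / p), where y = s ln s.  Completed by the prime powers, that sum is
     T(y) = sum (mangoldt n / n) tanh (y / n) = ln y - gamma + A0 + O(1 / ln y).
   The last formula needs the prime number theorem in the form of a second-order Mertens estimate on average.  With
   r(u) = sum over n <= exp u of mangoldt n / n, minus u, plus gamma, the Laplace transform of u r(u) extends with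
   polynomial growth to the imaginary axis, by the 3-4-1 bound for zeta; Fourier inversion against the rapidly
   decaying Fourier transform of the kernel exp z (1 - tanh (exp z)^2) shows that the averages of u r(u) against this
   kernel are bounded.

   It follows that K'(s) = ln s + ln ln s + A + O(ln ln s / ln s) and K(s) = s (K'(s) - 1) up to a relative error of
   that order.  Chernoff's bound at s = exp (tau - A) / tau gives the upper bound for the tail.  For the lower bound
   one tilts at the slightly larger s (1 + b theta), theta = ln tau / tau: the tilted mass concentrates on
   [tau, tau + B theta].  The sum of the Y p converges almost surely because its blocks over
   j^2 <= p < (j + 1)^2 have summable first absolute moments. *)
theory Submission
  imports Defs "HOL-Complex_Analysis.Complex_Analysis" "HOL-Number_Theory.Prime_Powers" "HOL-Real_Asymp.Real_Asymp"
begin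

section \<open>Mertens' estimate\<close>

text \<open>The relative error \<open>ln \<tau> / \<tau>\<close> dictates the precision of
  everything else. The saddle point has \<open>ln s\<close> of size \<tau>, so \<open>K'(s)\<close>
  must be known up to \<open>ln (ln s) / ln s\<close>. Chebyshev-type bounds give the Mertens sum
  only up to O(1), whereas its constant and an error O(1 / ln y) after smoothing are wanted;
  weighting the remainder by \<open>u\<close> turns a bounded average into exactly this gain. Since
  the average is against a fixed smooth kernel, whose Fourier transform beats every power, a
  polynomial lower bound for zeta near its line suffices. The loss \<open>ln (ln s)\<close> has one
  source. The sum with \<open>tanh (s ln p / p)\<close> is decided by primes of size about
  \<open>s ln s\<close>, where \<open>ln p\<close> exceeds \<open>ln s\<close> by about
  \<open>ln (ln s)\<close>; replacing \<open>ln p\<close> by \<open>ln s\<close> changes a bounded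
  part of the sum by that relative amount. The two tails differ in the sign of the Euler constant
  and in whether the positive value of the summand is \<open>ln p / (p - 1)\<close> or
  \<open>ln p / (p + 1)\<close>. The latter shifts the constant by a convergent sum over primes,
  which is why \<open>zeta'(2)\<close> appears in \<open>A1\<close> alone.\<close>

lemma sum_mangoldt_div:
  "(\<Sum>d=1..N. mangoldt d * real (N div d)) = ln (fact N :: real)"
proof (induction N)
  case 0 show ?case by simp
next
  case (Suc N)
  \<comment> \<open>Passing from \<open>N\<close> to \<open>Suc N\<close> raises the quotient by one
    exactly for the divisors of \<open>Suc N\<close>, so the increment is a divisor sum of
    \<open>mangoldt\<close>.\<close>
  have "(\<Sum>d=1..Suc N. mangoldt d * real (Suc N div d))
      = (\<Sum>d=1..Suc N. mangoldt d * real (N div d) + (if d dvd Suc N then mangoldt d else 0))"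
    by (intro sum.cong refl) (auto simp: div_Suc dvd_eq_mod_eq_0 algebra_simps)
  also have "\<dots> = (\<Sum>d=1..N. mangoldt d * real (N div d)) + (\<Sum>d | d \<in> {1..Suc N} \<and> d dvd Suc N. mangoldt d)"
    by (simp add: sum.distrib sum.inter_filter[symmetric] del: sum.cl_ivl_Suc)
      (simp add: atLeastAtMostSuc_conv)
  also have "{d. d \<in> {1..Suc N} \<and> d dvd Suc N} = {d. d dvd Suc N}"
    by (auto dest: dvd_imp_le simp: Suc_le_eq intro!: Nat.gr0I)
  also have "(\<Sum>d | d dvd Suc N. mangoldt d :: real) = ln (real (Suc N))"
    using mangoldt_sum[of "Suc N", where ?'a = real] by simp
  finally show ?case using Suc by (simp add: ln_mult)
qed

lemma div_mult_le_div: "2 * (m div d) \<le> 2 * m div (d::nat)"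
proof (cases "d = 0")
  case False
  thus ?thesis by (simp add: less_eq_div_iff_mult_less_eq)
qed simp

text \<open>Chebyshev's doubling argument. When \<open>ln (2m choose m)\<close> is written as a
  combination of values of \<open>mangoldt\<close>, every \<open>d\<close> in \<open>(m, 2m]\<close>
  has weight 1 and every smaller \<open>d\<close> a nonnegative weight, so the increment over
  \<open>(m, 2m]\<close> is at most \<open>2m ln 2\<close>. The constant 4 leaves room for the extra
  term \<open>mangoldt (2m + 1)\<close> when \<open>n\<close> is odd.\<close>

lemma sum_mangoldt_le: "(\<Sum>d=1..n. mangoldt d) \<le> 4 * real n"
proof (induction n rule: less_induct)
  case (less n)
  have dbl: "(\<Sum>d=1..2*m. mangoldt d) \<le> (\<Sum>d=1..m. mangoldt d) + 2 * real m * ln 2" for m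
  proof -
    have "(\<Sum>d=1..2*m. mangoldt d) - (\<Sum>d=1..m. mangoldt d) = (\<Sum>d=m+1..2*m. mangoldt d :: real)"
      using sum.ub_add_nat[of 1 m "mangoldt :: nat \<Rightarrow> real" m] by (simp add: mult_2)
    also have "\<dots> \<le> (\<Sum>d=1..2*m. mangoldt d * (real (2*m div d) - 2 * real (m div d)))"
    proof -
      have "(\<Sum>d=m+1..2*m. mangoldt d :: real) = (\<Sum>d=m+1..2*m. mangoldt d * (real (2*m div d) - 2 * real (m div d)))"
      proof (intro sum.cong refl)
        fix d assume d: "d \<in> {m+1..2*m}"
        have "2 * m div d = 1" using d by (intro div_nat_eqI) auto
        moreover have "m div d = 0" using d by auto
        ultimately show "mangoldt d = mangoldt d * (real (2*m div d) - 2 * real (m div d))"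
          by simp
      qed
      also have "\<dots> \<le> (\<Sum>d=1..2*m. mangoldt d * (real (2*m div d) - 2 * real (m div d)))"
      proof (intro sum_mono2)
        fix d
        have "2 * (m div d) \<le> 2 * m div d"
          using div_mult_le_div[of m d] by simp
        hence "2 * real (m div d) \<le> real (2*m div d)"
          by linarith
        thus "0 \<le> mangoldt d * (real (2*m div d) - 2 * real (m div d))"
          by (simp add: mangoldt_nonneg)
      qed auto
      finally show ?thesis .
    qed
    also have "\<dots> = ln (fact (2*m)) - 2 * ln (fact m)"
    proof -
      have "(\<Sum>d=1..2*m. mangoldt d * real (m div d)) = (\<Sum>d=1..m. mangoldt d * real (m div d))"
        by (intro sum.mono_neutral_right) auto
      moreover have "(\<Sum>d=1..2*m. mangoldt d * (real (2*m div d) - 2 * real (m div d)))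
          = (\<Sum>d=1..2*m. mangoldt d * real (2*m div d)) - 2 * (\<Sum>d=1..2*m. mangoldt d * real (m div d))"
        by (simp only: right_diff_distrib sum_subtractf sum_distrib_left mult.left_commute)
      ultimately show ?thesis
        using sum_mangoldt_div[of "2*m"] sum_mangoldt_div[of m] by simp
    qed
    also have "\<dots> = ln (real (2*m choose m))"
    proof -
      have "fact m * fact m * real (2*m choose m) = fact (2*m)"
        using binomial_fact_lemma[of m "2*m"] by (simp add: mult_2) (metis of_nat_fact of_nat_mult)
      hence "ln (fact (2*m) :: real) = ln (fact m * fact m * real (2*m choose m))" by simp
      also have "\<dots> = 2 * ln (fact m) + ln (real (2*m choose m))"
        by (simp add: ln_mult)
      finally show ?thesis by simp
    qed
    also have "\<dots> \<le> ln (2 ^ (2*m))"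
    proof -
      have "real (2*m choose m) \<le> 2 ^ (2*m)"
        using binomial_le_pow2[of "2*m" m] by (metis of_nat_le_iff of_nat_numeral of_nat_power)
      thus ?thesis by simp
    qed
    also have "\<dots> = 2 * real m * ln 2" by (simp add: ln_realpow)
    finally show ?thesis by simp
  qed
  have ln2: "ln (2::real) \<le> 1" using ln_le_minus_one[of "2::real"] by simp
  have rm: "2 * real m * ln 2 \<le> 2 * real m" for m
    using mult_left_mono[OF ln2, of "2 * real m"] by simp
  consider "n = 0" | m where "n = 2*m" "m > 0" | m where "n = 2*m+1"
    by (metis oddE evenE gr0I mult_0_right)
  thus ?case
  proof cases
    case 1 thus ?thesis by simp
  next
    case (2 m)
    have "(\<Sum>d=1..m. mangoldt d) \<le> 4 * real m" using less.IH[of m] 2 by simp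
    with dbl[of m] rm[of m] have "(\<Sum>d=1..2*m. mangoldt d) \<le> 8 * real m" by linarith
    thus ?thesis using 2 by simp
  next
    case (3 m)
    have "mangoldt (2*m+1) \<le> ln (real (2*m+1))"
    proof -
      have "mangoldt (2*m+1) \<le> (\<Sum>d | d dvd (2*m+1). mangoldt d :: real)"
        by (intro member_le_sum) (auto simp: mangoldt_nonneg)
      thus ?thesis using mangoldt_sum[of "2*m+1", where ?'a = real] by simp
    qed
    also have "\<dots> \<le> 2 * real m"
      using ln_le_minus_one[of "real (2*m+1)"] by simp
    finally have *: "mangoldt (2*m+1) \<le> 2 * real m" .
    have "(\<Sum>d=1..m. mangoldt d) \<le> 4 * real m" using less.IH[of m] 3 by simp
    with dbl[of m] rm[of m] * have "(\<Sum>d=1..2*m. mangoldt d) + mangoldt (2*m+1) \<le> 8 * real m + 4"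
      by linarith
    thus ?thesis using 3 by simp
  qed
qed

lemma mangoldt_le_ln: "n > 0 \<Longrightarrow> mangoldt n \<le> ln (real n)"
proof -
  assume "n > 0"
  hence "mangoldt n \<le> (\<Sum>d | d dvd n. mangoldt d :: real)"
    by (intro member_le_sum) (auto simp: mangoldt_nonneg)
  thus ?thesis using mangoldt_sum[of "n", where ?'a = real] \<open>n > 0\<close> by simp
qed

lemma ln_fact_ge: "real N * ln (real N) - real N \<le> ln (fact N :: real)"
proof (induction N)
  case (Suc N)
  show ?case
  proof (cases "N = 0")
    case False
    hence N: "real N > 0" by simp
    have "ln (1 + 1 / real N) \<le> 1 / real N" by (rule ln_add_one_self_le_self) simp
    also have "1 + 1 / real N = (1 + real N) / real N" using N by (simp add: field_simps)
    also have "ln ((1 + real N) / real N) = ln (1 + real N) - ln (real N)"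
      using N by (simp add: ln_div)
    finally have "real N * (ln (1 + real N) - ln (real N)) \<le> 1"
      using N by (simp add: field_simps)
    moreover have "ln (fact (Suc N) :: real) = ln (1 + real N) + ln (fact N)"
      by (simp add: ln_mult del: of_nat_Suc)
    ultimately show ?thesis using Suc by (simp only: of_nat_Suc) (simp add: algebra_simps)
  qed simp
qed simp

lemma ln_fact_le: "ln (fact N :: real) \<le> real N * ln (real N)"
proof (cases "N = 0")
  case False
  have "real (fact N) \<le> real (N ^ N)"
    using fact_le_power[of N, where ?'a=nat] by (simp only: of_nat_le_iff of_nat_id)
  hence "ln (fact N :: real) \<le> ln (real N ^ N)" using False by simp
  thus ?thesis by (simp add: ln_realpow)
qed simp

text \<open>Both sides of \<open>sum_mangoldt_div\<close> are compared with smooth versions: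
  Stirling at the level of O(N) for the factorial, and for the sum the replacement of
  \<open>N div d\<close> by \<open>N / d\<close>, which costs at most the Chebyshev sum. Division by
  \<open>N\<close> turns O(N) into a constant.\<close>

lemma mertens_bound:
  assumes "N > 0"
  shows "\<bar>(\<Sum>d=1..N. mangoldt d / real d) - ln (real N)\<bar> \<le> 4"
proof -
  have N: "real N > 0" using assms by simp
  have le: "real (N div d) \<le> real N / real d" for d
    by (rule of_nat_div_le_of_nat)
  have ge: "real N / real d \<le> real (N div d) + 1" for d
    using floor_divide_of_nat_eq[of N d, where ?'a=real] floor_correct[of "real N / real d"] by linarith
  have "ln (fact N) \<le> (\<Sum>d=1..N. mangoldt d * (real N / real d))"
    unfolding sum_mangoldt_div[symmetric]
    by (intro sum_mono mult_left_mono le mangoldt_nonneg)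
  also have "\<dots> = real N * (\<Sum>d=1..N. mangoldt d / real d)"
    by (simp add: sum_distrib_left mult_ac)
  finally have 1: "real N * (ln (real N) - 1) \<le> real N * (\<Sum>d=1..N. mangoldt d / real d)"
    using ln_fact_ge[of N] by (simp add: algebra_simps)
  have "real N * (\<Sum>d=1..N. mangoldt d / real d) = (\<Sum>d=1..N. mangoldt d * (real N / real d))"
    by (simp add: sum_distrib_left mult_ac)
  also have "\<dots> \<le> (\<Sum>d=1..N. mangoldt d * (real (N div d) + 1))"
    by (intro sum_mono mult_left_mono ge mangoldt_nonneg)
  also have "\<dots> = ln (fact N) + (\<Sum>d=1..N. mangoldt d)"
    using sum_mangoldt_div[of N] by (simp add: algebra_simps sum.distrib)
  also have "\<dots> \<le> real N * (ln (real N) + 4)"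
    using ln_fact_le[of N] sum_mangoldt_le[of N] by (simp add: algebra_simps)
  finally have "real N * (\<Sum>d=1..N. mangoldt d / real d) \<le> real N * (ln (real N) + 4)" .
  with 1 show ?thesis using N by (simp add: mult_le_cancel_left abs_le_iff)
qed

section \<open>Dirichlet series of real sequences\<close>

text \<open>A real sequence \<open>a\<close> gives the Dirichlet series \<open>\<Sum> a\<^sub>n n\<^bsup>-1-w\<^esup>\<close>; the shift by one puts the
  line of interest at \<open>Re w = 0\<close>.\<close>

definition dseries :: "(nat \<Rightarrow> real) \<Rightarrow> complex \<Rightarrow> complex" where
  "dseries a w = (\<Sum>n. of_real (a (Suc n)) * of_nat (Suc n) powr (-1 - w))"

definition abs_conv :: "(nat \<Rightarrow> real) \<Rightarrow> bool" where
  "abs_conv a \<longleftrightarrow> (\<forall>\<sigma>>0. summable (\<lambda>n. \<bar>a (Suc n)\<bar> * real (Suc n) powr (-1 - \<sigma>)))"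

lemma norm_nat_powr: "norm (of_nat (Suc n) powr (w::complex)) = real (Suc n) powr Re w"
  by (subst norm_powr_real_powr) (auto simp del: of_nat_Suc)

lemma dseries_norm_summable:
  assumes "abs_conv a" "Re w > 0"
  shows "summable (\<lambda>n. norm (of_real (a (Suc n)) * of_nat (Suc n) powr (-1 - w) :: complex))"
  using assms unfolding norm_mult norm_nat_powr abs_conv_def by simp

lemma dseries_sums:
  assumes "abs_conv a" "Re w > 0"
  shows "(\<lambda>n. of_real (a (Suc n)) * of_nat (Suc n) powr (-1 - w)) sums dseries a w"
  unfolding dseries_def by (rule summable_sums[OF summable_norm_cancel[OF dseries_norm_summable[OF assms]]])

lemma ln_le_powr: "ln (real (Suc n)) \<le> real (Suc n) powr e / e" if "e > 0"
proof -
  have "e * ln (real (Suc n)) = ln (real (Suc n) powr e)" by (simp add: ln_powr)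
  also have "\<dots> \<le> real (Suc n) powr e" using ln_le_minus_one[of "real (Suc n) powr e"] by simp
  finally show ?thesis using that by (simp add: field_simps)
qed

text \<open>The logarithm is absorbed by half of the available exponent \<sigma>.\<close>

lemma abs_conv_ln: assumes "abs_conv a" shows "abs_conv (\<lambda>n. a n * ln (real n))"
  unfolding abs_conv_def
proof (intro allI impI)
  fix \<sigma> :: real assume s: "\<sigma> > 0"
  have "summable (\<lambda>n. (2/\<sigma>) * (\<bar>a (Suc n)\<bar> * real (Suc n) powr (-1 - \<sigma>/2)))"
    using assms s by (intro summable_mult) (simp add: abs_conv_def)
  thus "summable (\<lambda>n. \<bar>a (Suc n) * ln (real (Suc n))\<bar> * real (Suc n) powr (-1 - \<sigma>))"
  proof (rule summable_comparison_test')
    fix n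
    have "\<bar>a (Suc n) * ln (real (Suc n))\<bar> * real (Suc n) powr (-1 - \<sigma>)
       \<le> \<bar>a (Suc n)\<bar> * (real (Suc n) powr (\<sigma>/2) / (\<sigma>/2)) * real (Suc n) powr (-1 - \<sigma>)"
      unfolding abs_mult using ln_le_powr[of "\<sigma>/2" n] s
      by (intro mult_right_mono mult_left_mono) auto
    also have "\<dots> = (2/\<sigma>) * (\<bar>a (Suc n)\<bar> * (real (Suc n) powr (\<sigma>/2) * real (Suc n) powr (-1 - \<sigma>)))"
      using s by (simp add: field_simps)
    also have "real (Suc n) powr (\<sigma>/2) * real (Suc n) powr (-1 - \<sigma>) = real (Suc n) powr (-1 - \<sigma>/2)"
      unfolding powr_add[symmetric] by (rule arg_cong[where f = "\<lambda>x. _ powr x"]) simp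
    finally show "norm (\<bar>a (Suc n) * ln (real (Suc n))\<bar> * real (Suc n) powr (-1 - \<sigma>))
        \<le> (2/\<sigma>) * (\<bar>a (Suc n)\<bar> * real (Suc n) powr (-1 - \<sigma>/2))"
      by simp
  qed
qed

lemma abs_conv_mono: "abs_conv a \<Longrightarrow> (\<And>n. \<bar>b n\<bar> \<le> \<bar>a n\<bar>) \<Longrightarrow> abs_conv b"
  unfolding abs_conv_def
proof (intro allI impI)
  fix \<sigma> :: real
  assume a: "\<forall>\<sigma>>0. summable (\<lambda>n. \<bar>a (Suc n)\<bar> * real (Suc n) powr (-1 - \<sigma>))"
    and b: "\<And>n. \<bar>b n\<bar> \<le> \<bar>a n\<bar>" and s: "\<sigma> > 0"
  show "summable (\<lambda>n. \<bar>b (Suc n)\<bar> * real (Suc n) powr (-1 - \<sigma>))"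
    by (rule summable_comparison_test'[OF a[rule_format, OF s]]) (simp add: b mult_right_mono)
qed

lemma abs_conv_1: "abs_conv (\<lambda>_. 1)"
  unfolding abs_conv_def
proof (intro allI impI)
  fix \<sigma> :: real assume "\<sigma> > 0"
  hence "summable (\<lambda>n. real n powr (-1 - \<sigma>))" by (subst summable_real_powr_iff) auto
  hence "summable (\<lambda>n. real (Suc n) powr (-1 - \<sigma>))" by (subst summable_Suc_iff)
  thus "summable (\<lambda>n. \<bar>1\<bar> * real (Suc n) powr (-1 - \<sigma>))" by simp
qed

lemma abs_conv_ln1: "abs_conv (\<lambda>n. ln (real n))"
  using abs_conv_ln[OF abs_conv_1] by simp

lemma abs_conv_mangoldt: "abs_conv mangoldt"
proof (rule abs_conv_mono[OF abs_conv_ln1])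
  fix n show "\<bar>mangoldt n\<bar> \<le> \<bar>ln (real n)\<bar>"
    using mangoldt_le_ln[of n] by (cases "n = 0") auto
qed

lemma dseries_has_field_derivative:
  assumes a: "abs_conv a" and w: "Re w > 0"
  shows "(dseries a has_field_derivative - dseries (\<lambda>n. a n * ln (real n)) w) (at w)"
proof -
  define f where "f n w = of_real (a (Suc n)) * of_nat (Suc n) powr (-1 - w)" for n and w :: complex
  define f' where "f' n w = - (of_real (a (Suc n) * ln (real (Suc n))) * of_nat (Suc n) powr (-1 - w))" for n and w :: complex
  \<comment> \<open>Halving \<open>Re w\<close> leaves an open half-plane around \<open>w\<close> on
    which the terms at abscissa \<open>Re w / 2\<close> are a uniform majorant.\<close>
  define S where "S = {x. Re x > Re w / 2}"
  have "\<exists>g g'. \<forall>x\<in>S. ((\<lambda>n. f n x) sums g x) \<and> ((\<lambda>n. f' n x) sums g' x) \<and> (g has_field_derivative g' x) (at x)"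
  proof -
    have S: "open S" unfolding S_def by (rule open_halfspace_Re_gt)
    have h: "summable (\<lambda>n. \<bar>a (Suc n)\<bar> * real (Suc n) powr (-1 - Re w / 2))"
      using a w unfolding abs_conv_def by auto
    have der: "(f n has_field_derivative f' n x) (at x)" for n x
    proof -
      have "((\<lambda>x. of_nat (Suc n) powr (-1 - x)) has_field_derivative
          (Ln (of_nat (Suc n)) * of_nat (Suc n) powr (-1 - x)) * (-1)) (at (x::complex))"
        by (rule DERIV_chain2[OF has_field_derivative_powr_right]) (auto intro!: derivative_eq_intros simp del: of_nat_Suc)
      from DERIV_cmult[OF this, of "of_real (a (Suc n))"]
      show ?thesis
        unfolding f_def f'_def using Ln_of_nat[of "Suc n"] by (simp add: mult_ac del: of_nat_Suc)
    qed
    have le: "\<forall>\<^sub>F n in sequentially. \<forall>x\<in>S. norm (f n x) \<le> \<bar>a (Suc n)\<bar> * real (Suc n) powr (-1 - Re w / 2)"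
      by (intro always_eventually allI ballI)
        (auto simp: f_def S_def norm_mult norm_nat_powr simp del: of_nat_Suc intro!: mult_left_mono powr_mono)
    show ?thesis by (rule series_and_derivative_comparison[OF S h der le]) blast
  qed
  then obtain g g' where g: "\<And>x. x \<in> S \<Longrightarrow> (\<lambda>n. f n x) sums g x" "\<And>x. x \<in> S \<Longrightarrow> (\<lambda>n. f' n x) sums g' x"
      "\<And>x. x \<in> S \<Longrightarrow> (g has_field_derivative g' x) (at x)" by blast
  have wS: "w \<in> S" using w by (simp add: S_def)
  have "g' w = - dseries (\<lambda>n. a n * ln (real n)) w"
  proof -
    have "(\<lambda>n. f' n w) sums - dseries (\<lambda>n. a n * ln (real n)) w"
      unfolding f'_def by (intro sums_minus dseries_sums abs_conv_ln a w)
    thus ?thesis using g(2)[OF wS] by (metis sums_unique2)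
  qed
  moreover have "g x = dseries a x" if "x \<in> S" for x
  proof -
    have "Re x > 0" using that w unfolding S_def by auto
    hence "(\<lambda>n. f n x) sums dseries a x" unfolding f_def by (intro dseries_sums a)
    thus ?thesis using g(1)[OF that] by (metis sums_unique2)
  qed
  ultimately show ?thesis
    using has_field_derivative_transform_within_open[OF g(3)[OF wS] _ wS, of "dseries a"]
      open_halfspace_Re_gt[of "Re w / 2"] unfolding S_def by simp
qed

text \<open>The double series over \<open>(d, m)\<close> converges absolutely, so it may be
  regrouped by the product \<open>k = d m\<close>; the inner sum of \<open>mangoldt\<close> over the
  divisors of \<open>k\<close> is \<open>ln k\<close>. Since the series of \<open>ln n\<close> is
  minus the derivative of zeta, this is the formula for the logarithmic derivative of zeta.\<close>

lemma dseries_mult_mangoldt: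
  assumes w: "Re w > 0"
  shows "dseries mangoldt w * dseries (\<lambda>_. 1) w = dseries (\<lambda>n. ln (real n)) w"
proof -
  define c where "c n = (of_nat n powr (-1 - w) :: complex)" for n :: nat
  have c_mult: "c (m * n) = c m * c n" for m n
    unfolding c_def of_nat_mult
    using powr_times_real[of "of_nat m" "of_nat n" "-1 - w"] by simp
  define P where "P = {n::nat. n > 0}"
  have hs: "((\<lambda>n. of_real (a n) * c n) has_sum dseries a w) P" and
       ab: "(\<lambda>n. norm (of_real (a n) * c n)) summable_on P" if "abs_conv a" for a
  proof -
    have bij: "bij_betw Suc UNIV P" unfolding P_def
      by (rule bij_betwI[of _ _ _ "\<lambda>n. n - 1"]) auto
    have "((\<lambda>n. of_real (a (Suc n)) * c (Suc n)) has_sum dseries a w) UNIV"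
      unfolding c_def by (intro norm_summable_imp_has_sum dseries_norm_summable dseries_sums that w)
    thus "((\<lambda>n. of_real (a n) * c n) has_sum dseries a w) P"
      using has_sum_reindex_bij_betw[OF bij, of "\<lambda>n. of_real (a n) * c n"] by simp
    have "(\<lambda>n. norm (of_real (a (Suc n)) * c (Suc n))) summable_on UNIV"
      unfolding c_def using dseries_norm_summable[OF that w]
      by (subst summable_on_UNIV_nonneg_real_iff) auto
    thus "(\<lambda>n. norm (of_real (a n) * c n)) summable_on P"
      using summable_on_reindex_bij_betw[OF bij, of "\<lambda>n. norm (of_real (a n) * c n)"] by simp
  qed
  let ?F = "\<lambda>(d,m). (of_real (mangoldt d) * c d) * c m"
  have abs: "(\<lambda>x. norm (?F x)) summable_on (P \<times> P)"
  proof -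
    have "(\<lambda>m. norm (c m)) summable_on P" using ab[OF abs_conv_1] by simp
    thus ?thesis
      using ab[OF abs_conv_mangoldt]
      by (subst Infinite_Sum.abs_summable_on_Sigma_iff)
         (auto simp: norm_mult infsum_cmult_right' abs_mult infsum_nonneg
           intro!: summable_on_cmult_right summable_on_cmult_left)
  qed
  have 1: "(?F has_sum (dseries mangoldt w * dseries (\<lambda>_. 1) w)) (P \<times> P)"
  proof (rule has_sum_SigmaI)
    show "((\<lambda>m. ?F (d, m)) has_sum (of_real (mangoldt d) * c d) * dseries (\<lambda>_. 1) w) P" if "d \<in> P" for d
      using has_sum_cmult_right[OF hs[OF abs_conv_1], of "of_real (mangoldt d) * c d"] by simp
    show "((\<lambda>d. of_real (mangoldt d) * c d * dseries (\<lambda>_. 1) w) has_sum dseries mangoldt w * dseries (\<lambda>_. 1) w) P"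
      by (intro has_sum_cmult_left hs abs_conv_mangoldt)
    show "?F summable_on P \<times> P" using abs by (rule Infinite_Sum.abs_summable_summable)
  qed
  \<comment> \<open>Pairs are relabelled by their product: \<open>(d, m)\<close> becomes
    \<open>(k, d)\<close> with \<open>d dvd k\<close>, so that the divisors of \<open>k\<close> form
    a fibre.\<close>
  let ?G = "\<lambda>(k,d). of_real (mangoldt d) * c k"
  have 2: "(?G has_sum (dseries mangoldt w * dseries (\<lambda>_. 1) w)) (Sigma P (\<lambda>k. {d. d dvd k}))"
  proof -
    have bij: "bij_betw (\<lambda>(k,d). (d, k div d)) (Sigma P (\<lambda>k. {d. d dvd k})) (P \<times> P)"
    proof (rule bij_betwI[where g = "\<lambda>(d,m). (d * m, d)"])
      show "(\<lambda>(k,d). (d, k div d)) \<in> Sigma P (\<lambda>k. {d. d dvd k}) \<rightarrow> P \<times> P"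
        by (auto simp: P_def elim!: dvdE)
      show "(\<lambda>(d,m). (d * m, d)) \<in> P \<times> P \<rightarrow> Sigma P (\<lambda>k. {d. d dvd k})"
        by (auto simp: P_def)
    qed (auto simp: P_def)
    have "((\<lambda>x. ?F (case x of (k,d) \<Rightarrow> (d, k div d))) has_sum (dseries mangoldt w * dseries (\<lambda>_. 1) w))
        (Sigma P (\<lambda>k. {d. d dvd k}))"
      using has_sum_reindex_bij_betw[OF bij, of ?F] 1 by blast
    moreover have "?F (case x of (k,d) \<Rightarrow> (d, k div d)) = ?G x" if "x \<in> Sigma P (\<lambda>k. {d. d dvd k})" for x
    proof -
      obtain k d where x: "x = (k, d)" by (cases x)
      hence "d dvd k" using that by auto
      hence "c k = c d * c (k div d)" using c_mult[of d "k div d"] by simp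
      thus ?thesis by (simp add: x)
    qed
    ultimately show ?thesis using has_sum_cong by (metis (no_types, lifting))
  qed
  have "((\<lambda>k. of_real (ln (real k)) * c k) has_sum (dseries mangoldt w * dseries (\<lambda>_. 1) w)) P"
  proof (rule has_sum_SigmaD[OF 2])
    fix k assume k: "k \<in> P"
    have fin: "finite {d. d dvd k}" using k by (simp add: P_def)
    have "(\<Sum>d | d dvd k. of_real (mangoldt d) * c k) = of_real (ln (real k)) * c k"
      using mangoldt_sum[of k, where ?'a = complex] k by (simp add: P_def sum_distrib_right[symmetric])
    thus "((\<lambda>d. ?G (k, d)) has_sum of_real (ln (real k)) * c k) {d. d dvd k}"
      using has_sum_finite[OF fin, of "\<lambda>d. of_real (mangoldt d) * c k"] by simp
  qed
  thus ?thesis using hs[OF abs_conv_ln1] by (metis has_sum_unique)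
qed

text \<open>Every term but the first decays at least like \<open>2 powr (-x)\<close> as
  \<open>x\<close> grows. The limit fixes the integration constant in the exponential formula for
  zeta.\<close>

lemma dseries_at_top:
  assumes "\<And>n. \<bar>a n\<bar> \<le> 1"
  shows "((\<lambda>x. dseries a (of_real x)) \<longlongrightarrow> of_real (a 1)) at_top"
proof -
  define S where "S = (\<Sum>n. real (Suc n) powr (-1 - 1))"
  have adm: "abs_conv a" by (rule abs_conv_mono[OF abs_conv_1]) (use assms in auto)
  have sm: "summable (\<lambda>n. real (Suc n) powr (-1 - 1))"
    using abs_conv_1 unfolding abs_conv_def by (auto dest: spec[of _ 1])
  have bd: "norm (dseries a (of_real x) - of_real (a 1)) \<le> S * 2 powr (1 - x)" if x: "x \<ge> 1" for x
  proof -
    define f where "f n = (of_real (a (Suc n)) * of_nat (Suc n) powr (-1 - of_real x) :: complex)" for n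
    have s1: "f sums dseries a (of_real x)"
      unfolding f_def by (rule dseries_sums[OF adm]) (use x in auto)
    have "(\<lambda>n. f (Suc n)) sums (dseries a (of_real x) - f 0)"
      using s1 by (subst sums_Suc_iff) simp
    hence s2: "(\<lambda>n. f (Suc n)) sums (dseries a (of_real x) - of_real (a 1))" by (simp add: f_def)
    have le: "norm (f (Suc n)) \<le> real (Suc (Suc n)) powr (-1 - 1) * 2 powr (1 - x)" for n
    proof -
      have "norm (f (Suc n)) \<le> real (Suc (Suc n)) powr (-1 - x)"
        unfolding f_def norm_mult norm_nat_powr using assms[of "Suc (Suc n)"]
        by (simp del: of_nat_Suc add: mult_left_le_one_le)
      also have "\<dots> = real (Suc (Suc n)) powr (-1 - 1) * real (Suc (Suc n)) powr (1 - x)"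
        unfolding powr_add[symmetric] by (rule arg_cong[where f = "\<lambda>x. _ powr x"]) simp
      also have "\<dots> \<le> real (Suc (Suc n)) powr (-1 - 1) * 2 powr (1 - x)"
        using x by (intro mult_left_mono powr_mono2') auto
      finally show ?thesis .
    qed
    have sm': "summable (\<lambda>n. real (Suc (Suc n)) powr (-1 - 1))"
      using summable_Suc_iff[of "\<lambda>n. real (Suc n) powr (-1 - 1)"] sm by simp
    have "norm (dseries a (of_real x) - of_real (a 1)) = norm (\<Sum>n. f (Suc n))"
      using s2 by (simp add: sums_iff)
    also have "\<dots> \<le> (\<Sum>n. norm (f (Suc n)))"
      by (rule summable_norm[OF summable_comparison_test'[OF summable_mult2[OF sm', of "2 powr (1-x)"]]])
        (use le in auto)
    also have "\<dots> \<le> (\<Sum>n. real (Suc (Suc n)) powr (-1 - 1) * 2 powr (1 - x))"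
      by (rule suminf_le[OF le summable_comparison_test'[OF summable_mult2[OF sm', of "2 powr (1-x)"]]
            summable_mult2[OF sm']]) (use le in auto)
    also have "\<dots> = (\<Sum>n. real (Suc (Suc n)) powr (-1 - 1)) * 2 powr (1 - x)"
      by (rule suminf_mult2[OF sm', symmetric])
    also have "\<dots> \<le> S * 2 powr (1 - x)"
      unfolding S_def using suminf_split_head[OF sm] by (intro mult_right_mono) auto
    finally show ?thesis .
  qed
  have "((\<lambda>x. S * 2 powr (1 - x)) \<longlongrightarrow> 0) at_top" by real_asymp
  hence "((\<lambda>x. dseries a (of_real x) - of_real (a 1)) \<longlongrightarrow> 0) at_top"
    by (rule Lim_null_comparison[rotated]) (use bd in \<open>auto simp: eventually_at_top_linorder intro!: exI[of _ 1]\<close>)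
  thus ?thesis by (simp add: LIM_zero_iff)
qed

lemma mangoldt_div_ln_le: "\<bar>mangoldt n / ln (real n)\<bar> \<le> 1"
proof (cases "n \<le> 1")
  case True
  thus ?thesis by (cases n) auto
next
  case False
  thus ?thesis using mangoldt_le_ln[of n] mangoldt_nonneg[of n] by (simp add: divide_le_eq)
qed

lemma abs_conv_mangoldt_div_ln: "abs_conv (\<lambda>n. mangoldt n / ln (real n))"
  by (rule abs_conv_mono[OF abs_conv_1]) (use mangoldt_div_ln_le in auto)

text \<open>The logarithm of the zeta function.  Both sides tend to 1 as \<open>w \<rightarrow> \<infinity>\<close> along the reals and have
  the same logarithmic derivative.\<close>

lemma zeta_eq_exp:
  assumes "Re w > 0"
  shows "dseries (\<lambda>_. 1) w = exp (dseries (\<lambda>n. mangoldt n / ln (real n)) w)"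
proof -
  let ?E = "dseries (\<lambda>n. mangoldt n / ln (real n))"
  let ?f = "\<lambda>w. dseries (\<lambda>_. 1) w * exp (- ?E w)"
  \<comment> \<open>For \<open>n <= 1\<close> the logarithm is 0 and division by it gives 0; this is
    harmless because \<open>mangoldt\<close> vanishes there.\<close>
  have eq: "(\<lambda>n. mangoldt n / ln (real n) * ln (real n)) = mangoldt"
  proof
    fix n show "mangoldt n / ln (real n) * ln (real n) = mangoldt n"
      by (cases "n \<le> 1"; cases n) auto
  qed
  have der: "(?f has_field_derivative 0) (at w)" if "Re w > 0" for w
  proof -
    have 1: "(dseries (\<lambda>_. 1) has_field_derivative - dseries (\<lambda>n. ln (real n)) w) (at w)"
      using dseries_has_field_derivative[OF abs_conv_1 that] by simp
    have 2: "(?E has_field_derivative - dseries mangoldt w) (at w)"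
      using dseries_has_field_derivative[OF abs_conv_mangoldt_div_ln that] unfolding eq .
    show ?thesis
      by (rule derivative_eq_intros 1 2 refl)+
         (use dseries_mult_mangoldt[OF that] in \<open>simp add: algebra_simps\<close>)
  qed
  have "convex {w. Re w > 0}" by (rule convex_halfspace_Re_gt)
  from has_field_derivative_zero_constant[OF this, of ?f]
  obtain c where c: "\<And>w. Re w > 0 \<Longrightarrow> ?f w = c"
    using der by (auto intro: has_field_derivative_at_within)
  have "((\<lambda>x. ?f (of_real x)) \<longlongrightarrow> of_real 1 * exp (- (of_real (mangoldt 1 / ln (real 1))))) at_top"
    by (intro tendsto_intros dseries_at_top mangoldt_div_ln_le) auto
  moreover have "\<forall>\<^sub>F x in at_top. ?f (of_real x) = c"
    using eventually_gt_at_top[of "0::real"] by eventually_elim (rule c, simp)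
  ultimately have "((\<lambda>x::real. c) \<longlongrightarrow> 1) at_top"
    by (simp add: filterlim_cong)
  hence "c = 1" by (simp add: tendsto_const_iff)
  thus ?thesis using c[OF assms] by (simp add: exp_minus field_simps)
qed

lemma dseries_Re_sums:
  assumes "abs_conv a" "\<sigma> > 0"
  shows "(\<lambda>n. a (Suc n) * real (Suc n) powr (-1 - \<sigma>) * cos (t * ln (real (Suc n)))) sums Re (dseries a (Complex \<sigma> t))"
proof -
  have "Re (of_nat (Suc n) powr (-1 - Complex \<sigma> t)) = real (Suc n) powr (-1 - \<sigma>) * cos (t * ln (real (Suc n)))" for n
    using Ln_of_nat[of "Suc n"] unfolding powr_def
    by (auto simp: Re_exp powr_def simp del: of_nat_Suc)
  thus ?thesis
    using sums_Re[OF dseries_sums[OF assms(1), of "Complex \<sigma> t"]] assms(2)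
    by (simp del: of_nat_Suc add: mult.assoc)
qed

text \<open>Apply \<open>3 + 4 cos x + cos (2 x) = 2 (1 + cos x)^2 >= 0\<close> to each term of the
  logarithm of zeta, whose coefficients are nonnegative, and exponentiate.\<close>

lemma zeta_341:
  assumes "\<sigma> > 0"
  shows "norm (dseries (\<lambda>_. 1) (of_real \<sigma>)) ^ 3 * norm (dseries (\<lambda>_. 1) (Complex \<sigma> t)) ^ 4
          * norm (dseries (\<lambda>_. 1) (Complex \<sigma> (2*t))) \<ge> 1"
proof -
  let ?a = "\<lambda>n. mangoldt n / ln (real n)"
  let ?E = "dseries ?a"
  define b where "b n = ?a (Suc n) * real (Suc n) powr (-1 - \<sigma>)" for n
  have b0: "b n \<ge> 0" for n unfolding b_def by (intro mult_nonneg_nonneg divide_nonneg_nonneg mangoldt_nonneg) auto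
  note s = dseries_Re_sums[OF abs_conv_mangoldt_div_ln assms, folded b_def]
  have s0: "b sums Re (?E (Complex \<sigma> 0))" using s[of 0] by simp
  have "(\<lambda>n. 3 * b n + 4 * (b n * cos (t * ln (real (Suc n)))) + b n * cos (2 * t * ln (real (Suc n)))) sums
        (3 * Re (?E (Complex \<sigma> 0)) + 4 * Re (?E (Complex \<sigma> t)) + Re (?E (Complex \<sigma> (2*t))))"
    by (intro sums_add sums_mult s s0)
  moreover have "0 \<le> 3 * b n + 4 * (b n * cos (t * ln (real (Suc n)))) + b n * cos (2 * t * ln (real (Suc n)))" for n
  proof -
    define L where "L = ln (real (Suc n))"
    have c2: "cos (2 * t * L) = 2 * (cos (t * L))\<^sup>2 - 1"
      using cos_double_cos[of "t * L"] by (simp only: mult.assoc)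
    have "3 * b n + 4 * (b n * cos (t * L)) + b n * cos (2 * t * L) = 2 * b n * (1 + cos (t * L))\<^sup>2"
      unfolding c2 by (simp add: algebra_simps power2_eq_square)
    thus ?thesis unfolding L_def[symmetric] using b0[of n] by simp
  qed
  ultimately have "0 \<le> 3 * Re (?E (Complex \<sigma> 0)) + 4 * Re (?E (Complex \<sigma> t)) + Re (?E (Complex \<sigma> (2*t)))"
    by (metis (no_types, lifting) sums_iff suminf_nonneg)
  hence "1 \<le> exp (3 * Re (?E (Complex \<sigma> 0)) + 4 * Re (?E (Complex \<sigma> t)) + Re (?E (Complex \<sigma> (2*t))))" by simp
  also have "\<dots> = exp (Re (?E (Complex \<sigma> 0))) ^ 3 * exp (Re (?E (Complex \<sigma> t))) ^ 4 * exp (Re (?E (Complex \<sigma> (2*t))))"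
    by (simp add: exp_add exp_of_nat_mult[symmetric])
  finally show ?thesis
    using assms by (simp add: zeta_eq_exp complex_of_real_def)
qed

section \<open>The zeta function on the line of absolute convergence\<close>

definition zeta_term :: "nat \<Rightarrow> complex \<Rightarrow> complex" where
  "zeta_term n w = w * of_nat (Suc n) powr (-1 - w) - of_nat (Suc n) powr (-w) + of_nat (Suc (Suc n)) powr (-w)"

text \<open>This is \<open>w \<zeta>(1 + w)\<close>, continued to \<open>Re w > -1/2\<close> by subtracting the telescoping series
  \<open>1 = \<Sum> (n\<^bsup>-w\<^esup> - (n + 1)\<^bsup>-w\<^esup>)\<close> termwise.\<close>

definition zeta_reg :: "complex \<Rightarrow> complex" where
  "zeta_reg w = 1 + (\<Sum>n. zeta_term n w)"

text \<open>The term is the error of the first-order Taylor expansion of \<open>z powr (-w)\<close>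
  at \<open>n + 1\<close>, evaluated at \<open>n + 2\<close>. The second derivative
  \<open>w (w + 1) z powr (-w - 2)\<close> supplies the growth in \<open>w\<close>, and
  \<open>Re w >= -1/2\<close> leaves the summable power \<open>-3/2\<close>.\<close>

lemma zeta_term_bound:
  assumes "Re w \<ge> -1/2"
  shows "norm (zeta_term n w) \<le> norm w * norm (w + 1) * real (Suc n) powr (-3/2)"
proof -
  define a b where "a = (of_nat (Suc n) :: complex)" and "b = (of_nat (Suc (Suc n)) :: complex)"
  define S where "S = closed_segment a b"
  define f where "f i z = (if i = 0 then z powr (-w) else if i = 1 then -w * z powr (-w-1)
      else w * (w+1) * z powr (-w-2))" for i :: nat and z :: complex
  have S: "Im x = 0 \<and> Re x \<ge> real (Suc n)" if xS: "x \<in> S" for x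
  proof -
    obtain u where "0 \<le> u" "u \<le> 1" "x = (1 - u) *\<^sub>R a + u *\<^sub>R b"
      using xS unfolding S_def closed_segment_def by auto
    hence "x = of_real (real (Suc n) + u)"
      by (simp add: a_def b_def scaleR_conv_of_real algebra_simps)
    thus ?thesis using \<open>0 \<le> u\<close> by (simp del: of_nat_Suc)
  qed
  have pos: "x \<notin> \<real>\<^sub>\<le>\<^sub>0 \<and> x \<noteq> 0" if "x \<in> S" for x
    using S[OF that] by (auto simp: complex_nonpos_Reals_iff)
  have "norm (f 0 b - (\<Sum>i\<le>1. f i a * (b - a) ^ i / fact i))
     \<le> (norm w * norm (w + 1) * real (Suc n) powr (-3/2)) * norm (b - a) ^ (Suc 1) / fact 1"
  proof (rule field_Taylor)
    show "convex S" "a \<in> S" "b \<in> S" by (auto simp: S_def)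
    show "(f i has_field_derivative f (Suc i) x) (at x within S)" if "x \<in> S" "i \<le> 1" for i x
    proof -
      have i: "i = 0 \<or> i = 1" using that by auto
      have "((\<lambda>z. z powr (-w)) has_field_derivative -w * x powr (-w-1)) (at x)"
        using pos[OF that(1)] by (auto intro!: derivative_eq_intros simp: field_simps powr_diff)
      moreover have "((\<lambda>z. -w * z powr (-w-1)) has_field_derivative w * (w+1) * x powr (-w-2)) (at x)"
      proof -
        have "((\<lambda>z. z powr (-w-1)) has_field_derivative (-w-1) * x powr (-w-1-1)) (at x)"
          by (rule has_field_derivative_powr) (use pos[OF that(1)] in auto)
        from DERIV_cmult[OF this, of "-w"] show ?thesis by (simp add: algebra_simps)
      qed
      ultimately show ?thesis
        using i unfolding f_def by (auto intro: has_field_derivative_at_within)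
    qed
    show "norm (f (Suc 1) x) \<le> norm w * norm (w + 1) * real (Suc n) powr (-3/2)" if "x \<in> S" for x
    proof -
      have x: "x = of_real (Re x)" "Re x \<ge> real (Suc n)" using S[OF that] by (auto simp: complex_eq_iff)
      have "norm (x powr (-w-2)) = Re x powr (- (Re w + 2))"
        using S[OF that] by (subst norm_powr_real_powr) (auto simp: complex_is_Real_iff)
      also have "\<dots> \<le> real (Suc n) powr (- (Re w + 2))"
        using x assms by (intro powr_mono2') auto
      also have "\<dots> \<le> real (Suc n) powr (- (3/2))"
        using assms by (intro powr_mono le_imp_neg_le) auto
      finally show ?thesis unfolding f_def
        by (simp add: norm_mult mult_left_mono del: of_nat_Suc)
    qed
  qed
  moreover have "b - a = 1" by (simp add: a_def b_def)
  moreover have "f 0 b - (\<Sum>i\<le>1. f i a * 1 ^ i / fact i) = zeta_term n w"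
  proof -
    have e: "-1 - w = -w - 1" by simp
    show ?thesis unfolding zeta_term_def e by (simp add: f_def a_def b_def algebra_simps)
  qed
  ultimately show ?thesis by simp
qed

lemma summable_32: "summable (\<lambda>n. real (Suc n) powr (-3/2))"
proof -
  have "summable (\<lambda>n. real n powr (-3/2))" by (subst summable_real_powr_iff) auto
  thus ?thesis by (subst summable_Suc_iff)
qed

definition zeta_reg_const :: real where "zeta_reg_const = 1 + (\<Sum>n. real (Suc n) powr (-3/2))"

lemma zeta_reg_const_ge: "zeta_reg_const \<ge> 1" "(\<Sum>n. real (Suc n) powr (-3/2)) \<le> zeta_reg_const"
  unfolding zeta_reg_const_def using suminf_nonneg[OF summable_32] by auto

lemma zeta_reg_minus_1:
  assumes "Re w \<ge> -1/2"
  shows "norm (zeta_reg w - 1) \<le> zeta_reg_const * norm w * norm (w + 1)"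
proof -
  let ?c = "norm w * norm (w + 1)"
  have le: "norm (zeta_term n w) \<le> ?c * real (Suc n) powr (-3/2)" for n using zeta_term_bound[OF assms] .
  note sm = summable_comparison_test'[OF summable_mult[OF summable_32, of ?c]]
  have "norm (zeta_reg w - 1) \<le> (\<Sum>n. norm (zeta_term n w))"
    unfolding zeta_reg_def add_diff_cancel_left' by (rule summable_norm[OF sm]) (use le in auto)
  also have "\<dots> \<le> (\<Sum>n. ?c * real (Suc n) powr (-3/2))"
    by (rule suminf_le[OF le sm summable_mult[OF summable_32]]) (use le in auto)
  also have "\<dots> = ?c * (\<Sum>n. real (Suc n) powr (-3/2))" by (rule suminf_mult[OF summable_32])
  also have "\<dots> \<le> ?c * zeta_reg_const" using zeta_reg_const_ge by (intro mult_left_mono) auto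
  finally show ?thesis by (simp add: mult_ac)
qed

lemma zeta_reg_bound:
  assumes "Re w \<ge> -1/2"
  shows "norm (zeta_reg w) \<le> 2 * zeta_reg_const * (1 + norm w) ^ 2"
proof -
  have "norm (zeta_reg w) \<le> 1 + norm (zeta_reg w - 1)"
    using norm_triangle_ineq[of 1 "zeta_reg w - 1"] by simp
  also have "\<dots> \<le> 1 + zeta_reg_const * norm w * norm (w + 1)" using zeta_reg_minus_1[OF assms] by simp
  also have "\<dots> \<le> zeta_reg_const * (1 + norm w)^2 + zeta_reg_const * (1 + norm w)^2"
  proof (rule add_mono)
    show "1 \<le> zeta_reg_const * (1 + norm w)^2"
      using mult_mono[OF zeta_reg_const_ge(1) one_le_power[of "1 + norm w" 2]] zeta_reg_const_ge(1) by simp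
    have "norm w * norm (w+1) \<le> (1 + norm w) * (1 + norm w)"
      using norm_triangle_ineq[of w 1] by (intro mult_mono) auto
    thus "zeta_reg_const * norm w * norm (w + 1) \<le> zeta_reg_const * (1 + norm w)^2"
      using zeta_reg_const_ge by (simp add: power2_eq_square mult.assoc)
  qed
  finally show ?thesis by simp
qed

definition zeta_term_deriv :: "nat \<Rightarrow> complex \<Rightarrow> complex" where
  "zeta_term_deriv n w = of_nat (Suc n) powr (-1 - w) - w * of_real (ln (real (Suc n))) * of_nat (Suc n) powr (-1 - w)
        + of_real (ln (real (Suc n))) * of_nat (Suc n) powr (-w) - of_real (ln (real (Suc (Suc n)))) * of_nat (Suc (Suc n)) powr (-w)"

text \<open>The bound on the terms is uniform on unit balls, and for holomorphic functions locally
  uniform convergence carries over to the derivatives.\<close>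

lemma zeta_reg_deriv:
  assumes "Re w > -1/2"
  shows "(zeta_reg has_field_derivative (\<Sum>n. zeta_term_deriv n w)) (at w)" and "(\<lambda>n. zeta_term_deriv n w) sums (\<Sum>n. zeta_term_deriv n w)"
proof -
  define S where "S = {w. Re w > -1/2}"
  have S: "open S" unfolding S_def by (rule open_halfspace_Re_gt)
  have der: "(zeta_term n has_field_derivative zeta_term_deriv n x) (at x)" for n x
  proof -
    have p: "((\<lambda>x. of_nat (Suc m) powr (c - x)) has_field_derivative
          - (ln (real (Suc m)) * of_nat (Suc m) powr (c - x))) (at (x::complex))" for m c
    proof -
      have "((\<lambda>x. of_nat (Suc m) powr (c - x)) has_field_derivative
          (Ln (of_nat (Suc m)) * of_nat (Suc m) powr (c - x)) * (-1)) (at (x::complex))"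
        by (rule DERIV_chain2[OF has_field_derivative_powr_right]) (auto intro!: derivative_eq_intros simp del: of_nat_Suc)
      thus ?thesis using Ln_of_nat[of "Suc m"] by (simp del: of_nat_Suc)
    qed
    note p0 = p[of _ 0, simplified diff_0]
    show ?thesis unfolding zeta_term_def zeta_term_deriv_def
      by (rule derivative_eq_intros p p0 refl)+ (simp add: algebra_simps del: of_nat_Suc)
  qed
  have "\<exists>g g'. \<forall>x\<in>S. ((\<lambda>n. zeta_term n x) sums g x) \<and> ((\<lambda>n. zeta_term_deriv n x) sums g' x) \<and> (g has_field_derivative g' x) (at x)"
  proof (rule series_and_derivative_comparison_local[OF S der])
    fix x assume "x \<in> S"
    let ?h = "\<lambda>n. (norm x + 1) * (norm x + 2) * real (Suc n) powr (-3/2)"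
    have "norm (zeta_term n y) \<le> ?h n" if "y \<in> ball x 1 \<inter> S" for y n
    proof -
      have y: "norm y \<le> norm x + 1"
        using that norm_triangle_ineq2[of y x] by (auto simp: dist_norm norm_minus_commute)
      have "norm (zeta_term n y) \<le> norm y * norm (y + 1) * real (Suc n) powr (-3/2)"
        using that by (intro zeta_term_bound) (auto simp: S_def)
      also have "\<dots> \<le> ?h n"
        using y norm_triangle_ineq[of y 1] by (intro mult_right_mono mult_mono) auto
      finally show ?thesis .
    qed
    thus "\<exists>d h. 0 < d \<and> summable h \<and> (\<forall>\<^sub>F n in sequentially. \<forall>y\<in>ball x d \<inter> S. norm (zeta_term n y) \<le> h n)"
      by (intro exI[of _ 1] exI[of _ ?h] conjI summable_mult summable_32 always_eventually allI ballI) simp_all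
  qed
  then obtain g g' where g: "\<And>x. x \<in> S \<Longrightarrow> (\<lambda>n. zeta_term n x) sums g x" "\<And>x. x \<in> S \<Longrightarrow> (\<lambda>n. zeta_term_deriv n x) sums g' x"
      "\<And>x. x \<in> S \<Longrightarrow> (g has_field_derivative g' x) (at x)" by blast
  have "(zeta_reg has_field_derivative g' w) (at w)" if "w \<in> S" for w
  proof -
    have "((\<lambda>w. 1 + g w) has_field_derivative g' w) (at w)"
      using g(3)[OF that] by (auto intro!: derivative_eq_intros)
    thus ?thesis
      by (rule has_field_derivative_transform_within_open[OF _ S that]) (use g(1) in \<open>auto simp: zeta_reg_def sums_iff\<close>)
  qed
  moreover have "w \<in> S" using assms by (simp add: S_def)
  ultimately show "(zeta_reg has_field_derivative (\<Sum>n. zeta_term_deriv n w)) (at w)" "(\<lambda>n. zeta_term_deriv n w) sums (\<Sum>n. zeta_term_deriv n w)"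
    using g(2)[of w] by (simp_all add: sums_iff)
qed

lemma zeta_reg_holomorphic: "zeta_reg holomorphic_on {w. Re w > -1/2}"
  unfolding holomorphic_on_open[OF open_halfspace_Re_gt] using zeta_reg_deriv(1) by blast

text \<open>Termwise differentiation at 0 leaves
  \<open>1 / (n + 1) + ln (n + 1) - ln (n + 2)\<close>, a series for the Euler constant. This is the
  constant term of the Laurent expansion of zeta at its pole, and it is what makes the Laplace
  transform of the centred remainder regular at 0.\<close>

lemma deriv_zeta_reg_0: "deriv zeta_reg 0 = of_real euler_mascheroni"
proof -
  have g': "(zeta_reg has_field_derivative (\<Sum>n. zeta_term_deriv n 0)) (at 0)" by (rule zeta_reg_deriv) simp
  have e0: "of_nat (Suc n) powr (0::complex) = 1" and e1: "of_nat (Suc n) powr (-1::complex) = inverse (of_nat (Suc n))" for n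
    by (simp_all add: powr_minus del: of_nat_Suc)
  have "(\<lambda>n. inverse (of_nat (Suc n)) + of_real (ln (real (Suc n))) - of_real (ln (real (Suc (Suc n))))) sums (\<Sum>n. zeta_term_deriv n 0)"
    using zeta_reg_deriv(2)[of 0] by (simp add: zeta_term_deriv_def e0 e1 del: of_nat_Suc)
  hence "(\<Sum>n. zeta_term_deriv n 0) = euler_mascheroni"
    using sums_unique2[OF _ euler_mascheroni_sum[where 'a = complex]] by simp
  thus ?thesis using g' by (simp add: DERIV_imp_deriv)
qed

text \<open>For \<open>Re w > 0\<close> the powers \<open>n powr (-w)\<close> tend to 0, so the
  telescoping series really sums to 1 and its subtraction in \<open>zeta_reg\<close> is
  undone.\<close>

lemma zeta_reg_eq:
  assumes "Re w > 0"
  shows "zeta_reg w = w * dseries (\<lambda>_. 1) w"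
proof -
  have "(\<lambda>n. of_nat (Suc n) powr (-w) :: complex) \<longlonglongrightarrow> 0"
  proof (rule Lim_null_comparison[OF always_eventually])
    show "\<forall>n. norm (of_nat (Suc n) powr (-w) :: complex) \<le> real (Suc n) powr (- Re w)"
      by (simp add: norm_nat_powr del: of_nat_Suc)
    show "(\<lambda>n. real (Suc n) powr (- Re w)) \<longlonglongrightarrow> 0"
      using assms by real_asymp
  qed
  from telescope_sums[OF this]
  have "(\<lambda>n. of_nat (Suc (Suc n)) powr (-w) - of_nat (Suc n) powr (-w) :: complex) sums - 1" by simp
  moreover have "(\<lambda>n. w * of_nat (Suc n) powr (-1 - w)) sums (w * dseries (\<lambda>_. 1) w)"
    using sums_mult[OF dseries_sums[OF abs_conv_1 assms], of w] by simp
  ultimately have "(\<lambda>n. w * of_nat (Suc n) powr (-1 - w) + (of_nat (Suc (Suc n)) powr (-w) - of_nat (Suc n) powr (-w))) sums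
     (w * dseries (\<lambda>_. 1) w + (-1))" by (intro sums_add)
  hence "(\<lambda>n. zeta_term n w) sums (w * dseries (\<lambda>_. 1) w - 1)" by (simp add: zeta_term_def algebra_simps)
  thus ?thesis by (simp add: zeta_reg_def sums_iff)
qed

text \<open>Cauchy's inequality on a disc of radius 1/4, which stays inside
  \<open>Re w > -1/2\<close>. This is the purpose of continuing beyond \<open>Re w = 0\<close>:
  derivatives are controlled up to and on that line with the same polynomial growth. The 8 is
  \<open>2 * 2^2\<close>, from \<open>1 + norm x <= 2 * (1 + norm w)\<close> on the circle.\<close>

lemma deriv_zeta_reg_bound:
  assumes "Re w \<ge> 0"
  shows "norm ((deriv ^^ n) zeta_reg w) \<le> fact n * (8 * zeta_reg_const * (1 + norm w) ^ 2) * 4 ^ n"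
proof -
  have sub: "cball w (1/4) \<subseteq> {w. Re w > -1/2}"
  proof
    fix z assume "z \<in> cball w (1/4)"
    hence "\<bar>Re w - Re z\<bar> \<le> 1/4"
      using abs_Re_le_cmod[of "w - z"] by (simp add: dist_norm)
    hence "Re w - Re z \<le> 1/4" by linarith
    hence "Re z \<ge> -(1/4)" using assms by linarith
    hence "Re z > -1/2" by simp
    thus "z \<in> {w. Re w > -1/2}" by simp
  qed
  have "norm ((deriv ^^ n) zeta_reg w) \<le> fact n * (8 * zeta_reg_const * (1 + norm w) ^ 2) / (1/4) ^ n"
  proof (rule Cauchy_inequality)
    show "zeta_reg holomorphic_on ball w (1/4)"
      by (rule holomorphic_on_subset[OF zeta_reg_holomorphic]) (rule subset_trans[OF ball_subset_cball sub])
    show "continuous_on (cball w (1/4)) zeta_reg"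
      by (rule holomorphic_on_imp_continuous_on[OF holomorphic_on_subset[OF zeta_reg_holomorphic sub]])
    fix x assume x: "norm (w - x) = 1/4"
    have "norm x \<le> norm w + 1/4" using norm_triangle_ineq2[of x w] x by (simp add: norm_minus_commute)
    moreover have "x \<in> cball w (1/4)" using x by (simp add: dist_norm)
    hence "norm (zeta_reg x) \<le> 2 * zeta_reg_const * (1 + norm x)^2" using sub by (intro zeta_reg_bound) auto
    moreover have "(1 + norm x)^2 \<le> (2 * (1 + norm w))^2"
    proof (rule power_mono)
      show "1 + norm x \<le> 2 * (1 + norm w)"
        using \<open>norm x \<le> norm w + 1/4\<close> norm_ge_zero[of w] by argo
    qed simp
    ultimately show "norm (zeta_reg x) \<le> 8 * zeta_reg_const * (1 + norm w)^2"
    proof -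
      assume a: "norm (zeta_reg x) \<le> 2 * zeta_reg_const * (1 + norm x)^2" "(1 + norm x)^2 \<le> (2 * (1 + norm w))^2"
      have "2 * zeta_reg_const * (1 + norm x)^2 \<le> 2 * zeta_reg_const * (2 * (1 + norm w))^2"
        using zeta_reg_const_ge(1) a(2) by (intro mult_left_mono) auto
      also have "\<dots> = 8 * zeta_reg_const * (1 + norm w)^2" by (simp only: power_mult_distrib) simp
      finally show ?thesis using a(1) by linarith
    qed
  qed auto
  thus ?thesis by (simp add: power_one_over field_simps)
qed

section \<open>Growth and quantitative non-vanishing of zeta near the line of absolute
  convergence\<close>

definition zeta_reg_growth :: real where "zeta_reg_growth = 256 * zeta_reg_const"

lemma zeta_reg_growth_ge: "zeta_reg_growth \<ge> 1" using zeta_reg_const_ge(1) by (simp add: zeta_reg_growth_def)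

lemma zeta_reg_bounds:
  assumes "Re w \<ge> 0"
  shows "norm (zeta_reg w) \<le> zeta_reg_growth * (1 + norm w)^2"
    and "norm (deriv zeta_reg w) \<le> zeta_reg_growth * (1 + norm w)^2"
    and "norm (deriv (deriv zeta_reg) w) \<le> zeta_reg_growth * (1 + norm w)^2"
proof -
  have "0 \<le> zeta_reg_const * (1 + norm w)^2" using zeta_reg_const_ge(1) by simp
  \<comment> \<open>The constant 256 is \<open>fact 2 * 8 * 4^2\<close>, the largest of the factors
    for derivatives of order at most 2.\<close>
  thus "norm (zeta_reg w) \<le> zeta_reg_growth * (1 + norm w)^2" "norm (deriv zeta_reg w) \<le> zeta_reg_growth * (1 + norm w)^2"
     "norm (deriv (deriv zeta_reg) w) \<le> zeta_reg_growth * (1 + norm w)^2"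
    using zeta_reg_bound[of w] deriv_zeta_reg_bound[OF assms, of 1] deriv_zeta_reg_bound[OF assms, of 2] assms
    by (simp_all add: zeta_reg_growth_def numeral_2_eq_2 algebra_simps)
qed

text \<open>The radius at which \<open>zeta_reg_minus_1\<close>, together with
  \<open>norm (w + 1) <= 2\<close>, still keeps \<open>zeta_reg\<close> within 1/2 of its value 1 at
  the origin.\<close>

definition zeta_reg_radius :: real where "zeta_reg_radius = 1 / (4 * zeta_reg_const)"

lemma zeta_reg_radius: "0 < zeta_reg_radius" "zeta_reg_radius \<le> 1/4"
  using zeta_reg_const_ge(1) by (auto simp: zeta_reg_radius_def field_simps)

lemma zeta_reg_near_0:
  assumes "norm w \<le> zeta_reg_radius"
  shows "norm (zeta_reg w) \<ge> 1/2"
proof -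
  have "Re w \<ge> -1/2" using abs_Re_le_cmod[of w] zeta_reg_radius assms by linarith
  hence "norm (zeta_reg w - 1) \<le> zeta_reg_const * norm w * norm (w + 1)" by (rule zeta_reg_minus_1)
  also have "\<dots> \<le> zeta_reg_const * zeta_reg_radius * 2"
    using norm_triangle_ineq[of w 1] zeta_reg_radius assms zeta_reg_const_ge(1) by (intro mult_mono) auto
  also have "\<dots> = 1/2" using zeta_reg_const_ge(1) by (simp add: zeta_reg_radius_def)
  finally have "norm (zeta_reg w - 1) \<le> 1/2" .
  thus ?thesis using norm_triangle_ineq2[of 1 "1 - zeta_reg w"] by (simp add: norm_minus_commute)
qed

text \<open>In the 3-4-1 inequality the pole contributes \<open>(Re w) powr (-3)\<close> and the
  factor at height \<open>2 t\<close> grows polynomially, so the fourth power of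
  \<open>zeta_reg w\<close> is at least a multiple of \<open>(Re w)^3\<close> over a power of
  \<open>1 + norm w\<close>. Staying away from 0 makes the division by \<open>norm w\<close>, which
  comes from \<open>zeta_reg w = w zeta (1 + w)\<close>, cost only a constant. The small constant is
  raised to the fourth power so that a fourth root can be taken cleanly.\<close>

lemma zeta_reg_lower_aux:
  assumes "0 < Re w" "Re w \<le> 1" "norm w \<ge> zeta_reg_radius"
  shows "(zeta_reg_radius ^ 5 / (256 * zeta_reg_growth ^ 4)) ^ 4 * (Re w) ^ 3 \<le> ((1 + norm w) * norm (zeta_reg w)) ^ 4"
proof -
  define x t where "x = Re w" and "t = Im w"
  have w: "w = Complex x t" by (simp add: x_def t_def)
  have x: "0 < x" "x \<le> 1" using assms by (simp_all add: x_def)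
  define w2 where "w2 = Complex x (2*t)"
  define c where "c = zeta_reg_radius ^ 5 / (256 * zeta_reg_growth ^ 4)"
  define N where "N = 1 + norm w"
  have N: "N \<ge> 1" by (simp add: N_def)
  have nd: "norm (dseries (\<lambda>_. 1) u) = norm (zeta_reg u) / norm u" if "Re u > 0" for u
  proof -
    have "norm u > 0" using that by auto
    thus ?thesis using zeta_reg_eq[OF that] by (simp add: norm_mult)
  qed
  have w2: "norm w2 \<ge> norm w" "norm w2 \<le> 2 * norm w"
    using x by (auto simp: w w2_def cmod_def real_sqrt_mult[symmetric] power_mult_distrib
         intro!: real_sqrt_le_mono) (simp add: real_le_lsqrt cmod_def power_mult_distrib)
  have wpos: "norm w > 0" using assms zeta_reg_radius by linarith
  have "1 \<le> (norm (zeta_reg (of_real x)) / x) ^ 3 * (norm (zeta_reg w) / norm w) ^ 4 * (norm (zeta_reg w2) / norm w2)"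
  proof -
    have "Re w > 0" "Re w2 > 0" "Re (of_real x :: complex) > 0" using x by (simp_all add: w w2_def)
    note n = this[THEN nd]
    show ?thesis
      using zeta_341[OF x(1), of t] n x unfolding w[symmetric] w2_def[symmetric] by simp
  qed
  also have "\<dots> \<le> (4 * zeta_reg_growth / x) ^ 3 * (norm (zeta_reg w) / norm w) ^ 4 * (4 * zeta_reg_growth * N^2 / norm w)"
  proof (intro mult_mono power_mono divide_right_mono frac_le)
    have "norm (zeta_reg (of_real x)) \<le> zeta_reg_growth * (1 + norm (of_real x :: complex))^2"
      using x by (intro zeta_reg_bounds) auto
    also have "\<dots> \<le> zeta_reg_growth * 2^2"
      using x zeta_reg_growth_ge by (intro mult_left_mono power_mono) auto
    finally show "norm (zeta_reg (of_real x)) \<le> 4 * zeta_reg_growth" by simp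
    have "norm (zeta_reg w2) \<le> zeta_reg_growth * (1 + norm w2)^2"
      using x by (intro zeta_reg_bounds) (auto simp: w2_def)
    also have "\<dots> \<le> zeta_reg_growth * (2 * N)^2"
      using w2 zeta_reg_growth_ge by (intro mult_left_mono power_mono) (auto simp: N_def)
    finally show "norm (zeta_reg w2) \<le> 4 * zeta_reg_growth * N^2" by (simp add: power_mult_distrib)
  qed (use x zeta_reg_growth_ge w2 wpos in auto)
  also have "\<dots> = 256 * zeta_reg_growth^4 * N^2 * norm (zeta_reg w) ^ 4 / (x ^ 3 * norm w ^ 5)"
    using x wpos by (simp add: field_simps power_mult_distrib eval_nat_numeral)
  finally have *: "x ^ 3 * norm w ^ 5 \<le> 256 * zeta_reg_growth^4 * N^2 * norm (zeta_reg w) ^ 4"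
    using x wpos by (simp add: field_simps)
  have "zeta_reg_radius ^ 5 * x ^ 3 \<le> norm w ^ 5 * x ^ 3"
    using x zeta_reg_radius assms by (intro mult_right_mono power_mono) auto
  also have "\<dots> \<le> 256 * zeta_reg_growth^4 * (N^2 * norm (zeta_reg w) ^ 4)" using * by (simp add: mult_ac)
  finally have "c * x^3 \<le> N^2 * norm (zeta_reg w) ^ 4"
    using zeta_reg_growth_ge by (simp add: c_def field_simps)
  also have "\<dots> \<le> N^4 * norm (zeta_reg w) ^ 4"
    using N by (intro mult_right_mono power_increasing) auto
  finally have 1: "c * x^3 \<le> (N * norm (zeta_reg w))^4" by (simp add: power_mult_distrib)
  have c: "0 \<le> c" "c \<le> 1"
  proof -
    show "0 \<le> c" using zeta_reg_radius zeta_reg_growth_ge by (simp add: c_def)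
    have "zeta_reg_radius ^ 5 \<le> 1" using zeta_reg_radius by (intro power_le_one) auto
    moreover have "1 \<le> 256 * zeta_reg_growth ^ 4" using one_le_power[OF zeta_reg_growth_ge, of 4] by simp
    ultimately have "zeta_reg_radius ^ 5 \<le> 256 * zeta_reg_growth ^ 4" by linarith
    thus "c \<le> 1" unfolding c_def using zeta_reg_growth_ge by (simp add: divide_le_eq)
  qed
  have "c ^ 4 \<le> c ^ 1" using c by (intro power_decreasing) auto
  hence "c ^ 4 * x^3 \<le> c * x^3" using x by (intro mult_right_mono) auto
  with 1 show ?thesis by (simp add: c_def x_def N_def)
qed

text \<open>The bound from the 3-4-1 inequality degenerates like \<open>(Re w) powr (3/4)\<close>.
  At abscissa \<open>y^4\<close> it is of order \<open>y^3\<close>, while by the derivative bound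
  moving from there to a smaller abscissa changes \<open>zeta_reg\<close> by order
  \<open>y^4\<close> only. For \<open>y\<close> small in terms of \<open>1 + norm w\<close> the
  first wins, and the bound becomes uniform down to \<open>Re w = 0\<close>. The tenth power results
  from \<open>y\<close> being of order \<open>(1 + norm w) powr (-3)\<close>.\<close>

lemma zeta_reg_lower:
  obtains c where "c > 0" "\<And>w. 0 < Re w \<Longrightarrow> Re w \<le> 1 \<Longrightarrow> c / (1 + norm w) ^ 10 \<le> norm (zeta_reg w)"
proof -
  define c where "c = zeta_reg_radius ^ 5 / (256 * zeta_reg_growth ^ 4)"
  have c: "0 < c" "c \<le> 1"
  proof -
    show "0 < c" using zeta_reg_radius zeta_reg_growth_ge by (simp add: c_def)
    have "zeta_reg_radius ^ 5 \<le> 1" using zeta_reg_radius by (intro power_le_one) auto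
    moreover have "1 \<le> 256 * zeta_reg_growth ^ 4" using one_le_power[OF zeta_reg_growth_ge, of 4] by simp
    ultimately have "zeta_reg_radius ^ 5 \<le> 256 * zeta_reg_growth ^ 4" by linarith
    thus "c \<le> 1" unfolding c_def using zeta_reg_growth_ge by (simp add: divide_le_eq)
  qed
  define d where "d = c ^ 4 / (4 * 16 ^ 3 * zeta_reg_growth ^ 3)"
  have d: "d > 0" "d \<le> 1/2"
  proof -
    show "d > 0" using c zeta_reg_growth_ge by (simp add: d_def)
    have "c ^ 4 \<le> 1" using c by (intro power_le_one) auto
    moreover have "1 \<le> zeta_reg_growth ^ 3" using one_le_power[OF zeta_reg_growth_ge, of 3] by simp
    ultimately have "c ^ 4 \<le> 8192 * zeta_reg_growth ^ 3" by linarith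
    thus "d \<le> 1/2" unfolding d_def using zeta_reg_growth_ge by (simp add: divide_le_eq)
  qed
  have main: "d / (1 + norm w) ^ 10 \<le> norm (zeta_reg w)" if w: "0 < Re w" "Re w \<le> 1" "norm w \<ge> zeta_reg_radius" for w
  proof -
    define N where "N = 1 + norm w"
    have N: "N \<ge> 1" by (simp add: N_def)
    \<comment> \<open>This size makes the loss \<open>4 * zeta_reg_growth * N^2 * y^4\<close> from
      the derivative bound equal to half of the gain \<open>c * y^3 / (2 * N)\<close>.\<close>
    define y where "y = c / (16 * zeta_reg_growth * N ^ 3)"
    have den: "1 \<le> 16 * zeta_reg_growth * N ^ 3"
      using mult_mono[OF zeta_reg_growth_ge one_le_power[OF N, of 3]] zeta_reg_growth_ge by simp
    have y: "0 < y" "y \<le> 1"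
      using c den by (auto simp: y_def divide_le_eq intro!: divide_pos_pos)
    have goal_eq: "c * y^3 / (4 * N) = d / N ^ 10"
      using c zeta_reg_growth_ge N unfolding y_def d_def by (simp add: field_simps eval_nat_numeral)
    have *: "c * y^3 \<le> (1 + norm u) * norm (zeta_reg u)" if u: "Re u \<ge> y^4" "Re u \<le> 1" "norm u \<ge> zeta_reg_radius" for u
    proof (rule power_le_imp_le_base[of _ 3])
      have "(c * y^3) ^ Suc 3 = c ^ 4 * (y^4)^3"
        by (simp add: power_mult_distrib power_mult[symmetric])
      also have "\<dots> \<le> c ^ 4 * (Re u)^3"
        using c y u by (intro mult_left_mono power_mono) auto
      also have "\<dots> \<le> ((1 + norm u) * norm (zeta_reg u)) ^ 4"
        unfolding c_def using u y by (intro zeta_reg_lower_aux) (auto intro: less_le_trans[OF zero_less_power])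
      finally show "(c * y^3) ^ Suc 3 \<le> ((1 + norm u) * norm (zeta_reg u)) ^ Suc 3" by simp
    qed simp
    have "c * y^3 / (4 * N) \<le> norm (zeta_reg w)"
    proof (cases "Re w \<ge> y^4")
      case True
      have "c * y^3 \<le> N * norm (zeta_reg w)" using *[OF True w(2,3)] by (simp add: N_def)
      also have "\<dots> \<le> 4 * N * norm (zeta_reg w)" using N by (intro mult_right_mono) auto
      finally show ?thesis using N by (simp add: field_simps)
    next
      case False
      \<comment> \<open>The comparison point lies to the right of \<open>w\<close> at the same
        height, at the abscissa where the 3-4-1 bound is still effective.\<close>
      define v where "v = Complex (y^4) (Im w)"
      have y4: "y ^ 4 \<le> 1" using y by (intro power_le_one) auto
      have vw: "norm (v - w) \<le> y^4" "v - w = of_real (y^4 - Re w)"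
        using False w by (auto simp: v_def complex_eq_iff cmod_def)
      have nv: "norm v \<le> norm w + y^4"
      proof -
        have "norm v \<le> norm w + norm (v - w)" using norm_triangle_ineq[of w "v - w"] by simp
        thus ?thesis using vw(1) by linarith
      qed
      have nv2: "norm w \<le> norm v"
      proof -
        have "(Re w)\<^sup>2 \<le> (y^4)\<^sup>2" using False w(1) by (intro power_mono) auto
        thus ?thesis unfolding v_def cmod_def complex.sel by (intro real_sqrt_le_mono add_right_mono)
      qed
      have "c * y^3 \<le> (1 + norm v) * norm (zeta_reg v)"
        by (rule *) (use nv2 w y4 in \<open>auto simp: v_def\<close>)
      also have "\<dots> \<le> 2 * N * norm (zeta_reg v)"
        using nv y4 norm_ge_zero[of w] unfolding N_def by (intro mult_right_mono) (argo, simp)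
      finally have 1: "c * y^3 / (2 * N) \<le> norm (zeta_reg v)" using N by (simp add: field_simps)
      have "norm (zeta_reg v - zeta_reg w) \<le> zeta_reg_growth * (2 * N)^2 * norm (v - w)"
      proof (rule field_differentiable_bound[of "closed_segment w v"])
        fix z assume z: "z \<in> closed_segment w v"
        have Rez: "Re z \<ge> 0"
        proof -
          have "closed_segment w v \<subseteq> {z. Re z \<ge> 0}"
            by (rule closed_segment_subset[OF _ _ convex_halfspace_Re_ge]) (use w y in \<open>auto simp: v_def\<close>)
          thus ?thesis using z by auto
        qed
        show "(zeta_reg has_field_derivative deriv zeta_reg z) (at z within closed_segment w v)"
          using Rez zeta_reg_deriv(1)[of z] by (metis DERIV_deriv_iff_field_differentiable field_differentiable_def
              has_field_derivative_at_within less_le_trans divide_minus_left half_gt_zero neg_less_0_iff_less zero_less_one)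
        have "norm z \<le> norm w + 1"
        proof -
          have "closed_segment w v \<subseteq> cball 0 (norm w + 1)"
            by (rule closed_segment_subset) (use nv y4 in auto)
          thus ?thesis using z by auto
        qed
        hence "1 + norm z \<le> 2 * N" using norm_ge_zero[of w] unfolding N_def by argo
        hence "(1 + norm z)^2 \<le> (2 * N)^2" by (intro power_mono) auto
        thus "norm (deriv zeta_reg z) \<le> zeta_reg_growth * (2 * N)^2"
          using zeta_reg_bounds(2)[OF Rez] zeta_reg_growth_ge by (meson mult_left_mono order_trans zero_le_one)
      qed auto
      also have "\<dots> \<le> zeta_reg_growth * (2 * N)^2 * y^4"
        using vw zeta_reg_growth_ge by (intro mult_left_mono) auto
      also have "\<dots> = y^3 * (4 * zeta_reg_growth * N^2 * y)" by (simp add: power_mult_distrib eval_nat_numeral)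
      also have "4 * zeta_reg_growth * N^2 * y = c / (4 * N)"
        using zeta_reg_growth_ge N by (simp add: y_def field_simps eval_nat_numeral)
      finally have 2: "norm (zeta_reg v - zeta_reg w) \<le> c * y^3 / (4 * N)" by (simp add: field_simps)
      have "c * y^3 / (2 * N) = c * y^3 / (4 * N) + c * y^3 / (4 * N)" using N by (simp add: field_simps)
      with 1 2 show ?thesis using norm_triangle_ineq2[of "zeta_reg v" "zeta_reg w"] by linarith
    qed
    thus ?thesis unfolding goal_eq by (simp add: N_def)
  qed
  have "d / (1 + norm w) ^ 10 \<le> norm (zeta_reg w)" if w: "0 < Re w" "Re w \<le> 1" for w
  proof (cases "norm w \<ge> zeta_reg_radius")
    case False
    have "d / (1 + norm w) ^ 10 \<le> d" using d one_le_power[of "1 + norm w" 10] by (simp add: divide_le_eq mult_le_cancel_left1)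
    with zeta_reg_near_0[of w] False d show ?thesis by simp
  qed (use main w in auto)
  thus ?thesis using that d by blast
qed

text \<open>The closed form of the Laplace transform of \<open>u * mertens_rem u\<close>: two terms
  come from the Mertens sum, \<open>2 / w ^ 3\<close> from the subtracted \<open>u^2\<close>, and
  the last one from the Euler constant times \<open>u\<close>.\<close>

definition rem_laplace :: "complex \<Rightarrow> complex" where
  "rem_laplace w = dseries (\<lambda>n. mangoldt n * ln (real n)) w / w + dseries mangoldt w / w ^ 2 - 2 / w ^ 3
     + of_real euler_mascheroni / w ^ 2"

lemma zeta_reg_nz:
  assumes "Re w > 0" shows "zeta_reg w \<noteq> 0"
  using assms by (auto simp: zeta_reg_eq zeta_eq_exp)

lemma deriv_zeta_reg:
  assumes "Re w > -1/2" shows "(zeta_reg has_field_derivative deriv zeta_reg w) (at w)"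
  using zeta_reg_deriv(1)[OF assms] DERIV_imp_deriv by metis

lemma logderiv_zeta_reg:
  assumes w: "Re w > 0"
  shows "deriv zeta_reg w / zeta_reg w = 1 / w - dseries mangoldt w"
proof -
  have wn: "w \<noteq> 0" using w by auto
  have "((\<lambda>w. w * dseries (\<lambda>_. 1) w) has_field_derivative
     dseries (\<lambda>_. 1) w - w * dseries (\<lambda>n. ln (real n)) w) (at w)"
    using dseries_has_field_derivative[OF abs_conv_1 w]
    by (auto intro!: derivative_eq_intros)
  hence "(zeta_reg has_field_derivative dseries (\<lambda>_. 1) w - w * dseries (\<lambda>n. ln (real n)) w) (at w)"
    by (rule has_field_derivative_transform_within_open[OF _ open_halfspace_Re_gt[of 0]])
      (use w zeta_reg_eq in auto)
  hence "deriv zeta_reg w = dseries (\<lambda>_. 1) w - w * dseries (\<lambda>n. ln (real n)) w" by (rule DERIV_imp_deriv)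
  also have "\<dots> = dseries (\<lambda>_. 1) w * (1 - w * dseries mangoldt w)"
    using dseries_mult_mangoldt[OF w] by (simp add: algebra_simps)
  finally show ?thesis using zeta_reg_nz[OF w] wn zeta_reg_eq[OF w] by (simp add: field_simps)
qed

lemma deriv_logderiv_zeta_reg:
  assumes w: "Re w > -1/2" "zeta_reg w \<noteq> 0"
  shows "((\<lambda>w. deriv zeta_reg w / zeta_reg w) has_field_derivative
     (deriv (deriv zeta_reg) w * zeta_reg w - deriv zeta_reg w ^ 2) / zeta_reg w ^ 2) (at w)"
proof -
  have "deriv zeta_reg holomorphic_on {w. Re w > -1/2}"
    by (rule holomorphic_deriv[OF zeta_reg_holomorphic open_halfspace_Re_gt])
  hence "(deriv zeta_reg has_field_derivative deriv (deriv zeta_reg) w) (at w)"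
    using w(1) holomorphic_derivI[OF _ open_halfspace_Re_gt] by auto
  from DERIV_divide[OF this deriv_zeta_reg[OF w(1)] w(2)] show ?thesis
    by (simp add: power2_eq_square)
qed

text \<open>On the half-plane \<open>Re w > 0\<close> the function \<open>rem_laplace\<close> is the derivative of \<open>(F(w) - \<gamma>) / w\<close>, where \<open>F\<close> is the
  logarithmic derivative of \<open>zeta_reg\<close>; since \<open>F(0) = \<gamma>\<close>, there is no pole at 0.\<close>

lemma rem_laplace_eq:
  assumes w: "Re w > 0"
  shows "rem_laplace w = (deriv (deriv zeta_reg) w * zeta_reg w - deriv zeta_reg w ^ 2) / zeta_reg w ^ 2 / w
           + (of_real euler_mascheroni - deriv zeta_reg w / zeta_reg w) / w ^ 2"
proof -
  have wn: "w \<noteq> 0" using w by auto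
  have "((\<lambda>w. 1 / w - dseries mangoldt w) has_field_derivative
      - (1 / w ^ 2) + dseries (\<lambda>n. mangoldt n * ln (real n)) w) (at w)"
    using dseries_has_field_derivative[OF abs_conv_mangoldt w] wn
    by (auto intro!: derivative_eq_intros simp: power2_eq_square)
  hence "((\<lambda>w. deriv zeta_reg w / zeta_reg w) has_field_derivative
      - (1 / w ^ 2) + dseries (\<lambda>n. mangoldt n * ln (real n)) w) (at w)"
    by (rule has_field_derivative_transform_within_open[OF _ open_halfspace_Re_gt[of 0]])
      (use w logderiv_zeta_reg in auto)
  moreover have "Re w > -1/2" using w by auto
  ultimately have "(deriv (deriv zeta_reg) w * zeta_reg w - deriv zeta_reg w ^ 2) / zeta_reg w ^ 2
      = - (1 / w ^ 2) + dseries (\<lambda>n. mangoldt n * ln (real n)) w"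
    using DERIV_unique deriv_logderiv_zeta_reg zeta_reg_nz[OF w] by blast
  note eq = this
  show ?thesis unfolding eq rem_laplace_def logderiv_zeta_reg[OF w] using wn
    by (simp add: field_simps eval_nat_numeral)
qed

lemma zeta_reg_0: "zeta_reg 0 = 1"
  by (simp add: zeta_reg_def zeta_term_def del: of_nat_Suc)

text \<open>The single terms of \<open>rem_laplace\<close> blow up at 0, but together they are the
  derivative of the difference quotient \<open>h\<close> of a function holomorphic near 0. Its
  singularity is removable, so the derivative is continuous on a smaller closed disc and bounded
  there.\<close>

lemma rem_laplace_bound_near_0: "\<exists>B. \<forall>w. 0 < Re w \<longrightarrow> norm w \<le> zeta_reg_radius / 2 \<longrightarrow> norm (rem_laplace w) \<le> B"
proof -
  let ?F = "\<lambda>w. deriv zeta_reg w / zeta_reg w"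
  have Re: "Re w > -1/2" if "w \<in> ball 0 zeta_reg_radius" for w
  proof -
    have "\<bar>Re w\<bar> < 1/4" using abs_Re_le_cmod[of w] that zeta_reg_radius by (simp)
    hence "Re w > -(1/4)" by linarith
    thus ?thesis by simp
  qed
  have nz: "zeta_reg w \<noteq> 0" if "w \<in> ball 0 zeta_reg_radius" for w
    using zeta_reg_near_0[of w] that by auto
  have hol: "?F holomorphic_on ball 0 zeta_reg_radius"
    unfolding holomorphic_on_open[OF open_ball] using deriv_logderiv_zeta_reg Re nz by blast
  define h where "h = (\<lambda>z. if z = 0 then deriv ?F 0 else (?F z - ?F 0) / (z - 0))"
  have h: "h holomorphic_on ball 0 zeta_reg_radius" unfolding h_def by (rule pole_lemma_open[OF hol open_ball])
  have "continuous_on (ball 0 zeta_reg_radius) (deriv h)"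
    by (intro holomorphic_on_imp_continuous_on holomorphic_deriv h open_ball)
  hence "continuous_on (cball 0 (zeta_reg_radius/2)) (deriv h)"
    by (rule continuous_on_subset) (use zeta_reg_radius in auto)
  hence "compact (deriv h ` cball 0 (zeta_reg_radius/2))" by (intro compact_continuous_image compact_cball)
  then obtain B where B: "\<And>w. w \<in> cball 0 (zeta_reg_radius/2) \<Longrightarrow> norm (deriv h w) \<le> B"
    using compact_imp_bounded bounded_iff by (metis (no_types, lifting) imageI)
  have "norm (rem_laplace w) \<le> B" if w: "0 < Re w" "norm w \<le> zeta_reg_radius / 2" for w
  proof -
    have wn: "w \<noteq> 0" using w by auto
    have wb: "w \<in> ball 0 zeta_reg_radius" using w zeta_reg_radius by auto
    have F0: "?F 0 = of_real euler_mascheroni" by (simp add: deriv_zeta_reg_0 zeta_reg_0)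
    define F' where "F' = (deriv (deriv zeta_reg) w * zeta_reg w - deriv zeta_reg w ^ 2) / zeta_reg w ^ 2"
    define Fw where "Fw = ?F w"
    have "((\<lambda>z. ?F z - of_real euler_mascheroni) has_field_derivative F') (at w)"
      using DERIV_diff[OF deriv_logderiv_zeta_reg[OF Re[OF wb] nz[OF wb]] DERIV_const[of "of_real euler_mascheroni"]]
      unfolding F'_def[symmetric] by (simp only: diff_0_right)
    from DERIV_divide[OF this DERIV_ident wn]
    have "((\<lambda>z. (?F z - of_real euler_mascheroni) / z) has_field_derivative
      (F' * w - (Fw - of_real euler_mascheroni) * 1) / (w * w)) (at w)" unfolding Fw_def .
    hence "(h has_field_derivative
      (F' * w - (Fw - of_real euler_mascheroni) * 1) / (w * w)) (at w)"
      by (rule has_field_derivative_transform_within_open[of _ _ _ "- {0}"])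
         (use wn F0 in \<open>auto simp: h_def\<close>)
    hence "deriv h w = (F' * w - (Fw - of_real euler_mascheroni) * 1) / (w * w)"
      by (rule DERIV_imp_deriv)
    also have "\<dots> = rem_laplace w" unfolding rem_laplace_eq[OF w(1)] F'_def[symmetric] Fw_def[symmetric]
      using wn by (simp add: field_simps power2_eq_square)
    finally show ?thesis using B[of w] w by simp
  qed
  thus ?thesis by blast
qed

text \<open>The exponent 24 is 4 from the numerator, products of two quantities of quadratic growth,
  plus 20 from squaring the reciprocal of the lower bound for \<open>zeta_reg\<close>. Near 0, where
  dividing by \<open>w\<close> is not harmless, the removable singularity takes over.\<close>

lemma rem_laplace_bound:
  obtains C where "C \<ge> 0" "\<And>w. 0 < Re w \<Longrightarrow> Re w \<le> 1 \<Longrightarrow> norm (rem_laplace w) \<le> C * (1 + norm w) ^ 24"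
proof -
  obtain B where B: "\<And>w. 0 < Re w \<Longrightarrow> norm w \<le> zeta_reg_radius / 2 \<Longrightarrow> norm (rem_laplace w) \<le> B"
    using rem_laplace_bound_near_0 by blast
  obtain c where c: "c > 0" "\<And>w. 0 < Re w \<Longrightarrow> Re w \<le> 1 \<Longrightarrow> c / (1 + norm w) ^ 10 \<le> norm (zeta_reg w)"
    using zeta_reg_lower by blast
  define r where "r = zeta_reg_radius / 2"
  have r: "r > 0" using zeta_reg_radius by (simp add: r_def)
  let ?g = "norm (of_real euler_mascheroni :: complex)"
  define C where "C = (2 * zeta_reg_growth^2 / c^2) / r + (?g + zeta_reg_growth / c) / r^2"
  have C: "C \<ge> 0" using c zeta_reg_growth_ge r by (auto simp: C_def)
  have "norm (rem_laplace w) \<le> (C + \<bar>B\<bar>) * (1 + norm w) ^ 24" if w: "0 < Re w" "Re w \<le> 1" for w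
  proof (cases "norm w \<le> r")
    case True
    have "norm (rem_laplace w) \<le> B" using B[OF w(1)] True by (simp add: r_def)
    also have "\<dots> \<le> C + \<bar>B\<bar>" using C by linarith
    also have "\<dots> \<le> (C + \<bar>B\<bar>) * (1 + norm w) ^ 24"
      using C one_le_power[of "1 + norm w" 24] by (simp add: mult_le_cancel_left1)
    finally show ?thesis .
  next
    case False
    define N where "N = 1 + norm w"
    have N: "N \<ge> 1" by (simp add: N_def)
    have Re: "Re w \<ge> 0" using w by simp
    note b = zeta_reg_bounds[OF Re, folded N_def]
    have lo: "c / N ^ 10 \<le> norm (zeta_reg w)" using c(2)[OF w] by (simp add: N_def)
    have cN: "0 < c / N ^ 10" using c N by simp
    have num: "norm (deriv (deriv zeta_reg) w * zeta_reg w - deriv zeta_reg w ^ 2) \<le> 2 * zeta_reg_growth^2 * N^4"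
    proof -
      have "norm (deriv (deriv zeta_reg) w * zeta_reg w - deriv zeta_reg w ^ 2) \<le> norm (deriv (deriv zeta_reg) w) * norm (zeta_reg w) + norm (deriv zeta_reg w) ^ 2"
        using norm_triangle_ineq4[of "deriv (deriv zeta_reg) w * zeta_reg w" "deriv zeta_reg w ^ 2"] by (simp add: norm_mult norm_power)
      also have "\<dots> \<le> (zeta_reg_growth * N^2) * (zeta_reg_growth * N^2) + (zeta_reg_growth * N^2)^2"
        using b zeta_reg_growth_ge by (intro add_mono mult_mono power_mono) auto
      finally show ?thesis by (simp add: power_mult_distrib power2_eq_square eval_nat_numeral mult_ac)
    qed
    have 1: "norm ((deriv (deriv zeta_reg) w * zeta_reg w - deriv zeta_reg w ^ 2) / zeta_reg w ^ 2 / w) \<le> (2 * zeta_reg_growth^2 * N^4) / (c / N ^ 10)^2 / r"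
      unfolding norm_divide norm_power using num lo cN False r
      by (intro frac_le power_mono) auto
    have 2: "norm (deriv zeta_reg w / zeta_reg w) \<le> (zeta_reg_growth * N^2) / (c / N^10)"
      unfolding norm_divide using b lo cN by (intro frac_le) auto
    have 3: "norm ((of_real euler_mascheroni - deriv zeta_reg w / zeta_reg w) / w^2) \<le> (?g + (zeta_reg_growth * N^2) / (c / N^10)) / r^2"
    proof -
      have "norm (of_real euler_mascheroni - deriv zeta_reg w / zeta_reg w) \<le> ?g + (zeta_reg_growth * N^2) / (c / N^10)"
        using norm_triangle_ineq4[of "of_real euler_mascheroni" "deriv zeta_reg w / zeta_reg w"] 2 by linarith
      moreover have "r ^ 2 \<le> norm w ^ 2" using False r by (intro power_mono) auto
      moreover have "0 \<le> ?g + (zeta_reg_growth * N^2) / (c / N^10)"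
        using zeta_reg_growth_ge N c(1) by (intro add_nonneg_nonneg divide_nonneg_nonneg mult_nonneg_nonneg) auto
      ultimately show ?thesis unfolding norm_divide norm_power using r by (intro frac_le) auto
    qed
    have "norm (rem_laplace w) \<le> (2 * zeta_reg_growth^2 * N^4) / (c / N ^ 10)^2 / r + (?g + (zeta_reg_growth * N^2) / (c / N^10)) / r^2"
      unfolding rem_laplace_eq[OF w(1)] using norm_triangle_mono[OF 1 3] .
    also have "\<dots> = (2 * zeta_reg_growth^2 / c^2) / r * N^24 + ?g / r^2 * 1 + (zeta_reg_growth / c) / r^2 * N^12"
    proof -
      have "N^4 * N^20 = N^24" "N^2 * N^10 = N^12" by (simp_all flip: power_add)
      thus ?thesis by (simp add: power_divide add_divide_distrib mult.assoc)
    qed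
    also have "\<dots> \<le> (2 * zeta_reg_growth^2 / c^2) / r * N^24 + ?g / r^2 * N^24 + (zeta_reg_growth / c) / r^2 * N^24"
      using c N r zeta_reg_growth_ge by (intro add_mono mult_left_mono power_increasing one_le_power) auto
    also have "\<dots> = C * N^24" using r c by (simp add: C_def algebra_simps add_divide_distrib)
    also have "\<dots> \<le> (C + \<bar>B\<bar>) * N^24" using N by (intro mult_right_mono) auto
    finally show ?thesis by (simp add: N_def)
  qed
  thus ?thesis using that[of "C + \<bar>B\<bar>"] C by auto
qed

section \<open>Fourier inversion\<close>

lemma integral_FTC_real_line:
  fixes f F :: "real \<Rightarrow> 'a::euclidean_space"
  assumes "integrable lborel f" "\<And>x. (F has_vector_derivative f x) (at x)" "\<And>x. isCont f x"
    "(F \<longlongrightarrow> A) at_bot" "(F \<longlongrightarrow> B) at_top"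
  shows "integral\<^sup>L lborel f = B - A"
proof -
  have "(LBINT x=-\<infinity>..\<infinity>. f x) = B - A"
    by (rule interval_integral_FTC_integrable)
      (use assms in \<open>auto simp: set_integrable_def ereal_tendsto_simps\<close>)
  thus ?thesis by (simp add: interval_lebesgue_integral_def set_lebesgue_integral_def)
qed

lemma integrable_inverse_square: "integrable lborel (\<lambda>x::real. 1 / (1 + x^2))"
  using integrable_inverse_1_plus_square by (simp add: set_integrable_def field_simps)

lemma exp_ge_power: "x ^ m / fact m \<le> exp x" if "x \<ge> 0" for x :: real
proof -
  have "(\<Sum>n\<in>{m}. x ^ n /\<^sub>R fact n) \<le> exp x"
    unfolding exp_def using that
    by (intro sum_le_suminf) (auto intro: summable_exp)
  thus ?thesis by (simp add: field_simps)
qed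

lemma integrable_moment_exp: "integrable lborel (\<lambda>z::real. \<bar>z\<bar> ^ j * exp (- \<bar>z\<bar>))"
proof (rule Bochner_Integration.integrable_bound)
  show "integrable lborel (\<lambda>x::real. (fact j + fact (j + 2)) * (1 / (1 + x^2)))"
    by (intro integrable_mult_right integrable_inverse_square)
  show "(\<lambda>z::real. \<bar>z\<bar> ^ j * exp (- \<bar>z\<bar>)) \<in> borel_measurable lborel" by measurable
  show "AE x in lborel. norm (\<bar>x\<bar> ^ j * exp (- \<bar>x\<bar>)) \<le> norm ((fact j + fact (j + 2)) * (1 / (1 + x^2)) :: real)"
  proof (rule AE_I2)
    fix x :: real
    have "\<bar>x\<bar> ^ j * (1 + x^2) = \<bar>x\<bar> ^ j + \<bar>x\<bar> ^ (j + 2)"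
      by (simp add: algebra_simps power_add power2_eq_square)
    also have "\<dots> \<le> fact j * exp \<bar>x\<bar> + fact (j+2) * exp \<bar>x\<bar>"
      using exp_ge_power[of "\<bar>x\<bar>" j] exp_ge_power[of "\<bar>x\<bar>" "j+2"]
      by (intro add_mono) (simp_all add: divide_le_eq mult.commute del: fact_Suc add_2_eq_Suc')
    finally have "\<bar>x\<bar> ^ j * (1 + x^2) \<le> (fact j + fact (j+2)) * exp \<bar>x\<bar>"
      by (simp only: distrib_right)
    moreover have "1 + x^2 > 0" by (simp add: add_pos_nonneg)
    ultimately have "\<bar>x\<bar> ^ j * exp (- \<bar>x\<bar>) \<le> (fact j + fact (j+2)) * (1 / (1 + x^2))"
      by (simp add: exp_minus field_simps del: fact_Suc add_2_eq_Suc')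
    moreover have r0: "0 \<le> (fact j + fact (j+2)) * (1 / (1 + x^2))" by simp
    moreover have l0: "0 \<le> \<bar>x\<bar> ^ j * exp (- \<bar>x\<bar>)" by simp
    ultimately show "norm (\<bar>x\<bar> ^ j * exp (- \<bar>x\<bar>)) \<le> norm ((fact j + fact (j + 2)) * (1 / (1 + x^2)))"
      unfolding real_norm_def abs_of_nonneg[OF r0] abs_of_nonneg[OF l0] by blast
  qed
qed

text \<open>A class containing the kernel and closed under differentiation; hence the Fourier transform of a member
  decays faster than every power.\<close>

inductive tanh_exp_class :: "(real \<Rightarrow> real) \<Rightarrow> bool" where
  base: "tanh_exp_class (\<lambda>z. exp z ^ Suc a * tanh (exp z) ^ b * (1 - tanh (exp z) ^ 2))"
| add: "tanh_exp_class f \<Longrightarrow> tanh_exp_class g \<Longrightarrow> tanh_exp_class (\<lambda>z. f z + g z)"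
| scale: "tanh_exp_class f \<Longrightarrow> tanh_exp_class (\<lambda>z. c * f z)"

lemma one_minus_tanh_sq_le: "1 - tanh x ^ 2 \<le> 4 * exp (- 2 * x)" for x :: real
proof -
  have c: "cosh x \<ge> exp x / 2" by (simp add: cosh_def)
  have "1 - tanh x ^ 2 = 1 / cosh x ^ 2"
  proof -
    have "1 - tanh x ^ 2 = (cosh x ^ 2 - sinh x ^ 2) / cosh x ^ 2"
      using cosh_real_pos[of x] by (simp add: tanh_def power_divide diff_divide_distrib)
    thus ?thesis by (simp only: hyperbolic_pythagoras)
  qed
  also have "\<dots> \<le> 1 / (exp x / 2) ^ 2"
    using c by (intro divide_left_mono power_mono mult_pos_pos zero_less_power cosh_real_pos) auto
  also have "\<dots> = 4 * exp (- 2 * x)"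
    by (simp add: power_divide exp_minus exp_double inverse_eq_divide)
  finally show ?thesis .
qed

lemma tanh_sq_le_1: "tanh x ^ 2 \<le> 1" for x :: real
  using tanh_real_bounds[of x] by (simp add: abs_square_le_1 abs_le_iff)

text \<open>On the right the doubly exponential decay of \<open>1 - tanh (exp z) ^ 2\<close> beats
  every power of \<open>exp z\<close>; on the left at least one factor \<open>exp z\<close> remains,
  which is why the exponent in the base case is \<open>Suc a\<close>.\<close>

lemma tanh_exp_class_bound: "tanh_exp_class f \<Longrightarrow> \<exists>C. \<forall>z. \<bar>f z\<bar> \<le> C * exp (- \<bar>z\<bar>)"
proof (induction rule: tanh_exp_class.induct)
  case (base a b)
  have "\<bar>exp z ^ Suc a * tanh (exp z) ^ b * (1 - tanh (exp z) ^ 2)\<bar> \<le> (4 * fact (a+2)) * exp (- \<bar>z\<bar>)" for z :: real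
  proof -
    define x where "x = exp z"
    have x: "x > 0" by (simp add: x_def)
    have "\<bar>tanh x ^ b\<bar> \<le> 1"
      using tanh_real_bounds[of x] by (simp add: power_abs power_le_one abs_le_iff)
    hence "\<bar>x ^ Suc a * tanh x ^ b * (1 - tanh x ^ 2)\<bar> \<le> x ^ Suc a * 1 * (1 - tanh x ^ 2)"
      using x tanh_sq_le_1[of x] unfolding abs_mult
      by (intro mult_mono) (auto simp: abs_of_nonneg)
    also have "\<dots> \<le> x ^ Suc a * (4 * exp (- 2 * x))"
      using x one_minus_tanh_sq_le[of x] by simp
    also have "\<dots> \<le> (4 * fact (a+2)) * exp (- \<bar>z\<bar>)"
    proof (cases "z \<ge> 0")
      case True
      have "x ^ (a + 2) \<le> fact (a+2) * exp x"
        using exp_ge_power[of x "a+2"] x by (simp add: divide_le_eq mult.commute del: fact_Suc add_2_eq_Suc')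
      also have "\<dots> \<le> fact (a+2) * exp (2 * x)" using x by (intro mult_left_mono) auto
      finally have "x ^ Suc a * x \<le> fact (a+2) * exp (2 * x)" by (simp add: mult_ac)
      hence "x ^ Suc a * (4 * exp (- 2 * x)) \<le> 4 * fact (a+2) / x"
        using x by (simp add: field_simps exp_minus del: fact_Suc add_2_eq_Suc' power_Suc)
      also have "\<dots> = (4 * fact (a+2)) * exp (- \<bar>z\<bar>)"
        using True by (simp add: x_def exp_minus field_simps del: fact_Suc add_2_eq_Suc')
      finally show ?thesis .
    next
      case False
      have "x ^ a \<le> fact a * exp x"
        using exp_ge_power[of x "a"] x by (simp add: divide_le_eq mult.commute)
      also have "\<dots> \<le> fact (a+2) * exp (2 * x)"
        using x by (intro mult_mono fact_mono) auto
      finally have "x * x ^ a \<le> x * (fact (a+2) * exp (2 * x))" using x by simp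
      hence "x ^ Suc a * (4 * exp (- 2 * x)) \<le> 4 * fact (a+2) * x"
        using x by (simp add: field_simps exp_minus del: fact_Suc add_2_eq_Suc')
      also have "\<dots> = (4 * fact (a+2)) * exp (- \<bar>z\<bar>)" using False by (simp add: x_def)
      finally show ?thesis .
    qed
    finally show ?thesis by (simp add: x_def)
  qed
  thus ?case by blast
next
  case (add f g)
  then obtain C D where C: "\<And>z. \<bar>f z\<bar> \<le> C * exp (- \<bar>z\<bar>)" and D: "\<And>z. \<bar>g z\<bar> \<le> D * exp (- \<bar>z\<bar>)" by blast
  have "\<bar>f z + g z\<bar> \<le> (C + D) * exp (- \<bar>z\<bar>)" for z
    using abs_triangle_ineq[of "f z" "g z"] C[of z] D[of z] unfolding distrib_right by linarith
  thus ?case by blast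
next
  case (scale f c)
  then obtain C where C: "\<And>z. \<bar>f z\<bar> \<le> C * exp (- \<bar>z\<bar>)" by blast
  have "\<bar>c * f z\<bar> \<le> (\<bar>c\<bar> * C) * exp (- \<bar>z\<bar>)" for z
    using mult_left_mono[OF C[of z], of "\<bar>c\<bar>"] by (simp add: abs_mult mult_ac)
  thus ?case by blast
qed

lemma tanh_exp_class_deriv: "tanh_exp_class f \<Longrightarrow> \<exists>g. tanh_exp_class g \<and> (\<forall>z. (f has_real_derivative g z) (at z))"
proof (induction rule: tanh_exp_class.induct)
  case (base a b)
  let ?B = "\<lambda>a b z. exp z ^ Suc a * tanh (exp z) ^ b * (1 - tanh (exp z) ^ 2) :: real"
  \<comment> \<open>Differentiating the power of tanh produces \<open>(1 - T^2)^2\<close>; one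
    factor is expanded, which gives the second summand and part of the third. For
    \<open>b = 0\<close> the truncated \<open>b - 1\<close> is harmless because its coefficient
    vanishes.\<close>
  let ?g = "\<lambda>z. real (Suc a) * ?B a b z + (real b * ?B (Suc a) (b - 1) z + ((- real b - 2) * ?B (Suc a) (Suc b) z))"
  have "tanh_exp_class ?g" by (intro tanh_exp_class.intros)
  moreover have "(?B a b has_real_derivative ?g z) (at z)" for z
  proof -
    define x where "x = exp z"
    define T where "T = tanh x"
    have c: "cosh x \<noteq> 0" using cosh_real_pos[of x] by simp
    have dT: "((\<lambda>z. tanh (exp z)) has_real_derivative (1 - T^2) * x) (at z)"
      using c unfolding x_def T_def by (auto intro!: derivative_eq_intros)
    have dE: "(exp has_real_derivative x) (at z)" unfolding x_def by (rule DERIV_exp)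
    have "(?B a b has_real_derivative
        ((real (Suc a) * x * x ^ a) * T ^ b + (real b * ((1 - T^2) * x) * T ^ (b - 1)) * x ^ Suc a) * (1 - T^2)
          + (- (2 * ((1 - T^2) * x) * T)) * (x ^ Suc a * T ^ b)) (at z)"
      by (rule derivative_eq_intros dT dE refl)+ (simp add: x_def[symmetric] T_def[symmetric] mult_ac)
    also have "((real (Suc a) * x * x ^ a) * T ^ b + (real b * ((1 - T^2) * x) * T ^ (b - 1)) * x ^ Suc a) * (1 - T^2)
          + (- (2 * ((1 - T^2) * x) * T)) * (x ^ Suc a * T ^ b) = ?g z"
      unfolding x_def[symmetric] T_def[symmetric]
      by (cases b) (simp_all add: algebra_simps power2_eq_square)
    finally show ?thesis .
  qed
  ultimately show ?case by blast
next
  case (add f g)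
  then obtain f' g' where "tanh_exp_class f'" "\<And>z. (f has_real_derivative f' z) (at z)"
      "tanh_exp_class g'" "\<And>z. (g has_real_derivative g' z) (at z)" by blast
  thus ?case by (intro exI[of _ "\<lambda>z. f' z + g' z"]) (auto intro: tanh_exp_class.intros derivative_eq_intros)
next
  case (scale f c)
  then obtain f' where "tanh_exp_class f'" "\<And>z. (f has_real_derivative f' z) (at z)" by blast
  thus ?case by (intro exI[of _ "\<lambda>z. c * f' z"]) (auto intro: tanh_exp_class.intros DERIV_cmult)
qed

lemma tanh_exp_class_cont: "tanh_exp_class f \<Longrightarrow> isCont f z"
  using tanh_exp_class_deriv DERIV_isCont by blast

lemma tanh_exp_class_measurable: "tanh_exp_class f \<Longrightarrow> f \<in> borel_measurable borel"
  by (intro borel_measurable_continuous_onI continuous_at_imp_continuous_on) (auto intro: tanh_exp_class_cont)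

lemma tanh_exp_class_integrable_moment: assumes "tanh_exp_class f" shows "integrable lborel (\<lambda>z. \<bar>z\<bar> ^ j * f z)"
proof -
  obtain C where C: "\<And>z. \<bar>f z\<bar> \<le> C * exp (- \<bar>z\<bar>)" using tanh_exp_class_bound[OF assms] by blast
  note [measurable] = tanh_exp_class_measurable[OF assms]
  show ?thesis
  proof (rule Bochner_Integration.integrable_bound)
    show "integrable lborel (\<lambda>z. C * (\<bar>z\<bar> ^ j * exp (- \<bar>z\<bar>)))"
      by (intro integrable_mult_right integrable_moment_exp)
    show "AE z in lborel. norm (\<bar>z\<bar> ^ j * f z) \<le> norm (C * (\<bar>z\<bar> ^ j * exp (- \<bar>z\<bar>)))"
    proof (rule AE_I2)
      fix z :: real
      have "norm (\<bar>z\<bar> ^ j * f z) = \<bar>z\<bar> ^ j * \<bar>f z\<bar>" by (simp add: abs_mult power_abs)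
      also have "\<dots> \<le> \<bar>z\<bar> ^ j * (C * exp (- \<bar>z\<bar>))" by (intro mult_left_mono C) auto
      also have "\<dots> \<le> norm (C * (\<bar>z\<bar> ^ j * exp (- \<bar>z\<bar>)))" by (simp add: mult_ac)
      finally show "norm (\<bar>z\<bar> ^ j * f z) \<le> norm (C * (\<bar>z\<bar> ^ j * exp (- \<bar>z\<bar>)))" .
    qed
  qed measurable
qed

lemma tanh_exp_class_integrable: "tanh_exp_class f \<Longrightarrow> integrable lborel f"
  using tanh_exp_class_integrable_moment[of f 0] by simp

section \<open>Decay of the Fourier transform\<close>

definition fourier :: "(real \<Rightarrow> real) \<Rightarrow> real \<Rightarrow> complex" where
  "fourier f t = (\<integral>z. of_real (f z) * iexp (- (t * z)) \<partial>lborel)"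

lemma fourier_integrable:
  assumes "integrable lborel f"
  shows "integrable lborel (\<lambda>z. of_real (f z) * iexp (- (t * z)))"
proof -
  have [measurable]: "f \<in> borel_measurable borel" using assms by auto
  show ?thesis
    by (rule Bochner_Integration.integrable_bound[OF assms]) (auto simp: norm_mult)
qed

lemma fourier_norm_le: "norm (fourier f t) \<le> (\<integral>z. \<bar>f z\<bar> \<partial>lborel)"
proof -
  have "norm (fourier f t) \<le> (\<integral>z. norm (of_real (f z) * iexp (- (t * z))) \<partial>lborel)"
    unfolding fourier_def by (rule integral_norm_bound)
  thus ?thesis by (simp add: norm_mult)
qed

text \<open>Integration by parts, carried out by integrating the derivative of
  \<open>f z * iexp (- (t * z))\<close>, which tends to 0 at both ends.\<close>

lemma fourier_deriv:
  assumes "tanh_exp_class f" "tanh_exp_class g" "\<And>z. (f has_real_derivative g z) (at z)"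
  shows "fourier g t = \<i> * t * fourier f t"
proof -
  have ig: "integrable lborel (\<lambda>z. of_real (g z) * iexp (- (t * z)))"
    and "if": "integrable lborel (\<lambda>z. of_real (f z) * iexp (- (t * z)))"
    by (intro fourier_integrable tanh_exp_class_integrable assms)+
  let ?h = "\<lambda>z. of_real (g z) * iexp (- (t * z)) - \<i> * t * (of_real (f z) * iexp (- (t * z)))"
  have int: "integrable lborel ?h" by (intro Bochner_Integration.integrable_diff ig integrable_mult_right "if")
  obtain C where C: "\<And>z. \<bar>f z\<bar> \<le> C * exp (- \<bar>z\<bar>)" using tanh_exp_class_bound[OF assms(1)] by blast
  have lim: "((\<lambda>z. of_real (f z) * iexp (- (t * z))) \<longlongrightarrow> 0) F"
    if "((\<lambda>z. C * exp (- \<bar>z\<bar>)) \<longlongrightarrow> 0) F" for F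
    by (rule Lim_null_comparison[OF _ that]) (auto simp: norm_mult intro!: always_eventually C)
  have "integral\<^sup>L lborel ?h = 0 - 0"
  proof (rule integral_FTC_real_line[OF int])
    show "((\<lambda>z. of_real (f z) * iexp (- (t * z))) has_vector_derivative ?h z) (at z)" for z
    proof -
      have "((\<lambda>z. of_real (f z) :: complex) has_vector_derivative of_real (g z)) (at z)"
        using assms(3) by (intro has_vector_derivative_of_real) (simp add: has_real_derivative_iff_has_vector_derivative)
      moreover have "((\<lambda>z. iexp (- (t * z))) has_vector_derivative (- \<i> * t * iexp (- (t * z)))) (at z)"
        by (auto intro!: derivative_eq_intros simp: has_vector_derivative_complex_iff Re_exp Im_exp)
      ultimately have "((\<lambda>z. of_real (f z) * iexp (- (t * z))) has_vector_derivative
         (of_real (f z) * (- \<i> * t * iexp (- (t * z))) + of_real (g z) * iexp (- (t * z)))) (at z)"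
        by (rule has_vector_derivative_mult)
      thus ?thesis by (simp add: algebra_simps)
    qed
    show "isCont ?h z" for z
      using tanh_exp_class_cont[OF assms(1), of z] tanh_exp_class_cont[OF assms(2), of z] by (intro continuous_intros) auto
    show "((\<lambda>z. of_real (f z) * iexp (- (t * z))) \<longlongrightarrow> 0) at_bot" by (rule lim) real_asymp
    show "((\<lambda>z. of_real (f z) * iexp (- (t * z))) \<longlongrightarrow> 0) at_top" by (rule lim) real_asymp
  qed
  hence "fourier g t - \<i> * t * fourier f t = 0"
    unfolding fourier_def using ig "if" by (simp add: Bochner_Integration.integral_diff)
  thus ?thesis by simp
qed

lemma tanh_exp_class_fourier_decay: "tanh_exp_class f \<Longrightarrow> \<exists>C. \<forall>t. \<bar>t\<bar> ^ m * norm (fourier f t) \<le> C"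
proof (induction m arbitrary: f)
  case 0
  thus ?case using fourier_norm_le by auto
next
  case (Suc m)
  obtain g where g: "tanh_exp_class g" "\<And>z. (f has_real_derivative g z) (at z)" using tanh_exp_class_deriv[OF Suc.prems] by blast
  obtain C where C: "\<And>t. \<bar>t\<bar> ^ m * norm (fourier g t) \<le> C" using Suc.IH[OF g(1)] by blast
  have "\<bar>t\<bar> ^ Suc m * norm (fourier f t) = \<bar>t\<bar> ^ m * norm (fourier g t)" for t
    using fourier_deriv[OF Suc.prems g] by (simp add: norm_mult mult_ac)
  hence "\<bar>t\<bar> ^ Suc m * norm (fourier f t) \<le> C" for t using C[of t] by metis
  thus ?case by blast
qed

lemma fourier_measurable:
  assumes "integrable lborel f"
  shows "fourier f \<in> borel_measurable borel"
proof -
  have [measurable]: "f \<in> borel_measurable borel" using assms by auto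
  have "(\<lambda>t. \<integral>z. of_real (f z) * iexp (- (t * z)) \<partial>lborel) \<in> borel_measurable lborel"
    by measurable
  thus ?thesis unfolding fourier_def[abs_def] by simp
qed

text \<open>Two more powers of decay than asked for are spent on the factor
  \<open>1 / (1 + t^2)\<close>, so that the product with a polynomial remains integrable.\<close>

lemma tanh_exp_class_fourier_decay':
  assumes "tanh_exp_class f"
  shows "\<exists>C\<ge>0. \<forall>t. (1 + \<bar>t\<bar>) ^ m * norm (fourier f t) \<le> C / (1 + t^2)"
proof -
  obtain C where C: "\<And>t. \<bar>t\<bar> ^ (m + 2) * norm (fourier f t) \<le> C" using tanh_exp_class_fourier_decay[OF assms] by blast
  obtain D where D: "\<And>t. \<bar>t\<bar> ^ 0 * norm (fourier f t) \<le> D" using tanh_exp_class_fourier_decay[OF assms] by blast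
  have "(1 + \<bar>t\<bar>) ^ m * norm (fourier f t) \<le> (2 ^ (m+2) * (C + D)) / (1 + t^2)" for t
  proof -
    have CD: "0 \<le> C" "0 \<le> D" using order_trans[OF _ C[of 0]] order_trans[OF _ D[of 0]] by auto
    have "(1 + \<bar>t\<bar>) ^ (m+2) \<le> 2 ^ (m+2) * (1 + \<bar>t\<bar> ^ (m+2))"
    proof (cases "\<bar>t\<bar> \<le> 1")
      case True
      hence "(1 + \<bar>t\<bar>) ^ (m+2) \<le> 2 ^ (m+2)" by (intro power_mono) auto
      also have "\<dots> \<le> 2 ^ (m+2) * (1 + \<bar>t\<bar> ^ (m+2))" by simp
      finally show ?thesis .
    next
      case False
      hence "(1 + \<bar>t\<bar>) ^ (m+2) \<le> (2 * \<bar>t\<bar>) ^ (m+2)" by (intro power_mono) auto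
      also have "\<dots> = 2 ^ (m+2) * \<bar>t\<bar> ^ (m+2)" by (rule power_mult_distrib)
      also have "\<dots> \<le> 2 ^ (m+2) * (1 + \<bar>t\<bar> ^ (m+2))" by simp
      finally show ?thesis .
    qed
    hence "(1 + \<bar>t\<bar>) ^ (m+2) * norm (fourier f t) \<le> 2 ^ (m+2) * (1 + \<bar>t\<bar> ^ (m+2)) * norm (fourier f t)"
      by (intro mult_right_mono) auto
    also have "\<dots> = 2 ^ (m+2) * (\<bar>t\<bar> ^ (m+2) * norm (fourier f t) + norm (fourier f t))" by (simp only: algebra_simps)
    also have "\<dots> \<le> 2 ^ (m+2) * (C + D)" using C[of t] D[of t] by (intro mult_left_mono add_mono) auto
    finally have 1: "(1 + \<bar>t\<bar>)^m * (1 + \<bar>t\<bar>)^2 * norm (fourier f t) \<le> 2 ^ (m+2) * (C + D)" by (simp only: power_add)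
    have "1 + t^2 \<le> (1 + \<bar>t\<bar>)^2" by (simp add: power2_eq_square algebra_simps)
    hence "(1 + \<bar>t\<bar>)^m * (1 + t^2) * norm (fourier f t) \<le> (1 + \<bar>t\<bar>)^m * (1 + \<bar>t\<bar>)^2 * norm (fourier f t)"
      by (intro mult_right_mono mult_left_mono) auto
    also note 1
    finally have "((1 + \<bar>t\<bar>)^m * norm (fourier f t)) * (1 + t^2) \<le> 2 ^ (m+2) * (C + D)" by (simp only: mult_ac)
    moreover have "1 + t^2 > 0" by (simp add: add_pos_nonneg)
    ultimately show ?thesis by (simp only: pos_le_divide_eq)
  qed
  moreover have "0 \<le> 2 ^ (m+2) * (C + D)"
    using order_trans[OF _ C[of 0]] order_trans[OF _ D[of 0]] by auto
  ultimately show ?thesis by blast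
qed

section \<open>Inversion by Gaussian regularisation\<close>

lemma integrable_product:
  fixes f g :: "real \<Rightarrow> complex" and h :: "real \<times> real \<Rightarrow> complex"
  assumes f: "integrable lborel f" and g: "integrable lborel g"
    and h: "h \<in> borel_measurable (lborel \<Otimes>\<^sub>M lborel)" "\<And>x y. norm (h (x, y)) \<le> norm (f x) * norm (g y)"
  shows "integrable (lborel \<Otimes>\<^sub>M lborel) h"
proof (rule lborel_pair.Fubini_integrable[OF h(1)])
  have [measurable]: "f \<in> borel_measurable borel" "g \<in> borel_measurable borel" using f g by auto
  note [measurable] = h(1)
  have gi: "integrable lborel (\<lambda>y. norm (h (x, y)))" for x
    by (rule Bochner_Integration.integrable_bound[OF integrable_mult_right[OF integrable_norm[OF g], of "norm (f x)"]])
      (use h(2) in \<open>auto simp: abs_mult\<close>)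
  show "integrable lborel (\<lambda>x. \<integral>y. norm (h (x, y)) \<partial>lborel)"
  proof (rule Bochner_Integration.integrable_bound[OF integrable_mult_left[OF integrable_norm[OF f], of "\<integral>y. norm (g y) \<partial>lborel"]])
    show "AE x in lborel. norm (\<integral>y. norm (h (x, y)) \<partial>lborel) \<le> norm (norm (f x) * (\<integral>y. norm (g y) \<partial>lborel))"
    proof (rule AE_I2)
      fix x
      have "(\<integral>y. norm (h (x, y)) \<partial>lborel) \<le> (\<integral>y. norm (f x) * norm (g y) \<partial>lborel)"
        by (intro integral_mono gi integrable_mult_right integrable_norm g h(2))
      thus "norm (\<integral>y. norm (h (x, y)) \<partial>lborel) \<le> norm (norm (f x) * (\<integral>y. norm (g y) \<partial>lborel))"
        by (simp add: abs_mult)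
    qed
  qed measurable
  show "AE x in lborel. integrable lborel (\<lambda>y. h (x, y))"
    by (rule AE_I2, rule integrable_norm_cancel[OF gi]) measurable
qed

text \<open>A rescaling of the characteristic function of the standard normal distribution.\<close>

lemma gauss_fourier:
  assumes e: "e > 0"
  shows "(\<integral>t. iexp (t * a) * of_real (exp (- ((e * t)^2) / 2)) \<partial>lborel)
    = of_real (sqrt (2 * pi) / e * exp (- ((a / e)^2) / 2))"
    and "integrable lborel (\<lambda>t. iexp (t * a) * of_real (exp (- ((e * t)^2) / 2)))"
proof -
  have d: "of_real (exp (- (y^2) / 2)) = complex_of_real (sqrt (2 * pi)) * of_real (std_normal_density y)" for y
  proof -
    have "exp (- (y^2) / 2) = sqrt (2 * pi) * std_normal_density y"
      by (simp add: std_normal_density_def)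
    thus ?thesis by (simp only: of_real_mult)
  qed
  define g where "g = (\<lambda>t. iexp (t * a) * of_real (exp (- ((e * t)^2) / 2)))"
  have sc: "g (0 + 1/e * y) = complex_of_real (sqrt (2 * pi)) * (std_normal_density y *\<^sub>R iexp ((a/e) * y))" for y
    unfolding g_def using e d[of y] by (simp add: scaleR_conv_of_real mult_ac)
  have int: "integrable lborel (\<lambda>y. std_normal_density y *\<^sub>R iexp ((a/e) * y))"
    by (rule Bochner_Integration.integrable_bound[OF integrable_normal_density[of 1 0]]) auto
  have "integrable lborel (\<lambda>y. g (0 + 1/e * y))" unfolding sc by (intro integrable_mult_right int)
  hence "integrable lborel g" using e by (subst (asm) lborel_integrable_real_affine_iff) auto
  thus "integrable lborel (\<lambda>t. iexp (t * a) * of_real (exp (- ((e * t)^2) / 2)))" by (simp only: g_def)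
  have ch: "(\<integral>y. std_normal_density y *\<^sub>R iexp ((a/e) * y) \<partial>lborel) = of_real (exp (- ((a / e)^2) / 2))"
  proof -
    have "char std_normal_distribution (a/e) = (\<integral>y. std_normal_density y *\<^sub>R iexp ((a/e) * y) \<partial>lborel)"
      unfolding char_def by (subst integral_density) auto
    thus ?thesis unfolding char_std_normal_distribution by simp
  qed
  have "integral\<^sup>L lborel g = \<bar>1/e\<bar> *\<^sub>R (\<integral>y. g (0 + 1/e * y) \<partial>lborel)"
    using e by (intro lborel_integral_real_affine) auto
  also have "\<dots> = of_real (sqrt (2 * pi) / e * exp (- ((a / e)^2) / 2))"
    unfolding sc using ch e by (simp add: scaleR_conv_of_real)
  finally show "(\<integral>t. iexp (t * a) * of_real (exp (- ((e * t)^2) / 2)) \<partial>lborel)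
    = of_real (sqrt (2 * pi) / e * exp (- ((a / e)^2) / 2))" by (simp only: g_def)
qed

text \<open>The Gaussian factor makes the double integral absolutely convergent, so the order may be
  exchanged; the inner integral is again Gaussian, and the result is \<open>k\<close> averaged over
  a normal distribution of width \<open>e\<close> around \<open>z\<close>.\<close>

lemma fourier_inversion_regularised:
  assumes k: "integrable lborel k" "continuous_on UNIV k" "\<And>z. \<bar>k z\<bar> \<le> B" and e: "e > 0"
  shows "(\<integral>t. fourier k t * iexp (t * z) * of_real (exp (- ((e * t)^2) / 2)) \<partial>lborel)
     = of_real (2 * pi * (\<integral>y. std_normal_density y * k (z + e * y) \<partial>lborel))"
proof -
  have [measurable]: "k \<in> borel_measurable borel" using k by auto
  let ?G = "\<lambda>t. of_real (exp (- ((e * t)^2) / 2)) :: complex"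
  have G: "integrable lborel ?G" using gauss_fourier(2)[OF e, of 0] by simp
  have int: "integrable (lborel \<Otimes>\<^sub>M lborel) (\<lambda>(x,t). of_real (k x) * (iexp (t * (z - x)) * ?G t))"
    by (rule integrable_product[where f = "\<lambda>x. of_real (k x)" and g = ?G])
      (use k(1) G in \<open>auto simp: norm_mult\<close>)
  have "(\<integral>t. fourier k t * iexp (t * z) * ?G t \<partial>lborel)
      = (\<integral>t. (\<integral>x. of_real (k x) * (iexp (t * (z - x)) * ?G t) \<partial>lborel) \<partial>lborel)"
  proof (intro Bochner_Integration.integral_cong refl)
    fix t
    have "fourier k t * iexp (t * z) * ?G t = (\<integral>x. of_real (k x) * iexp (- (t * x)) * (iexp (t * z) * ?G t) \<partial>lborel)"
      unfolding fourier_def by (subst integral_mult_left_zero) (simp only: mult.assoc)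
    also have "\<dots> = (\<integral>x. of_real (k x) * (iexp (t * (z - x)) * ?G t) \<partial>lborel)"
    proof (intro Bochner_Integration.integral_cong refl)
      fix x
      have "iexp (- (t * x)) * iexp (t * z) = iexp (t * (z - x))"
        unfolding exp_add[symmetric] by (simp add: algebra_simps)
      thus "of_real (k x) * iexp (- (t * x)) * (iexp (t * z) * ?G t) = of_real (k x) * (iexp (t * (z - x)) * ?G t)"
        by (metis mult.assoc)
    qed
    finally show "fourier k t * iexp (t * z) * ?G t = (\<integral>x. of_real (k x) * (iexp (t * (z - x)) * ?G t) \<partial>lborel)" .
  qed
  also have "\<dots> = (\<integral>x. (\<integral>t. of_real (k x) * (iexp (t * (z - x)) * ?G t) \<partial>lborel) \<partial>lborel)"
    using int by (rule lborel_pair.Fubini_integral)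
  also have "\<dots> = (\<integral>x. of_real (k x * (sqrt (2 * pi) / e * exp (- (((z - x) / e)^2) / 2))) \<partial>lborel)"
    by (simp only: integral_mult_right_zero gauss_fourier(1)[OF e], simp only: of_real_mult)
  also have "\<dots> = of_real (\<integral>x. k x * (sqrt (2 * pi) / e * exp (- (((z - x) / e)^2) / 2)) \<partial>lborel)"
    by (rule integral_complex_of_real)
  also have "(\<integral>x. k x * (sqrt (2 * pi) / e * exp (- (((z - x) / e)^2) / 2)) \<partial>lborel)
      = \<bar>e\<bar> *\<^sub>R (\<integral>y. k (z + e * y) * (sqrt (2 * pi) / e * exp (- (((z - (z + e * y)) / e)^2) / 2)) \<partial>lborel)"
    using e by (intro lborel_integral_real_affine) auto
  also have "\<dots> = 2 * pi * (\<integral>y. std_normal_density y * k (z + e * y) \<partial>lborel)"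
  proof -
    have eq: "e * (k (z + e * y) * (sqrt (2 * pi) / e * exp (- (((z - (z + e * y)) / e)^2) / 2)))
        = 2 * pi * (std_normal_density y * k (z + e * y))" for y
    proof -
      have s: "sqrt (2 * pi) = 2 * pi / sqrt (2 * pi)"
        using real_sqrt_mult_self[of "2 * pi"] by (simp add: field_simps del: real_sqrt_mult_self)
      show ?thesis using e unfolding std_normal_density_def by (subst s) (simp add: power_divide)
    qed
    have "\<bar>e\<bar> *\<^sub>R (\<integral>y. k (z + e * y) * (sqrt (2 * pi) / e * exp (- (((z - (z + e * y)) / e)^2) / 2)) \<partial>lborel)
      = (\<integral>y. e * (k (z + e * y) * (sqrt (2 * pi) / e * exp (- (((z - (z + e * y)) / e)^2) / 2))) \<partial>lborel)"
      using e by (simp only: integral_mult_right_zero real_scaleR_def abs_of_pos)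
    thus ?thesis unfolding eq by (simp only: integral_mult_right_zero)
  qed
  finally show ?thesis .
qed

text \<open>Both sides of the regularised formula converge as the width tends to 0: one is dominated
  by the Fourier transform, the other by the normal density times the bound on
  \<open>k\<close>.\<close>

lemma fourier_inversion:
  assumes k: "integrable lborel k" "continuous_on UNIV k" "\<And>z. \<bar>k z\<bar> \<le> B"
    and K: "integrable lborel (fourier k)"
  shows "of_real (2 * pi * k z) = (\<integral>t. fourier k t * iexp (t * z) \<partial>lborel)"
proof -
  define e where "e n = 1 / real (Suc n)" for n
  have e: "e n > 0" for n by (simp add: e_def)
  have e0: "e \<longlonglongrightarrow> 0" unfolding e_def by real_asymp
  have [measurable]: "k \<in> borel_measurable borel" "fourier k \<in> borel_measurable borel" using k K by auto
  have "(\<lambda>n. \<integral>t. fourier k t * iexp (t * z) * of_real (exp (- ((e n * t)^2) / 2)) \<partial>lborel)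
      \<longlonglongrightarrow> (\<integral>t. fourier k t * iexp (t * z) * of_real (exp (- ((0 * t)^2) / 2)) \<partial>lborel)"
  proof (rule integral_dominated_convergence[where w = "\<lambda>t. norm (fourier k t)"])
    show "AE t in lborel. (\<lambda>n. fourier k t * iexp (t * z) * of_real (exp (- ((e n * t)^2) / 2)))
       \<longlonglongrightarrow> fourier k t * iexp (t * z) * of_real (exp (- ((0 * t)^2) / 2))"
      by (intro AE_I2 tendsto_intros e0) auto
  qed (use K in \<open>auto simp: norm_mult mult_left_le\<close>)
  moreover have "(\<lambda>n. \<integral>t. fourier k t * iexp (t * z) * of_real (exp (- ((e n * t)^2) / 2)) \<partial>lborel)
      \<longlonglongrightarrow> of_real (2 * pi * (\<integral>y. std_normal_density y * k (z + 0 * y) \<partial>lborel))"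
  proof -
    have "(\<lambda>n. \<integral>y. std_normal_density y * k (z + e n * y) \<partial>lborel)
        \<longlonglongrightarrow> (\<integral>y. std_normal_density y * k (z + 0 * y) \<partial>lborel)"
    proof (rule integral_dominated_convergence[where w = "\<lambda>y. std_normal_density y * B"])
      show "AE y in lborel. (\<lambda>n. std_normal_density y * k (z + e n * y)) \<longlonglongrightarrow> std_normal_density y * k (z + 0 * y)"
      proof (rule AE_I2)
        fix y
        have "(\<lambda>n. z + e n * y) \<longlonglongrightarrow> z + 0 * y" by (intro tendsto_intros e0)
        hence "(\<lambda>n. k (z + e n * y)) \<longlonglongrightarrow> k (z + 0 * y)"
          using k(2) by (intro isCont_tendsto_compose[of _ k]) (auto simp: continuous_on_eq_continuous_at)
        thus "(\<lambda>n. std_normal_density y * k (z + e n * y)) \<longlonglongrightarrow> std_normal_density y * k (z + 0 * y)"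
          by (rule tendsto_mult_left)
      qed
      show "AE y in lborel. norm (std_normal_density y * k (z + e n * y)) \<le> std_normal_density y * B" for n
        by (rule AE_I2) (simp add: abs_mult mult_left_mono k(3))
    qed auto
    thus ?thesis unfolding fourier_inversion_regularised[OF k e] by (intro tendsto_of_real tendsto_mult_left)
  qed
  ultimately have "(\<integral>t. fourier k t * iexp (t * z) * of_real (exp (- ((0 * t)^2) / 2)) \<partial>lborel)
     = of_real (2 * pi * (\<integral>y. std_normal_density y * k (z + 0 * y) \<partial>lborel))"
    by (rule LIMSEQ_unique)
  thus ?thesis by simp
qed

section \<open>The kernel\<close>

text \<open>The kernel is the derivative of \<open>tanh (exp z)\<close>: \<open>sech_ker (v - u)\<close> is the weight that turns averages over
  \<open>u = ln n\<close> into sums with the factor \<open>tanh (y / n)\<close>, \<open>y = exp v\<close>.\<close>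

definition sech_ker :: "real \<Rightarrow> real" where "sech_ker z = exp z * (1 - tanh (exp z) ^ 2)"

lemma tanh_exp_class_sech_ker: "tanh_exp_class sech_ker"
  using tanh_exp_class.base[of 0 0] by (simp add: sech_ker_def[abs_def])

lemma sech_ker_nonneg: "sech_ker z \<ge> 0"
  using tanh_sq_le_1 by (simp add: sech_ker_def)

lemma sech_ker_measurable [measurable]: "sech_ker \<in> borel_measurable borel"
  by (rule tanh_exp_class_measurable[OF tanh_exp_class_sech_ker])

lemma tanh_exp_deriv: "((\<lambda>z. tanh (exp z)) has_real_derivative sech_ker z) (at z)"
proof -
  have "cosh (exp z) \<noteq> 0" using cosh_real_pos[of "exp z"] by simp
  thus ?thesis unfolding sech_ker_def by (auto intro!: derivative_eq_intros)
qed

lemma tanh_exp_measurable [measurable]: "(\<lambda>z::real. tanh (exp z)) \<in> borel_measurable borel"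
  by (intro borel_measurable_continuous_onI continuous_at_imp_continuous_on)
     (use tanh_exp_deriv DERIV_isCont in blast)

lemma tanh_le_self: "0 \<le> tanh x \<and> tanh x \<le> x" if "x \<ge> 0" for x :: real
proof -
  have "x - tanh x \<ge> 0 - tanh 0"
  proof (rule DERIV_nonneg_imp_nondecreasing[OF that])
    fix y :: real
    have "cosh y \<noteq> 0" using cosh_real_pos[of y] by simp
    hence "((\<lambda>x. x - tanh x) has_real_derivative 1 - (1 - tanh y ^ 2)) (at y)"
      by (auto intro!: derivative_eq_intros)
    thus "\<exists>D. ((\<lambda>x. x - tanh x) has_real_derivative D) (at y) \<and> D \<ge> 0" by fastforce
  qed
  thus ?thesis using that by simp
qed

lemma one_minus_tanh: "1 - tanh x = 2 / (exp (2 * x) + 1)" for x :: real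
proof -
  have "exp (- x) = 1 / exp x" by (simp add: exp_minus field_simps)
  hence "tanh x = (exp x - 1 / exp x) / (exp x + 1 / exp x)" by (simp only: tanh_altdef)
  also have "exp x - 1 / exp x = (exp x * exp x - 1) / exp x" by (simp add: field_simps)
  also have "exp x + 1 / exp x = (exp x * exp x + 1) / exp x" by (simp add: field_simps)
  finally have "tanh x = (exp x * exp x - 1) / (exp x * exp x + 1)" by simp
  moreover have "exp x * exp x = exp (2 * x)" by (simp flip: exp_add)
  moreover have "exp (2 * x) + 1 \<noteq> 0" using exp_gt_zero[of "2*x"] by linarith
  ultimately show ?thesis by (simp add: field_simps)
qed

lemma one_minus_tanh_le: "1 - tanh x \<le> 2 * exp (- 2 * x)" for x :: real
proof -
  have "2 / (exp (2 * x) + 1) \<le> 2 / exp (2 * x)" by (intro divide_left_mono mult_pos_pos add_pos_pos) auto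
  thus ?thesis unfolding one_minus_tanh by (simp add: exp_minus field_simps)
qed

lemma tanh_exp_at_bot: "((\<lambda>z::real. tanh (exp z)) \<longlongrightarrow> 0) at_bot"
proof (rule Lim_null_comparison[OF always_eventually])
  show "\<forall>z. norm (tanh (exp z)) \<le> exp z" using tanh_le_self by (simp add: less_imp_le)
qed (rule exp_at_bot)

lemma tanh_exp_at_top: "((\<lambda>z::real. tanh (exp z)) \<longlongrightarrow> 1) at_top"
  by (rule filterlim_compose[OF tanh_real_at_top exp_at_top])

lemma integral_sech_ker: "integral\<^sup>L lborel sech_ker = 1"
proof -
  have "integral\<^sup>L lborel sech_ker = 1 - 0"
    by (rule integral_FTC_real_line[OF tanh_exp_class_integrable[OF tanh_exp_class_sech_ker] _ tanh_exp_class_cont[OF tanh_exp_class_sech_ker] tanh_exp_at_bot tanh_exp_at_top])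
      (use tanh_exp_deriv in \<open>simp add: has_real_derivative_iff_has_vector_derivative\<close>)
  thus ?thesis by simp
qed

lemma sech_ker_moment: "integrable lborel (\<lambda>z. z ^ j * sech_ker z)"
  by (rule Bochner_Integration.integrable_bound[OF tanh_exp_class_integrable_moment[OF tanh_exp_class_sech_ker, of j]])
    (auto simp: abs_mult power_abs)

text \<open>After \<open>z = v - u\<close> this is an integral of the kernel over a left half-line,
  hence a value of its primitive. With \<open>u0 = ln n\<close> and \<open>y = exp v\<close> that
  value is \<open>tanh (y / n)\<close>.\<close>

lemma integral_sech_ker_tail: "integral\<^sup>L lborel (\<lambda>u. indicator {u0..} u * sech_ker (v - u)) = tanh (exp (v - u0))"
proof -
  have "integral\<^sup>L lborel (\<lambda>u. indicator {u0..} u * sech_ker (v - u))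
     = \<bar>-1\<bar> *\<^sub>R integral\<^sup>L lborel (\<lambda>z. indicator {u0..} (v + (-1) * z) * sech_ker (v - (v + (-1) * z)))"
    by (rule lborel_integral_real_affine) simp
  also have "\<dots> = integral\<^sup>L lborel (\<lambda>z. indicator {..v - u0} z * sech_ker z)"
    by (simp, intro Bochner_Integration.integral_cong) (auto simp: indicator_def)
  also have "\<dots> = (LBINT z=-\<infinity>..v - u0. sech_ker z)"
    unfolding interval_lebesgue_integral_def set_lebesgue_integral_def
    by (simp, intro integral_cong_AE AE_I[of _ _ "{v - u0}"])
       (auto simp: indicator_def einterval_def split: if_splits)
  also have "\<dots> = tanh (exp (v - u0)) - 0"
  proof (rule interval_integral_FTC_integrable)
    show "((\<lambda>z. tanh (exp z)) has_vector_derivative sech_ker x) (at x)" for x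
      using tanh_exp_deriv by (simp add: has_real_derivative_iff_has_vector_derivative)
    show "isCont sech_ker x" for x by (rule tanh_exp_class_cont[OF tanh_exp_class_sech_ker])
    show "set_integrable lborel (einterval (-\<infinity>) (ereal (v - u0))) sech_ker"
      unfolding set_integrable_def using integrable_mult_indicator[OF _ tanh_exp_class_integrable[OF tanh_exp_class_sech_ker]] by simp
    show "(((\<lambda>z. tanh (exp z)) \<circ> real_of_ereal) \<longlongrightarrow> 0) (at_right (-\<infinity>))"
      using tanh_exp_at_bot by (simp add: ereal_tendsto_simps)
    have "isCont (\<lambda>z. tanh (exp z)) (v - u0)" using tanh_exp_deriv DERIV_isCont by blast
    thus "(((\<lambda>z. tanh (exp z)) \<circ> real_of_ereal) \<longlongrightarrow> tanh (exp (v - u0))) (at_left (ereal (v - u0)))"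
      unfolding ereal_tendsto_simps isCont_def using filterlim_at_split by blast
  qed simp
  finally show ?thesis by simp
qed

section \<open>The first moment of the kernel\<close>

lemma integral_01_tanh:
  "integral {0..1} (\<lambda>t::real. tanh t / t) = (LBINT z=-\<infinity>..0. tanh (exp z))"
  "set_integrable lborel (einterval (-\<infinity>) 0) (\<lambda>z. tanh (exp z))"
proof -
  let ?S = "{..<0::real}"
  have E: "einterval (-\<infinity>) 0 = ?S" by (auto simp: einterval_def zero_ereal_def)
  have bexp: "set_integrable lborel (einterval (-\<infinity>) 0) (exp :: real \<Rightarrow> real)"
    by (rule interval_integral_FTC_nonneg(1)[where F = exp and A = 0 and B = 1])
      (auto simp: ereal_tendsto_simps zero_ereal_def exp_at_bot intro!: tendsto_eq_intros)
  show int: "set_integrable lborel (einterval (-\<infinity>) 0) (\<lambda>z. tanh (exp z))"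
    unfolding set_integrable_def
    by (rule Bochner_Integration.integrable_bound[OF bexp[unfolded set_integrable_def]])
      (use tanh_le_self[of "exp _"] in \<open>auto simp: indicator_def E\<close>)
  have "set_integrable lborel ?S (\<lambda>z. tanh (exp z))" using int by (simp only: E)
  hence abs: "(\<lambda>z. tanh (exp z)) absolutely_integrable_on ?S"
    unfolding set_integrable_def by (rule integrable_completion[THEN iffD2, rotated]) measurable
  \<comment> \<open>The substitution \<open>t = exp x\<close> turns \<open>dt / t\<close> into
    \<open>dx\<close>; the factor \<open>\<bar>exp x\<bar>\<close> is the Jacobian.\<close>
  have "(\<lambda>x. \<bar>exp x\<bar> * (tanh (exp x) / exp x)) absolutely_integrable_on ?S \<and>
           integral ?S (\<lambda>x. \<bar>exp x\<bar> * (tanh (exp x) / exp x)) = integral ?S (\<lambda>z. tanh (exp z))"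
    using abs by simp
  hence "integral (exp ` ?S) (\<lambda>t. tanh t / t) = integral ?S (\<lambda>z. tanh (exp z))"
    by (subst (asm) has_absolute_integral_change_of_variables_1')
       (auto intro!: derivative_eq_intros simp: inj_on_def)
  moreover have "exp ` ?S = {0<..<1::real}"
  proof -
    have "y \<in> exp ` ?S" if "0 < y" "y < 1" for y :: real
      using that by (intro image_eqI[of _ _ "ln y"]) auto
    thus ?thesis by auto
  qed
  moreover have "integral {0..1} (\<lambda>t::real. tanh t / t) = integral {0<..<1} (\<lambda>t::real. tanh t / t)"
    by (rule integral_subset_negligible[symmetric]) (auto intro: negligible_subset[of "{0, 1}"])
  moreover have "(LBINT z=-\<infinity>..0. tanh (exp z)) = integral ?S (\<lambda>z. tanh (exp z))"
    using set_borel_integral_eq_integral(2)[OF int]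
    by (simp add: interval_lebesgue_integral_def E)
  ultimately show "integral {0..1} (\<lambda>t::real. tanh t / t) = (LBINT z=-\<infinity>..0. tanh (exp z))" by simp
qed

lemma integral_1_infty_tanh:
  "integral {1..} (\<lambda>t::real. (tanh t - 1) / t) = (LBINT z=0..\<infinity>. tanh (exp z) - 1)"
  "set_integrable lborel (einterval 0 \<infinity>) (\<lambda>z. tanh (exp z) - 1)"
proof -
  let ?S = "{0::real<..}"
  have E: "einterval 0 \<infinity> = ?S" by (auto simp: einterval_def zero_ereal_def)
  have bexp: "set_integrable lborel (einterval 0 \<infinity>) (\<lambda>x::real. 2 * exp (- x))"
  proof (rule interval_integral_FTC_nonneg(1)[where F = "\<lambda>x. - 2 * exp (- x)" and A = "-2" and B = 0])
    show "((\<lambda>x. - 2 * exp (- x)) has_real_derivative 2 * exp (- x)) (at x)" for x :: real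
      by (auto intro!: derivative_eq_intros)
    show "(((\<lambda>x. - 2 * exp (- x)) \<circ> real_of_ereal) \<longlongrightarrow> - 2) (at_right 0)"
      unfolding zero_ereal_def ereal_tendsto_simps by real_asymp
    show "(((\<lambda>x. - 2 * exp (- x)) \<circ> real_of_ereal) \<longlongrightarrow> 0) (at_left \<infinity>)"
      unfolding ereal_tendsto_simps by real_asymp
  qed auto
  have bd: "\<bar>tanh (exp z) - 1\<bar> \<le> 2 * exp (- z)" for z :: real
  proof -
    have "\<bar>tanh (exp z) - 1\<bar> = 1 - tanh (exp z)" using tanh_real_lt_1[of "exp z"] by linarith
    also have "\<dots> \<le> 2 * exp (- 2 * exp z)" by (rule one_minus_tanh_le)
    also have "\<dots> \<le> 2 * exp (- z)"
    proof -
      have "z \<le> 2 * exp z" using exp_ge_add_one_self[of z] exp_gt_zero[of z] by argo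
      thus ?thesis by simp
    qed
    finally show ?thesis .
  qed
  show int: "set_integrable lborel (einterval 0 \<infinity>) (\<lambda>z. tanh (exp z) - 1)"
    unfolding set_integrable_def
    by (rule Bochner_Integration.integrable_bound[OF bexp[unfolded set_integrable_def]])
      (use bd in \<open>auto simp: indicator_def E\<close>)
  have "set_integrable lborel ?S (\<lambda>z. tanh (exp z) - 1)" using int by (simp only: E)
  hence abs: "(\<lambda>z. tanh (exp z) - 1) absolutely_integrable_on ?S"
    unfolding set_integrable_def by (rule integrable_completion[THEN iffD2, rotated]) measurable
  have "(\<lambda>x. \<bar>exp x\<bar> * ((tanh (exp x) - 1) / exp x)) absolutely_integrable_on ?S \<and>
           integral ?S (\<lambda>x. \<bar>exp x\<bar> * ((tanh (exp x) - 1) / exp x)) = integral ?S (\<lambda>z. tanh (exp z) - 1)"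
    using abs by simp
  hence "integral (exp ` ?S) (\<lambda>t. (tanh t - 1) / t) = integral ?S (\<lambda>z. tanh (exp z) - 1)"
    by (subst (asm) has_absolute_integral_change_of_variables_1')
       (auto intro!: derivative_eq_intros simp: inj_on_def)
  moreover have "exp ` ?S = {1::real<..}"
  proof -
    have "y \<in> exp ` ?S" if "1 < y" for y :: real
      using that by (intro image_eqI[of _ _ "ln y"]) auto
    thus ?thesis by auto
  qed
  moreover have "integral {1..} (\<lambda>t::real. (tanh t - 1) / t) = integral {1<..} (\<lambda>t::real. (tanh t - 1) / t)"
    by (rule integral_subset_negligible[symmetric]) (auto intro: negligible_subset[of "{1}"])
  moreover have "(LBINT z=0..\<infinity>. tanh (exp z) - 1) = integral ?S (\<lambda>z. tanh (exp z) - 1)"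
    using set_borel_integral_eq_integral(2)[OF int]
    by (simp add: interval_lebesgue_integral_def E)
  ultimately show "integral {1..} (\<lambda>t::real. (tanh t - 1) / t) = (LBINT z=0..\<infinity>. tanh (exp z) - 1)" by simp
qed

text \<open>Integration by parts on each half-line. The primitive of the kernel is normalised to
  vanish at the respective infinite end, \<open>tanh (exp z)\<close> on the left and
  \<open>tanh (exp z) - 1\<close> on the right, and the factor \<open>z\<close> kills the boundary
  term at 0. The two remaining integrals are those of \<open>A0\<close> after
  \<open>t = exp z\<close>, which explains its splitting at \<open>t = 1\<close>.\<close>

lemma integral_z_sech_ker: "(\<integral>z. z * sech_ker z \<partial>lborel) = - A0"
proof -
  have zk: "integrable lborel (\<lambda>z. z * sech_ker z)" using sech_ker_moment[of 1] by simp
  have sub: "set_integrable lborel (einterval a b) (\<lambda>z. z * sech_ker z)" for a b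
    unfolding set_integrable_def using integrable_mult_indicator[OF _ zk] by simp
  have cont: "isCont (\<lambda>z::real. tanh (exp z)) x" for x using tanh_exp_deriv DERIV_isCont by blast
  have ck: "isCont sech_ker x" for x by (rule tanh_exp_class_cont[OF tanh_exp_class_sech_ker])
  have 1: "(LBINT z=-\<infinity>..0. z * sech_ker z + tanh (exp z)) = 0 * tanh (exp 0) - 0"
  proof (rule interval_integral_FTC_integrable)
    show "((\<lambda>z. z * tanh (exp z)) has_vector_derivative x * sech_ker x + tanh (exp x)) (at x)" for x
      unfolding has_real_derivative_iff_has_vector_derivative[symmetric]
      by (rule derivative_eq_intros tanh_exp_deriv refl)+ simp
    show "isCont (\<lambda>z. z * sech_ker z + tanh (exp z)) x" for x by (intro continuous_intros cont ck)
    show "set_integrable lborel (einterval (-\<infinity>) 0) (\<lambda>z. z * sech_ker z + tanh (exp z))"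
      by (intro set_integral_add sub integral_01_tanh(2))
    have "((\<lambda>z::real. z * tanh (exp z)) \<longlongrightarrow> 0) at_bot"
    proof (rule Lim_null_comparison[OF always_eventually])
      show "\<forall>z::real. norm (z * tanh (exp z)) \<le> \<bar>z\<bar> * exp z"
        using tanh_le_self[of "exp _"] by (auto simp: abs_mult intro!: mult_left_mono)
      show "((\<lambda>z::real. \<bar>z\<bar> * exp z) \<longlongrightarrow> 0) at_bot" by real_asymp
    qed
    thus "(((\<lambda>z. z * tanh (exp z)) \<circ> real_of_ereal) \<longlongrightarrow> 0) (at_right (-\<infinity>))"
      by (simp add: ereal_tendsto_simps)
    have "isCont (\<lambda>z::real. z * tanh (exp z)) 0" by (intro continuous_intros cont)
    thus "(((\<lambda>z. z * tanh (exp z)) \<circ> real_of_ereal) \<longlongrightarrow> 0 * tanh (exp 0)) (at_left 0)"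
      unfolding zero_ereal_def ereal_tendsto_simps isCont_def using filterlim_at_split by blast
  qed simp
  have 2: "(LBINT z=0..\<infinity>. z * sech_ker z + (tanh (exp z) - 1)) = 0 - 0 * (tanh (exp 0) - 1)"
  proof (rule interval_integral_FTC_integrable)
    show "((\<lambda>z. z * (tanh (exp z) - 1)) has_vector_derivative x * sech_ker x + (tanh (exp x) - 1)) (at x)" for x
      unfolding has_real_derivative_iff_has_vector_derivative[symmetric]
      by (rule derivative_eq_intros tanh_exp_deriv refl)+ simp
    show "isCont (\<lambda>z. z * sech_ker z + (tanh (exp z) - 1)) x" for x by (intro continuous_intros cont ck)
    show "set_integrable lborel (einterval 0 \<infinity>) (\<lambda>z. z * sech_ker z + (tanh (exp z) - 1))"
      by (intro set_integral_add sub integral_1_infty_tanh(2))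
    have "((\<lambda>z::real. z * (tanh (exp z) - 1)) \<longlongrightarrow> 0) at_top"
    proof (rule Lim_null_comparison[OF always_eventually])
      show "\<forall>z::real. norm (z * (tanh (exp z) - 1)) \<le> \<bar>z\<bar> * (2 * exp (- 2 * exp z))"
      proof
        fix z :: real
        have "\<bar>tanh (exp z) - 1\<bar> \<le> 2 * exp (- 2 * exp z)"
          using one_minus_tanh_le[of "exp z"] tanh_real_lt_1[of "exp z"] by linarith
        thus "norm (z * (tanh (exp z) - 1)) \<le> \<bar>z\<bar> * (2 * exp (- 2 * exp z))"
          unfolding real_norm_def abs_mult by (intro mult_left_mono) auto
      qed
      show "((\<lambda>z::real. \<bar>z\<bar> * (2 * exp (- 2 * exp z))) \<longlongrightarrow> 0) at_top" by real_asymp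
    qed
    thus "(((\<lambda>z. z * (tanh (exp z) - 1)) \<circ> real_of_ereal) \<longlongrightarrow> 0) (at_left \<infinity>)"
      by (simp add: ereal_tendsto_simps)
    have "isCont (\<lambda>z::real. z * (tanh (exp z) - 1)) 0" by (intro continuous_intros cont)
    thus "(((\<lambda>z. z * (tanh (exp z) - 1)) \<circ> real_of_ereal) \<longlongrightarrow> 0 * (tanh (exp 0) - 1)) (at_right 0)"
      unfolding zero_ereal_def ereal_tendsto_simps isCont_def using filterlim_at_split by blast
  qed simp
  have 3: "(LBINT z=-\<infinity>..0. z * sech_ker z) = - integral {0..1} (\<lambda>t::real. tanh t / t)"
    using 1 sub[of "-\<infinity>" 0] integral_01_tanh
    by (subst (asm) interval_lebesgue_integral_add(2)) (auto simp: interval_lebesgue_integrable_def)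
  have 4: "(LBINT z=0..\<infinity>. z * sech_ker z) = - integral {1..} (\<lambda>t::real. (tanh t - 1) / t)"
    using 2 sub[of 0 \<infinity>] integral_1_infty_tanh
    by (subst (asm) interval_lebesgue_integral_add(2)) (auto simp: interval_lebesgue_integrable_def)
  have "(LBINT z=-\<infinity>..0. z * sech_ker z) + (LBINT z=0..\<infinity>. z * sech_ker z) = (LBINT z=-\<infinity>..\<infinity>. z * sech_ker z)"
    by (rule interval_integral_sum) (use sub[of "-\<infinity>" "\<infinity>"] in \<open>simp add: interval_lebesgue_integrable_def\<close>)
  also have "\<dots> = (\<integral>z. z * sech_ker z \<partial>lborel)"
    by (simp add: interval_lebesgue_integral_def set_lebesgue_integral_def)
  finally show ?thesis unfolding 3 4 A0_def by simp
qed

section \<open>Laplace transform of the Mertens remainder\<close>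

lemma integral_Ici_FTC:
  fixes f F :: "real \<Rightarrow> 'a::euclidean_space"
  assumes int: "integrable lborel (\<lambda>u. indicator {a..} u *\<^sub>R f u)"
    and F: "\<And>u. (F has_vector_derivative f u) (at u)" "\<And>u. isCont f u" "(F \<longlongrightarrow> B) at_top"
  shows "(\<integral>u. indicator {a..} u *\<^sub>R f u \<partial>lborel) = B - F a"
proof -
  have ae: "AE u in lborel. indicator {a..} u *\<^sub>R f u = indicator (einterval (ereal a) \<infinity>) u *\<^sub>R f u"
    by (rule AE_I[of _ _ "{a}"]) (auto simp: indicator_def einterval_def split: if_splits)
  have meas: "f \<in> borel_measurable borel"
    by (intro borel_measurable_continuous_onI continuous_at_imp_continuous_on) (use F in auto)
  note [measurable] = meas
  have si: "set_integrable lborel (einterval (ereal a) \<infinity>) f"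
    unfolding set_integrable_def
    by (subst integrable_cong_AE[OF _ _ ae, symmetric]) (use int in auto)
  have "(LBINT u=a..\<infinity>. f u) = B - F a"
  proof (rule interval_integral_FTC_integrable[OF _ _ _ si])
    show "((F \<circ> real_of_ereal) \<longlongrightarrow> F a) (at_right (ereal a))"
      using has_vector_derivative_continuous[OF F(1)[of a]] unfolding ereal_tendsto_simps continuous_within
      using filterlim_at_split by blast
    show "((F \<circ> real_of_ereal) \<longlongrightarrow> B) (at_left \<infinity>)" using F(3) by (simp add: ereal_tendsto_simps)
  qed (use F in auto)
  also have "(LBINT u=a..\<infinity>. f u) = (\<integral>u. indicator {a..} u *\<^sub>R f u \<partial>lborel)"
    unfolding interval_lebesgue_integral_def set_lebesgue_integral_def
    using integral_cong_AE[OF _ _ ae] int by simp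
  finally show ?thesis .
qed

lemma integrable_exp_moment:
  assumes "Re w > 0"
  shows "integrable lborel (\<lambda>u. indicator {0..} u *\<^sub>R (of_real u ^ j * exp (- w * of_real u)))"
proof -
  define s where "s = Re w"
  have s: "s > 0" using assms by (simp add: s_def)
  have "integrable lborel (\<lambda>u. \<bar>0 + s * u\<bar> ^ j * exp (- \<bar>0 + s * u\<bar>))"
    by (rule lborel_integrable_real_affine[OF integrable_moment_exp]) (use s in auto)
  hence "integrable lborel (\<lambda>u. (1 / s ^ j) * (\<bar>0 + s * u\<bar> ^ j * exp (- \<bar>0 + s * u\<bar>)))"
    by (rule integrable_mult_right)
  thus ?thesis
    by (rule Bochner_Integration.integrable_bound)
      (use s in \<open>auto simp: norm_mult norm_power indicator_def abs_mult power_mult_distrib s_def\<close>)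
qed

lemma integrable_exp_moment':
  assumes "Re w > 0" "a \<ge> 0"
  shows "integrable lborel (\<lambda>u. indicator {a..} u *\<^sub>R (of_real u ^ j * exp (- w * of_real u)))"
  by (rule Bochner_Integration.integrable_bound[OF integrable_exp_moment[OF assms(1), of j]])
    (use assms in \<open>auto simp: indicator_def\<close>)

lemma exp_cmult_deriv:
  fixes w :: complex
  shows "((\<lambda>u. exp (- w * of_real u)) has_vector_derivative - w * exp (- w * of_real u)) (at u)"
  using exp_scaleR_has_vector_derivative_right[of "- w" u UNIV] by (simp add: scaleR_conv_of_real mult.commute)

lemma cexp_moment_at_top:
  assumes "Re w > 0"
  shows "((\<lambda>u. of_real u ^ j * exp (- w * of_real u)) \<longlongrightarrow> 0) at_top"
proof (rule Lim_null_comparison[OF always_eventually])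
  show "\<forall>u. norm (of_real u ^ j * exp (- w * of_real u)) \<le> \<bar>u\<bar> ^ j * exp (- Re w * u)"
    by (auto simp: norm_mult norm_power)
  show "((\<lambda>u. \<bar>u\<bar> ^ j * exp (- Re w * u)) \<longlongrightarrow> 0) at_top"
    using assms by real_asymp
qed

lemma integral_exp_moment_1:
  assumes w: "Re w > 0" and a: "a \<ge> 0"
  shows "(\<integral>u. indicator {a..} u *\<^sub>R (of_real u ^ 1 * exp (- w * of_real u)) \<partial>lborel)
     = (of_real a / w + 1 / w ^ 2) * exp (- w * of_real a)"
proof -
  have wn: "w \<noteq> 0" using w by auto
  define F where "F u = - ((of_real u / w + 1 / w ^ 2) * exp (- w * of_real u))" for u
  have "(\<integral>u. indicator {a..} u *\<^sub>R (of_real u ^ 1 * exp (- w * of_real u)) \<partial>lborel) = 0 - F a"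
  proof (rule integral_Ici_FTC[OF integrable_exp_moment'[OF w a]])
    fix u
    have "((\<lambda>u. of_real u / w + 1 / w ^ 2) has_vector_derivative (1 / w)) (at u)"
      by (auto intro!: derivative_eq_intros)
    from has_vector_derivative_minus[OF has_vector_derivative_mult[OF this exp_cmult_deriv[of w]]]
    show "(F has_vector_derivative (of_real u ^ 1 * exp (- w * of_real u))) (at u)"
      unfolding F_def by (rule has_vector_derivative_eq_rhs) (use wn in \<open>simp add: field_simps power2_eq_square\<close>)
    show "isCont (\<lambda>u. of_real u ^ 1 * exp (- w * of_real u)) u" by (intro continuous_intros)
    have "((\<lambda>u. - ((1/w) * (of_real u ^ 1 * exp (- w * of_real u)) + 1 / w^2 * (of_real u ^ 0 * exp (- w * of_real u))))
       \<longlongrightarrow> - ((1/w) * 0 + 1/w^2 * 0)) at_top"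
      by (intro tendsto_intros cexp_moment_at_top w)
    thus "(F \<longlongrightarrow> 0) at_top" by (simp add: F_def[abs_def] algebra_simps)
  qed
  thus ?thesis by (simp add: F_def)
qed

lemma integral_exp_moment_2:
  assumes w: "Re w > 0"
  shows "(\<integral>u. indicator {0..} u *\<^sub>R (of_real u ^ 2 * exp (- w * of_real u)) \<partial>lborel) = 2 / w ^ 3"
proof -
  have wn: "w \<noteq> 0" using w by auto
  define F where "F u = - ((of_real u ^ 2 / w + 2 * of_real u / w ^ 2 + 2 / w ^ 3) * exp (- w * of_real u))" for u
  have "(\<integral>u. indicator {0..} u *\<^sub>R (of_real u ^ 2 * exp (- w * of_real u)) \<partial>lborel) = 0 - F 0"
  proof (rule integral_Ici_FTC[OF integrable_exp_moment'[OF w]])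
    fix u
    have "((\<lambda>u. of_real u ^ 2) has_vector_derivative (2 * of_real u :: complex)) (at u)"
    proof -
      have o: "(of_real has_vector_derivative (1::complex)) (at u)" by (auto intro!: derivative_eq_intros)
      show ?thesis using has_vector_derivative_mult[OF o o] by (simp add: power2_eq_square)
    qed
    hence "((\<lambda>u. of_real u ^ 2 / w + 2 * of_real u / w ^ 2 + 2 / w ^ 3) has_vector_derivative (2 * of_real u / w + 2 / w^2)) (at u)"
      by (auto intro!: derivative_eq_intros has_vector_derivative_divide)
    from has_vector_derivative_minus[OF has_vector_derivative_mult[OF this exp_cmult_deriv[of w]]]
    show "(F has_vector_derivative (of_real u ^ 2 * exp (- w * of_real u))) (at u)"
      unfolding F_def by (rule has_vector_derivative_eq_rhs) (use wn in \<open>simp add: field_simps eval_nat_numeral\<close>)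
    show "isCont (\<lambda>u. of_real u ^ 2 * exp (- w * of_real u)) u" by (intro continuous_intros)
    have "((\<lambda>u. - ((1/w) * (of_real u ^ 2 * exp (- w * of_real u)) + 2 / w^2 * (of_real u ^ 1 * exp (- w * of_real u))
         + 2 / w^3 * (of_real u ^ 0 * exp (- w * of_real u))))
       \<longlongrightarrow> - ((1/w) * 0 + 2/w^2 * 0 + 2/w^3 * 0)) at_top"
      by (intro tendsto_intros cexp_moment_at_top w)
    thus "(F \<longlongrightarrow> 0) at_top" by (simp add: F_def[abs_def] algebra_simps)
  qed auto
  thus ?thesis by (simp add: F_def)
qed

section \<open>The Mertens sum and its remainder\<close>

definition mangoldt_coeff :: "nat \<Rightarrow> real" where "mangoldt_coeff n = mangoldt (Suc n) / real (Suc n)"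

lemma mangoldt_coeff_nonneg: "mangoldt_coeff n \<ge> 0" by (simp add: mangoldt_coeff_def mangoldt_nonneg)

definition mertens_sum :: "real \<Rightarrow> real" where "mertens_sum u = (\<Sum>d=1..nat \<lfloor>exp u\<rfloor>. mangoldt d / real d)"

definition mertens_rem :: "real \<Rightarrow> real" where "mertens_rem u = mertens_sum u - u + euler_mascheroni"

text \<open>Written as a series of half-line indicators, the step function can be integrated term by
  term, and its measurability is immediate.\<close>

lemma mertens_sum_sums: "(\<lambda>n. mangoldt_coeff n * indicator {ln (real (Suc n))..} u) sums mertens_sum u"
proof -
  have "(\<lambda>n. mangoldt_coeff n * indicator {ln (real (Suc n))..} u) sums (\<Sum>n<nat \<lfloor>exp u\<rfloor>. mangoldt_coeff n * indicator {ln (real (Suc n))..} u)"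
  proof (rule sums_finite)
    fix n assume "n \<notin> {..<nat \<lfloor>exp u\<rfloor>}"
    hence "exp u < real (Suc n)" by (simp add: not_less nat_le_iff floor_le_iff)
    hence "u < ln (real (Suc n))" by (metis ln_exp ln_less_cancel_iff exp_gt_zero less_trans)
    thus "mangoldt_coeff n * indicator {ln (real (Suc n))..} u = 0" by simp
  qed simp
  also have "(\<Sum>n<nat \<lfloor>exp u\<rfloor>. mangoldt_coeff n * indicator {ln (real (Suc n))..} u) = (\<Sum>n<nat \<lfloor>exp u\<rfloor>. mangoldt_coeff n)"
  proof (intro sum.cong refl)
    fix n assume "n \<in> {..<nat \<lfloor>exp u\<rfloor>}"
    hence "real (Suc n) \<le> exp u" by (simp add: Suc_le_eq less_floor_iff) linarith
    hence "ln (real (Suc n)) \<le> u" by (metis ln_exp ln_le_cancel_iff exp_gt_zero of_nat_0_less_iff zero_less_Suc)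
    thus "mangoldt_coeff n * indicator {ln (real (Suc n))..} u = mangoldt_coeff n" by simp
  qed
  also have "\<dots> = mertens_sum u"
    unfolding mertens_sum_def mangoldt_coeff_def by (simp add: sum.atLeast1_atMost_eq)
  finally show ?thesis .
qed

lemma mertens_sum_measurable [measurable]: "mertens_sum \<in> borel_measurable borel"
proof -
  have "mertens_sum = (\<lambda>u. \<Sum>n. mangoldt_coeff n * indicator {ln (real (Suc n))..} u)"
    using mertens_sum_sums by (auto simp: sums_iff fun_eq_iff)
  also have "\<dots> \<in> borel_measurable borel" by measurable
  finally show ?thesis .
qed

lemma mertens_rem_measurable [measurable]: "mertens_rem \<in> borel_measurable borel"
  unfolding mertens_rem_def[abs_def] by measurable

text \<open>The 5 is 4 from \<open>mertens_bound\<close> plus 1 for rounding \<open>exp u\<close> to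
  an integer inside the logarithm.\<close>

definition mertens_rem_const :: real where "mertens_rem_const = 5 + \<bar>euler_mascheroni\<bar>"

lemma mertens_rem_bound: assumes "u \<ge> 0" shows "\<bar>mertens_rem u\<bar> \<le> mertens_rem_const"
proof -
  define N where "N = nat \<lfloor>exp u\<rfloor>"
  have e1: "exp u \<ge> 1" using assms by simp
  have N: "N > 0" "real N \<le> exp u" "exp u < real N + 1"
    using e1 unfolding N_def by (auto simp: le_nat_floor)
  have "\<bar>mertens_sum u - ln (real N)\<bar> \<le> 4"
    unfolding mertens_sum_def N_def[symmetric] using mertens_bound[OF N(1)] .
  moreover have "ln (real N) \<le> u" using N by (metis ln_exp ln_le_cancel_iff exp_gt_zero of_nat_0_less_iff)
  moreover have "u \<le> ln (real N) + 1"
  proof -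
    have "u \<le> ln (2 * real N)"
    proof -
      have "exp u \<le> 2 * real N" using N by linarith
      thus ?thesis using ln_ge_iff[of "2 * real N" u] N by simp
    qed
    also have "\<dots> = ln 2 + ln (real N)" using N by (simp add: ln_mult)
    also have "ln (2::real) \<le> 1" using ln_le_minus_one[of "2::real"] by simp
    finally show ?thesis by simp
  qed
  ultimately show ?thesis unfolding mertens_rem_def mertens_rem_const_def by linarith
qed

lemma mertens_rem_laplace_integrable:
  assumes "Re w > 0"
  shows "integrable lborel (\<lambda>u. indicator {0..} u *\<^sub>R (of_real (u * mertens_rem u) * exp (- w * of_real u)))"
proof (rule Bochner_Integration.integrable_bound[OF integrable_mult_right[OF integrable_exp_moment[OF assms, of 1], of "of_real mertens_rem_const"]])
  show "AE u in lborel. norm (indicator {0..} u *\<^sub>R (of_real (u * mertens_rem u) * exp (- w * of_real u)))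
    \<le> norm (of_real mertens_rem_const * (indicator {0..} u *\<^sub>R (of_real u ^ 1 * exp (- w * of_real u))))"
  proof (rule AE_I2)
    fix u :: real
    show "norm (indicator {0..} u *\<^sub>R (of_real (u * mertens_rem u) * exp (- w * of_real u)))
    \<le> norm (of_real mertens_rem_const * (indicator {0..} u *\<^sub>R (of_real u ^ 1 * exp (- w * of_real u))))"
    proof (cases "u \<ge> 0")
      case True
      have "\<bar>mertens_rem u\<bar> * (u * exp (- (Re w * u))) \<le> \<bar>mertens_rem_const\<bar> * (u * exp (- (Re w * u)))"
        using mertens_rem_bound[OF True] True by (intro mult_right_mono) auto
      thus ?thesis using True by (simp add: norm_mult abs_mult mult_ac)
    qed simp
  qed
qed measurable

text \<open>Each jump at \<open>ln n\<close> contributes the integral of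
  \<open>u * exp (- w * u)\<close> over \<open>[ln n, \<infinity>)\<close>. Its part proportional to
  \<open>ln n\<close> gives the series of \<open>mangoldt n * ln n\<close>, the rest the series of
  \<open>mangoldt n\<close>.\<close>

lemma mertens_rem_laplace:
  assumes w: "Re w > 0"
  shows "(\<integral>u. indicator {0..} u *\<^sub>R (of_real (u * mertens_rem u) * exp (- w * of_real u)) \<partial>lborel) = rem_laplace w"
proof -
  have wn: "w \<noteq> 0" using w by auto
  let ?e = "\<lambda>j u. of_real u ^ j * exp (- w * of_real u)"
  define f where "f n u = of_real (mangoldt_coeff n) * (indicator {ln (real (Suc n))..} u *\<^sub>R ?e 1 u)" for n u
  have lnn: "ln (real (Suc n)) \<ge> 0" for n by simp
  have fi: "integrable lborel (f n)" for n
    unfolding f_def by (intro integrable_mult_right integrable_exp_moment' w lnn)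
  \<comment> \<open>The integral of the norm is the same moment at the real point
    \<open>Re w\<close>, read off from the complex formula.\<close>
  have nfi: "(\<integral>u. norm (f n u) \<partial>lborel) = mangoldt_coeff n * ((ln (real (Suc n)) / Re w + 1 / (Re w) ^ 2) * exp (- Re w * ln (real (Suc n))))" for n
  proof -
    have "complex_of_real (\<integral>u. norm (f n u) \<partial>lborel) = (\<integral>u. of_real (norm (f n u)) \<partial>lborel)"
      by simp
    also have "\<dots> = (\<integral>u. of_real (mangoldt_coeff n) * (indicator {ln (real (Suc n))..} u *\<^sub>R (of_real u ^ 1 * exp (- of_real (Re w) * of_real u))) \<partial>lborel)"
    proof (intro Bochner_Integration.integral_cong refl)
      fix u :: real
      show "of_real (norm (f n u)) = complex_of_real (mangoldt_coeff n) * (indicator {ln (real (Suc n))..} u *\<^sub>R (of_real u ^ 1 * exp (- of_real (Re w) * of_real u)))"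
        using mangoldt_coeff_nonneg[of n] order_trans[OF lnn[of n], of u]
        by (auto simp: f_def norm_mult indicator_def exp_of_real[symmetric] simp del: of_nat_Suc)
    qed
    also have "\<dots> = of_real (mangoldt_coeff n) * ((of_real (ln (real (Suc n))) / of_real (Re w) + 1 / of_real (Re w) ^ 2) * exp (- of_real (Re w) * of_real (ln (real (Suc n)))))"
      by (subst integral_mult_right_zero, subst integral_exp_moment_1) (use w lnn in auto)
    also have "\<dots> = of_real (mangoldt_coeff n * ((ln (real (Suc n)) / Re w + 1 / (Re w) ^ 2) * exp (- Re w * ln (real (Suc n)))))"
      by (simp add: exp_of_real[symmetric] del: of_nat_Suc)
    finally show ?thesis unfolding of_real_eq_iff .
  qed
  have pw: "mangoldt_coeff n * exp (- s * ln (real (Suc n))) = mangoldt (Suc n) * real (Suc n) powr (-1 - s)" for n s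
  proof -
    have "real (Suc n) powr (-1 - s) = exp (- s * ln (real (Suc n))) / real (Suc n)"
      unfolding powr_def by (simp add: algebra_simps exp_diff exp_minus divide_inverse del: of_nat_Suc)
    thus ?thesis by (simp add: mangoldt_coeff_def del: of_nat_Suc)
  qed
  have sm: "summable (\<lambda>n. \<integral>u. norm (f n u) \<partial>lborel)"
  proof -
    have "summable (\<lambda>n. (1 / Re w) * (\<bar>mangoldt (Suc n) * ln (real (Suc n))\<bar> * real (Suc n) powr (-1 - Re w))
          + 1 / (Re w)^2 * (\<bar>mangoldt (Suc n)\<bar> * real (Suc n) powr (-1 - Re w)))"
      using abs_conv_ln[OF abs_conv_mangoldt] abs_conv_mangoldt w unfolding abs_conv_def
      by (intro summable_add summable_mult) auto
    moreover have "(\<integral>u. norm (f n u) \<partial>lborel) = (1 / Re w) * (\<bar>mangoldt (Suc n) * ln (real (Suc n))\<bar> * real (Suc n) powr (-1 - Re w))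
          + 1 / (Re w)^2 * (\<bar>mangoldt (Suc n)\<bar> * real (Suc n) powr (-1 - Re w))" for n
      unfolding nfi using pw[of n "Re w"] lnn[of n] mangoldt_nonneg[of "Suc n"]
      by (simp add: algebra_simps abs_mult del: of_nat_Suc)
    ultimately show ?thesis by simp
  qed
  have AAe: "(\<integral>u. indicator {0..} u *\<^sub>R (of_real (mertens_sum u) * ?e 1 u) \<partial>lborel) = dseries (\<lambda>n. mangoldt n * ln (real n)) w / w + dseries mangoldt w / w ^ 2"
    and AAi: "integrable lborel (\<lambda>u. indicator {0..} u *\<^sub>R (of_real (mertens_sum u) * ?e 1 u))"
  proof -
    have fs: "(\<lambda>n. f n u) sums (indicator {0..} u *\<^sub>R (of_real (mertens_sum u) * ?e 1 u))" for u
    proof -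
      have "(\<lambda>n. of_real (mangoldt_coeff n * indicator {ln (real (Suc n))..} u) * (indicator {0..} u *\<^sub>R ?e 1 u)) sums (of_real (mertens_sum u) * (indicator {0..} u *\<^sub>R ?e 1 u))"
        by (intro sums_mult2) (use mertens_sum_sums sums_of_real in blast)
      moreover have "of_real (mangoldt_coeff n * indicator {ln (real (Suc n))..} u) * (indicator {0..} u *\<^sub>R ?e 1 u) = f n u" for n
        using order_trans[OF lnn[of n], of u] by (auto simp: f_def indicator_def simp del: of_nat_Suc)
      ultimately show ?thesis by (simp add: mult_ac scaleR_conv_of_real)
    qed
    have "AE u in lborel. summable (\<lambda>n. norm (f n u))"
    proof (rule AE_I2)
      fix u
      have "(\<lambda>n. (mangoldt_coeff n * indicator {ln (real (Suc n))..} u) * norm (?e 1 u)) sums (mertens_sum u * norm (?e 1 u))"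
        by (intro sums_mult2 mertens_sum_sums)
      moreover have "norm (f n u) = (mangoldt_coeff n * indicator {ln (real (Suc n))..} u) * norm (?e 1 u)" for n
        using mangoldt_coeff_nonneg[of n] by (simp add: f_def norm_mult)
      ultimately show "summable (\<lambda>n. norm (f n u))" by (simp add: sums_iff)
    qed
    note int = integral_suminf[OF fi this sm] integrable_suminf[OF fi this sm]
    have eq: "(\<lambda>u. \<Sum>n. f n u) = (\<lambda>u. indicator {0..} u *\<^sub>R (of_real (mertens_sum u) * ?e 1 u))"
      using fs by (auto simp: sums_iff)
    show "integrable lborel (\<lambda>u. indicator {0..} u *\<^sub>R (of_real (mertens_sum u) * ?e 1 u))"
      using int(2) unfolding eq .
    have "integral\<^sup>L lborel (f n) = of_real (mangoldt (Suc n) * ln (real (Suc n))) * of_nat (Suc n) powr (-1 - w) / w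
         + of_real (mangoldt (Suc n)) * of_nat (Suc n) powr (-1 - w) / w ^ 2" for n
    proof -
      have P: "of_nat (Suc n) powr (-1 - w) = exp (- w * of_real (ln (real (Suc n)))) / of_nat (Suc n)"
        using Ln_of_nat[of "Suc n"] unfolding powr_def
        by (simp add: algebra_simps exp_diff exp_minus divide_inverse exp_of_real[symmetric] del: of_nat_Suc)
           (simp add: exp_of_real del: of_nat_Suc)
      have "integral\<^sup>L lborel (f n) = of_real (mangoldt_coeff n) * ((of_real (ln (real (Suc n))) / w + 1 / w ^ 2) * exp (- w * of_real (ln (real (Suc n)))))"
        unfolding f_def by (subst integral_mult_right_zero, subst integral_exp_moment_1) (use w lnn in auto)
      thus ?thesis unfolding P by (simp add: mangoldt_coeff_def ring_distribs add_divide_distrib del: of_nat_Suc)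
    qed
    moreover have "(\<lambda>n. of_real (mangoldt (Suc n) * ln (real (Suc n))) * of_nat (Suc n) powr (-1 - w) / w
         + of_real (mangoldt (Suc n)) * of_nat (Suc n) powr (-1 - w) / w ^ 2) sums
      (dseries (\<lambda>n. mangoldt n * ln (real n)) w / w + dseries mangoldt w / w ^ 2)"
      by (intro sums_add sums_divide dseries_sums abs_conv_ln abs_conv_mangoldt w)
    ultimately show "(\<integral>u. indicator {0..} u *\<^sub>R (of_real (mertens_sum u) * ?e 1 u) \<partial>lborel) = dseries (\<lambda>n. mangoldt n * ln (real n)) w / w + dseries mangoldt w / w ^ 2"
      using int(1) unfolding eq by (simp add: sums_iff)
  qed
  have "(\<integral>u. indicator {0..} u *\<^sub>R (of_real (u * mertens_rem u) * exp (- w * of_real u)) \<partial>lborel)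
     = (\<integral>u. indicator {0..} u *\<^sub>R (of_real (mertens_sum u) * ?e 1 u) - indicator {0..} u *\<^sub>R ?e 2 u
         + of_real euler_mascheroni * (indicator {0..} u *\<^sub>R ?e 1 u) \<partial>lborel)"
    by (intro Bochner_Integration.integral_cong refl) (auto simp: mertens_rem_def indicator_def algebra_simps power2_eq_square)
  also have "\<dots> = dseries (\<lambda>n. mangoldt n * ln (real n)) w / w + dseries mangoldt w / w ^ 2 - 2 / w ^ 3
     + of_real euler_mascheroni * ((of_real 0 / w + 1 / w ^ 2) * exp (- w * of_real 0))"
    using AAi integrable_exp_moment[OF w, of 2] integrable_exp_moment[OF w, of 1]
    by (simp only: Bochner_Integration.integral_add Bochner_Integration.integral_diff integral_mult_right_zero
        Bochner_Integration.integrable_diff integrable_mult_right AAe integral_exp_moment_2[OF w]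
        integral_exp_moment_1[OF w order.refl])
  also have "\<dots> = rem_laplace w" by (simp add: rem_laplace_def)
  finally show ?thesis .
qed

section \<open>Averages of the remainder against the kernel\<close>

definition sech_ker_const :: real where "sech_ker_const = (\<integral>z. \<bar>z\<bar> * sech_ker z \<partial>lborel)"

lemma sech_ker_affine_integrable:
  assumes "integrable lborel (\<lambda>z. g z * sech_ker z)"
  shows "integrable lborel (\<lambda>u. g (v - u) * sech_ker (v - u))"
    and "(\<integral>u. g (v - u) * sech_ker (v - u) \<partial>lborel) = (\<integral>z. g z * sech_ker z \<partial>lborel)"
  using lborel_integrable_real_affine[OF assms, of "-1" v] lborel_integral_real_affine[of "-1" "\<lambda>z. g z * sech_ker z" v]
  by simp_all

lemma sech_ker_abs_moment: "integrable lborel (\<lambda>z. \<bar>z\<bar> ^ j * sech_ker z)"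
  by (rule tanh_exp_class_integrable_moment[OF tanh_exp_class_sech_ker])

lemma integrable_u_mertens_rem_sech_ker: "integrable lborel (\<lambda>u. indicator {0..} u * (u * mertens_rem u) * sech_ker (v - u))"
proof (rule Bochner_Integration.integrable_bound)
  have "integrable lborel (\<lambda>z. (mertens_rem_const * (\<bar>v\<bar> + \<bar>z\<bar>)) * sech_ker z)"
    using integrable_mult_right[OF sech_ker_abs_moment[of 0], of "mertens_rem_const * \<bar>v\<bar>"] integrable_mult_right[OF sech_ker_abs_moment[of 1], of mertens_rem_const]
    by (simp add: algebra_simps)
  from sech_ker_affine_integrable(1)[OF this, of v]
  show "integrable lborel (\<lambda>u. (mertens_rem_const * (\<bar>v\<bar> + \<bar>v - u\<bar>)) * sech_ker (v - u))" .
  show "AE u in lborel. norm (indicator {0..} u * (u * mertens_rem u) * sech_ker (v - u)) \<le> norm (mertens_rem_const * (\<bar>v\<bar> + \<bar>v - u\<bar>) * sech_ker (v - u))"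
  proof (rule AE_I2)
    fix u :: real
    show "norm (indicator {0..} u * (u * mertens_rem u) * sech_ker (v - u)) \<le> norm (mertens_rem_const * (\<bar>v\<bar> + \<bar>v - u\<bar>) * sech_ker (v - u))"
    proof (cases "u \<ge> 0")
      case True
      have mertens_rem_const: "mertens_rem_const \<ge> 0" by (simp add: mertens_rem_const_def)
      have "\<bar>u * mertens_rem u\<bar> \<le> (\<bar>v\<bar> + \<bar>v - u\<bar>) * mertens_rem_const"
        unfolding abs_mult using mertens_rem_bound[OF True] True by (intro mult_mono) auto
      hence "\<bar>u * mertens_rem u\<bar> * sech_ker (v - u) \<le> (\<bar>v\<bar> + \<bar>v - u\<bar>) * mertens_rem_const * sech_ker (v - u)"
        using sech_ker_nonneg by (rule mult_right_mono)
      thus ?thesis using True sech_ker_nonneg[of "v - u"] mertens_rem_const by (simp add: abs_mult mult_ac)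
    qed simp
  qed
qed measurable

text \<open>The growth of \<open>rem_laplace\<close> is polynomial of degree 24 uniformly for
  \<sigma> in \<open>(0, 1]\<close>, and the Fourier transform of the kernel decays faster. That the
  bound is independent of \<sigma> later permits \<sigma> to tend to 0.\<close>

lemma rem_laplace_line_bound:
  obtains B where "\<And>\<sigma>. 0 < \<sigma> \<Longrightarrow> \<sigma> \<le> 1 \<Longrightarrow> (\<integral>t. norm (fourier sech_ker t) * norm (rem_laplace (Complex \<sigma> t)) \<partial>lborel) \<le> B"
proof -
  obtain C where C: "C \<ge> 0" "\<And>w. 0 < Re w \<Longrightarrow> Re w \<le> 1 \<Longrightarrow> norm (rem_laplace w) \<le> C * (1 + norm w) ^ 24"
    using rem_laplace_bound by blast
  obtain D where D: "D \<ge> 0" "\<And>t. (1 + \<bar>t\<bar>) ^ 24 * norm (fourier sech_ker t) \<le> D / (1 + t^2)"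
    using tanh_exp_class_fourier_decay'[OF tanh_exp_class_sech_ker, of 24] by blast
  have bd: "norm (fourier sech_ker t) * norm (rem_laplace (Complex \<sigma> t)) \<le> C * 2 ^ 24 * D * (1 / (1 + t^2))"
    if "0 < \<sigma>" "\<sigma> \<le> 1" for \<sigma> t
  proof -
    have "norm (Complex \<sigma> t) \<le> \<bar>\<sigma>\<bar> + \<bar>t\<bar>" using cmod_le[of "Complex \<sigma> t"] by simp
    hence "1 + norm (Complex \<sigma> t) \<le> 2 * (1 + \<bar>t\<bar>)" using that abs_ge_zero[of t] unfolding ring_distribs by argo
    hence "(1 + norm (Complex \<sigma> t)) ^ 24 \<le> (2 * (1 + \<bar>t\<bar>)) ^ 24" by (intro power_mono) auto
    hence "C * (1 + norm (Complex \<sigma> t)) ^ 24 \<le> C * (2 ^ 24 * (1 + \<bar>t\<bar>) ^ 24)"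
      using C(1) by (intro mult_left_mono) (simp only: power_mult_distrib, simp)
    hence "norm (rem_laplace (Complex \<sigma> t)) \<le> C * (2 ^ 24 * (1 + \<bar>t\<bar>) ^ 24)"
      using C(2)[of "Complex \<sigma> t"] that by simp
    hence "norm (fourier sech_ker t) * norm (rem_laplace (Complex \<sigma> t)) \<le> norm (fourier sech_ker t) * (C * (2 ^ 24 * (1 + \<bar>t\<bar>) ^ 24))"
      by (intro mult_left_mono) auto
    also have "\<dots> = C * 2 ^ 24 * ((1 + \<bar>t\<bar>) ^ 24 * norm (fourier sech_ker t))" by (simp only: mult_ac)
    also have "\<dots> \<le> C * 2 ^ 24 * (D / (1 + t^2))" using D(2) C(1) by (intro mult_left_mono) auto
    finally show ?thesis by simp
  qed
  have "(\<integral>t. norm (fourier sech_ker t) * norm (rem_laplace (Complex \<sigma> t)) \<partial>lborel) \<le> (\<integral>t. C * 2 ^ 24 * D * (1 / (1 + t^2)) \<partial>lborel)"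
    if "0 < \<sigma>" "\<sigma> \<le> 1" for \<sigma>
    by (rule integral_mono_AE'[OF integrable_mult_right[OF integrable_inverse_square]])
       (use bd[OF that] C(1) D(1) in auto)
  thus ?thesis using that by blast
qed

lemma fourier_sech_ker_integrable: "integrable lborel (fourier sech_ker)"
proof -
  obtain D where D: "D \<ge> 0" "\<And>t. (1 + \<bar>t\<bar>) ^ 0 * norm (fourier sech_ker t) \<le> D / (1 + t^2)"
    using tanh_exp_class_fourier_decay'[OF tanh_exp_class_sech_ker, of 0] by blast
  have [measurable]: "fourier sech_ker \<in> borel_measurable borel" by (rule fourier_measurable[OF tanh_exp_class_integrable[OF tanh_exp_class_sech_ker]])
  show ?thesis
    by (rule Bochner_Integration.integrable_bound[OF integrable_mult_right[OF integrable_inverse_square, of D]])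
      (use D in auto)
qed

lemma sech_ker_inversion: "of_real (2 * pi * sech_ker z) = (\<integral>t. fourier sech_ker t * iexp (t * z) \<partial>lborel)"
proof -
  obtain C where C: "\<And>z. \<bar>sech_ker z\<bar> \<le> C * exp (- \<bar>z\<bar>)" using tanh_exp_class_bound[OF tanh_exp_class_sech_ker] by blast
  have C0: "C \<ge> 0" using order_trans[OF abs_ge_zero C[of 0]] by simp
  have "\<bar>sech_ker z\<bar> \<le> C" for z
  proof -
    have "C * exp (- \<bar>z\<bar>) \<le> C * 1" using C0 by (intro mult_left_mono) auto
    thus ?thesis using C[of z] by simp
  qed
  thus ?thesis
    by (intro fourier_inversion[OF tanh_exp_class_integrable[OF tanh_exp_class_sech_ker] _ _ fourier_sech_ker_integrable] continuous_at_imp_continuous_on)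
       (use tanh_exp_class_cont[OF tanh_exp_class_sech_ker] in auto)
qed

text \<open>A Parseval identity: the kernel is written as its Fourier integral, and after exchanging
  the integrals the inner one is a Laplace transform at \<open>Complex \<sigma> t\<close>. The
  damping by \<open>exp (- \<sigma> * u)\<close> makes the exchange legitimate.\<close>

lemma mertens_rem_sech_ker_laplace:
  assumes s: "\<sigma> > 0"
  shows "complex_of_real (2 * pi * (\<integral>u. indicator {0..} u * (u * mertens_rem u) * exp (- \<sigma> * u) * sech_ker (v - u) \<partial>lborel))
     = (\<integral>t. fourier sech_ker t * iexp (t * v) * rem_laplace (Complex \<sigma> t) \<partial>lborel)"
proof -
  define g :: "real \<Rightarrow> complex" where "g = (\<lambda>u. indicator {0..} u *\<^sub>R (of_real (u * mertens_rem u) * exp (- of_real \<sigma> * of_real u)))"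
  have g: "integrable lborel g" unfolding g_def by (rule mertens_rem_laplace_integrable) (use s in simp)
  have [measurable]: "fourier sech_ker \<in> borel_measurable borel" "g \<in> borel_measurable borel" using fourier_sech_ker_integrable g by auto
  have int: "integrable (lborel \<Otimes>\<^sub>M lborel) (\<lambda>(u,t). g u * (fourier sech_ker t * iexp (t * (v - u))))"
    by (rule integrable_product[OF g fourier_sech_ker_integrable]) (auto simp: norm_mult)
  have "complex_of_real (2 * pi * (\<integral>u. indicator {0..} u * (u * mertens_rem u) * exp (- \<sigma> * u) * sech_ker (v - u) \<partial>lborel))
     = (\<integral>u. of_real (2 * pi * (indicator {0..} u * (u * mertens_rem u) * exp (- \<sigma> * u) * sech_ker (v - u))) \<partial>lborel)"
    by (simp only: integral_complex_of_real integral_mult_right_zero)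
  also have "\<dots> = (\<integral>u. g u * of_real (2 * pi * sech_ker (v - u)) \<partial>lborel)"
    by (intro Bochner_Integration.integral_cong refl) (auto simp: g_def indicator_def exp_of_real[symmetric])
  also have "\<dots> = (\<integral>u. (\<integral>t. g u * (fourier sech_ker t * iexp (t * (v - u))) \<partial>lborel) \<partial>lborel)"
    unfolding sech_ker_inversion by (simp only: integral_mult_right_zero)
  also have "\<dots> = (\<integral>t. (\<integral>u. g u * (fourier sech_ker t * iexp (t * (v - u))) \<partial>lborel) \<partial>lborel)"
    by (rule lborel_pair.Fubini_integral[OF int, symmetric])
  also have "\<dots> = (\<integral>t. fourier sech_ker t * iexp (t * v) * rem_laplace (Complex \<sigma> t) \<partial>lborel)"
  proof (intro Bochner_Integration.integral_cong refl)
    fix t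
    have "(\<integral>u. g u * (fourier sech_ker t * iexp (t * (v - u))) \<partial>lborel)
      = (\<integral>u. (fourier sech_ker t * iexp (t * v)) * (indicator {0..} u *\<^sub>R (of_real (u * mertens_rem u) * exp (- Complex \<sigma> t * of_real u))) \<partial>lborel)"
    proof (intro Bochner_Integration.integral_cong refl)
      fix u
      have "exp (- of_real \<sigma> * of_real u) * iexp (t * (v - u)) = iexp (t * v) * exp (- Complex \<sigma> t * of_real u)"
      proof -
        have "Complex \<sigma> t = of_real \<sigma> + \<i> * of_real t" by (simp add: complex_eq_iff)
        thus ?thesis unfolding exp_add[symmetric] by (simp add: algebra_simps)
      qed
      hence "(of_real (indicator {0..} u) * of_real (u * mertens_rem u) * fourier sech_ker t) * (exp (- of_real \<sigma> * of_real u) * iexp (t * (v - u)))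
         = (of_real (indicator {0..} u) * of_real (u * mertens_rem u) * fourier sech_ker t) * (iexp (t * v) * exp (- Complex \<sigma> t * of_real u))"
        by (simp only:)
      thus "g u * (fourier sech_ker t * iexp (t * (v - u))) = (fourier sech_ker t * iexp (t * v)) * (indicator {0..} u *\<^sub>R (of_real (u * mertens_rem u) * exp (- Complex \<sigma> t * of_real u)))"
        by (simp only: g_def scaleR_conv_of_real mult_ac)
    qed
    also have "\<dots> = fourier sech_ker t * iexp (t * v) * rem_laplace (Complex \<sigma> t)"
      unfolding integral_mult_right_zero using mertens_rem_laplace[of "Complex \<sigma> t"] s by simp
    finally show "(\<integral>u. g u * (fourier sech_ker t * iexp (t * (v - u))) \<partial>lborel) = fourier sech_ker t * iexp (t * v) * rem_laplace (Complex \<sigma> t)" .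
  qed
  finally show ?thesis .
qed

text \<open>The translation \<open>v\<close> enters the Fourier side only through
  \<open>iexp (t * v)\<close>, of modulus 1, and the line bound is uniform in \<sigma>; so the
  damping can be removed by dominated convergence without losing the bound.\<close>

lemma u_mertens_rem_sech_ker_bound:
  obtains B where "\<And>v. \<bar>\<integral>u. indicator {0..} u * (u * mertens_rem u) * sech_ker (v - u) \<partial>lborel\<bar> \<le> B"
proof -
  obtain B where B: "\<And>\<sigma>. 0 < \<sigma> \<Longrightarrow> \<sigma> \<le> 1 \<Longrightarrow> (\<integral>t. norm (fourier sech_ker t) * norm (rem_laplace (Complex \<sigma> t)) \<partial>lborel) \<le> B"
    using rem_laplace_line_bound by blast
  have "\<bar>\<integral>u. indicator {0..} u * (u * mertens_rem u) * sech_ker (v - u) \<partial>lborel\<bar> \<le> B / (2 * pi)" for v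
  proof -
    define s where "s n = 1 / real (Suc n)" for n
    have s: "0 < s n" "s n \<le> 1" for n by (auto simp: s_def)
    have s0: "s \<longlonglongrightarrow> 0" unfolding s_def by real_asymp
    let ?I = "\<lambda>n. \<integral>u. indicator {0..} u * (u * mertens_rem u) * exp (- s n * u) * sech_ker (v - u) \<partial>lborel"
    have "\<bar>?I n\<bar> \<le> B / (2 * pi)" for n
    proof -
      have "2 * pi * \<bar>?I n\<bar> = norm (of_real (2 * pi * ?I n) :: complex)" unfolding norm_of_real by (simp add: abs_mult)
      also have "\<dots> \<le> (\<integral>t. norm (fourier sech_ker t * iexp (t * v) * rem_laplace (Complex (s n) t)) \<partial>lborel)"
        unfolding mertens_rem_sech_ker_laplace[OF s(1)] by (rule integral_norm_bound)
      also have "\<dots> = (\<integral>t. norm (fourier sech_ker t) * norm (rem_laplace (Complex (s n) t)) \<partial>lborel)" by (simp add: norm_mult)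
      also have "\<dots> \<le> B" using B s by blast
      finally show ?thesis by (simp add: field_simps)
    qed
    moreover have "?I \<longlonglongrightarrow> (\<integral>u. indicator {0..} u * (u * mertens_rem u) * sech_ker (v - u) \<partial>lborel)"
    proof (rule integral_dominated_convergence[where w = "\<lambda>u. \<bar>indicator {0..} u * (u * mertens_rem u) * sech_ker (v - u)\<bar>"])
      show "AE u in lborel. (\<lambda>n. indicator {0..} u * (u * mertens_rem u) * exp (- s n * u) * sech_ker (v - u)) \<longlonglongrightarrow> indicator {0..} u * (u * mertens_rem u) * sech_ker (v - u)"
      proof (rule AE_I2)
        fix u
        have "(\<lambda>n. indicator {0..} u * (u * mertens_rem u) * exp (- s n * u) * sech_ker (v - u)) \<longlonglongrightarrow> indicator {0..} u * (u * mertens_rem u) * exp (- 0 * u) * sech_ker (v - u)"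
          by (intro tendsto_intros s0)
        thus "(\<lambda>n. indicator {0..} u * (u * mertens_rem u) * exp (- s n * u) * sech_ker (v - u)) \<longlonglongrightarrow> indicator {0..} u * (u * mertens_rem u) * sech_ker (v - u)" by simp
      qed
      show "AE u in lborel. norm (indicator {0..} u * (u * mertens_rem u) * exp (- s n * u) * sech_ker (v - u)) \<le> \<bar>indicator {0..} u * (u * mertens_rem u) * sech_ker (v - u)\<bar>" for n
      proof (rule AE_I2)
        fix u :: real
        show "norm (indicator {0..} u * (u * mertens_rem u) * exp (- s n * u) * sech_ker (v - u)) \<le> \<bar>indicator {0..} u * (u * mertens_rem u) * sech_ker (v - u)\<bar>"
        proof (cases "u \<ge> 0")
          case True
          hence "exp (- s n * u) \<le> 1" using s(1)[of n] by simp
          hence "\<bar>u * mertens_rem u * sech_ker (v - u)\<bar> * exp (- s n * u) \<le> \<bar>u * mertens_rem u * sech_ker (v - u)\<bar>"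
            by (intro mult_left_le) auto
          thus ?thesis using True by (simp add: abs_mult mult_ac)
        qed simp
      qed
      show "integrable lborel (\<lambda>u. \<bar>indicator {0..} u * (u * mertens_rem u) * sech_ker (v - u)\<bar>)"
        using integrable_u_mertens_rem_sech_ker by (rule integrable_abs)
    qed measurable
    ultimately show ?thesis
      using Lim_bounded[OF tendsto_rabs] by blast
  qed
  thus ?thesis using that by blast
qed

section \<open>The completed tanh sum\<close>

definition mtanh_sum :: "real \<Rightarrow> real" where "mtanh_sum y = (\<Sum>n. mangoldt_coeff n * tanh (y / real (Suc n)))"

lemma mtanh_sum_summable: assumes "y \<ge> 0" shows "summable (\<lambda>n. mangoldt_coeff n * tanh (y / real (Suc n)))"
proof (rule summable_comparison_test'[of "\<lambda>n. y * (\<bar>mangoldt (Suc n)\<bar> * real (Suc n) powr (-1 - 1))"])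
  show "summable (\<lambda>n. y * (\<bar>mangoldt (Suc n)\<bar> * real (Suc n) powr (-1 - 1)))"
    using abs_conv_mangoldt unfolding abs_conv_def by (intro summable_mult) (auto dest: spec[of _ 1])
  fix n
  have p: "real (Suc n) powr (-1 - 1) = 1 / (real (Suc n) * real (Suc n))"
    using powr_realpow[of "real (Suc n)" 2] by (simp add: powr_minus_divide power2_eq_square del: of_nat_Suc)
  have "norm (mangoldt_coeff n * tanh (y / real (Suc n))) \<le> mangoldt_coeff n * (y / real (Suc n))"
  proof -
    have t: "0 \<le> tanh (y / real (Suc n))" "tanh (y / real (Suc n)) \<le> y / real (Suc n)"
      using tanh_le_self[of "y / real (Suc n)"] assms by auto
    have "norm (mangoldt_coeff n * tanh (y / real (Suc n))) = mangoldt_coeff n * tanh (y / real (Suc n))"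
      unfolding real_norm_def using t(1) mangoldt_coeff_nonneg[of n] by (intro abs_of_nonneg mult_nonneg_nonneg)
    thus ?thesis using mult_left_mono[OF t(2) mangoldt_coeff_nonneg[of n]] by simp
  qed
  also have "\<dots> = y * (\<bar>mangoldt (Suc n)\<bar> * real (Suc n) powr (-1 - 1))"
    unfolding p by (simp add: mangoldt_coeff_def del: of_nat_Suc)
  finally show "norm (mangoldt_coeff n * tanh (y / real (Suc n))) \<le> y * (\<bar>mangoldt (Suc n)\<bar> * real (Suc n) powr (-1 - 1))" .
qed

text \<open>Each indicator of \<open>[ln n, \<infinity>)\<close> integrates against the kernel to
  \<open>tanh (exp v / n)\<close>, so exchanging sum and integral turns an average of the Mertens
  sum into \<open>mtanh_sum\<close>.\<close>

lemma mtanh_sum_eq: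
  "(\<integral>u. mertens_sum u * sech_ker (v - u) \<partial>lborel) = mtanh_sum (exp v)" "integrable lborel (\<lambda>u. mertens_sum u * sech_ker (v - u))"
proof -
  define f where "f n u = mangoldt_coeff n * (indicator {ln (real (Suc n))..} u * sech_ker (v - u))" for n u
  have kv: "integrable lborel (\<lambda>u. sech_ker (v - u))"
    using sech_ker_affine_integrable(1)[of "\<lambda>_. 1" v] tanh_exp_class_integrable[OF tanh_exp_class_sech_ker] by simp
  have fi: "integrable lborel (f n)" for n
    unfolding f_def using integrable_mult_indicator[OF _ kv, of "{ln (real (Suc n))..}"]
    by (intro integrable_mult_right) simp
  have f0: "f n u \<ge> 0" for n u by (simp add: f_def mangoldt_coeff_nonneg sech_ker_nonneg)
  have fe: "(\<integral>u. f n u \<partial>lborel) = mangoldt_coeff n * tanh (exp v / real (Suc n))" for n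
    unfolding f_def integral_mult_right_zero integral_sech_ker_tail by (simp add: exp_diff del: of_nat_Suc)
  have fs: "(\<lambda>n. f n u) sums (mertens_sum u * sech_ker (v - u))" for u
    using sums_mult2[OF mertens_sum_sums[of u], of "sech_ker (v - u)"] by (simp add: f_def mult.assoc)
  have "AE u in lborel. summable (\<lambda>n. norm (f n u))"
    using fs f0 by (auto simp: sums_iff)
  note ae = this
  have sm: "summable (\<lambda>n. \<integral>u. norm (f n u) \<partial>lborel)"
    using mtanh_sum_summable[of "exp v"] f0 fe by simp
  note integral_suminf[OF fi ae sm] integrable_suminf[OF fi ae sm]
  moreover have "(\<lambda>u. \<Sum>n. f n u) = (\<lambda>u. mertens_sum u * sech_ker (v - u))" using fs by (auto simp: sums_iff)
  ultimately show "(\<integral>u. mertens_sum u * sech_ker (v - u) \<partial>lborel) = mtanh_sum (exp v)" "integrable lborel (\<lambda>u. mertens_sum u * sech_ker (v - u))"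
    using fe by (simp_all add: mtanh_sum_def)
qed

lemma mertens_sum_neg: "u < 0 \<Longrightarrow> mertens_sum u = 0"
proof -
  assume "u < 0"
  hence "exp u < 1" by simp
  hence "nat \<lfloor>exp u\<rfloor> = 0" by (simp add: floor_less_iff)
  thus ?thesis by (simp add: mertens_sum_def)
qed

text \<open>Split \<open>mertens_sum u\<close> into \<open>u - euler_mascheroni\<close> and the
  remainder. The linear part averages to \<open>v - euler_mascheroni + A0\<close> because the kernel
  has mass 1 and first moment \<open>- A0\<close>. In \<open>v\<close> times the average of the
  remainder, write \<open>v = u + (v - u)\<close>: the part with \<open>u\<close> is the bounded
  average, the part with \<open>v - u\<close> is controlled by the absolute first moment. Hence
  \<open>v\<close> times the error is bounded.\<close>

lemma mtanh_sum_asymp: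
  obtains C where "C \<ge> 0" "\<And>y. y > 1 \<Longrightarrow> \<bar>mtanh_sum y - (ln y - euler_mascheroni + A0)\<bar> \<le> C / ln y"
proof -
  obtain B where B: "\<And>v. \<bar>\<integral>u. indicator {0..} u * (u * mertens_rem u) * sech_ker (v - u) \<partial>lborel\<bar> \<le> B"
    using u_mertens_rem_sech_ker_bound by blast
  have B0: "B \<ge> 0" using order_trans[OF abs_ge_zero B] by blast
  define g where "g = \<bar>euler_mascheroni :: real\<bar>"
  define D where "D = (\<integral>z. ((2 * \<bar>z\<bar> + g) * \<bar>z\<bar>) * sech_ker z \<partial>lborel)"
  have Di: "integrable lborel (\<lambda>z. ((2 * \<bar>z\<bar> + g) * \<bar>z\<bar>) * sech_ker z)"
  proof -
    have eq: "(\<lambda>z. ((2 * \<bar>z\<bar> + g) * \<bar>z\<bar>) * sech_ker z) = (\<lambda>z. 2 * (\<bar>z\<bar> ^ 2 * sech_ker z) + g * (\<bar>z\<bar> ^ 1 * sech_ker z))"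
      by (rule ext) (simp add: distrib_right power2_eq_square del: power2_abs)
    show ?thesis unfolding eq by (intro Bochner_Integration.integrable_add integrable_mult_right sech_ker_abs_moment)
  qed
  have D0: "D \<ge> 0" unfolding D_def by (intro integral_nonneg_AE AE_I2) (simp add: sech_ker_nonneg g_def)
  have KB0: "sech_ker_const \<ge> 0" unfolding sech_ker_const_def by (intro integral_nonneg_AE AE_I2) (simp add: sech_ker_nonneg)
  have rB0: "mertens_rem_const \<ge> 0" by (simp add: mertens_rem_const_def)
  define C where "C = B + mertens_rem_const * sech_ker_const + D"
  have main: "\<bar>mtanh_sum (exp v) - (v - euler_mascheroni + A0)\<bar> \<le> C / v" if v: "v > 0" for v
  proof -
    have kv: "integrable lborel (\<lambda>u. sech_ker (v - u))"
      using sech_ker_affine_integrable(1)[of "\<lambda>_. 1" v] tanh_exp_class_integrable[OF tanh_exp_class_sech_ker] by simp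
    define L where "L u = (u - euler_mascheroni) * sech_ker (v - u)" for u
    have zL: "integrable lborel (\<lambda>z. (v - z - euler_mascheroni) * sech_ker z)"
    proof -
      have eq: "(\<lambda>z. (v - z - euler_mascheroni) * sech_ker z) = (\<lambda>z. (v - euler_mascheroni) * sech_ker z - z ^ 1 * sech_ker z)"
        by (rule ext) (simp add: algebra_simps)
      show ?thesis unfolding eq
        by (intro Bochner_Integration.integrable_diff integrable_mult_right sech_ker_moment tanh_exp_class_integrable tanh_exp_class_sech_ker)
    qed
    have L: "integrable lborel L" and Le: "integral\<^sup>L lborel L = v - euler_mascheroni + A0"
    proof -
      show "integrable lborel L"
        using sech_ker_affine_integrable(1)[OF zL, of v] unfolding L_def[abs_def] by simp
      have "integral\<^sup>L lborel L = (\<integral>z. (v - z - euler_mascheroni) * sech_ker z \<partial>lborel)"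
        using sech_ker_affine_integrable(2)[OF zL, of v] unfolding L_def[abs_def] by simp
      also have "\<dots> = (\<integral>z. (v - euler_mascheroni) * sech_ker z - z * sech_ker z \<partial>lborel)" by (simp add: algebra_simps)
      also have "\<dots> = (v - euler_mascheroni) * 1 - (- A0)"
        using integrable_mult_right[OF tanh_exp_class_integrable[OF tanh_exp_class_sech_ker], of "v - euler_mascheroni"] sech_ker_moment[of 1]
        by (simp add: integral_z_sech_ker integral_sech_ker)
      finally show "integral\<^sup>L lborel L = v - euler_mascheroni + A0" by simp
    qed
    \<comment> \<open>On \<open>u < 0\<close> the Mertens sum is 0 while the linear part is not;
      \<open>Q\<close> collects this discrepancy and \<open>R\<close> the true remainder on
      \<open>u >= 0\<close>.\<close>
    define R where "R u = indicator {0..} u * mertens_rem u * sech_ker (v - u)" for u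
    define Q where "Q u = indicator {..<0} u * L u" for u
    have Q: "integrable lborel Q"
      unfolding Q_def[abs_def] using integrable_mult_indicator[OF _ L, of "{..<0}"] by simp
    have split: "mertens_sum u * sech_ker (v - u) - L u = R u - Q u" for u
      by (cases "u \<ge> 0") (auto simp: R_def Q_def L_def mertens_rem_def mertens_sum_neg algebra_simps)
    have Ri: "integrable lborel R"
    proof -
      have "integrable lborel (\<lambda>u. (mertens_sum u * sech_ker (v - u) - L u) + Q u)"
        by (intro Bochner_Integration.integrable_add Bochner_Integration.integrable_diff mtanh_sum_eq(2) L Q)
      moreover have "(\<lambda>u. (mertens_sum u * sech_ker (v - u) - L u) + Q u) = R" using split by (auto simp: fun_eq_iff)
      ultimately show ?thesis by simp
    qed
    have eq: "mtanh_sum (exp v) - (v - euler_mascheroni + A0) = integral\<^sup>L lborel R - integral\<^sup>L lborel Q"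
    proof -
      have "mtanh_sum (exp v) - (v - euler_mascheroni + A0) = (\<integral>u. mertens_sum u * sech_ker (v - u) - L u \<partial>lborel)"
        using mtanh_sum_eq[of v] L Le by simp
      also have "\<dots> = integral\<^sup>L lborel R - integral\<^sup>L lborel Q" unfolding split using Ri Q by simp
      finally show ?thesis .
    qed
    have vR: "v * \<bar>integral\<^sup>L lborel R\<bar> \<le> B + mertens_rem_const * sech_ker_const"
    proof -
      define S where "S u = R u * (v - u)" for u
      have Ki: "integrable lborel (\<lambda>u. mertens_rem_const * (\<bar>v - u\<bar> * sech_ker (v - u)))"
        using sech_ker_affine_integrable(1)[of "\<lambda>z. \<bar>z\<bar>" v] sech_ker_abs_moment[of 1] by (intro integrable_mult_right) simp
      have Sb: "\<bar>S u\<bar> \<le> mertens_rem_const * (\<bar>v - u\<bar> * sech_ker (v - u))" for u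
      proof (cases "u \<ge> 0")
        case True
        have "\<bar>mertens_rem u\<bar> * (\<bar>v - u\<bar> * sech_ker (v - u)) \<le> mertens_rem_const * (\<bar>v - u\<bar> * sech_ker (v - u))"
          using mertens_rem_bound[OF True] sech_ker_nonneg by (intro mult_right_mono) auto
        thus ?thesis using True sech_ker_nonneg[of "v - u"] by (simp add: S_def R_def abs_mult mult_ac)
      qed (use rB0 sech_ker_nonneg in \<open>simp add: S_def R_def\<close>)
      have [measurable]: "R \<in> borel_measurable borel" using Ri by auto
      have Si: "integrable lborel S"
        unfolding S_def[abs_def]
        by (rule Bochner_Integration.integrable_bound[OF Ki]) (use Sb in \<open>auto simp: S_def intro!: AE_I2 order_trans[OF _ abs_ge_self]\<close>)
      have "v * integral\<^sup>L lborel R = (\<integral>u. indicator {0..} u * (u * mertens_rem u) * sech_ker (v - u) + S u \<partial>lborel)"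
        unfolding integral_mult_right_zero[symmetric]
        by (intro Bochner_Integration.integral_cong refl) (simp add: S_def R_def algebra_simps)
      also have "\<dots> = (\<integral>u. indicator {0..} u * (u * mertens_rem u) * sech_ker (v - u) \<partial>lborel) + integral\<^sup>L lborel S"
        by (rule Bochner_Integration.integral_add[OF integrable_u_mertens_rem_sech_ker Si])
      finally have e: "v * integral\<^sup>L lborel R = \<dots>" .
      have "\<bar>integral\<^sup>L lborel S\<bar> \<le> (\<integral>u. \<bar>S u\<bar> \<partial>lborel)" by (rule integral_abs_bound)
      also have "\<dots> \<le> (\<integral>u. mertens_rem_const * (\<bar>v - u\<bar> * sech_ker (v - u)) \<partial>lborel)"
        by (intro integral_mono integrable_abs Si Ki Sb)
      also have "\<dots> = mertens_rem_const * sech_ker_const"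
        using sech_ker_affine_integrable(2)[of "\<lambda>z. \<bar>z\<bar>" v] sech_ker_abs_moment[of 1] by (simp add: sech_ker_const_def)
      finally have "\<bar>v * integral\<^sup>L lborel R\<bar> \<le> B + mertens_rem_const * sech_ker_const" unfolding e using B[of v] by linarith
      thus ?thesis using v by (simp add: abs_mult)
    qed
    have vQ: "v * \<bar>integral\<^sup>L lborel Q\<bar> \<le> D"
    proof -
      have Dv: "integrable lborel (\<lambda>u. ((2 * \<bar>v - u\<bar> + g) * \<bar>v - u\<bar>) * sech_ker (v - u))"
        using sech_ker_affine_integrable(1)[OF Di] .
      \<comment> \<open>For \<open>u < 0 < v\<close> the distance from \<open>u\<close> to
        \<open>v\<close> exceeds both \<open>v\<close> and the modulus of \<open>u\<close>, so first
        and second absolute moments of the kernel control \<open>v * Q\<close>.\<close>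
      have Qb: "\<bar>v * Q u\<bar> \<le> ((2 * \<bar>v - u\<bar> + g) * \<bar>v - u\<bar>) * sech_ker (v - u)" for u
      proof (cases "u < 0")
        case True
        have "v * \<bar>u - euler_mascheroni\<bar> \<le> \<bar>v - u\<bar> * (2 * \<bar>v - u\<bar> + g)"
        proof (rule mult_mono)
          have "\<bar>u - euler_mascheroni\<bar> \<le> - u + g"
            using True abs_triangle_ineq4[of u "euler_mascheroni"] by (simp add: g_def)
          thus "\<bar>u - euler_mascheroni\<bar> \<le> 2 * \<bar>v - u\<bar> + g" using True v by simp
        qed (use True v in auto)
        hence "v * \<bar>u - euler_mascheroni\<bar> * sech_ker (v - u) \<le> \<bar>v - u\<bar> * (2 * \<bar>v - u\<bar> + g) * sech_ker (v - u)"
          using sech_ker_nonneg by (rule mult_right_mono)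
        thus ?thesis using True v sech_ker_nonneg[of "v - u"] by (simp add: Q_def L_def abs_mult mult_ac)
      qed (use sech_ker_nonneg in \<open>simp add: Q_def g_def\<close>)
      have Qi: "integrable lborel (\<lambda>u. \<bar>v * Q u\<bar>)" by (rule integrable_abs[OF integrable_mult_right[OF Q]])
      have "(\<integral>u. \<bar>v * Q u\<bar> \<partial>lborel) \<le> (\<integral>u. ((2 * \<bar>v - u\<bar> + g) * \<bar>v - u\<bar>) * sech_ker (v - u) \<partial>lborel)"
        by (rule integral_mono[OF Qi Dv Qb])
      also have "\<dots> = D" unfolding D_def using sech_ker_affine_integrable(2)[OF Di] .
      finally have "\<bar>\<integral>u. v * Q u \<partial>lborel\<bar> \<le> D" using integral_abs_bound[of lborel "\<lambda>u. v * Q u"] by linarith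
      thus ?thesis using v by (simp add: abs_mult)
    qed
    have "v * \<bar>mtanh_sum (exp v) - (v - euler_mascheroni + A0)\<bar> \<le> v * (\<bar>integral\<^sup>L lborel R\<bar> + \<bar>integral\<^sup>L lborel Q\<bar>)"
      unfolding eq by (rule mult_left_mono[OF abs_triangle_ineq4]) (use v in simp)
    also have "\<dots> \<le> C" using vR vQ by (simp add: C_def distrib_left)
    finally show ?thesis using v by (simp add: field_simps)
  qed
  have "\<bar>mtanh_sum y - (ln y - euler_mascheroni + A0)\<bar> \<le> C / ln y" if "y > 1" for y
    using main[of "ln y"] that by simp
  moreover have "C \<ge> 0" using B0 KB0 rB0 D0 by (simp add: C_def)
  ultimately show ?thesis using that by blast
qed

section \<open>From prime powers to primes\<close>

lemma summable_abs_conv: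
  assumes "abs_conv a" "\<sigma> > 0"
  shows "summable (\<lambda>n. \<bar>a n\<bar> * real n powr (-1 - \<sigma>))"
proof -
  have "summable (\<lambda>n. \<bar>a (Suc n)\<bar> * real (Suc n) powr (-1 - \<sigma>))" using assms unfolding abs_conv_def by blast
  thus ?thesis by (subst (asm) summable_Suc_iff[of "\<lambda>n. \<bar>a n\<bar> * real n powr (-1 - \<sigma>)"])
qed

lemma ln_nat_nonneg: "ln (real n) \<ge> 0"
  by (cases n) auto

lemma summable_ln_powr: "\<sigma> > 0 \<Longrightarrow> summable (\<lambda>n. ln (real n) * real n powr (-1 - \<sigma>))"
  using summable_abs_conv[OF abs_conv_ln1, of \<sigma>] by (simp add: ln_nat_nonneg)

lemma summable_ln2_powr: "\<sigma> > 0 \<Longrightarrow> summable (\<lambda>n. ln (real n) * ln (real n) * real n powr (-1 - \<sigma>))"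
  using summable_abs_conv[OF abs_conv_ln[OF abs_conv_ln1], of \<sigma>] by (simp add: ln_nat_nonneg)

definition prime_power_part :: "nat \<Rightarrow> real" where
  "prime_power_part n = mangoldt n - (if prime n then ln (real n) else 0)"

lemma prime_power_part_nonneg: "prime_power_part n \<ge> 0"
  by (simp add: prime_power_part_def mangoldt_nonneg)

text \<open>The contribution of the powers \<open>p^k\<close> with \<open>k >= 2\<close> to the
  series of \<open>mangoldt n * n powr (-s)\<close>, in the form of a summed geometric
  series.\<close>

definition prime_power_term :: "real \<Rightarrow> nat \<Rightarrow> real" where
  "prime_power_term s p = (if prime p then ln (real p) * (real p powr (-s)) ^ 2 / (1 - real p powr (-s)) else 0)"

lemma powr_neg_prime_lt_1: "prime p \<Longrightarrow> s > 0 \<Longrightarrow> real p powr (-s) \<le> 2 powr (-s) \<and> 2 powr (-s) < (1::real)"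
proof
  assume p: "prime p" "s > 0"
  hence "real p \<ge> 2" using prime_ge_2_nat by simp
  thus "real p powr (-s) \<le> 2 powr (-s)" using p by (intro powr_mono2') auto
  show "2 powr (-s) < (1::real)" using p by (simp add: powr_less_one)
qed

lemma prime_power_term_summable:
  assumes s: "s > 1/2"
  shows "summable (prime_power_term s)" "prime_power_term s p \<ge> 0"
proof -
  let ?d = "1 - 2 powr (-s)"
  have b: "norm (prime_power_term s p) \<le> (1 / ?d) * (ln (real p) * real p powr (-1 - (2 * s - 1)))" and nn: "prime_power_term s p \<ge> 0" for p
  proof -
    show "prime_power_term s p \<ge> 0"
      using powr_neg_prime_lt_1[of p s] s ln_nat_nonneg[of p] by (auto simp: prime_power_term_def intro!: divide_nonneg_nonneg)
    moreover have "prime_power_term s p \<le> (1 / ?d) * (ln (real p) * real p powr (-1 - (2 * s - 1)))"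
    proof (cases "prime p")
      case True
      have e: "(real p powr (-s)) ^ 2 = real p powr (-1 - (2 * s - 1))"
        by (simp add: power2_eq_square flip: powr_add)
      have "prime_power_term s p \<le> ln (real p) * (real p powr (-s)) ^ 2 / ?d"
        using powr_neg_prime_lt_1[of p s] True s ln_nat_nonneg[of p] unfolding prime_power_term_def
        by (auto intro!: divide_left_mono mult_pos_pos)
      thus ?thesis unfolding e by simp
    qed (use s powr_neg_prime_lt_1[of 2 s] ln_nat_nonneg[of p] in \<open>simp add: prime_power_term_def\<close>)
    ultimately show "norm (prime_power_term s p) \<le> (1 / ?d) * (ln (real p) * real p powr (-1 - (2 * s - 1)))" by simp
  qed
  show "prime_power_term s p \<ge> 0" by (rule nn)
  have "summable (\<lambda>p. (1 / ?d) * (ln (real p) * real p powr (-1 - (2 * s - 1))))"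
    using s by (intro summable_mult summable_ln_powr) auto
  thus "summable (prime_power_term s)" by (rule summable_comparison_test') (use b in auto)
qed

text \<open>Proper prime powers are enumerated without repetition by \<open>(p, k)\<close> through
  \<open>p ^ (k + 2)\<close>, and the sum over \<open>k\<close> is geometric. The abscissa 1/2 is
  that of the squares of primes.\<close>

lemma prime_power_part_sums:
  assumes s: "s > 1/2"
  shows "(\<lambda>n. prime_power_part n * real n powr (-s)) sums (\<Sum>p. prime_power_term s p)"
proof -
  let ?Q = "{p::nat. prime p}"
  let ?f = "\<lambda>(p,k). ln (real p) * (real p powr (-s)) ^ (k + 2)"
  let ?h = "\<lambda>(p,k). p ^ Suc (Suc k)"
  have inner: "((\<lambda>k. ?f (p, k)) has_sum prime_power_term s p) UNIV" if "p \<in> ?Q" for p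
  proof -
    define x where "x = real p powr (-s)"
    have x: "0 \<le> x" "x < 1" using powr_neg_prime_lt_1[of p s] that s by (auto simp: x_def)
    have "(\<lambda>k. ln (real p) * x ^ 2 * x ^ k) sums (ln (real p) * x ^ 2 * (1 / (1 - x)))"
      using x by (intro sums_mult geometric_sums) auto
    hence "(\<lambda>k. ln (real p) * x ^ (k + 2)) sums prime_power_term s p"
      using that by (simp add: prime_power_term_def x_def power_add mult_ac power2_eq_square)
    moreover have "summable (\<lambda>k. norm (ln (real p) * x ^ (k + 2)))"
      using calculation x ln_nat_nonneg[of p] by (simp add: sums_iff)
    ultimately show ?thesis unfolding x_def by (simp add: norm_summable_imp_has_sum)
  qed
  have outer: "((\<lambda>p. prime_power_term s p) has_sum (\<Sum>p. prime_power_term s p)) ?Q"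
  proof -
    have "((\<lambda>p. prime_power_term s p) has_sum (\<Sum>p. prime_power_term s p)) UNIV"
      using prime_power_term_summable[OF s] by (intro norm_summable_imp_has_sum) (auto simp: summable_sums)
    thus ?thesis by (rule has_sum_cong_neutral[THEN iffD1, rotated -1]) (auto simp: prime_power_term_def)
  qed
  have "?f summable_on (?Q \<times> (UNIV :: nat set))"
    by (rule summable_on_SigmaI[OF inner])
       (use outer ln_nat_nonneg in \<open>auto simp: has_sum_imp_summable intro!: mult_nonneg_nonneg\<close>)
  hence fs: "(?f has_sum (\<Sum>p. prime_power_term s p)) (?Q \<times> (UNIV :: nat set))"
    by (intro has_sum_SigmaI[OF inner outer])
  have inj: "inj_on ?h (?Q \<times> (UNIV :: nat set))"
  proof (rule inj_onI)
    fix x y assume xy: "x \<in> ?Q \<times> (UNIV :: nat set)" "y \<in> ?Q \<times> (UNIV :: nat set)" "?h x = ?h y"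
    obtain p k q l where e: "x = (p, k)" "y = (q, l)" by (cases x; cases y)
    have pq: "prime p" "prime q" "p ^ Suc (Suc k) = q ^ Suc (Suc l)" using xy by (auto simp: e)
    have "p = q" using pq by (metis aprimedivisor_prime_power zero_less_Suc)
    moreover have "p > 1" using pq prime_gt_1_nat by blast
    ultimately show "x = y" using pq(3) power_inject_exp[of p "Suc (Suc k)" "Suc (Suc l)"] by (auto simp: e simp del: power_Suc)
  qed
  have "((\<lambda>n. prime_power_part n * real n powr (-s)) \<circ> ?h has_sum (\<Sum>p. prime_power_term s p)) (?Q \<times> (UNIV :: nat set))"
  proof (rule has_sum_cong[THEN iffD2, OF _ fs])
    fix x assume "x \<in> ?Q \<times> (UNIV :: nat set)"
    then obtain p k where x: "x = (p, k)" "prime p" by auto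
    have np: "\<not> prime (p ^ Suc (Suc k))" using prime_power_iff[of p "Suc (Suc k)"] by auto
    have "real (p ^ Suc (Suc k)) powr (-s) = (real p powr (-s)) ^ (k + 2)"
      using prime_gt_0_nat[OF x(2)]
      by (simp add: powr_realpow[symmetric] powr_powr mult.commute del: power_Suc of_nat_Suc)
    moreover have "prime_power_part (p ^ Suc (Suc k)) = ln (real p)"
      using np mangoldt_primepow'[OF x(2), of "Suc (Suc k)", where ?'a = real] by (simp add: prime_power_part_def del: power_Suc)
    ultimately show "((\<lambda>n. prime_power_part n * real n powr (-s)) \<circ> ?h) x = ?f x" by (simp add: x(1) del: power_Suc)
  qed
  hence "((\<lambda>n. prime_power_part n * real n powr (-s)) has_sum (\<Sum>p. prime_power_term s p)) (?h ` (?Q \<times> (UNIV :: nat set)))"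
    using has_sum_reindex[OF inj] by blast
  hence "((\<lambda>n. prime_power_part n * real n powr (-s)) has_sum (\<Sum>p. prime_power_term s p)) UNIV"
  proof (rule has_sum_cong_neutral[THEN iffD1, rotated -1])
    fix n assume n: "n \<in> UNIV - ?h ` (?Q \<times> (UNIV :: nat set))"
    have "prime_power_part n = 0"
    proof (cases "primepow n")
      case True
      then obtain p k where pk: "prime p" "k > 0" "n = p ^ k" by (auto simp: primepow_def)
      have "k = 1"
      proof (rule ccontr)
        assume "k \<noteq> 1"
        then obtain j where "k = Suc (Suc j)" using pk(2) by (metis One_nat_def gr0_implies_Suc not0_implies_Suc)
        thus False using n pk by auto
      qed
      thus ?thesis using pk by (simp add: prime_power_part_def)
    next
      case False
      moreover have "\<not> prime n" using False primepow_prime by blast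
      ultimately show ?thesis by (simp add: prime_power_part_def mangoldt_def)
    qed
    thus "prime_power_part n * real n powr (-s) = 0" by simp
  qed auto
  thus ?thesis by (rule has_sum_imp_sums)
qed

lemma dseries_of_real:
  assumes "abs_conv a" "x > 0"
  shows "dseries a (of_real x) = of_real (\<Sum>n. a (Suc n) * real (Suc n) powr (-1 - x))"
proof -
  have "(\<lambda>n. of_real (a (Suc n)) * of_nat (Suc n) powr (-1 - of_real x)) sums dseries a (of_real x)"
    by (rule dseries_sums) (use assms in auto)
  moreover have "of_real (a (Suc n)) * of_nat (Suc n) powr (-1 - of_real x) = (of_real (a (Suc n) * real (Suc n) powr (-1 - x)) :: complex)" for n
    using powr_of_real[of "real (Suc n)" "-1 - x"] by (simp del: of_nat_Suc)
  ultimately have "(\<lambda>n. of_real (a (Suc n) * real (Suc n) powr (-1 - x)) :: complex) sums dseries a (of_real x)" by (simp only:)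
  moreover have "summable (\<lambda>n. a (Suc n) * real (Suc n) powr (-1 - x))"
    by (rule summable_comparison_test'[of "\<lambda>n. \<bar>a (Suc n)\<bar> * real (Suc n) powr (-1 - x)"])
       (use assms in \<open>auto simp: abs_conv_def abs_mult\<close>)
  ultimately show ?thesis using sums_of_real[OF summable_sums] sums_unique2 by blast
qed

lemma zeta_eq_dseries: "x > 1 \<Longrightarrow> zeta x = Re (dseries (\<lambda>_. 1) (of_real (x - 1)))"
  by (subst dseries_of_real[OF abs_conv_1]) (auto simp: zeta_def powr_minus_divide simp del: of_nat_Suc)

lemma zeta_logderiv_2: "deriv zeta 2 / zeta 2 = - (\<Sum>n. mangoldt (Suc n) * real (Suc n) powr (-2))"
proof -
  define D where "D = (\<Sum>n. ln (real (Suc n)) * real (Suc n) powr (-1 - 1))"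
  define L where "L = (\<Sum>n. mangoldt (Suc n) * real (Suc n) powr (-1 - 1))"
  have one: "dseries a 1 = of_real (\<Sum>n. a (Suc n) * real (Suc n) powr (-1 - 1))" if "abs_conv a" for a
    using dseries_of_real[OF that, of 1] by simp
  have z2: "of_real (zeta 2) = dseries (\<lambda>_. 1) 1"
    using zeta_eq_dseries[of 2] one[OF abs_conv_1] by simp
  have "((\<lambda>x. of_real (x - 1) :: complex) has_vector_derivative 1) (at (2::real))"
    by (auto intro!: derivative_eq_intros)
  moreover have "(dseries (\<lambda>_. 1) has_field_derivative - dseries (\<lambda>n. ln (real n)) 1) (at (of_real (2 - 1)))"
    using dseries_has_field_derivative[OF abs_conv_1, of 1] by simp
  ultimately have "(dseries (\<lambda>_. 1) \<circ> (\<lambda>x. of_real (x - 1)) has_vector_derivative (1 * - dseries (\<lambda>n. ln (real n)) 1)) (at (2::real))"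
    by (rule field_vector_diff_chain_at)
  from bounded_linear.has_vector_derivative[OF bounded_linear_Re this]
  have "((\<lambda>x. Re (dseries (\<lambda>_. 1) (of_real (x - 1)))) has_real_derivative - D) (at 2)"
    by (simp add: o_def has_real_derivative_iff_has_vector_derivative one[OF abs_conv_ln1] D_def del: of_nat_Suc)
  hence "(zeta has_real_derivative - D) (at 2)"
    by (rule has_field_derivative_transform_within_open[of _ _ _ "{1<..}"]) (auto simp: zeta_eq_dseries)
  hence "deriv zeta 2 = - D" by (rule DERIV_imp_deriv)
  moreover have "L * zeta 2 = D"
  proof -
    have "complex_of_real (L * zeta 2) = of_real D"
      using dseries_mult_mangoldt[of 1] by (simp add: z2 one[OF abs_conv_mangoldt] one[OF abs_conv_ln1] L_def D_def del: of_nat_Suc)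
    thus ?thesis by (simp only: of_real_eq_iff)
  qed
  moreover have "zeta 2 \<noteq> 0"
    using z2 zeta_eq_exp[of 1] by auto
  ultimately have "deriv zeta 2 / zeta 2 = - L" by (simp add: field_simps)
  thus ?thesis by (simp add: L_def)
qed

lemma zeta_logderiv_2_primes:
  "deriv zeta 2 / zeta 2 = - (\<Sum>p. if prime p then ln (real p) / (real p ^ 2 - 1) else 0)"
  "summable (\<lambda>p. if prime p then ln (real p) / (real p ^ 2 - 1) else 0)"
proof -
  let ?g = "\<lambda>p. if prime p then ln (real p) * real p powr (-2) else 0"
  have 1: "summable (\<lambda>n. ln (real n) * real n powr (-2))" using summable_ln_powr[of 1] by simp
  have g: "summable ?g"
    by (rule summable_comparison_test'[OF 1]) (auto simp: ln_nat_nonneg)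
  have "(\<lambda>n. prime_power_part n * real n powr (-2) + ?g n) sums ((\<Sum>p. prime_power_term 2 p) + (\<Sum>p. ?g p))"
    by (intro sums_add prime_power_part_sums summable_sums g) simp
  moreover have "prime_power_part n * real n powr (-2) + ?g n = mangoldt n * real n powr (-2)" for n
    by (simp add: prime_power_part_def algebra_simps)
  moreover have "(\<Sum>p. prime_power_term 2 p) + (\<Sum>p. ?g p) = (\<Sum>p. prime_power_term 2 p + ?g p)"
    using suminf_add[OF prime_power_term_summable(1) g, of 2] by simp
  moreover have eq: "prime_power_term 2 p + ?g p = (if prime p then ln (real p) / (real p ^ 2 - 1) else 0)" for p
  \<comment> \<open>With \<open>N = p^2\<close> this is
    \<open>1 / N + 1 / (N^2 * (1 - 1 / N)) = 1 / (N - 1)\<close>, multiplied by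
    \<open>ln p\<close>.\<close>
  proof (cases "prime p")
    case True
    hence p: "real p > 1" using prime_gt_1_nat by auto
    have x: "real p powr (-2) = 1 / real p ^ 2" using p by (simp add: powr_minus_divide)
    have "real p ^ 2 > 1" using p by simp
    hence "real p ^ 2 - 1 \<noteq> 0" "real p ^ 2 \<noteq> 0" by linarith+
    moreover define N where "N = real p ^ 2"
    ultimately show ?thesis using True unfolding prime_power_term_def x N_def[symmetric]
      by (simp add: field_simps power2_eq_square)
  qed (simp add: prime_power_term_def)
  ultimately have "(\<lambda>n. mangoldt n * real n powr (-2)) sums (\<Sum>p. if prime p then ln (real p) / (real p ^ 2 - 1) else 0)" by simp
  hence "(\<lambda>n. mangoldt (Suc n) * real (Suc n) powr (-2)) sums (\<Sum>p. if prime p then ln (real p) / (real p ^ 2 - 1) else 0)"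
    by (subst sums_Suc_iff) simp
  thus "deriv zeta 2 / zeta 2 = - (\<Sum>p. if prime p then ln (real p) / (real p ^ 2 - 1) else 0)"
    unfolding zeta_logderiv_2 by (simp add: sums_iff)
  show "summable (\<lambda>p. if prime p then ln (real p) / (real p ^ 2 - 1) else 0)"
    using summable_add[OF prime_power_term_summable(1) g, of 2] eq by simp
qed

text \<open>On proper prime powers tanh may be replaced by 1 up to a small error, so completing the
  sum over primes costs just the constant given by \<open>prime_power_term 1\<close>. The error uses
  \<open>1 - tanh x <= 2 * x powr (-1/4)\<close>; the exponent 1/4 is small enough to leave the
  abscissa 3/4, which exceeds 1/2.\<close>

lemma mtanh_sum_primes:
  assumes y: "y > 0"
  shows "summable (\<lambda>p. if prime p then ln (real p) / real p * tanh (y / real p) else 0)"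
    and "\<bar>(\<Sum>p. if prime p then ln (real p) / real p * tanh (y / real p) else 0) - (mtanh_sum y - (\<Sum>p. prime_power_term 1 p))\<bar>
       \<le> 2 * y powr (-1/4) * (\<Sum>p. prime_power_term (3/4) p)"
proof -
  let ?f = "\<lambda>p. if prime p then ln (real p) / real p * tanh (y / real p) else 0"
  have T: "(\<lambda>n. mangoldt n / real n * tanh (y / real n)) sums mtanh_sum y"
  proof -
    have "(\<lambda>n. mangoldt_coeff n * tanh (y / real (Suc n))) sums mtanh_sum y"
      unfolding mtanh_sum_def by (rule summable_sums[OF mtanh_sum_summable]) (use y in simp)
    thus ?thesis unfolding mangoldt_coeff_def by (subst (asm) sums_Suc_iff[of "\<lambda>n. mangoldt n / real n * tanh (y / real n)"]) simp
  qed
  have p1: "real n powr (-1) = 1 / real n" for n by (cases "n = 0") (auto simp: powr_minus_divide)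
  have t01: "0 \<le> tanh (y / real n)" "tanh (y / real n) \<le> 1" for n
    using tanh_le_self[of "y / real n"] tanh_real_lt_1[of "y / real n"] y by auto
  have one: "(\<lambda>n. prime_power_part n * real n powr (-1)) sums (\<Sum>p. prime_power_term 1 p)" by (rule prime_power_part_sums) simp
  have c: "summable (\<lambda>n. prime_power_part n / real n * tanh (y / real n))"
  proof (rule summable_comparison_test'[OF sums_summable[OF one]])
    fix n show "norm (prime_power_part n / real n * tanh (y / real n)) \<le> prime_power_part n * real n powr (-1)"
      unfolding p1 using t01[of n] prime_power_part_nonneg[of n] by (simp add: abs_mult mult_left_le divide_right_mono)
  qed
  have split: "?f n = mangoldt n / real n * tanh (y / real n) - prime_power_part n / real n * tanh (y / real n)" for n
    by (simp add: prime_power_part_def diff_divide_distrib left_diff_distrib)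
  have fs: "?f sums (mtanh_sum y - (\<Sum>n. prime_power_part n / real n * tanh (y / real n)))"
    unfolding split by (intro sums_diff T summable_sums c)
  thus "summable ?f" by (rule sums_summable)
  have d: "(\<lambda>n. prime_power_part n / real n * (1 - tanh (y / real n))) sums ((\<Sum>p. prime_power_term 1 p) - (\<Sum>n. prime_power_part n / real n * tanh (y / real n)))"
    using sums_diff[OF one summable_sums[OF c]] by (simp add: p1 right_diff_distrib)
  have b: "prime_power_part n / real n * (1 - tanh (y / real n)) \<le> 2 * y powr (-1/4) * (prime_power_part n * real n powr (- (3/4)))" for n
  proof (cases "n = 0")
    case False
    define x where "x = y / real n"
    have x: "x > 0" using False y by (simp add: x_def)
    have "1 - tanh x \<le> 2 * exp (- 2 * x)" by (rule one_minus_tanh_le)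
    also have "exp (- 2 * x) \<le> x powr (- (1/4))"
    proof -
      have "ln x \<le> 8 * x" using ln_le_minus_one[OF x] x by linarith
      hence "- 2 * x \<le> - (1/4) * ln x" by simp
      thus ?thesis using x by (simp add: powr_def)
    qed
    also have "x powr (- (1/4)) = y powr (-1/4) * real n powr (1/4)"
      using y False unfolding x_def by (simp add: powr_divide powr_minus field_simps)
    finally have "prime_power_part n / real n * (1 - tanh x) \<le> prime_power_part n / real n * (2 * (y powr (-1/4) * real n powr (1/4)))"
      using prime_power_part_nonneg[of n] by (intro mult_left_mono) auto
    also have "real n powr (1/4) = real n * real n powr (- (3/4))"
      using False powr_add[of "real n" 1 "-(3/4)"] by simp
    hence "prime_power_part n / real n * (2 * (y powr (-1/4) * real n powr (1/4))) = 2 * y powr (-1/4) * (prime_power_part n * real n powr (- (3/4)))"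
      using False by simp
    finally show ?thesis by (simp add: x_def)
  qed (simp add: prime_power_part_def)
  have "(\<Sum>p. prime_power_term 1 p) - (\<Sum>n. prime_power_part n / real n * tanh (y / real n)) \<le> 2 * y powr (-1/4) * (\<Sum>p. prime_power_term (3/4) p)"
    by (rule sums_le[OF b d sums_mult[OF prime_power_part_sums]]) simp
  moreover have "0 \<le> (\<Sum>p. prime_power_term 1 p) - (\<Sum>n. prime_power_part n / real n * tanh (y / real n))"
    by (rule sums_le[OF _ sums_zero d]) (use prime_power_part_nonneg t01 in \<open>auto intro!: mult_nonneg_nonneg divide_nonneg_nonneg\<close>)
  moreover have "(\<Sum>p. ?f p) = mtanh_sum y - (\<Sum>n. prime_power_part n / real n * tanh (y / real n))" using fs by (simp add: sums_iff)
  ultimately show "\<bar>(\<Sum>p. ?f p) - (mtanh_sum y - (\<Sum>p. prime_power_term 1 p))\<bar> \<le> 2 * y powr (-1/4) * (\<Sum>p. prime_power_term (3/4) p)" by simp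
qed

section \<open>The logarithm of the moment generating function\<close>

definition val_plus :: "nat \<Rightarrow> real" where "val_plus p = ln (real p) / (real p - 1)"
definition val_minus :: "nat \<Rightarrow> real" where "val_minus p = ln (real p) / (real p + 1)"
definition ln_ratio :: "nat \<Rightarrow> real" where "ln_ratio p = ln (real p) / real p"

text \<open>The two tails of the distribution are treated together: \<open>\<beta> p\<close> and \<open>-\<alpha> p\<close> are the two non-zero
  values of the summand at \<open>p\<close>.\<close>

definition tail_values :: "(nat \<Rightarrow> real) \<Rightarrow> (nat \<Rightarrow> real) \<Rightarrow> bool" where
  "tail_values \<beta> \<alpha> \<longleftrightarrow> (\<beta> = val_plus \<and> \<alpha> = val_minus) \<or> (\<beta> = val_minus \<and> \<alpha> = val_plus)"

lemma ln_prime_ge: "prime p \<Longrightarrow> ln (real p) \<ge> 1/2"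
proof -
  assume "prime p"
  hence "real p \<ge> 2" using prime_ge_2_nat by simp
  hence "ln (real p) \<ge> ln 2" by simp
  moreover have "ln 2 \<ge> (1/2 :: real)" using ln_le_minus_one[of "1/2::real"] by (simp add: ln_div)
  ultimately show ?thesis by linarith
qed

text \<open>What the two assignments share: the positive value is within a factor 2 of
  \<open>ln_ratio\<close>, the sum \<open>\<beta> p + \<alpha> p\<close> is the same for both, and
  sum and difference deviate from \<open>2 * ln_ratio p\<close> and 0 only by order
  \<open>ln p / p^2\<close>.\<close>

lemma tail_values_bounds:
  assumes "tail_values \<beta> \<alpha>" "prime p"
  shows "ln_ratio p / 2 \<le> \<beta> p" "\<beta> p \<le> 2 * ln_ratio p" "\<alpha> p \<le> 2 * ln_ratio p" "0 < \<alpha> p" "0 < \<beta> p" "\<beta> p \<le> 1" "\<alpha> p \<le> 1"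
    "\<beta> p + \<alpha> p = 2 * ln (real p) * real p / (real p ^ 2 - 1)"
    "\<bar>\<beta> p - \<alpha> p\<bar> \<le> 4 * ln (real p) / real p ^ 2" "0 < ln_ratio p"
    "2 * ln_ratio p \<le> \<beta> p + \<alpha> p" "\<beta> p + \<alpha> p - 2 * ln_ratio p \<le> 2 * ln (real p) / real p ^ 2"
proof -
  define P l where "P = real p" and "l = ln P"
  have P: "P \<ge> 2" using prime_ge_2_nat[OF assms(2)] by (simp add: P_def)
  have l: "l \<ge> 1/2" using ln_prime_ge[OF assms(2)] by (simp add: l_def P_def)
  have lP: "l \<le> P - 1" unfolding l_def by (rule ln_le_minus_one) (use P in simp)
  have P2: "P ^ 2 \<ge> 4" using power_mono[OF P, of 2] by simp
  have P21: "P ^ 2 - 1 = (P - 1) * (P + 1)" by (simp add: power2_eq_square algebra_simps)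
  have d: "l / P / 2 \<le> l / (P + 1)" "l / (P + 1) \<le> l / (P - 1)" "l / (P - 1) \<le> 2 * (l / P)" "l / (P - 1) \<le> 1"
    using P l lP by (auto simp: field_simps)
  have pos: "0 < l / (P + 1)" "0 < l / P" using P l by auto
  have s: "l / (P - 1) + l / (P + 1) = 2 * l * P / (P ^ 2 - 1)" "l / (P - 1) - l / (P + 1) = 2 * l / (P ^ 2 - 1)"
    using P unfolding P21 by (auto simp: field_simps)
  have b2: "2 * l / (P ^ 2 - 1) \<le> 4 * l / P ^ 2"
  proof -
    have "2 * l / (P ^ 2 - 1) \<le> 2 * l / (P ^ 2 / 2)"
      using P2 l by (intro divide_left_mono mult_pos_pos) auto
    thus ?thesis by simp
  qed
  define v where "v = 2 * l / (P ^ 2 - 1)"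
  have v0: "v \<ge> 0" unfolding v_def using P2 l by (intro divide_nonneg_nonneg) auto
  note defs = val_plus_def val_minus_def ln_ratio_def P_def[symmetric] l_def[symmetric]
  note tail_values = assms(1)[unfolded tail_values_def]
  show "ln_ratio p / 2 \<le> \<beta> p" "\<beta> p \<le> 2 * ln_ratio p" "\<alpha> p \<le> 2 * ln_ratio p" "0 < \<alpha> p" "0 < \<beta> p" "\<beta> p \<le> 1" "\<alpha> p \<le> 1" "0 < ln_ratio p"
    using tail_values d pos by (auto simp: defs)
  show 1: "\<beta> p + \<alpha> p = 2 * ln (real p) * real p / (real p ^ 2 - 1)"
    using tail_values s(1) by (auto simp: defs add.commute)
  have "\<bar>\<beta> p - \<alpha> p\<bar> = v"
    using tail_values s(2)[folded v_def] v0 abs_minus_commute[of "\<beta> p" "\<alpha> p"] by (auto simp: defs)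
  hence "\<bar>\<beta> p - \<alpha> p\<bar> = 2 * l / (P ^ 2 - 1)" by (simp only: v_def)
  thus "\<bar>\<beta> p - \<alpha> p\<bar> \<le> 4 * ln (real p) / real p ^ 2" using b2 by (simp add: defs)
  have dd: "2 * l * P / (P ^ 2 - 1) - 2 * (l / P) = 2 * l / (P * (P ^ 2 - 1))"
    using P P2 by (simp add: field_simps power2_eq_square)
  have "P ^ 2 \<le> P * (P ^ 2 - 1)"
  proof -
    have "P * P \<le> P * (P ^ 2 - 1)"
    proof (rule mult_left_mono)
      have "P * 2 \<le> P * P" using P by (intro mult_left_mono) auto
      thus "P \<le> P ^ 2 - 1" using P unfolding power2_eq_square by linarith
    qed (use P in simp)
    thus ?thesis by (simp add: power2_eq_square)
  qed
  hence "2 * l / (P * (P ^ 2 - 1)) \<le> 2 * l / P ^ 2"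
    using P P2 l by (intro divide_left_mono mult_pos_pos) auto
  thus "\<beta> p + \<alpha> p - 2 * ln_ratio p \<le> 2 * ln (real p) / real p ^ 2"
    unfolding 1 using dd by (simp add: defs)
  have "0 \<le> 2 * l / (P * (P ^ 2 - 1))" using P P2 l by (intro divide_nonneg_nonneg mult_nonneg_nonneg) auto
  thus "2 * ln_ratio p \<le> \<beta> p + \<alpha> p"
    unfolding 1 using dd by (simp add: defs)
qed

text \<open>The logarithmic derivative of \<open>mgf_factor\<close>. The common weight
  \<open>p / (2 * (p + 1))\<close> of the two nonzero values has been cancelled, which leaves
  \<open>2 / p\<close> for the value 0.\<close>

definition log_mgf_term :: "(nat \<Rightarrow> real) \<Rightarrow> (nat \<Rightarrow> real) \<Rightarrow> nat \<Rightarrow> real \<Rightarrow> real" where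
  "log_mgf_term \<beta> \<alpha> p s = (\<beta> p * exp (s * \<beta> p) - \<alpha> p * exp (- (s * \<alpha> p))) / (exp (s * \<beta> p) + exp (- (s * \<alpha> p)) + 2 / real p)"

text \<open>Mean value theorem: the derivative of \<open>x / (exp (s * x) + 1)\<close> is at most
  \<open>(1 + s * x) * exp (- (s * x))\<close> in modulus, and
  \<open>1 + z <= 2 * exp (z / 2)\<close>.\<close>

lemma logistic_diff:
  fixes s a b :: real
  assumes "s > 0" "0 \<le> a" "a \<le> b"
  shows "\<bar>b / (exp (s * b) + 1) - a / (exp (s * a) + 1)\<bar> \<le> 2 * exp (- (s * a / 2)) * (b - a)"
proof -
  have "\<bar>b / (exp (s * b) + 1) - a / (exp (s * a) + 1)\<bar> \<le> 2 * exp (- (s * a / 2)) * \<bar>b - a\<bar>"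
  proof (rule field_differentiable_bound[of "{a..b}", unfolded real_norm_def])
    fix x assume x: "x \<in> {a..b}"
    define E where "E = exp (s * x)"
    have E: "E \<ge> 1" using x assms by (simp add: E_def)
    show "((\<lambda>x. x / (exp (s * x) + 1)) has_field_derivative ((E + 1) - x * (E * s)) / (E + 1)^2) (at x within {a..b})"
      using E by (auto intro!: derivative_eq_intros simp: E_def[symmetric] power2_eq_square mult_ac)
    have z: "s * x \<ge> 0" using x assms by auto
    have "\<bar>(E + 1) - x * (E * s)\<bar> \<le> (1 + s * x) * (E + 1)"
    proof -
      have "0 \<le> s * x * (2 * E + 1)" "0 \<le> 2 * (E+1) + s * x" using z E by auto
      thus ?thesis unfolding abs_le_iff by (simp add: algebra_simps)
    qed
    hence "\<bar>((E + 1) - x * (E * s)) / (E + 1)^2\<bar> \<le> (1 + s * x) * (E + 1) / (E + 1)^2"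
      using E by (simp add: abs_divide divide_right_mono)
    also have "\<dots> = (1 + s * x) / (E + 1)" using E by (simp add: power2_eq_square)
    also have "\<dots> \<le> (1 + s * x) / E" using E z by (intro divide_left_mono) auto
    also have "\<dots> \<le> 2 * exp (s * x / 2) / E"
    proof -
      define z where "z = s * x"
      have "1 + z / 2 \<le> exp (z / 2)" by (rule exp_ge_add_one_self)
      hence "1 + z \<le> 2 * exp (z / 2)" by argo
      thus ?thesis using E unfolding z_def by (intro divide_right_mono) auto
    qed
    also have "\<dots> = 2 * exp (- (s * x / 2))"
      by (simp add: E_def exp_minus field_simps flip: exp_add)
    also have "\<dots> \<le> 2 * exp (- (s * a / 2))" using x assms by simp
    finally show "\<bar>((E + 1) - x * (E * s)) / (E + 1)^2\<bar> \<le> 2 * exp (- (s * a / 2))" .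
  qed (use assms in auto)
  thus ?thesis using assms by simp
qed

lemma exp_neg_le_powr: "x > 0 \<Longrightarrow> exp (- x) \<le> x powr (- (1/2))" for x :: real
proof -
  assume x: "x > 0"
  have "ln x \<le> 2 * x" using ln_le_minus_one[OF x] x by linarith
  hence "- x \<le> - (1/2) * ln x" by simp
  thus ?thesis using x by (simp add: powr_def)
qed

text \<open>The term \<open>ln_ratio p * tanh (s * ln_ratio p)\<close> is the logarithmic derivative
  for a symmetric sign times \<open>ln_ratio p\<close>. Two changes lead to it, apart from the shift
  \<open>\<beta> p - ln_ratio p\<close>: dropping the weight of the value 0, and replacing
  \<open>\<beta> p + \<alpha> p\<close> by \<open>2 * ln_ratio p\<close>. Both cost order
  \<open>ln p / p^2\<close> times \<open>exp (- (s * ln_ratio p / 2))\<close>.\<close>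

lemma log_mgf_term_approx:
  assumes tail_values: "tail_values \<beta> \<alpha>" and p: "prime p" and s: "s > 0"
  shows "\<bar>log_mgf_term \<beta> \<alpha> p s - ((\<beta> p - ln_ratio p) + ln_ratio p * tanh (s * ln_ratio p))\<bar> \<le> 40 * s powr (- (1/2)) * (ln (real p) * real p powr (- (3/2)))"
proof -
  note b = tail_values_bounds[OF tail_values p]
  define P l where "P = real p" and "l = ln P"
  have P: "P \<ge> 2" using prime_ge_2_nat[OF p] by (simp add: P_def)
  have l: "l \<ge> 1/2" using ln_prime_ge[OF p] by (simp add: l_def P_def)
  define B A G where "B = \<beta> p" and "A = \<alpha> p" and "G = ln_ratio p"
  note b = b[folded B_def A_def G_def P_def, folded l_def]
  have Gl: "G = l / P" by (simp add: G_def ln_ratio_def P_def l_def)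
  define S where "S = B + A"
  define D where "D = exp (s * S) + 1"
  define e where "e = 2 / P * exp (s * A)"
  have e: "e > 0" using P by (simp add: e_def)
  have D: "D \<ge> 1" by (simp add: D_def)
  \<comment> \<open>Multiplying through by \<open>exp (s * A)\<close> exposes a logistic form:
    \<open>e\<close> stems from the value 0, and with \<open>e\<close> removed the quotient depends
    on \<open>S = B + A\<close> alone.\<close>
  have mmE: "log_mgf_term \<beta> \<alpha> p s - B = - ((S + B * e) / (D + e))"
  proof -
    have den: "exp (s * B) + exp (- (s * A)) + 2 / P > 0" using P by (intro add_pos_pos) auto
    have x: "exp (s * A) * (exp (s * B) + exp (- (s * A)) + 2 / P) = D + e"
      by (simp add: D_def e_def S_def distrib_left algebra_simps flip: exp_add)
    have y: "exp (s * A) * (B * exp (s * B) - A * exp (- (s * A))) = B * exp (s * S) - A"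
      by (simp add: S_def algebra_simps flip: exp_add)
    have "log_mgf_term \<beta> \<alpha> p s = (exp (s * A) * (B * exp (s * B) - A * exp (- (s * A)))) / (exp (s * A) * (exp (s * B) + exp (- (s * A)) + 2 / P))"
      by (simp add: log_mgf_term_def B_def A_def P_def)
    also have "\<dots> = (B * exp (s * S) - A) / (D + e)" unfolding x y ..
    finally have "log_mgf_term \<beta> \<alpha> p s = (B * exp (s * S) - A) / (D + e)" .
    moreover have "D + e \<noteq> 0" using D e by linarith
    ultimately show ?thesis by (simp add: field_simps D_def S_def)
  qed
  have t: "G * (1 - tanh (s * G)) = 2 * G / (exp (s * (2 * G)) + 1)"
    by (simp add: one_minus_tanh mult_ac)
  have Gpos: "G > 0" by (rule b)
  have Spos: "0 \<le> S" "S \<le> 4 * G" using b by (auto simp: S_def)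
  have 1: "\<bar>(S + B * e) / (D + e) - S / D\<bar> \<le> 12 * l / P^2 * exp (- (s * G / 2))"
  proof -
    have "(S + B * e) / (D + e) - S / D = e * (B * D - S) / (D * (D + e))"
      using D e by (simp add: field_simps)
    hence "\<bar>(S + B * e) / (D + e) - S / D\<bar> = e * \<bar>B * D - S\<bar> / (D * (D + e))"
      using D e by (simp add: abs_mult)
    also have "\<dots> \<le> e * (B * D + S * D) / (D * D)"
    proof (intro frac_le mult_left_mono mult_nonneg_nonneg)
      have "S * 1 \<le> S * D" using Spos D by (intro mult_left_mono) auto
      moreover have "0 \<le> B * D" using b D by simp
      ultimately show "\<bar>B * D - S\<bar> \<le> B * D + S * D" using Spos by (simp add: abs_le_iff)
    qed (use D e Spos b in auto)
    also have "\<dots> = (B + S) * (e / D)" using D by (simp add: field_simps)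
    also have "\<dots> \<le> (6 * G) * (2 / P * exp (- (s * G / 2)))"
    proof (intro mult_mono)
      show "B + S \<le> 6 * G" using b Spos by linarith
      have "e / D \<le> e / exp (s * S)" using e D unfolding D_def by (intro divide_left_mono mult_pos_pos add_pos_pos) auto
      also have "\<dots> = 2 / P * exp (- (s * B))"
        by (simp add: e_def S_def distrib_left exp_add exp_minus field_simps)
      also have "\<dots> \<le> 2 / P * exp (- (s * G / 2))"
        using b(1) s P mult_left_mono[OF b(1), of s] by (intro mult_left_mono) auto
      finally show "e / D \<le> 2 / P * exp (- (s * G / 2))" .
    qed (use b e D P in auto)
    also have "\<dots> = 12 * l / P^2 * exp (- (s * G / 2))" by (simp add: Gl power2_eq_square)
    finally show ?thesis .
  qed
  have 2: "\<bar>S / D - 2 * G / (exp (s * (2 * G)) + 1)\<bar> \<le> 4 * l / P^2 * exp (- (s * G / 2))"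
  proof -
    have "\<bar>S / D - 2 * G / (exp (s * (2 * G)) + 1)\<bar> \<le> 2 * exp (- (s * (2 * G) / 2)) * (S - 2 * G)"
      unfolding D_def using logistic_diff[OF s, of "2 * G" S] b by (simp add: S_def)
    also have "\<dots> \<le> 2 * exp (- (s * G / 2)) * (2 * l / P^2)"
    proof (intro mult_mono)
      show "S - 2 * G \<le> 2 * l / P^2" using b by (simp add: S_def)
    qed (use b s Gpos in \<open>auto simp: S_def\<close>)
    finally show ?thesis by (simp add: mult_ac)
  qed
  have "\<bar>log_mgf_term \<beta> \<alpha> p s - ((B - G) + G * tanh (s * G))\<bar> = \<bar>- ((S + B * e) / (D + e)) + 2 * G / (exp (s * (2 * G)) + 1)\<bar>"
    using mmE t by (simp add: algebra_simps)
  also have "\<dots> \<le> 16 * l / P^2 * exp (- (s * G / 2))"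
  proof -
    have "16 * l / P^2 * exp (- (s * G / 2)) = 12 * l / P^2 * exp (- (s * G / 2)) + 4 * l / P^2 * exp (- (s * G / 2))"
      by (simp add: field_simps)
    thus ?thesis using 1 2 by linarith
  qed
  \<comment> \<open>Half a power of \<open>P\<close> is given up for half a power of
    \<open>s\<close>: the remaining exponent 3/2 still makes the sum over primes converge, and the
    total error tends to 0.\<close>
  also have "\<dots> \<le> 16 * l / P^2 * (2 * (P powr (1/2) * s powr (- (1/2))))"
  proof (intro mult_left_mono)
    have "exp (- (s * G / 2)) \<le> (s * G / 2) powr (- (1/2))"
      using s Gpos by (intro exp_neg_le_powr) auto
    also have "\<dots> \<le> (s / (4 * P)) powr (- (1/2))"
    proof (rule powr_mono2')
      show "s / (4 * P) \<le> s * G / 2" using s P l by (simp add: Gl field_simps)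
    qed (use s P in auto)
    also have "\<dots> = 2 * (P powr (1/2) * s powr (- (1/2)))"
    proof -
      have "(4::real) powr (1/2) = 2" by (simp add: powr_half_sqrt)
      thus ?thesis using s P by (simp add: powr_divide powr_mult powr_minus field_simps)
    qed
    finally show "exp (- (s * G / 2)) \<le> 2 * (P powr (1/2) * s powr (- (1/2)))" .
  qed (use l in auto)
  also have "\<dots> = 32 * s powr (- (1/2)) * (l * P powr (- (3/2)))"
  proof -
    have "P powr (1/2) = P^2 * P powr (- (3/2))"
      using P powr_add[of P 2 "-(3/2)"] by simp
    thus ?thesis using P by simp
  qed
  also have "\<dots> \<le> 40 * s powr (- (1/2)) * (l * P powr (- (3/2)))"
    using l by (intro mult_right_mono) auto
  finally show ?thesis by (simp add: B_def G_def l_def P_def)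
qed

section \<open>Replacing ln p by ln s inside tanh\<close>

definition tanh_halving :: "real \<Rightarrow> real" where "tanh_halving x = tanh x - tanh (x / 2)"

lemma tanh_halving_nonneg: "x \<ge> 0 \<Longrightarrow> tanh_halving x \<ge> 0"
  by (simp add: tanh_halving_def)

lemma tanh_diff_bounds:
  fixes a b :: real
  assumes "0 \<le> a" "a \<le> b"
  shows "tanh b - tanh a \<le> (b - a) * (1 - tanh a ^ 2)" "(b - a) * (1 - tanh b ^ 2) \<le> tanh b - tanh a"
proof -
  have "\<exists>z. a \<le> z \<and> z \<le> b \<and> tanh b - tanh a = (b - a) * (1 - tanh z ^ 2)"
  proof (cases "a = b")
    case False
    hence "a < b" using assms by simp
    have der: "(tanh has_real_derivative 1 - tanh x ^ 2) (at x)" for x :: real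
    proof -
      have "cosh x \<noteq> 0" using cosh_real_pos[of x] by simp
      thus ?thesis by (auto intro!: derivative_eq_intros)
    qed
    from MVT2[OF \<open>a < b\<close>, of tanh "\<lambda>z. 1 - tanh z ^ 2"] der
    obtain z where "a < z" "z < b" "tanh b - tanh a = (b - a) * (1 - tanh z ^ 2)" by blast
    thus ?thesis by (intro exI[of _ z]) auto
  qed auto
  then obtain z where z: "a \<le> z" "z \<le> b" "tanh b - tanh a = (b - a) * (1 - tanh z ^ 2)" by blast
  have "0 \<le> tanh a" using assms by simp
  hence "tanh a ^ 2 \<le> tanh z ^ 2" "tanh z ^ 2 \<le> tanh b ^ 2"
    using z by (auto intro!: power_mono)
  thus "tanh b - tanh a \<le> (b - a) * (1 - tanh a ^ 2)" "(b - a) * (1 - tanh b ^ 2) \<le> tanh b - tanh a"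
    unfolding z(3) using assms by (auto intro!: mult_left_mono)
qed

text \<open>Differences of tanh between nearby arguments have size
  \<open>x * (1 - tanh x ^ 2)\<close>. Bounding this by \<open>tanh x - tanh (x / 2)\<close> makes
  the corresponding sum over primes at most a difference of two values of \<open>mtanh_sum\<close>,
  whose main terms differ by \<open>ln 2\<close>.\<close>

lemma tanh_halving_ge: "x \<ge> 0 \<Longrightarrow> x / 2 * (1 - tanh x ^ 2) \<le> tanh_halving x"
  using tanh_diff_bounds(2)[of "x/2" x] by (simp add: tanh_halving_def)

definition sech_1_sq :: real where "sech_1_sq = 1 - tanh 1 ^ 2"

lemma sech_1_sq_pos: "sech_1_sq > 0"
  using tanh_real_bounds[of 1] by (simp add: sech_1_sq_def abs_square_less_1)

text \<open>Four ranges of \<open>p\<close> give the four terms. For \<open>p <= s\<close> both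
  arguments are at least \<open>L / 2\<close>, and both tanh are within \<open>2 / s\<close> of 1.
  For \<open>s < p <= y'\<close> one has \<open>ln p - L <= 2 * ln L\<close>. For
  \<open>y' < p <= s^4\<close> only \<open>ln p - L <= 3 * L\<close> is available, but the arguments
  are small, and measuring them on the larger scale \<open>y' = y * L\<close> regains a factor
  \<open>1 / L\<close>. Beyond \<open>s^4\<close> the trivial bound \<open>tanh x <= x\<close> is
  summable with a factor \<open>1 / s\<close> to spare.\<close>

lemma tanh_scale_diff:
  assumes p: "prime p" and s: "s \<ge> exp 1"
  defines "L \<equiv> ln s" and "y \<equiv> s * ln s" and "y' \<equiv> s * (ln s)^2"
  shows "ln_ratio p * \<bar>tanh (s * ln_ratio p) - tanh (y / real p)\<bar> \<le>
     4 * s powr (- (1/2)) * (ln (real p) * real p powr (- (3/2)))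
     + 4 * ln L / L * (ln_ratio p * tanh_halving (y / real p))
     + 6 / (sech_1_sq * L) * (ln_ratio p * tanh_halving (y' / real p))
     + 1 / s * (ln (real p) * ln (real p) * real p powr (- (3/2)))" (is "_ \<le> ?a + ?b + ?c + ?d")
proof -
  define P l where "P = real p" and "l = ln P"
  have P: "P \<ge> 2" using prime_ge_2_nat[OF p] by (simp add: P_def)
  have l: "l \<ge> 1/2" using ln_prime_ge[OF p] by (simp add: l_def P_def)
  have G: "ln_ratio p = l / P" by (simp add: ln_ratio_def l_def P_def)
  have Gpos: "ln_ratio p > 0" using P l by (simp add: G)
  have s1: "s > 1" using s exp_gt_one[of 1] by linarith
  have L1: "L \<ge> 1" using s s1 by (simp add: L_def ln_ge_iff)
  have y: "y > 0" "y' > 0" using s1 L1 unfolding y_def y'_def L_def by auto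
  have lnL: "ln L \<ge> 0" using L1 by simp
  have a0: "?a \<ge> 0" using l by (simp add: l_def P_def)
  have b0: "?b \<ge> 0" using lnL L1 Gpos y by (intro mult_nonneg_nonneg divide_nonneg_nonneg tanh_halving_nonneg) auto
  have c0: "?c \<ge> 0" using sech_1_sq_pos L1 Gpos y by (intro mult_nonneg_nonneg divide_nonneg_nonneg tanh_halving_nonneg) auto
  have d0: "?d \<ge> 0" using l s1 by (simp add: l_def P_def)
  define z where "z = y / P"
  have z: "z = s * L / P" by (simp add: z_def y_def L_def)
  have zpos: "z > 0" using y P by (simp add: z_def)
  have P32: "P powr (- (3/2)) = P powr (- (1/2)) / P" using P powr_add[of P "-1" "-(1/2)"] by (simp add: powr_minus_divide)
  show ?thesis
  proof (cases "P \<le> s")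
    case True
    \<comment> \<open>Either \<open>ln p >= L / 2\<close>, and \<open>p <= s\<close> suffices, or
      \<open>p <= sqrt s\<close>, and then \<open>s / p >= sqrt s >= L\<close>.\<close>
    have lo1: "s * ln_ratio p \<ge> L / 2"
    proof (cases "l \<ge> L / 2")
      case True
      have "L / 2 \<le> l * 1" using True by simp
      also have "\<dots> \<le> l * (s / P)" using l P \<open>P \<le> s\<close> by (intro mult_left_mono) auto
      finally show ?thesis by (simp add: G mult_ac)
    next
      case False
      have "P = exp l" using P by (simp add: l_def)
      hence "P \<le> exp (L / 2)" using False by simp
      have "s = exp (L / 2) * exp (L / 2)" using s1 by (simp add: L_def flip: exp_add)
      hence "exp (L / 2) \<le> s / P" using \<open>P \<le> exp (L / 2)\<close> P by (simp add: field_simps)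
      moreover have "L \<le> exp (L / 2)"
      proof -
        have "1 + L / 2 + (L / 2)^2 / 2 \<le> exp (L / 2)" by (rule exp_lower_Taylor_quadratic) (use L1 in simp)
        moreover have "0 \<le> (L / 2 - 1)^2" by simp
        ultimately show ?thesis by (simp add: power2_eq_square algebra_simps)
      qed
      ultimately have "L \<le> s / P" by linarith
      hence "L * (1/2) \<le> (s / P) * l" using l L1 by (intro mult_mono) auto
      thus ?thesis by (simp add: G mult_ac)
    qed
    have lo2: "z \<ge> L / 2"
    proof -
      have "L * 1 \<le> L * (s / P)" using True P L1 by (intro mult_left_mono) auto
      hence "L \<le> z" by (simp add: z mult_ac)
      thus ?thesis using L1 by linarith
    qed
    have up: "1 - tanh x \<le> 2 / s" if "x \<ge> L / 2" for x
    proof -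
      have "1 - tanh x \<le> 2 * exp (- 2 * x)" by (rule one_minus_tanh_le)
      also have "\<dots> \<le> 2 * exp (- L)" using that by simp
      also have "\<dots> = 2 / s" using s1 by (simp add: L_def exp_minus field_simps)
      finally show ?thesis .
    qed
    have "\<bar>tanh (s * ln_ratio p) - tanh z\<bar> \<le> 2 / s"
      using up[OF lo1] up[OF lo2] tanh_real_lt_1[of "s * ln_ratio p"] tanh_real_lt_1[of z] by linarith
    also have "2 / s \<le> 4 * s powr (- (1/2)) * P powr (- (1/2))"
    proof -
      have "1 / s = s powr (- (1/2)) * s powr (- (1/2))"
        using s1 by (simp add: powr_minus_divide flip: powr_add)
      also have "\<dots> \<le> s powr (- (1/2)) * P powr (- (1/2))"
        using True P by (intro mult_left_mono powr_mono2') auto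
      finally have "2 / s \<le> 2 * (s powr (- (1/2)) * P powr (- (1/2)))" by simp
      also have "\<dots> \<le> 4 * (s powr (- (1/2)) * P powr (- (1/2)))" by (intro mult_right_mono) auto
      finally show ?thesis by simp
    qed
    finally have "ln_ratio p * \<bar>tanh (s * ln_ratio p) - tanh z\<bar> \<le> ln_ratio p * (4 * s powr (- (1/2)) * P powr (- (1/2)))"
      using Gpos by (intro mult_left_mono) auto
    also have "\<dots> = ?a" using P32 by (simp add: G l_def P_def)
    finally show ?thesis using b0 c0 d0 by (simp add: z_def P_def)
  next
    case False
    hence ls: "l \<ge> L" using s1 unfolding l_def L_def by simp
    have zeta_reg_radius: "z \<le> s * ln_ratio p" using ls s1 P unfolding z G by (simp add: divide_right_mono)
    have dif: "\<bar>tanh (s * ln_ratio p) - tanh z\<bar> = tanh (s * ln_ratio p) - tanh z" using zeta_reg_radius by simp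
    have zz: "s * ln_ratio p - z = (s / P) * (l - L)" by (simp add: z G diff_divide_distrib right_diff_distrib)
    have up: "tanh (s * ln_ratio p) - tanh z \<le> (s / P) * (l - L) * (1 - tanh z ^ 2)"
      using tanh_diff_bounds(1)[OF less_imp_le[OF zpos] zeta_reg_radius] unfolding zz .
    have sq: "0 \<le> 1 - tanh z ^ 2" "1 - tanh z ^ 2 \<le> 1" using tanh_sq_le_1[of z] by auto
    have sP: "s / P > 0" using s1 P by simp
    consider "P \<le> y'" | "P > y'" "P \<le> s ^ 4" | "P > s ^ 4" by linarith
    thus ?thesis
    proof cases
      case 1
      have "l \<le> ln y'" using 1 P unfolding l_def by simp
      also have "\<dots> = L + 2 * ln L" using s1 L1 unfolding y'_def L_def[symmetric]
        by (simp add: ln_mult ln_realpow L_def)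
      finally have "l - L \<le> 2 * ln L" by simp
      hence "(s / P) * (l - L) * (1 - tanh z ^ 2) \<le> (s / P) * (2 * ln L) * (1 - tanh z ^ 2)"
        using sq sP by (intro mult_right_mono mult_left_mono) auto
      also have "\<dots> = 4 * ln L / L * (z / 2 * (1 - tanh z ^ 2))" using L1 by (simp add: z)
      also have "\<dots> \<le> 4 * ln L / L * tanh_halving z" using tanh_halving_ge[of z] zpos lnL L1 by (intro mult_left_mono) auto
      finally have "\<bar>tanh (s * ln_ratio p) - tanh z\<bar> \<le> 4 * ln L / L * tanh_halving z" using up dif by linarith
      hence "ln_ratio p * \<bar>tanh (s * ln_ratio p) - tanh z\<bar> \<le> ln_ratio p * (4 * ln L / L * tanh_halving z)"
        using Gpos by (intro mult_left_mono) auto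
      also have "\<dots> = ?b" by (simp add: z_def P_def)
      finally have fin: "ln_ratio p * \<bar>tanh (s * ln_ratio p) - tanh (y / real p)\<bar> \<le> ?b" by (simp only: z_def P_def)
      show ?thesis using fin a0 c0 d0 by linarith
    next
      case 2
      have "l \<le> ln (s ^ 4)" using 2 P s1 unfolding l_def by (subst ln_le_cancel_iff) auto
      also have "\<dots> = 4 * L" using s1 by (simp add: L_def ln_realpow)
      finally have "l - L \<le> 3 * L" by simp
      hence "(s / P) * (l - L) * (1 - tanh z ^ 2) \<le> (s / P) * (3 * L) * (1 - tanh z ^ 2)"
        using sq sP by (intro mult_right_mono mult_left_mono) auto
      also have "\<dots> \<le> (s / P) * (3 * L) * 1"
        using sq sP L1 by (intro mult_left_mono mult_nonneg_nonneg less_imp_le[OF sP]) auto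
      also have "\<dots> = 6 / (sech_1_sq * L) * (y' / P / 2 * sech_1_sq)"
        using sech_1_sq_pos L1 by (simp add: y'_def L_def[symmetric] power2_eq_square)
      also have "\<dots> \<le> 6 / (sech_1_sq * L) * tanh_halving (y' / P)"
      proof (intro mult_left_mono)
        define x where "x = y' / P"
        have x: "0 \<le> x" "x \<le> 1" using 2 y P by (auto simp: x_def)
        have "tanh x ^ 2 \<le> tanh 1 ^ 2" using x by (intro power_mono) auto
        hence "x / 2 * sech_1_sq \<le> x / 2 * (1 - tanh x ^ 2)" using x unfolding sech_1_sq_def by (intro mult_left_mono) auto
        also have "\<dots> \<le> tanh_halving x" by (rule tanh_halving_ge[OF x(1)])
        finally show "y' / P / 2 * sech_1_sq \<le> tanh_halving (y' / P)" by (simp add: x_def)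
      qed (use sech_1_sq_pos L1 in auto)
      finally have "\<bar>tanh (s * ln_ratio p) - tanh z\<bar> \<le> 6 / (sech_1_sq * L) * tanh_halving (y' / P)" using up dif by linarith
      hence "ln_ratio p * \<bar>tanh (s * ln_ratio p) - tanh z\<bar> \<le> ln_ratio p * (6 / (sech_1_sq * L) * tanh_halving (y' / P))"
        using Gpos by (intro mult_left_mono) auto
      also have "\<dots> = ?c" by (simp add: P_def)
      finally have fin: "ln_ratio p * \<bar>tanh (s * ln_ratio p) - tanh (y / real p)\<bar> \<le> ?c" by (simp only: z_def P_def)
      show ?thesis using fin a0 b0 d0 by linarith
    next
      case 3
      have "\<bar>tanh (s * ln_ratio p) - tanh z\<bar> \<le> s * ln_ratio p"
      proof -
        have "0 \<le> tanh z" using zpos by simp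
        moreover have "tanh (s * ln_ratio p) \<le> s * ln_ratio p" using tanh_le_self[of "s * ln_ratio p"] s1 Gpos by simp
        ultimately show ?thesis using dif by linarith
      qed
      hence "ln_ratio p * \<bar>tanh (s * ln_ratio p) - tanh z\<bar> \<le> ln_ratio p * (s * ln_ratio p)"
        using Gpos by (intro mult_left_mono) auto
      also have "\<dots> = l * l * (s * (P powr (-2)))" using P by (simp add: G powr_minus_divide power2_eq_square)
      also have "\<dots> \<le> l * l * (1 / s * P powr (- (3/2)))"
      proof (intro mult_left_mono)
        have "P powr (-2) = P powr (- (1/2)) * P powr (- (3/2))" by (simp flip: powr_add)
        also have "\<dots> \<le> (s ^ 4) powr (- (1/2)) * P powr (- (3/2))"
          using 3 s1 by (intro mult_right_mono powr_mono2') auto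
        also have "(s ^ 4) powr (- (1/2)) = 1 / s ^ 2"
        proof -
          have "s ^ 4 = s powr 4" using powr_realpow[of s 4] s1 by simp
          hence "(s ^ 4) powr (- (1/2)) = s powr (-2)" by (simp only: powr_powr) simp
          thus ?thesis using s1 by (simp add: powr_minus_divide)
        qed
        finally have "s * P powr (-2) \<le> s * (1 / s ^ 2 * P powr (- (3/2)))" using s1 by (intro mult_left_mono) auto
        also have "\<dots> = 1 / s * P powr (- (3/2))" using s1 by (simp add: power2_eq_square)
        finally show "s * P powr (-2) \<le> 1 / s * P powr (- (3/2))" .
      qed (use l in auto)
      also have "\<dots> = ?d" by (simp add: l_def P_def)
      finally have fin: "ln_ratio p * \<bar>tanh (s * ln_ratio p) - tanh (y / real p)\<bar> \<le> ?d" by (simp only: z_def P_def)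
      show ?thesis using fin a0 b0 c0 by linarith
    qed
  qed
qed

abbreviation on_primes :: "(nat \<Rightarrow> real) \<Rightarrow> nat \<Rightarrow> real" where
  "on_primes f p \<equiv> (if prime p then f p else 0)"

lemma on_primes_sums_bound:
  assumes g: "g sums G" and le: "\<And>p. prime p \<Longrightarrow> \<bar>f p\<bar> \<le> g p" and g0: "\<And>p. g p \<ge> 0"
  shows "summable (on_primes f)" "\<bar>\<Sum>p. on_primes f p\<bar> \<le> G"
proof -
  have le': "norm (on_primes f p) \<le> g p" for p using le[of p] g0[of p] by auto
  have a: "summable (\<lambda>p. norm (on_primes f p))"
    by (rule summable_comparison_test'[OF sums_summable[OF g]]) (use le' in auto)
  thus "summable (on_primes f)" by (rule summable_norm_cancel)
  have "\<bar>\<Sum>p. on_primes f p\<bar> \<le> (\<Sum>p. norm (on_primes f p))" using summable_norm[OF a] by simp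
  also have "\<dots> \<le> G" using suminf_le[OF le' a sums_summable[OF g]] g by (simp add: sums_iff)
  finally show "\<bar>\<Sum>p. on_primes f p\<bar> \<le> G" .
qed

lemma mtanh_sum_sums:
  assumes "y > 0" shows "(\<lambda>n. mangoldt n / real n * tanh (y / real n)) sums mtanh_sum y"
proof -
  have "(\<lambda>n. mangoldt_coeff n * tanh (y / real (Suc n))) sums mtanh_sum y"
    unfolding mtanh_sum_def by (rule summable_sums[OF mtanh_sum_summable]) (use assms in simp)
  thus ?thesis unfolding mangoldt_coeff_def by (subst (asm) sums_Suc_iff[of "\<lambda>n. mangoldt n / real n * tanh (y / real n)"]) simp
qed

lemma tanh_halving_sum:
  assumes y: "y > 0"
  shows "summable (on_primes (\<lambda>p. ln_ratio p * tanh_halving (y / real p)))"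
    and "(\<Sum>p. on_primes (\<lambda>p. ln_ratio p * tanh_halving (y / real p)) p) \<le> mtanh_sum y - mtanh_sum (y / 2)"
proof -
  let ?g = "\<lambda>n. mangoldt n / real n * tanh_halving (y / real n)"
  have g: "?g sums (mtanh_sum y - mtanh_sum (y / 2))"
    using sums_diff[OF mtanh_sum_sums[OF y] mtanh_sum_sums[of "y / 2"]] y
    by (simp add: tanh_halving_def right_diff_distrib mult.commute)
  have g0: "?g n \<ge> 0" for n using mangoldt_nonneg[of n] y by (intro mult_nonneg_nonneg divide_nonneg_nonneg tanh_halving_nonneg) auto
  have le: "\<bar>ln_ratio p * tanh_halving (y / real p)\<bar> \<le> ?g p" if "prime p" for p
    using that g0[of p] by (simp add: ln_ratio_def)
  show "summable (on_primes (\<lambda>p. ln_ratio p * tanh_halving (y / real p)))"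
    "(\<Sum>p. on_primes (\<lambda>p. ln_ratio p * tanh_halving (y / real p)) p) \<le> mtanh_sum y - mtanh_sum (y / 2)"
    using on_primes_sums_bound[OF g le g0] by auto
qed

text \<open>The main terms differ by \<open>ln 2\<close>; the threshold \<open>2 * exp 1\<close>
  keeps both logarithms at least 1, so that the error terms stay bounded.\<close>

lemma mtanh_sum_diff_bound:
  obtains B where "B \<ge> 0" "\<And>y. y \<ge> 2 * exp 1 \<Longrightarrow> mtanh_sum y - mtanh_sum (y / 2) \<le> B"
proof -
  obtain C where C: "C \<ge> 0" "\<And>y. y > 1 \<Longrightarrow> \<bar>mtanh_sum y - (ln y - euler_mascheroni + A0)\<bar> \<le> C / ln y"
    using mtanh_sum_asymp by blast
  have "mtanh_sum y - mtanh_sum (y / 2) \<le> 1 + 2 * C" if y: "y \<ge> 2 * exp 1" for y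
  proof -
    have e: "exp 1 > (1::real)" by simp
    have y2: "y / 2 \<ge> exp 1" "y \<ge> exp 1" using y e by linarith+
    hence y1: "y / 2 > 1" "y > 1" using e by linarith+
    have l: "ln (y / 2) \<ge> 1" "ln y \<ge> 1" using y2 y1 by (auto simp: ln_ge_iff)
    have c: "C / ln (y / 2) \<le> C" "C / ln y \<le> C"
      using l C(1) mult_left_mono[OF l(1) C(1)] mult_left_mono[OF l(2) C(1)] by (auto simp: divide_le_eq)
    have "ln (2::real) \<le> 1" using ln_le_minus_one[of "2::real"] by simp
    moreover have "ln (y / 2) = ln y - ln 2" using y1 by (simp add: ln_div)
    ultimately show ?thesis using C(2)[OF y1(1)] C(2)[OF y1(2)] c by linarith
  qed
  thus ?thesis using that[of "1 + 2 * C"] C(1) by auto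
qed

lemma ln_powr_sums: "(\<lambda>p. ln (real p) * real p powr (- (3/2))) sums (\<Sum>p. ln (real p) * real p powr (- (3/2)))"
  using summable_ln_powr[of "1/2"] by (simp add: summable_sums)

lemma ln2_powr_sums: "(\<lambda>p. ln (real p) * ln (real p) * real p powr (- (3/2))) sums (\<Sum>p. ln (real p) * ln (real p) * real p powr (- (3/2)))"
  using summable_ln2_powr[of "1/2"] by (simp add: summable_sums)

text \<open>At \<open>y = s * ln s\<close> the main term of \<open>mtanh_sum\<close> is
  \<open>ln s + ln (ln s)\<close> plus a constant. Among the error bounds only the second term of
  \<open>tanh_scale_diff\<close> has the order \<open>ln (ln s) / ln s\<close>; the others are of
  order \<open>1 / ln s\<close> or smaller.\<close>

lemma tanh_sum_asymp:
  obtains C where "C \<ge> 0" "\<And>s. s \<ge> exp 1 \<Longrightarrow> summable (on_primes (\<lambda>p. ln_ratio p * tanh (s * ln_ratio p)))"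
    "\<forall>\<^sub>F s in at_top. \<bar>(\<Sum>p. on_primes (\<lambda>p. ln_ratio p * tanh (s * ln_ratio p)) p)
        - (ln s + ln (ln s) - euler_mascheroni + A0 - (\<Sum>p. prime_power_term 1 p))\<bar> \<le> C * (ln (ln s) / ln s)"
proof -
  obtain B where B: "B \<ge> 0" "\<And>y. y \<ge> 2 * exp 1 \<Longrightarrow> mtanh_sum y - mtanh_sum (y / 2) \<le> B"
    using mtanh_sum_diff_bound by blast
  obtain C where C: "C \<ge> 0" "\<And>y. y > 1 \<Longrightarrow> \<bar>mtanh_sum y - (ln y - euler_mascheroni + A0)\<bar> \<le> C / ln y"
    using mtanh_sum_asymp by blast
  define S1 where "S1 = (\<Sum>p. ln (real p) * real p powr (- (3/2)))"
  define S2 where "S2 = (\<Sum>p. ln (real p) * ln (real p) * real p powr (- (3/2)))"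
  define S3 where "S3 = (\<Sum>p. prime_power_term (3/4) p)"
  have S0: "S1 \<ge> 0" "S2 \<ge> 0" "S3 \<ge> 0"
    unfolding S1_def S2_def S3_def using ln_powr_sums ln2_powr_sums prime_power_term_summable
    by (auto intro!: suminf_nonneg mult_nonneg_nonneg ln_nat_nonneg simp: sums_iff)
  let ?U = "\<lambda>s p. ln_ratio p * \<bar>tanh (s * ln_ratio p) - tanh (s * ln s / real p)\<bar>"
  let ?d = "\<lambda>s p. ln_ratio p * tanh (s * ln_ratio p) - ln_ratio p * tanh (s * ln s / real p)"
  have diff: "summable (on_primes (?d s)) \<and> \<bar>\<Sum>p. on_primes (?d s) p\<bar> \<le>
      4 * s powr (- (1/2)) * S1 + 4 * ln (ln s) / ln s * (mtanh_sum (s * ln s) - mtanh_sum (s * ln s / 2))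
      + 6 / (sech_1_sq * ln s) * (mtanh_sum (s * (ln s)^2) - mtanh_sum (s * (ln s)^2 / 2)) + 1 / s * S2"
    if s: "s \<ge> exp 1" for s
  proof -
    have s1: "s > 1" using s exp_gt_one[of 1] by linarith
    have L1: "ln s \<ge> 1" using s s1 by (simp add: ln_ge_iff)
    have y: "s * ln s > 0" "s * (ln s)^2 > 0" using s1 L1 by auto
    define D where "D y = (\<Sum>p. on_primes (\<lambda>p. ln_ratio p * tanh_halving (y / real p)) p)" for y
    have lam0: "ln_ratio p \<ge> 0" for p by (simp add: ln_ratio_def ln_nat_nonneg)
    let ?g = "\<lambda>p. 4 * s powr (- (1/2)) * (ln (real p) * real p powr (- (3/2)))
     + 4 * ln (ln s) / ln s * on_primes (\<lambda>p. ln_ratio p * tanh_halving (s * ln s / real p)) p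
     + 6 / (sech_1_sq * ln s) * on_primes (\<lambda>p. ln_ratio p * tanh_halving (s * (ln s)^2 / real p)) p
     + 1 / s * (ln (real p) * ln (real p) * real p powr (- (3/2)))"
    have g: "?g sums (4 * s powr (- (1/2)) * S1 + 4 * ln (ln s) / ln s * D (s * ln s)
       + 6 / (sech_1_sq * ln s) * D (s * (ln s)^2) + 1 / s * S2)"
      unfolding S1_def S2_def D_def
      by (intro sums_add sums_mult ln_powr_sums ln2_powr_sums summable_sums tanh_halving_sum(1) y)
    have g0: "?g p \<ge> 0" for p
    proof -
      have "0 \<le> on_primes (\<lambda>p. ln_ratio p * tanh_halving (z / real p)) p" if "z > 0" for z
        using that lam0 by (auto intro!: mult_nonneg_nonneg tanh_halving_nonneg)
      thus ?thesis using y L1 s1 sech_1_sq_pos ln_nat_nonneg[of p]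
        by (intro add_nonneg_nonneg mult_nonneg_nonneg divide_nonneg_nonneg) auto
    qed
    have le: "\<bar>?d s p\<bar> \<le> ?g p" if "prime p" for p
      using tanh_scale_diff[OF that s] lam0[of p] that by (simp add: abs_mult right_diff_distrib[symmetric] del: right_diff_distrib_numeral)
    have "D (s * ln s) \<le> mtanh_sum (s * ln s) - mtanh_sum (s * ln s / 2)" "D (s * (ln s)^2) \<le> mtanh_sum (s * (ln s)^2) - mtanh_sum (s * (ln s)^2 / 2)"
      unfolding D_def by (intro tanh_halving_sum(2) y)+
    hence "4 * ln (ln s) / ln s * D (s * ln s) \<le> 4 * ln (ln s) / ln s * (mtanh_sum (s * ln s) - mtanh_sum (s * ln s / 2))"
      "6 / (sech_1_sq * ln s) * D (s * (ln s)^2) \<le> 6 / (sech_1_sq * ln s) * (mtanh_sum (s * (ln s)^2) - mtanh_sum (s * (ln s)^2 / 2))"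
      using L1 sech_1_sq_pos by (intro mult_left_mono; simp)+
    thus ?thesis using on_primes_sums_bound[OF g le g0] by linarith
  qed
  have tp: "summable (on_primes (\<lambda>p. ln_ratio p * tanh (s * ln s / real p)))"
    "\<bar>(\<Sum>p. on_primes (\<lambda>p. ln_ratio p * tanh (s * ln s / real p)) p) - (mtanh_sum (s * ln s) - (\<Sum>p. prime_power_term 1 p))\<bar> \<le> 2 * (s * ln s) powr (-1/4) * S3"
    if "s \<ge> exp 1" for s
  proof -
    have "s > 1" using that exp_gt_one[of 1] by linarith
    hence "s * ln s > 0" by simp
    from mtanh_sum_primes[OF this] show "summable (on_primes (\<lambda>p. ln_ratio p * tanh (s * ln s / real p)))"
     "\<bar>(\<Sum>p. on_primes (\<lambda>p. ln_ratio p * tanh (s * ln s / real p)) p) - (mtanh_sum (s * ln s) - (\<Sum>p. prime_power_term 1 p))\<bar> \<le> 2 * (s * ln s) powr (-1/4) * S3"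
      unfolding ln_ratio_def S3_def by auto
  qed
  have ad: "on_primes (?d s) p + on_primes (\<lambda>p. ln_ratio p * tanh (s * ln s / real p)) p = on_primes (\<lambda>p. ln_ratio p * tanh (s * ln_ratio p)) p" for s p
    by simp
  have sm: "summable (on_primes (\<lambda>p. ln_ratio p * tanh (s * ln_ratio p)))"
    and se: "(\<Sum>p. on_primes (\<lambda>p. ln_ratio p * tanh (s * ln_ratio p)) p) = (\<Sum>p. on_primes (?d s) p) + (\<Sum>p. on_primes (\<lambda>p. ln_ratio p * tanh (s * ln s / real p)) p)"
    if "s \<ge> exp 1" for s
  proof -
    note dd = conjunct1[OF diff[OF that]]
    show "summable (on_primes (\<lambda>p. ln_ratio p * tanh (s * ln_ratio p)))" using summable_add[OF dd tp(1)[OF that]] unfolding ad .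
    show "(\<Sum>p. on_primes (\<lambda>p. ln_ratio p * tanh (s * ln_ratio p)) p) = (\<Sum>p. on_primes (?d s) p) + (\<Sum>p. on_primes (\<lambda>p. ln_ratio p * tanh (s * ln s / real p)) p)"
      using suminf_add[OF dd tp(1)[OF that]] unfolding ad by simp
  qed
  define K where "K = 4 * S1 + 4 * B + 6 / sech_1_sq * B + S2 + 2 * S3 + C"
  have K0: "K \<ge> 0" using S0 B(1) C(1) sech_1_sq_pos by (simp add: K_def)
  have "\<forall>\<^sub>F s::real in at_top. s powr (- (1/2)) \<le> ln (ln s) / ln s" by real_asymp
  moreover have "\<forall>\<^sub>F s::real in at_top. 1 / ln s \<le> ln (ln s) / ln s" by real_asymp
  moreover have "\<forall>\<^sub>F s::real in at_top. 1 / s \<le> ln (ln s) / ln s" by real_asymp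
  moreover have "\<forall>\<^sub>F s::real in at_top. (s * ln s) powr (-1/4) \<le> ln (ln s) / ln s" by real_asymp
  moreover have "\<forall>\<^sub>F s::real in at_top. s \<ge> 2 * exp 1" by (rule eventually_ge_at_top)
  moreover have "\<forall>\<^sub>F s::real in at_top. ln (ln s) \<ge> 0" by real_asymp
  ultimately have "\<forall>\<^sub>F s in at_top. \<bar>(\<Sum>p. on_primes (\<lambda>p. ln_ratio p * tanh (s * ln_ratio p)) p)
        - (ln s + ln (ln s) - euler_mascheroni + A0 - (\<Sum>p. prime_power_term 1 p))\<bar> \<le> K * (ln (ln s) / ln s)"
  proof eventually_elim
    case (elim s)
    define h where "h = ln (ln s) / ln s"
    note e = elim[folded h_def]
    have s: "s \<ge> exp 1" using e(5) exp_gt_zero[of "1::real"] by linarith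
    have s1: "s > 1" using s exp_gt_one[of 1] by linarith
    have L1: "ln s \<ge> 1" using s s1 by (simp add: ln_ge_iff)
    have y1: "s * ln s \<ge> 2 * exp 1" using mult_mono[OF e(5) L1] s1 by simp
    have y2: "s * (ln s)^2 \<ge> 2 * exp 1"
      using mult_mono[OF y1 L1] s1 L1 by (simp add: power2_eq_square mult.assoc)
    have h0: "h \<ge> 0" using e(6) L1 by (simp add: h_def)
    have 1: "4 * s powr (- (1/2)) * S1 \<le> 4 * S1 * h" using mult_left_mono[OF e(1) S0(1)] by (simp add: mult_ac)
    have 2: "4 * ln (ln s) / ln s * (mtanh_sum (s * ln s) - mtanh_sum (s * ln s / 2)) \<le> 4 * B * h"
    proof -
      have "4 * ln (ln s) / ln s * (mtanh_sum (s * ln s) - mtanh_sum (s * ln s / 2)) = 4 * h * (mtanh_sum (s * ln s) - mtanh_sum (s * ln s / 2))"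
        by (simp add: h_def)
      also have "\<dots> \<le> 4 * h * B" using B(2)[OF y1] h0 by (intro mult_left_mono) auto
      finally show ?thesis by (simp only: mult_ac)
    qed
    have 3: "6 / (sech_1_sq * ln s) * (mtanh_sum (s * (ln s)^2) - mtanh_sum (s * (ln s)^2 / 2)) \<le> 6 / sech_1_sq * B * h"
    proof -
      have "6 / (sech_1_sq * ln s) * (mtanh_sum (s * (ln s)^2) - mtanh_sum (s * (ln s)^2 / 2)) \<le> 6 / (sech_1_sq * ln s) * B"
        using B(2)[OF y2] sech_1_sq_pos L1 by (intro mult_left_mono) auto
      also have "\<dots> = 6 / sech_1_sq * B * (1 / ln s)" by simp
      also have "\<dots> \<le> 6 / sech_1_sq * B * h" using e(2) sech_1_sq_pos B(1) by (intro mult_left_mono) auto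
      finally show ?thesis .
    qed
    have 4: "1 / s * S2 \<le> S2 * h" using mult_left_mono[OF e(3) S0(2)] by (simp add: mult_ac)
    have 5: "2 * (s * ln s) powr (-1/4) * S3 \<le> 2 * S3 * h" using mult_left_mono[OF e(4) S0(3)] by (simp add: mult_ac)
    have yg: "s * ln s > 1" using y1 exp_gt_one[of 1] by linarith
    have ly: "ln (s * ln s) = ln s + ln (ln s)" using s1 L1 by (simp add: ln_mult)
    have lly: "ln (ln s) \<ge> 0" by (rule e(6))
    have 6: "C / ln (s * ln s) \<le> C * h"
    proof -
      have "C / ln (s * ln s) \<le> C / ln s" unfolding ly using L1 C(1) lly by (intro divide_left_mono mult_pos_pos) linarith+
      also have "\<dots> = C * (1 / ln s)" by simp
      also have "\<dots> \<le> C * h" using e(2) C(1) by (intro mult_left_mono) auto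
      finally show ?thesis .
    qed
    have Kh: "K * h = 4 * S1 * h + 4 * B * h + 6 / sech_1_sq * B * h + S2 * h + 2 * S3 * h + C * h"
      by (simp add: K_def distrib_right)
    have "\<bar>mtanh_sum (s * ln s) - (ln s + ln (ln s) - euler_mascheroni + A0)\<bar> \<le> C / ln (s * ln s)"
      using C(2)[OF yg] by (simp add: ly)
    hence "\<bar>(\<Sum>p. on_primes (\<lambda>p. ln_ratio p * tanh (s * ln_ratio p)) p)
        - (ln s + ln (ln s) - euler_mascheroni + A0 - (\<Sum>p. prime_power_term 1 p))\<bar> \<le> K * h"
      unfolding Kh se[OF s] using conjunct2[OF diff[OF s]] tp(2)[OF s] 1 2 3 4 5 6 by linarith
    thus ?case by (simp only: h_def)
  qed
  thus ?thesis using that K0 sm by blast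
qed

section \<open>Identification of the constants A1 and A2\<close>

definition tail_const :: "(nat \<Rightarrow> real) \<Rightarrow> real" where
  "tail_const \<beta> = A0 - euler_mascheroni + (\<Sum>p. on_primes (\<lambda>p. \<beta> p - ln_ratio p) p) - (\<Sum>p. prime_power_term 1 p)"

text \<open>Summing \<open>p powr (-k)\<close> over \<open>k >= 2\<close> gives
  \<open>1 / (p - 1) - 1 / p\<close>. So for \<open>val_plus\<close> the correction of the value and
  the removed prime powers cancel in \<open>tail_const\<close>.\<close>

lemma prime_power_term_1: "prime_power_term 1 p = on_primes (\<lambda>p. val_plus p - ln_ratio p) p"
proof (cases "prime p")
  case True
  hence "real p > 1" using prime_gt_1_nat by auto
  thus ?thesis using True by (simp add: prime_power_term_def val_plus_def ln_ratio_def powr_minus_divide field_simps power2_eq_square)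
qed (simp add: prime_power_term_def)

text \<open>Partial fractions, \<open>1 / (p + 1) = 1 / (p - 1) - 2 / (p^2 - 1)\<close>. Compared
  with \<open>val_plus\<close>, what is left over sums to twice the logarithmic derivative of zeta
  at 2.\<close>

lemma val_minus_minus_ln_ratio: "on_primes (\<lambda>p. val_minus p - ln_ratio p) p = prime_power_term 1 p - 2 * on_primes (\<lambda>p. ln (real p) / (real p ^ 2 - 1)) p"
proof (cases "prime p")
  case True
  hence p: "real p > 1" using prime_gt_1_nat by auto
  have "real p ^ 2 - 1 = (real p - 1) * (real p + 1)" by (simp add: power2_eq_square algebra_simps)
  moreover have "ln (real p) / (real p + 1) = ln (real p) / (real p - 1) - 2 * (ln (real p) / ((real p - 1) * (real p + 1)))"
  proof -
    define a b l where "a = real p - 1" and "b = real p + 1" and "l = ln (real p)"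
    have ab: "a \<noteq> 0" "b \<noteq> 0" "l * a = l * b - 2 * l" using p by (auto simp: a_def b_def algebra_simps)
    have "l / b = (l * a) / (a * b)" using ab(1) by simp
    also have "\<dots> = (l * b) / (a * b) - 2 * (l / (a * b))" unfolding ab(3) by (simp add: diff_divide_distrib)
    also have "(l * b) / (a * b) = l / a" using ab(2) by simp
    finally show ?thesis by (simp only: a_def b_def l_def)
  qed
  ultimately show ?thesis using True by (simp add: prime_power_term_1 val_plus_def ln_ratio_def val_minus_def)
qed (simp add: prime_power_term_1)

lemma tail_values_diff_summable: "tail_values \<beta> \<alpha> \<Longrightarrow> summable (on_primes (\<lambda>p. \<beta> p - ln_ratio p))"
proof -
  have 1: "summable (on_primes (\<lambda>p. val_plus p - ln_ratio p))"
    using prime_power_term_summable(1)[of 1] by (simp add: prime_power_term_1[abs_def])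
  moreover have "summable (on_primes (\<lambda>p. val_minus p - ln_ratio p))"
    unfolding val_minus_minus_ln_ratio[abs_def]
    by (intro summable_diff prime_power_term_summable(1) summable_mult zeta_logderiv_2_primes(2)) simp
  moreover assume "tail_values \<beta> \<alpha>"
  ultimately show ?thesis unfolding tail_values_def by auto
qed

lemma tail_const_val_plus: "- euler_mascheroni + tail_const val_plus = A2"
  by (simp add: tail_const_def A2_def prime_power_term_1)

lemma tail_const_val_minus: "euler_mascheroni + tail_const val_minus = A1"
proof -
  have "(\<Sum>p. on_primes (\<lambda>p. val_minus p - ln_ratio p) p) = (\<Sum>p. prime_power_term 1 p - 2 * on_primes (\<lambda>p. ln (real p) / (real p ^ 2 - 1)) p)"
    by (simp only: val_minus_minus_ln_ratio)
  also have "\<dots> = (\<Sum>p. prime_power_term 1 p) - 2 * (\<Sum>p. on_primes (\<lambda>p. ln (real p) / (real p ^ 2 - 1)) p)"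
    by (subst suminf_diff[symmetric], rule prime_power_term_summable(1), simp, rule summable_mult[OF zeta_logderiv_2_primes(2)],
        subst suminf_mult[OF zeta_logderiv_2_primes(2)], simp)
  finally show ?thesis by (simp add: tail_const_def A1_def zeta_logderiv_2_primes(1))
qed

lemma log_mgf_term_sum_asymp:
  assumes tail_values: "tail_values \<beta> \<alpha>"
  obtains C where "C \<ge> 0"
    "\<forall>\<^sub>F s in at_top. \<bar>(\<Sum>p. on_primes (\<lambda>p. log_mgf_term \<beta> \<alpha> p s) p) - (ln s + ln (ln s) + tail_const \<beta>)\<bar> \<le> C * (ln (ln s) / ln s)"
proof -
  obtain C where C: "C \<ge> 0" "\<And>s. s \<ge> exp 1 \<Longrightarrow> summable (on_primes (\<lambda>p. ln_ratio p * tanh (s * ln_ratio p)))"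
    "\<forall>\<^sub>F s in at_top. \<bar>(\<Sum>p. on_primes (\<lambda>p. ln_ratio p * tanh (s * ln_ratio p)) p)
        - (ln s + ln (ln s) - euler_mascheroni + A0 - (\<Sum>p. prime_power_term 1 p))\<bar> \<le> C * (ln (ln s) / ln s)"
    using tanh_sum_asymp by blast
  define S1 where "S1 = (\<Sum>p. ln (real p) * real p powr (- (3/2)))"
  have S0: "S1 \<ge> 0"
    unfolding S1_def using ln_powr_sums by (auto intro!: suminf_nonneg mult_nonneg_nonneg ln_nat_nonneg simp: sums_iff)
  let ?d = "\<lambda>s p. log_mgf_term \<beta> \<alpha> p s - ((\<beta> p - ln_ratio p) + ln_ratio p * tanh (s * ln_ratio p))"
  have d: "summable (on_primes (?d s))" "\<bar>\<Sum>p. on_primes (?d s) p\<bar> \<le> 40 * s powr (- (1/2)) * S1" if "s \<ge> exp 1" for s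
  proof -
    have s: "s > 0" using that exp_gt_zero[of "1::real"] by linarith
    have g0: "0 \<le> 40 * s powr (- (1/2)) * (ln (real p) * real p powr (- (3/2)))" for p
      using ln_nat_nonneg[of p] by simp
    show "summable (on_primes (?d s))" "\<bar>\<Sum>p. on_primes (?d s) p\<bar> \<le> 40 * s powr (- (1/2)) * S1"
      unfolding S1_def
      using on_primes_sums_bound[OF sums_mult[OF ln_powr_sums, of "40 * s powr (- (1/2))"], of "?d s"] log_mgf_term_approx[OF tail_values _ s] g0 by auto
  qed
  have se: "(\<Sum>p. on_primes (\<lambda>p. log_mgf_term \<beta> \<alpha> p s) p) = (\<Sum>p. on_primes (?d s) p) + (\<Sum>p. on_primes (\<lambda>p. \<beta> p - ln_ratio p) p) + (\<Sum>p. on_primes (\<lambda>p. ln_ratio p * tanh (s * ln_ratio p)) p)"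
    if "s \<ge> exp 1" for s
  proof -
    have "(\<lambda>p. on_primes (?d s) p + on_primes (\<lambda>p. \<beta> p - ln_ratio p) p + on_primes (\<lambda>p. ln_ratio p * tanh (s * ln_ratio p)) p) sums
      ((\<Sum>p. on_primes (?d s) p) + (\<Sum>p. on_primes (\<lambda>p. \<beta> p - ln_ratio p) p) + (\<Sum>p. on_primes (\<lambda>p. ln_ratio p * tanh (s * ln_ratio p)) p))"
      by (intro sums_add summable_sums d(1) tail_values_diff_summable[OF tail_values] C(2) that)
    moreover have "(\<lambda>p. on_primes (?d s) p + on_primes (\<lambda>p. \<beta> p - ln_ratio p) p + on_primes (\<lambda>p. ln_ratio p * tanh (s * ln_ratio p)) p) = on_primes (\<lambda>p. log_mgf_term \<beta> \<alpha> p s)"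
      by auto
    ultimately show ?thesis by (simp add: sums_iff)
  qed
  have "\<forall>\<^sub>F s::real in at_top. s powr (- (1/2)) \<le> ln (ln s) / ln s" by real_asymp
  moreover have "\<forall>\<^sub>F s::real in at_top. s \<ge> exp 1" by (rule eventually_ge_at_top)
  ultimately have "\<forall>\<^sub>F s in at_top. \<bar>(\<Sum>p. on_primes (\<lambda>p. log_mgf_term \<beta> \<alpha> p s) p) - (ln s + ln (ln s) + tail_const \<beta>)\<bar> \<le> (40 * S1 + C) * (ln (ln s) / ln s)"
    using C(3)
  proof eventually_elim
    case (elim s)
    have "40 * s powr (- (1/2)) * S1 \<le> 40 * S1 * (ln (ln s) / ln s)"
    proof -
      have "40 * S1 * s powr (- (1/2)) \<le> 40 * S1 * (ln (ln s) / ln s)" using elim(1) S0 by (intro mult_left_mono) auto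
      thus ?thesis by (simp only: mult_ac)
    qed
    thus ?case using se[OF elim(2)] d(2)[OF elim(2)] elim(3) unfolding tail_const_def distrib_right by linarith
  qed
  thus ?thesis using that[of "40 * S1 + C"] S0 C(1) by auto
qed

section \<open>The logarithmic moment generating function and its derivative\<close>

definition mgf_factor :: "(nat \<Rightarrow> real) \<Rightarrow> (nat \<Rightarrow> real) \<Rightarrow> nat \<Rightarrow> real \<Rightarrow> real" where
  "mgf_factor \<beta> \<alpha> p s = 1 / (real p + 1) + real p / (2 * (real p + 1)) * (exp (s * \<beta> p) + exp (- (s * \<alpha> p)))"

definition log_mgf :: "real \<Rightarrow> (nat \<Rightarrow> real) \<Rightarrow> (nat \<Rightarrow> real) \<Rightarrow> real \<Rightarrow> real" where
  "log_mgf \<kappa> \<beta> \<alpha> s = \<kappa> * s + (\<Sum>p. on_primes (\<lambda>p. ln (mgf_factor \<beta> \<alpha> p s)) p)"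

lemma mgf_factor_pos: "mgf_factor \<beta> \<alpha> p s > 0"
  unfolding mgf_factor_def by (intro add_pos_nonneg mult_nonneg_nonneg add_nonneg_nonneg) auto

lemma mgf_factor_deriv:
  assumes "prime p"
  shows "((\<lambda>s. ln (mgf_factor \<beta> \<alpha> p s)) has_real_derivative log_mgf_term \<beta> \<alpha> p s) (at s)"
proof -
  have p: "real p > 0" using prime_gt_0_nat[OF assms] by simp
  define E F where "E = exp (s * \<beta> p)" and "F = exp (- (s * \<alpha> p))"
  have EF: "E > 0" "F > 0" by (simp_all add: E_def F_def)
  have d: "(mgf_factor \<beta> \<alpha> p has_real_derivative real p / (2 * (real p + 1)) * (\<beta> p * E - \<alpha> p * F)) (at s)"
    unfolding mgf_factor_def[abs_def] E_def F_def
    by (rule derivative_eq_intros refl)+ (simp add: algebra_simps)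
  have v: "mgf_factor \<beta> \<alpha> p s = real p / (2 * (real p + 1)) * (E + F + 2 / real p)"
  proof -
    define P1 where "P1 = real p + 1"
    have "real p / (2 * P1) * (2 / real p) = 1 / P1" using p by simp
    thus ?thesis unfolding mgf_factor_def E_def F_def P1_def[symmetric] by (simp only: distrib_left)
  qed
  have nz: "E + F + 2 / real p \<noteq> 0" using EF p by (intro less_imp_neq[symmetric] add_pos_pos) auto
  have "((\<lambda>s. ln (mgf_factor \<beta> \<alpha> p s)) has_real_derivative
     1 / mgf_factor \<beta> \<alpha> p s * (real p / (2 * (real p + 1)) * (\<beta> p * E - \<alpha> p * F))) (at s)"
    by (rule DERIV_chain2[OF DERIV_ln_divide[OF mgf_factor_pos] d])
  also have "1 / mgf_factor \<beta> \<alpha> p s * (real p / (2 * (real p + 1)) * (\<beta> p * E - \<alpha> p * F)) = (\<beta> p * E - \<alpha> p * F) / (E + F + 2 / real p)"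
  proof -
    define q where "q = real p / (2 * (real p + 1))"
    have "q \<noteq> 0" using p by (simp add: q_def)
    thus ?thesis unfolding v q_def[symmetric] using nz by simp
  qed
  also have "\<dots> = log_mgf_term \<beta> \<alpha> p s" by (simp add: log_mgf_term_def E_def F_def)
  finally show ?thesis .
qed

text \<open>A majorant for differentiating term by term on \<open>[0, S]\<close>. Each of
  \<open>\<beta> p\<close> and \<open>\<alpha> p\<close> alone has size \<open>ln p / p\<close>,
  which is not summable over primes; the numerator is therefore written as
  \<open>(B - A) * E + A * (E - F)\<close>, where both parts are of second order in
  \<open>1 / p\<close> up to logarithms.\<close>

lemma log_mgf_term_uniform_bound:
  assumes tail_values: "tail_values \<beta> \<alpha>" and p: "prime p" and u: "0 \<le> u" "u \<le> S"
  shows "\<bar>log_mgf_term \<beta> \<alpha> p u\<bar> \<le> exp S * (8 + 8 * S) * (ln (real p) * ln (real p) * real p powr (-2))"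
proof -
  define P l where "P = real p" and "l = ln P"
  have P: "P \<ge> 2" using prime_ge_2_nat[OF p] by (simp add: P_def)
  have l: "l \<ge> 1/2" using ln_prime_ge[OF p] by (simp add: l_def P_def)
  note b = tail_values_bounds[OF tail_values p]
  define B A where "B = \<beta> p" and "A = \<alpha> p"
  have lamP: "ln_ratio p = l / P" by (simp add: ln_ratio_def l_def P_def)
  note b = b[unfolded lamP, folded B_def A_def P_def, folded l_def]
  define E F where "E = exp (u * B)" and "F = exp (- (u * A))"
  have uB: "u * B \<le> S" using mult_mono[of u S B 1] u b by auto
  have E: "E \<ge> 1" "E \<le> exp S" using u b uB by (auto simp: E_def)
  have F: "0 < F" by (simp add: F_def)
  have FE: "0 \<le> E - F" "E - F \<le> u * (A + B) * E"
  proof -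
    have "F \<le> 1" using u b by (simp add: F_def)
    thus "0 \<le> E - F" using E by simp
    have "1 - u * (A + B) \<le> exp (- (u * (A + B)))" using exp_ge_add_one_self[of "- (u * (A + B))"] by simp
    hence "E * (1 - u * (A + B)) \<le> E * exp (- (u * (A + B)))" using E by (intro mult_left_mono) auto
    also have "\<dots> = F" by (simp add: E_def F_def algebra_simps flip: exp_add)
    finally show "E - F \<le> u * (A + B) * E" by (simp add: algebra_simps)
  qed
  have num: "\<bar>B * E - A * F\<bar> \<le> exp S * (8 + 8 * S) * (l * l / P^2)"
  proof -
    have "B * E - A * F = (B - A) * E + A * (E - F)" by (simp add: algebra_simps)
    hence "\<bar>B * E - A * F\<bar> \<le> \<bar>B - A\<bar> * E + A * (E - F)"
      using abs_triangle_ineq[of "(B - A) * E" "A * (E - F)"] E b FE by (simp add: abs_mult)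
    also have "\<dots> \<le> (4 * l / P^2) * exp S + (2 * l / P) * (S * (4 * l / P) * exp S)"
    proof (intro add_mono mult_mono)
      show "\<bar>B - A\<bar> \<le> 4 * l / P^2" by (rule b)
      show "A \<le> 2 * l / P" using b by simp
      have "u * (A + B) * E \<le> S * (4 * l / P) * exp S"
        using u b E P l by (intro mult_mono) (auto simp: add_divide_distrib)
      thus "E - F \<le> S * (4 * l / P) * exp S" using FE by linarith
    qed (use E FE u b P l in auto)
    also have "\<dots> = exp S * ((4 * l + 8 * S * (l * l)) / P^2)"
      using P by (simp add: field_simps power2_eq_square)
    also have "\<dots> \<le> exp S * ((8 * (l * l) + 8 * S * (l * l)) / P^2)"
    proof (intro mult_left_mono divide_right_mono add_right_mono)
      have "l * (1/2) \<le> l * l" using l by (intro mult_left_mono) auto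
      thus "4 * l \<le> 8 * (l * l)" by simp
    qed auto
    also have "\<dots> = exp S * (8 + 8 * S) * (l * l / P^2)" by (simp add: algebra_simps add_divide_distrib)
    finally show ?thesis .
  qed
  have den: "E + F + 2 / P \<ge> 1" using E F P by (simp add: add_increasing2)
  have "\<bar>log_mgf_term \<beta> \<alpha> p u\<bar> = \<bar>B * E - A * F\<bar> / (E + F + 2 / P)"
    using den by (simp add: log_mgf_term_def E_def F_def B_def A_def P_def abs_divide)
  also have "\<dots> \<le> \<bar>B * E - A * F\<bar> / 1" using den by (intro divide_left_mono) auto
  also have "\<dots> \<le> exp S * (8 + 8 * S) * (l * l / P^2)" using num by simp
  also have "l * l / P^2 = l * l * P powr (-2)" using P by (simp add: powr_minus_divide)
  finally show ?thesis by (simp add: l_def P_def)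
qed

lemma log_mgf_deriv:
  assumes tail_values: "tail_values \<beta> \<alpha>" and s: "s > 0"
  shows "(log_mgf \<kappa> \<beta> \<alpha> has_real_derivative \<kappa> + (\<Sum>p. on_primes (\<lambda>p. log_mgf_term \<beta> \<alpha> p s) p)) (at s)"
    and "summable (on_primes (\<lambda>p. ln (mgf_factor \<beta> \<alpha> p s)))"
proof -
  define S where "S = s + 1"
  define M where "M p = exp S * (8 + 8 * S) * (ln (real p) * ln (real p) * real p powr (-2))" for p :: nat
  have M: "summable M" unfolding M_def using summable_ln2_powr[of 1] by (intro summable_mult) simp
  have M0: "M p \<ge> 0" for p using ln_nat_nonneg[of p] s by (simp add: M_def S_def)
  let ?f = "\<lambda>p s. on_primes (\<lambda>p. ln (mgf_factor \<beta> \<alpha> p s)) p"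
  let ?f' = "\<lambda>p s. on_primes (\<lambda>p. log_mgf_term \<beta> \<alpha> p s) p"
  have der: "(?f p has_real_derivative ?f' p x) (at x within {0..S})" for p x
    using mgf_factor_deriv[of p \<beta> \<alpha> x] by (cases "prime p") (auto intro: has_field_derivative_at_within)
  have bd: "norm (?f' p x) \<le> M p" if "x \<in> {0..S}" for p x
    using log_mgf_term_uniform_bound[OF tail_values, of p x S] M0[of p] that by (auto simp: M_def)
  have ul: "uniform_limit {0..S} (\<lambda>n x. \<Sum>p<n. ?f' p x) (\<lambda>x. \<Sum>p. ?f' p x) sequentially"
    by (rule Weierstrass_m_test[OF bd M])
  \<comment> \<open>At \<open>s = 0\<close> every factor is 1, which supplies the point of
    convergence that termwise differentiation starts from.\<close>
  have z: "mgf_factor \<beta> \<alpha> p 0 = 1" for p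
  proof -
    define P1 where "P1 = real p + 1"
    have "P1 > 0" "real p = P1 - 1" by (simp_all add: P1_def)
    thus ?thesis unfolding mgf_factor_def P1_def[symmetric] by (simp add: field_simps)
  qed
  have "\<exists>g. \<forall>x\<in>{0..S}. (\<lambda>p. ?f p x) sums g x \<and> (g has_field_derivative (\<Sum>p. ?f' p x)) (at x within {0..S})"
    by (rule has_field_derivative_series[OF _ der ul, of 0]) (use s in \<open>auto simp: z S_def cong: if_cong\<close>)
  then obtain g where g: "\<And>x. x \<in> {0..S} \<Longrightarrow> (\<lambda>p. ?f p x) sums g x"
     "\<And>x. x \<in> {0..S} \<Longrightarrow> (g has_field_derivative (\<Sum>p. ?f' p x)) (at x within {0..S})" by blast
  have sS: "s \<in> {0..S}" "s \<in> {0<..<S}" using s by (auto simp: S_def)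
  show "summable (on_primes (\<lambda>p. ln (mgf_factor \<beta> \<alpha> p s)))" using g(1)[OF sS(1)] by (rule sums_summable)
  have "at s within {0..S} = at s" using sS(2) by (intro at_within_interior) (auto simp: interior_atLeastAtMost_real)
  hence "(g has_real_derivative (\<Sum>p. ?f' p s)) (at s)" using g(2)[OF sS(1)] by simp
  hence "((\<lambda>s. \<kappa> * s + g s) has_real_derivative \<kappa> + (\<Sum>p. ?f' p s)) (at s)"
    by (auto intro!: derivative_eq_intros)
  thus "(log_mgf \<kappa> \<beta> \<alpha> has_real_derivative \<kappa> + (\<Sum>p. on_primes (\<lambda>p. log_mgf_term \<beta> \<alpha> p s) p)) (at s)"
    by (rule has_field_derivative_transform_within_open[of _ _ _ "{0<..<S}"])
       (use sS g(1) in \<open>auto simp: log_mgf_def sums_iff\<close>)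
qed

text \<open>The derivative of \<open>s * (ln s + ln (ln s) + A - 1)\<close> is
  \<open>ln s + ln (ln s) + A + 1 / ln s\<close>, so the difference \<open>H\<close> has a
  derivative of order \<open>h s = ln (ln s) / ln s\<close>. In place of an integral of
  \<open>h\<close> the comparison function is \<open>s * h s\<close>, whose derivative is eventually
  at least \<open>h s / 2\<close>: adding or subtracting a multiple of it makes \<open>H\<close>
  monotone.\<close>

lemma antiderivative_asymp:
  fixes F F' :: "real \<Rightarrow> real"
  assumes der: "\<And>s. s > 0 \<Longrightarrow> (F has_real_derivative F' s) (at s)"
    and C: "C \<ge> 0"
    and as: "\<forall>\<^sub>F s in at_top. \<bar>F' s - (ln s + ln (ln s) + A)\<bar> \<le> C * (ln (ln s) / ln s)"
  shows "\<forall>\<^sub>F s in at_top. \<bar>F s - s * (ln s + ln (ln s) + A - 1)\<bar> \<le> (2 * C + 3) * (s * (ln (ln s) / ln s))"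
proof -
  define h where "h s = ln (ln s) / ln s" for s :: real
  define h' where "h' s = h s + (1 - ln (ln s)) / (ln s)^2" for s :: real
  define H where "H s = F s - s * (ln s + ln (ln s) + A - 1)" for s
  define H' where "H' s = F' s - (ln s + ln (ln s) + A + 1 / ln s)" for s
  define c where "c = 2 * C + 2"
  have "\<forall>\<^sub>F s::real in at_top. 1 / ln s \<le> h s" unfolding h_def by real_asymp
  moreover have "\<forall>\<^sub>F s::real in at_top. h s / 2 \<le> h' s" unfolding h_def h'_def by real_asymp
  moreover have "\<forall>\<^sub>F s::real in at_top. s > exp 1" by (rule eventually_gt_at_top)
  ultimately have "\<forall>\<^sub>F s in at_top. \<bar>H' s\<bar> \<le> c * h' s \<and> s > exp 1"
    using as
  proof eventually_elim
    case (elim s)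
    have s1: "s > 1" using elim(3) exp_gt_one[of 1] by linarith
    have "\<bar>H' s\<bar> \<le> C * h s + 1 / ln s" using elim(4) s1 unfolding H'_def h_def[symmetric]
      by (intro order_trans[OF abs_triangle_ineq4[of "F' s - (ln s + ln (ln s) + A)" "1 / ln s", simplified diff_diff_eq]])
         (simp add: abs_of_pos)
    also have "\<dots> \<le> C * h s + h s" using elim(1) by simp
    also have "\<dots> = c * (h s / 2)" by (simp add: c_def algebra_simps)
    also have "\<dots> \<le> c * h' s" using elim(2) C by (intro mult_left_mono) (auto simp: c_def)
    finally show ?case using elim(3) by simp
  qed
  then obtain a where a: "\<And>s. s \<ge> a \<Longrightarrow> \<bar>H' s\<bar> \<le> c * h' s \<and> s > exp 1"
    by (auto simp: eventually_at_top_linorder)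
  have a1: "s > 1" "ln s > 0" if "s \<ge> a" for s
  proof -
    show "s > 1" using a[OF that] exp_gt_one[of 1] by linarith
    thus "ln s > 0" by simp
  qed
  have dH: "(H has_real_derivative H' s) (at s)" if "s \<ge> a" for s
  proof -
    have s: "s > 0" "ln s > 0" "ln s \<noteq> 0" using a1[OF that] by auto
    have "((\<lambda>s. s * (ln s + ln (ln s) + A - 1)) has_real_derivative (ln s + ln (ln s) + A + 1 / ln s)) (at s)"
      using s by (auto intro!: derivative_eq_intros simp: field_simps)
    from DERIV_diff[OF der[OF s(1)] this] show ?thesis unfolding H_def[abs_def] H'_def .
  qed
  have dh: "((\<lambda>s. s * h s) has_real_derivative h' s) (at s)" if "s \<ge> a" for s
  proof -
    have s: "s > 0" "ln s > 0" "ln s \<noteq> 0" using a1[OF that] by auto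
    show ?thesis unfolding h_def h'_def
      using s by (auto intro!: derivative_eq_intros simp: field_simps power2_eq_square)
  qed
  have up: "H s - c * (s * h s) \<le> H a - c * (a * h a)" if "s \<ge> a" for s
  proof (rule DERIV_nonpos_imp_nonincreasing[OF that])
    fix x assume x: "a \<le> x" "x \<le> s"
    have "((\<lambda>s. H s - c * (s * h s)) has_real_derivative H' x - c * h' x) (at x)"
      by (intro DERIV_diff DERIV_cmult dH dh x)
    moreover have "H' x - c * h' x \<le> 0" using a[OF x(1)] by (simp add: abs_le_iff)
    ultimately show "\<exists>y. ((\<lambda>s. H s - c * (s * h s)) has_real_derivative y) (at x) \<and> y \<le> 0" by blast
  qed
  have lo: "H a + c * (a * h a) \<le> H s + c * (s * h s)" if "s \<ge> a" for s
  proof (rule DERIV_nonneg_imp_nondecreasing[OF that])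
    fix x assume x: "a \<le> x" "x \<le> s"
    have "((\<lambda>s. H s + c * (s * h s)) has_real_derivative H' x + c * h' x) (at x)"
      by (intro DERIV_add DERIV_cmult dH dh x)
    moreover have "0 \<le> H' x + c * h' x" using a[OF x(1)] by (simp add: abs_le_iff)
    ultimately show "\<exists>y. ((\<lambda>s. H s + c * (s * h s)) has_real_derivative y) (at x) \<and> 0 \<le> y" by blast
  qed
  \<comment> \<open>The constants of integration at \<open>a\<close> are absorbed by one further
    \<open>s * h s\<close>, which tends to infinity.\<close>
  define R where "R = \<bar>H a - c * (a * h a)\<bar> + \<bar>H a + c * (a * h a)\<bar>"
  have "filterlim (\<lambda>s::real. s * h s) at_top at_top" unfolding h_def by real_asymp
  hence "\<forall>\<^sub>F s::real in at_top. R \<le> s * h s" by (simp add: filterlim_at_top)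
  moreover have "\<forall>\<^sub>F s::real in at_top. s \<ge> a" by (rule eventually_ge_at_top)
  ultimately show ?thesis
  proof eventually_elim
    case (elim s)
    have "\<bar>H s\<bar> \<le> c * (s * h s) + R" using up[OF elim(2)] lo[OF elim(2)] unfolding R_def by linarith
    also have "\<dots> \<le> c * (s * h s) + s * h s" using elim(1) by simp
    also have "\<dots> = (2 * C + 3) * (s * h s)" by (simp add: c_def algebra_simps)
    finally show ?case unfolding H_def h_def .
  qed
qed

section \<open>The random sum\<close>

text \<open>A partial sum differs from the last sum over complete blocks by at most one block of the
  majorant \<open>b\<close>, which tends to 0. Blocks between consecutive squares have length
  \<open>2 * j + 1\<close>, short enough for terms of size \<open>ln n / n\<close>.\<close>

lemma summable_square_blocks:
  fixes f b :: "nat \<Rightarrow> real"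
  assumes sm: "summable (\<lambda>j. \<Sum>n=j^2..<(Suc j)^2. f n)"
    and le: "\<And>n. \<bar>f n\<bar> \<le> b n"
    and b0: "(\<lambda>j. \<Sum>n=j^2..<(Suc j)^2. b n) \<longlonglongrightarrow> 0"
  shows "summable f"
proof -
  define j where "j N = nat \<lfloor>sqrt (real N)\<rfloor>" for N
  have j1: "(j N)^2 \<le> N" and j2: "N < (Suc (j N))^2" for N
  proof -
    have "real (j N) \<le> sqrt (real N)" by (simp add: j_def)
    hence "real (j N) ^ 2 \<le> sqrt (real N) ^ 2" by (intro power_mono) auto
    hence "real ((j N)^2) \<le> real N" by simp
    thus "(j N)^2 \<le> N" by (simp only: of_nat_le_iff)
    have "sqrt (real N) < real (Suc (j N))" unfolding j_def by (simp add: floor_less_iff[symmetric]) linarith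
    hence "sqrt (real N) ^ 2 < real (Suc (j N)) ^ 2" by (intro power_strict_mono) auto
    hence "real N < real ((Suc (j N))^2)" by simp
    thus "N < (Suc (j N))^2" by (simp only: of_nat_less_iff)
  qed
  have jt: "filterlim j at_top at_top"
    unfolding j_def by (intro filterlim_compose[OF filterlim_nat_sequentially]
      filterlim_compose[OF filterlim_floor_sequentially] filterlim_compose[OF sqrt_at_top] filterlim_real_sequentially)
  have prime_block: "(\<Sum>i<J. \<Sum>n=i^2..<(Suc i)^2. f n) = (\<Sum>n<J^2. f n)" for J
  proof (induction J)
    case (Suc J)
    have "J^2 \<le> (Suc J)^2" by (intro power_mono) auto
    hence "(\<Sum>n<(Suc J)^2. f n) = (\<Sum>n<J^2. f n) + (\<Sum>n=J^2..<(Suc J)^2. f n)"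
      using sum.atLeastLessThan_concat[of 0 "J^2" "(Suc J)^2" f] by (simp add: atLeast0LessThan del: power_Suc)
    thus ?case using Suc by simp
  qed simp
  have rem: "\<bar>(\<Sum>n<N. f n) - (\<Sum>n<(j N)^2. f n)\<bar> \<le> (\<Sum>n=(j N)^2..<(Suc (j N))^2. b n)" for N
  proof -
    have "(\<Sum>n<N. f n) = (\<Sum>n<(j N)^2. f n) + (\<Sum>n=(j N)^2..<N. f n)"
      using sum.atLeastLessThan_concat[of 0 "(j N)^2" N f] j1[of N] by (simp add: atLeast0LessThan)
    hence "\<bar>(\<Sum>n<N. f n) - (\<Sum>n<(j N)^2. f n)\<bar> = \<bar>\<Sum>n=(j N)^2..<N. f n\<bar>" by simp
    also have "\<dots> \<le> (\<Sum>n=(j N)^2..<N. \<bar>f n\<bar>)" by (rule sum_abs)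
    also have "\<dots> \<le> (\<Sum>n=(j N)^2..<N. b n)" by (intro sum_mono le)
    also have "\<dots> \<le> (\<Sum>n=(j N)^2..<(Suc (j N))^2. b n)"
      using j2[of N] le by (intro sum_mono2) (auto intro: order_trans[OF abs_ge_zero])
    finally show ?thesis .
  qed
  have "(\<lambda>J. \<Sum>i<J. \<Sum>n=i^2..<(Suc i)^2. f n) \<longlonglongrightarrow> (\<Sum>j. \<Sum>n=j^2..<(Suc j)^2. f n)"
    by (rule summable_LIMSEQ[OF sm])
  from filterlim_compose[OF this jt]
  have 1: "(\<lambda>N. \<Sum>n<(j N)^2. f n) \<longlonglongrightarrow> (\<Sum>j. \<Sum>n=j^2..<(Suc j)^2. f n)" unfolding prime_block .
  have 2: "(\<lambda>N. (\<Sum>n<N. f n) - (\<Sum>n<(j N)^2. f n)) \<longlonglongrightarrow> 0"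
    by (rule Lim_null_comparison[OF _ filterlim_compose[OF b0 jt]]) (use rem in \<open>auto intro!: always_eventually\<close>)
  from tendsto_add[OF 2 1] show ?thesis by (auto simp: summable_def sums_def)
qed

text \<open>By monotone convergence the sum of the absolute values has finite expectation, hence is
  finite almost everywhere.\<close>

lemma (in prob_space) AE_summable_of_expectation:
  fixes D :: "nat \<Rightarrow> 'a \<Rightarrow> real"
  assumes int: "\<And>j. integrable M (D j)" and sm: "summable (\<lambda>j. expectation (\<lambda>\<omega>. \<bar>D j \<omega>\<bar>))"
  shows "AE \<omega> in M. summable (\<lambda>j. D j \<omega>)"
proof -
  have [measurable]: "D j \<in> borel_measurable M" for j using int by auto
  have "(\<integral>\<^sup>+\<omega>. (\<Sum>j. ennreal \<bar>D j \<omega>\<bar>) \<partial>M) = (\<Sum>j. \<integral>\<^sup>+\<omega>. ennreal \<bar>D j \<omega>\<bar> \<partial>M)"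
    by (rule nn_integral_suminf) measurable
  also have "\<dots> = (\<Sum>j. ennreal (expectation (\<lambda>\<omega>. \<bar>D j \<omega>\<bar>)))"
    by (intro suminf_cong nn_integral_eq_integral integrable_abs int) auto
  also have "\<dots> = ennreal (\<Sum>j. expectation (\<lambda>\<omega>. \<bar>D j \<omega>\<bar>))"
    by (rule suminf_ennreal2[OF _ sm]) (intro integral_nonneg_AE AE_I2, simp)
  finally have "(\<integral>\<^sup>+\<omega>. (\<Sum>j. ennreal \<bar>D j \<omega>\<bar>) \<partial>M) \<noteq> \<infinity>" by simp
  hence "AE \<omega> in M. (\<Sum>j. ennreal \<bar>D j \<omega>\<bar>) \<noteq> \<infinity>"
    by (intro nn_integral_PInf_AE) measurable
  thus ?thesis
  proof eventually_elim
    case (elim \<omega>)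
    have "summable (\<lambda>j. \<bar>D j \<omega>\<bar>)"
      using elim by (intro summable_suminf_not_top) (auto simp: top_ennreal_def infinity_ennreal_def)
    thus ?case by (rule summable_rabs_cancel)
  qed
qed

lemma exp_le_quadratic: "\<bar>x\<bar> \<le> 1 \<Longrightarrow> exp x \<le> 1 + x + x^2" for x :: real
proof (cases "x \<ge> 0")
  case True
  assume "\<bar>x\<bar> \<le> 1"
  thus ?thesis using exp_bound[of x] True by simp
next
  case False
  assume a: "\<bar>x\<bar> \<le> 1"
  define y where "y = - x"
  have y: "0 \<le> y" "y \<le> 1" using a False by (auto simp: y_def)
  have "1 + y \<le> exp y" by (rule exp_ge_add_one_self)
  hence "exp (- y) \<le> 1 / (1 + y)" using y by (simp add: exp_minus field_simps)
  also have "\<dots> \<le> 1 - y + y^2"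
  proof -
    have "1 \<le> (1 - y + y^2) * (1 + y)" using y by (simp add: algebra_simps power2_eq_square)
    thus ?thesis using y by (simp add: divide_le_eq)
  qed
  finally show ?thesis by (simp add: y_def)
qed

lemma inverse_real_Suc: "1 / (real p + 1) = 1 - 2 * (real p / (2 * (real p + 1)))"
proof -
  define d where "d = real p + 1"
  have "d > 0" "real p = d - 1" by (auto simp: d_def)
  thus ?thesis unfolding d_def[symmetric] by (simp add: field_simps)
qed

text \<open>The linear terms of the two exponentials almost cancel, since
  \<open>\<beta> p - \<alpha> p\<close> is of order \<open>ln p / p^2\<close>; what remains is the
  quadratic term. The smallness of \<open>\<bar>t\<bar> * ln_ratio p\<close> puts both arguments in
  the range of the quadratic bound for exp.\<close>

lemma mgf_factor_le:
  assumes tail_values: "tail_values \<beta> \<alpha>" and p: "prime p" and t: "\<bar>t\<bar> * (2 * ln_ratio p) \<le> 1"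
  shows "mgf_factor \<beta> \<alpha> p t \<le> exp (\<bar>t\<bar> * (4 * ln (real p) / real p ^ 2) + t^2 * (8 * (ln_ratio p)^2))"
proof -
  note b = tail_values_bounds[OF tail_values p]
  define q where "q = real p / (2 * (real p + 1))"
  have q: "0 \<le> q" "q \<le> 1" by (auto simp: q_def divide_le_eq)
  have q2: "1 / (real p + 1) = 1 - 2 * q" unfolding q_def using inverse_real_Suc .
  have le: "\<bar>t * x\<bar> \<le> 1" if "0 < x" "x \<le> 2 * ln_ratio p" for x
    using t mult_left_mono[OF that(2), of "\<bar>t\<bar>"] that(1) by (simp add: abs_mult)
  have sq: "x^2 \<le> 4 * (ln_ratio p)^2" if "0 < x" "x \<le> 2 * ln_ratio p" for x
    using power_mono[OF that(2), of 2] that by (simp add: power_mult_distrib)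
  have e1: "exp (t * \<beta> p) \<le> 1 + t * \<beta> p + (t * \<beta> p)^2" by (rule exp_le_quadratic[OF le]) (use b in auto)
  have e2: "exp (t * - \<alpha> p) \<le> 1 + t * - \<alpha> p + (t * - \<alpha> p)^2" using exp_le_quadratic[of "t * - \<alpha> p"] le[of "\<alpha> p"] b by simp
  have "exp (t * \<beta> p) + exp (- (t * \<alpha> p)) \<le> 2 + (t * (\<beta> p - \<alpha> p) + t^2 * (\<beta> p ^ 2 + \<alpha> p ^ 2))"
    using e1 e2 by (simp add: algebra_simps power_mult_distrib)
  also have "t * (\<beta> p - \<alpha> p) \<le> \<bar>t\<bar> * (4 * ln (real p) / real p ^ 2)"
    using abs_ge_self[of "t * (\<beta> p - \<alpha> p)"] mult_left_mono[OF b(9), of "\<bar>t\<bar>"] by (simp add: abs_mult)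
  also have "t^2 * (\<beta> p ^ 2 + \<alpha> p ^ 2) \<le> t^2 * (8 * (ln_ratio p)^2)"
    using sq[of "\<beta> p"] sq[of "\<alpha> p"] b by (intro mult_left_mono) auto
  finally have s: "exp (t * \<beta> p) + exp (- (t * \<alpha> p)) \<le> 2 + (\<bar>t\<bar> * (4 * ln (real p) / real p ^ 2) + t^2 * (8 * (ln_ratio p)^2))" by simp
  define Q where "Q = \<bar>t\<bar> * (4 * ln (real p) / real p ^ 2) + t^2 * (8 * (ln_ratio p)^2)"
  have Q: "Q \<ge> 0" unfolding Q_def using ln_nat_nonneg[of p] by simp
  have "mgf_factor \<beta> \<alpha> p t = 1 - 2 * q + q * (exp (t * \<beta> p) + exp (- (t * \<alpha> p)))"
    unfolding mgf_factor_def q2 q_def[symmetric] by simp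
  also have "\<dots> \<le> 1 - 2 * q + q * (2 + Q)" using s q by (intro add_left_mono mult_left_mono) (auto simp: Q_def)
  also have "\<dots> \<le> 1 + Q" using mult_left_le_one_le[OF Q q] by (simp add: distrib_left)
  also have "\<dots> \<le> exp Q" by (rule exp_ge_add_one_self)
  finally show ?thesis by (simp add: Q_def)
qed

lemma (in prob_space) AE_three_values:
  fixes Z :: "'a \<Rightarrow> real"
  assumes [measurable]: "Z \<in> borel_measurable M" and ne: "a \<noteq> b" "a \<noteq> c" "b \<noteq> c"
    and sum: "prob {\<omega>\<in>space M. Z \<omega> = a} + (prob {\<omega>\<in>space M. Z \<omega> = b} + prob {\<omega>\<in>space M. Z \<omega> = c}) = 1"
  shows "AE \<omega> in M. Z \<omega> = a \<or> Z \<omega> = b \<or> Z \<omega> = c"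
proof -
  let ?S = "\<lambda>v. {\<omega>\<in>space M. Z \<omega> = v}"
  have "prob (?S a \<union> (?S b \<union> ?S c)) = prob (?S a) + prob (?S b \<union> ?S c)"
    using ne by (intro finite_measure_Union) auto
  also have "prob (?S b \<union> ?S c) = prob (?S b) + prob (?S c)"
    using ne by (intro finite_measure_Union) auto
  finally have "prob {\<omega>\<in>space M. Z \<omega> = a \<or> Z \<omega> = b \<or> Z \<omega> = c} = 1"
    using sum by (simp add: Collect_disj_eq[symmetric] conj_disj_distribL[symmetric] Un_def)
  thus ?thesis by (subst (asm) prob_Collect_eq_1) auto
qed

text \<open>The summands are oriented so that the positive value is \<open>\<beta> p\<close>; both
  tails of the original variable become right tails of a sum of this type.\<close>

locale prime_sum = prob_space M for M :: "'a measure" +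
  fixes Y :: "nat \<Rightarrow> 'a \<Rightarrow> real" and \<beta> \<alpha> :: "nat \<Rightarrow> real"
  assumes tail_values: "tail_values \<beta> \<alpha>"
    and indep: "indep_vars (\<lambda>_. borel) Y {p. prime p}"
    and Yb: "\<And>p. prime p \<Longrightarrow> prob {\<omega>\<in>space M. Y p \<omega> = \<beta> p} = real p / (2 * (real p + 1))"
    and Ya: "\<And>p. prime p \<Longrightarrow> prob {\<omega>\<in>space M. Y p \<omega> = - \<alpha> p} = real p / (2 * (real p + 1))"
    and Y0: "\<And>p. prime p \<Longrightarrow> prob {\<omega>\<in>space M. Y p \<omega> = 0} = 1 / (real p + 1)"
begin

lemma Y_rv [measurable]: "prime p \<Longrightarrow> Y p \<in> borel_measurable M"
  using indep unfolding indep_vars_def by auto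

lemma Y_AE: assumes p: "prime p" shows "AE \<omega> in M. Y p \<omega> = \<beta> p \<or> Y p \<omega> = - \<alpha> p \<or> Y p \<omega> = 0"
proof (rule AE_three_values[OF Y_rv[OF p]])
  show "prob {\<omega>\<in>space M. Y p \<omega> = \<beta> p} + (prob {\<omega>\<in>space M. Y p \<omega> = - \<alpha> p} + prob {\<omega>\<in>space M. Y p \<omega> = 0}) = 1"
    unfolding Yb[OF p] Ya[OF p] Y0[OF p] inverse_real_Suc by linarith
qed (use tail_values_bounds[OF tail_values p] in auto)

lemma Y_expectation:
  assumes p: "prime p" and f[measurable]: "f \<in> borel_measurable borel"
  shows "integrable M (\<lambda>\<omega>. f (Y p \<omega>))"
    and "expectation (\<lambda>\<omega>. f (Y p \<omega>)) = real p / (2 * (real p + 1)) * (f (\<beta> p) + f (- \<alpha> p)) + 1 / (real p + 1) * (f 0 :: real)"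
proof -
  note [measurable] = Y_rv[OF p]
  note b = tail_values_bounds[OF tail_values p]
  let ?S = "\<lambda>v. {\<omega>\<in>space M. Y p \<omega> = v}"
  let ?g = "\<lambda>\<omega>. f (\<beta> p) * indicator (?S (\<beta> p)) \<omega> + f (- \<alpha> p) * indicator (?S (- \<alpha> p)) \<omega> + f 0 * indicator (?S 0) \<omega>"
  have ae: "AE \<omega> in M. f (Y p \<omega>) = ?g \<omega>"
    using Y_AE[OF p] AE_space
  proof eventually_elim
    case (elim \<omega>)
    thus ?case using b by (auto simp: indicator_def)
  qed
  have gi: "integrable M ?g"
    by (intro Bochner_Integration.integrable_add integrable_mult_right integrable_real_indicator) (auto simp: emeasure_eq_measure)
  show "integrable M (\<lambda>\<omega>. f (Y p \<omega>))"
    by (subst integrable_cong_AE[OF _ _ ae]) (use gi in auto)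
  have "expectation (\<lambda>\<omega>. f (Y p \<omega>)) = expectation ?g"
    by (rule integral_cong_AE[OF _ _ ae]) auto
  also have "\<dots> = f (\<beta> p) * prob (?S (\<beta> p)) + f (- \<alpha> p) * prob (?S (- \<alpha> p)) + f 0 * prob (?S 0)"
    by (subst Bochner_Integration.integral_add, intro Bochner_Integration.integrable_add integrable_mult_right integrable_real_indicator;
        (auto simp: emeasure_eq_measure)?)+
  finally show "expectation (\<lambda>\<omega>. f (Y p \<omega>)) = real p / (2 * (real p + 1)) * (f (\<beta> p) + f (- \<alpha> p)) + 1 / (real p + 1) * f 0"
    unfolding Yb[OF p] Ya[OF p] Y0[OF p] by (simp only: distrib_left mult.commute[of "f _"] )
qed

lemma mgf:
  assumes I: "finite I" "I \<subseteq> {p. prime p}"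
  shows "integrable M (\<lambda>\<omega>. exp (t * (\<Sum>p\<in>I. Y p \<omega>)))"
    and "expectation (\<lambda>\<omega>. exp (t * (\<Sum>p\<in>I. Y p \<omega>))) = (\<Prod>p\<in>I. mgf_factor \<beta> \<alpha> p t)"
proof -
  have e: "exp (t * (\<Sum>p\<in>I. Y p \<omega>)) = (\<Prod>p\<in>I. exp (t * Y p \<omega>))" for \<omega>
    by (simp add: sum_distrib_left exp_sum I)
  have ind: "indep_vars (\<lambda>_. borel) (\<lambda>p \<omega>. exp (t * Y p \<omega>)) I"
    by (rule indep_vars_compose2[OF indep_vars_subset[OF indep I(2)], of "\<lambda>_ x. exp (t * x)"]) measurable
  have m: "(\<lambda>x. exp (t * x)) \<in> borel_measurable borel" by measurable
  have int: "integrable M (\<lambda>\<omega>. exp (t * Y p \<omega>))" if "p \<in> I" for p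
    using Y_expectation(1)[OF _ m, of p] that I by auto
  show "integrable M (\<lambda>\<omega>. exp (t * (\<Sum>p\<in>I. Y p \<omega>)))"
    unfolding e by (rule indep_vars_integrable[OF I(1) ind int])
  have "expectation (\<lambda>\<omega>. exp (t * (\<Sum>p\<in>I. Y p \<omega>))) = (\<Prod>p\<in>I. expectation (\<lambda>\<omega>. exp (t * Y p \<omega>)))"
    unfolding e by (rule indep_vars_lebesgue_integral[OF I(1) ind int])
  also have "\<dots> = (\<Prod>p\<in>I. mgf_factor \<beta> \<alpha> p t)"
  proof (intro prod.cong refl)
    fix p assume "p \<in> I"
    hence "prime p" using I by auto
    thus "expectation (\<lambda>\<omega>. exp (t * Y p \<omega>)) = mgf_factor \<beta> \<alpha> p t"
      using Y_expectation(2)[OF _ m, of p] by (simp add: mgf_factor_def add.commute)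
  qed
  finally show "expectation (\<lambda>\<omega>. exp (t * (\<Sum>p\<in>I. Y p \<omega>))) = (\<Prod>p\<in>I. mgf_factor \<beta> \<alpha> p t)" .
qed

definition prime_block :: "nat \<Rightarrow> nat set" where "prime_block j = {p \<in> {j^2..<(Suc j)^2}. prime p}"

lemma prime_block: "finite (prime_block j)" "prime_block j \<subseteq> {p. prime p}"
  by (auto simp: prime_block_def)

text \<open>Since \<open>\<bar>x\<bar> \<le> (exp (t x) + exp (-t x)) / t\<close>, the moment generating function at \<open>t = j\<^bsup>5/4\<^esup> / 32\<close>
  controls the absolute moment of a block.\<close>

lemma prime_block_abs_expectation:
  assumes j: "j \<ge> 1"
  shows "integrable M (\<lambda>\<omega>. \<Sum>p\<in>prime_block j. Y p \<omega>)"
    and "expectation (\<lambda>\<omega>. \<bar>\<Sum>p\<in>prime_block j. Y p \<omega>\<bar>) \<le> 64 * exp 12 * real j powr (- (5/4))"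
proof -
  define J where "J = real j"
  have J: "J \<ge> 1" using j by (simp add: J_def)
  \<comment> \<open>The exponent 5/4 exceeds 1, so \<open>1 / t\<close> is summable over the blocks,
    yet it is small enough that \<open>t^2 * (ln_ratio p)^2\<close> stays below a multiple of
    \<open>1 / j\<close> for primes \<open>p >= j^2\<close>. The 32 cancels the
    \<open>2 * 16\<close> in the bound on \<open>2 * ln_ratio p\<close>.\<close>
  define t where "t = J powr (5/4) / 32"
  have t: "t > 0" using J by (simp add: t_def)
  let ?D = "\<lambda>\<omega>. \<Sum>p\<in>prime_block j. Y p \<omega>"
  have yi: "integrable M (Y p)" if "prime p" for p using Y_expectation(1)[OF that, of "\<lambda>x. x"] by simp
  show Di: "integrable M ?D" by (intro Bochner_Integration.integrable_sum yi) (auto simp: prime_block_def)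
  have card: "real (card (prime_block j)) \<le> 3 * J"
  proof -
    have "card (prime_block j) \<le> card {j^2..<(Suc j)^2}" unfolding prime_block_def by (intro card_mono) auto
    also have "\<dots> = 2 * j + 1" by (simp add: power2_eq_square)
    finally show ?thesis using J j unfolding J_def by linarith
  qed
  \<comment> \<open>A factor \<open>exp (4 / J)\<close> for each of at most \<open>3 * J\<close>
    primes yields the constant \<open>exp 12\<close>.\<close>
  have mb: "mgf_factor \<beta> \<alpha> p u \<le> exp (4 / J)" if u: "\<bar>u\<bar> = t" and p: "p \<in> prime_block j" for u p
  proof -
    define P where "P = real p"
    have pp: "prime p" and Pj: "P \<ge> J powr 2" using p J by (auto simp: prime_block_def P_def J_def powr_numeral of_nat_power[symmetric] simp del: of_nat_power)
    have P: "P \<ge> 2" using prime_ge_2_nat[OF pp] by (simp add: P_def)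
    \<comment> \<open>The power 1/16 leaves the decay 15/8 for \<open>ln_ratio\<close>, and
      \<open>2 * (15/8 - 5/4) = 5/4\<close> still exceeds 1.\<close>
    have "ln P \<le> P powr (1/16) / (1/16)"
      using ln_le_powr[of "1/16" "p - 1"] P by (simp add: P_def)
    hence lnP: "ln P \<le> 16 * P powr (1/16)" by simp
    have ln_ratio: "ln_ratio p \<le> 16 * J powr (- (15/8))"
    proof -
      have "ln_ratio p \<le> 16 * P powr (1/16) / P" unfolding ln_ratio_def P_def[symmetric] using lnP P by (intro divide_right_mono) auto
      also have "\<dots> = 16 * P powr (- (15/16))" using P powr_diff[of P "1/16" 1] by simp
      also have "\<dots> \<le> 16 * (J powr 2) powr (- (15/16))" using Pj J by (intro mult_left_mono powr_mono2') auto
      also have "\<dots> = 16 * J powr (- (15/8))" by (simp add: powr_powr)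
      finally show ?thesis .
    qed
    have lam0: "0 \<le> ln_ratio p" by (simp add: ln_ratio_def ln_nat_nonneg)
    have l2: "4 * ln P / P^2 \<le> 64 * J powr (- (31/8))"
    proof -
      have "4 * ln P / P^2 \<le> 4 * (16 * P powr (1/16)) / P^2" using lnP by (intro divide_right_mono) auto
      also have "\<dots> = 64 * P powr (- (31/16))" using P powr_diff[of P "1/16" 2] by simp
      also have "\<dots> \<le> 64 * (J powr 2) powr (- (31/16))" using Pj J by (intro mult_left_mono powr_mono2') auto
      also have "\<dots> = 64 * J powr (- (31/8))" by (simp add: powr_powr)
      finally show ?thesis .
    qed
    have small: "J powr e \<le> 1" if "e \<le> 0" for e using that J powr_mono[of e 0 J] by simp
    have 1: "\<bar>u\<bar> * (2 * ln_ratio p) \<le> 1"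
    proof -
      have "\<bar>u\<bar> * (2 * ln_ratio p) \<le> t * (2 * (16 * J powr (- (15/8))))"
        unfolding u using ln_ratio t by (intro mult_left_mono) auto
      also have "\<dots> = J powr (5/4) * J powr (- (15/8))" by (simp add: t_def)
      also have "\<dots> = J powr (- (5/8))" by (simp flip: powr_add)
      also have "\<dots> \<le> 1" by (rule small) simp
      finally show ?thesis .
    qed
    have 2: "\<bar>u\<bar> * (4 * ln P / P^2) \<le> 2 / J"
    proof -
      have "\<bar>u\<bar> * (4 * ln P / P^2) \<le> t * (64 * J powr (- (31/8)))" unfolding u using l2 t by (intro mult_left_mono) auto
      also have "\<dots> = 2 * (J powr (5/4) * J powr (- (31/8)))" by (simp add: t_def)
      also have "\<dots> = 2 * J powr (- (21/8))" by (simp flip: powr_add)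
      also have "\<dots> \<le> 2 * J powr (-1)" using J by (intro mult_left_mono powr_mono) auto
      finally show ?thesis using J by (simp add: powr_minus_divide)
    qed
    have 3: "u^2 * (8 * (ln_ratio p)^2) \<le> 2 / J"
    proof -
      have "u^2 * (8 * (ln_ratio p)^2) = 8 * (\<bar>u\<bar> * ln_ratio p)^2" by (simp add: power_mult_distrib)
      also have "\<dots> \<le> 8 * (t * (16 * J powr (- (15/8))))^2"
        unfolding u using ln_ratio lam0 t by (intro mult_left_mono power_mono mult_nonneg_nonneg) auto
      also have "t * (16 * J powr (- (15/8))) = J powr (- (5/8)) / 2" by (simp add: t_def flip: powr_add)
      also have "8 * (J powr (- (5/8)) / 2)^2 = 2 * J powr (- (5/4))" by (simp add: power2_eq_square flip: powr_add)
      also have "\<dots> \<le> 2 * J powr (-1)" using J by (intro mult_left_mono powr_mono) auto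
      finally show ?thesis using J by (simp add: powr_minus_divide)
    qed
    have "mgf_factor \<beta> \<alpha> p u \<le> exp (\<bar>u\<bar> * (4 * ln (real p) / real p ^ 2) + u^2 * (8 * (ln_ratio p)^2))"
      by (rule mgf_factor_le[OF tail_values pp 1])
    also have "\<dots> \<le> exp (4 / J)" using 2 3 by (simp add: P_def[symmetric])
    finally show ?thesis .
  qed
  have E: "expectation (\<lambda>\<omega>. exp (u * ?D \<omega>)) \<le> exp 12" if u: "\<bar>u\<bar> = t" for u
  proof -
    have "expectation (\<lambda>\<omega>. exp (u * ?D \<omega>)) = (\<Prod>p\<in>prime_block j. mgf_factor \<beta> \<alpha> p u)" by (rule mgf(2)[OF prime_block])
    also have "\<dots> \<le> (\<Prod>p\<in>prime_block j. exp (4 / J))"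
      by (intro prod_mono conjI mb[OF u] less_imp_le[OF mgf_factor_pos])
    also have "\<dots> = exp (real (card (prime_block j)) * (4 / J))" by (simp only: exp_of_nat_mult prod_constant)
    also have "\<dots> \<le> exp 12" using mult_right_mono[OF card, of "4 / J"] J by simp
    finally show ?thesis .
  qed
  have pt: "\<bar>x\<bar> \<le> (1 / t) * (exp (t * x) + exp (- t * x))" for x
  proof -
    have "t * \<bar>x\<bar> \<le> exp (t * x) + exp (- t * x)"
    proof (cases "x \<ge> 0")
      case True
      thus ?thesis using exp_ge_add_one_self[of "t * x"] exp_gt_zero[of "- t * x"] unfolding abs_of_nonneg[OF True] by linarith
    next
      case False
      hence ax: "t * \<bar>x\<bar> = - t * x" by simp
      show ?thesis using exp_ge_add_one_self[of "- t * x"] exp_gt_zero[of "t * x"] unfolding ax by linarith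
    qed
    thus ?thesis using t by (simp add: field_simps)
  qed
  have "expectation (\<lambda>\<omega>. \<bar>?D \<omega>\<bar>) \<le> expectation (\<lambda>\<omega>. (1 / t) * (exp (t * ?D \<omega>) + exp (- t * ?D \<omega>)))"
    by (rule integral_mono[OF integrable_abs[OF Di] _ pt])
       (intro integrable_mult_right Bochner_Integration.integrable_add mgf(1)[OF prime_block])
  also have "\<dots> = (1 / t) * (expectation (\<lambda>\<omega>. exp (t * ?D \<omega>)) + expectation (\<lambda>\<omega>. exp (- t * ?D \<omega>)))"
    by (simp only: integral_mult_right_zero Bochner_Integration.integral_add[OF mgf(1)[OF prime_block] mgf(1)[OF prime_block]])
  also have "\<dots> \<le> (1 / t) * (exp 12 + exp 12)"
    using t by (intro mult_left_mono add_mono E) auto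
  also have "\<dots> = 64 * exp 12 * real j powr (- (5/4))"
    using J by (simp add: t_def J_def powr_minus_divide)
  finally show "expectation (\<lambda>\<omega>. \<bar>?D \<omega>\<bar>) \<le> 64 * exp 12 * real j powr (- (5/4))" .
qed

text \<open>The absolute block sums have expectations of order \<open>j powr (-5/4)\<close>, so the
  blocks are almost surely summable. To pass to the series itself, the bound
  \<open>2 * ln_ratio p\<close> on the modulus of \<open>Y p\<close> limits a block to
  \<open>2 * j + 1\<close> terms of size \<open>j powr (-3/2)\<close>, a total that tends to
  0.\<close>

lemma AE_Y_summable: "AE \<omega> in M. summable (on_primes (\<lambda>p. Y p \<omega>))"
proof -
  \<comment> \<open>Blocks are indexed from 1, where the moment bound holds; the block at 0 is
    restored below by shifting the series.\<close>
  let ?D = "\<lambda>j \<omega>. \<Sum>p\<in>prime_block (Suc j). Y p \<omega>"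
  have "AE \<omega> in M. summable (\<lambda>j. ?D j \<omega>)"
  proof (rule AE_summable_of_expectation)
    show "integrable M (?D j)" for j by (rule prime_block_abs_expectation(1)) simp
    have "summable (\<lambda>j. real j powr (- (5/4)))" by (subst summable_real_powr_iff) simp
    hence "summable (\<lambda>j. 64 * exp 12 * real (Suc j) powr (- (5/4)))"
      by (intro summable_mult) (subst summable_Suc_iff)
    thus "summable (\<lambda>j. expectation (\<lambda>\<omega>. \<bar>?D j \<omega>\<bar>))"
      by (rule summable_comparison_test') (use prime_block_abs_expectation(2)[of "Suc _"] in auto)
  qed
  moreover have "AE \<omega> in M. \<forall>p. prime p \<longrightarrow> \<bar>Y p \<omega>\<bar> \<le> 2 * ln_ratio p"
  proof (subst AE_all_countable, intro allI)
    fix p show "AE \<omega> in M. prime p \<longrightarrow> \<bar>Y p \<omega>\<bar> \<le> 2 * ln_ratio p"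
    proof (cases "prime p")
      case True
      show ?thesis using Y_AE[OF True]
        by eventually_elim (use tail_values_bounds[OF tail_values True] in auto)
    qed simp
  qed
  ultimately show ?thesis
  proof eventually_elim
    case (elim \<omega>)
    let ?f = "on_primes (\<lambda>p. Y p \<omega>)"
    have bl: "(\<Sum>n=j^2..<(Suc j)^2. ?f n) = (\<Sum>p\<in>prime_block j. Y p \<omega>)" for j
      unfolding prime_block_def by (rule sum.inter_filter[symmetric]) simp
    show ?case
    proof (rule summable_square_blocks)
      have "summable (\<lambda>j. \<Sum>p\<in>prime_block j. Y p \<omega>)"
        using elim(1) by (subst (asm) summable_Suc_iff)
      thus "summable (\<lambda>j. \<Sum>n=j^2..<(Suc j)^2. ?f n)" unfolding bl .
      have l0: "ln_ratio n \<ge> 0" for n by (simp add: ln_ratio_def ln_nat_nonneg)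
      show "\<bar>?f n\<bar> \<le> 2 * ln_ratio n" for n using elim(2) l0[of n] by auto
      have bd: "norm (\<Sum>n=j^2..<(Suc j)^2. 2 * ln_ratio n) \<le> (2 * real j + 1) * (8 * real j powr (- (3/2)))" if j: "j \<ge> 1" for j
      proof -
        have "(\<Sum>n=j^2..<(Suc j)^2. 2 * ln_ratio n) \<le> (\<Sum>n=j^2..<(Suc j)^2. 8 * real j powr (- (3/2)))"
        proof (rule sum_mono)
          fix n assume n: "n \<in> {j^2..<(Suc j)^2}"
          have nj: "real n \<ge> real j powr 2" using n j by (auto simp: powr_numeral of_nat_power[symmetric] simp del: of_nat_power)
          have n1: "n \<ge> 1" using n j by (metis atLeastLessThan_iff le_trans one_le_power)
          have "ln (real n) \<le> 4 * real n powr (1/4)" using ln_le_powr[of "1/4" "n - 1"] n1 by simp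
          hence "2 * ln_ratio n \<le> 2 * (4 * real n powr (1/4) / real n)"
            unfolding ln_ratio_def by (intro mult_left_mono divide_right_mono) auto
          also have "\<dots> = 8 * real n powr (- (3/4))" using n1 powr_diff[of "real n" "1/4" 1] by simp
          also have "\<dots> \<le> 8 * (real j powr 2) powr (- (3/4))" using nj j by (intro mult_left_mono powr_mono2') auto
          also have "\<dots> = 8 * real j powr (- (3/2))" unfolding powr_powr by simp
          finally show "2 * ln_ratio n \<le> 8 * real j powr (- (3/2))" .
        qed
        also have "\<dots> = (2 * real j + 1) * (8 * real j powr (- (3/2)))" by (simp add: power2_eq_square algebra_simps)
        finally show ?thesis using l0 by (simp add: sum_nonneg)
      qed
      show "(\<lambda>j. \<Sum>n=j^2..<(Suc j)^2. 2 * ln_ratio n) \<longlonglongrightarrow> 0"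
      proof (rule Lim_null_comparison)
        show "\<forall>\<^sub>F j in sequentially. norm (\<Sum>n=j^2..<(Suc j)^2. 2 * ln_ratio n) \<le> (2 * real j + 1) * (8 * real j powr (- (3/2)))"
          using bd by (auto simp: eventually_sequentially)
        show "(\<lambda>j. (2 * real j + 1) * (8 * real j powr (- (3/2)))) \<longlonglongrightarrow> 0" by real_asymp
      qed
    qed
  qed
qed

lemma partial_mgf:
  shows "integrable M (\<lambda>\<omega>. exp (t * (\<kappa> + (\<Sum>n<N. on_primes (\<lambda>p. Y p \<omega>) n))))"
    and "expectation (\<lambda>\<omega>. exp (t * (\<kappa> + (\<Sum>n<N. on_primes (\<lambda>p. Y p \<omega>) n))))
      = exp (\<kappa> * t + (\<Sum>n<N. on_primes (\<lambda>p. ln (mgf_factor \<beta> \<alpha> p t)) n))"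
proof -
  define I where "I = {p\<in>{..<N}. prime p}"
  have I: "finite I" "I \<subseteq> {p. prime p}" by (auto simp: I_def)
  have s: "(\<Sum>n<N. on_primes f n) = (\<Sum>p\<in>I. f p)" for f :: "nat \<Rightarrow> real"
    unfolding I_def by (rule sum.inter_filter[symmetric]) simp
  have e: "exp (t * (\<kappa> + (\<Sum>n<N. on_primes (\<lambda>p. Y p \<omega>) n))) = exp (\<kappa> * t) * exp (t * (\<Sum>p\<in>I. Y p \<omega>))" for \<omega>
    unfolding s by (simp add: distrib_left exp_add mult.commute)
  show "integrable M (\<lambda>\<omega>. exp (t * (\<kappa> + (\<Sum>n<N. on_primes (\<lambda>p. Y p \<omega>) n))))"
    unfolding e by (intro integrable_mult_right mgf(1)[OF I])
  have "expectation (\<lambda>\<omega>. exp (t * (\<kappa> + (\<Sum>n<N. on_primes (\<lambda>p. Y p \<omega>) n)))) = exp (\<kappa> * t) * (\<Prod>p\<in>I. mgf_factor \<beta> \<alpha> p t)"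
    unfolding e by (simp add: mgf(2)[OF I])
  also have "(\<Prod>p\<in>I. mgf_factor \<beta> \<alpha> p t) = exp (\<Sum>p\<in>I. ln (mgf_factor \<beta> \<alpha> p t))"
    by (simp add: exp_sum I mgf_factor_pos)
  finally show "expectation (\<lambda>\<omega>. exp (t * (\<kappa> + (\<Sum>n<N. on_primes (\<lambda>p. Y p \<omega>) n))))
      = exp (\<kappa> * t + (\<Sum>n<N. on_primes (\<lambda>p. ln (mgf_factor \<beta> \<alpha> p t)) n))"
    unfolding s by (simp add: exp_add)
qed

text \<open>The tail bounds pass to the limit through bounded continuous functions of
  \<open>W\<close>; in them this limit of moments takes the place of the moment generating function
  of \<open>W\<close>.\<close>

lemma partial_mgf_tendsto:
  assumes "t > 0"
  shows "(\<lambda>N. expectation (\<lambda>\<omega>. exp (t * (\<kappa> + (\<Sum>n<N. on_primes (\<lambda>p. Y p \<omega>) n))))) \<longlonglongrightarrow> exp (log_mgf \<kappa> \<beta> \<alpha> t)"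
  unfolding partial_mgf(2) log_mgf_def
  by (intro tendsto_exp tendsto_add tendsto_const summable_LIMSEQ log_mgf_deriv(2)[OF tail_values assms])

lemma partial_rv [measurable]: "(\<lambda>\<omega>. \<kappa> + (\<Sum>n<N. on_primes (\<lambda>p. Y p \<omega>) n)) \<in> borel_measurable M"
proof -
  have "(\<lambda>\<omega>. on_primes (\<lambda>p. Y p \<omega>) n) \<in> borel_measurable M" for n by (cases "prime n") (auto intro: Y_rv)
  thus ?thesis by measurable
qed

section \<open>Exponential tail bounds for the limit variable\<close>

context
  fixes \<kappa> :: real and W :: "'a \<Rightarrow> real"
  assumes W [measurable]: "W \<in> borel_measurable M"
    and lim: "AE \<omega> in M. (\<lambda>N. \<kappa> + (\<Sum>n<N. on_primes (\<lambda>p. Y p \<omega>) n)) \<longlonglongrightarrow> W \<omega>"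
begin

lemma partial_bounded_tendsto:
  fixes f :: "real \<Rightarrow> real"
  assumes f: "continuous_on UNIV f" and bd: "\<And>x. \<bar>f x\<bar> \<le> B"
  shows "(\<lambda>N. expectation (\<lambda>\<omega>. f (\<kappa> + (\<Sum>n<N. on_primes (\<lambda>p. Y p \<omega>) n)))) \<longlonglongrightarrow> expectation (\<lambda>\<omega>. f (W \<omega>))"
proof (rule integral_dominated_convergence[where w = "\<lambda>_. B"])
  have [measurable]: "f \<in> borel_measurable borel" by (rule borel_measurable_continuous_onI[OF f])
  show "(\<lambda>\<omega>. f (W \<omega>)) \<in> borel_measurable M" by measurable
  show "(\<lambda>\<omega>. f (\<kappa> + (\<Sum>n<N. on_primes (\<lambda>p. Y p \<omega>) n))) \<in> borel_measurable M" for N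
    using measurable_compose[OF partial_rv \<open>f \<in> borel_measurable borel\<close>] .
  show "AE \<omega> in M. (\<lambda>N. f (\<kappa> + (\<Sum>n<N. on_primes (\<lambda>p. Y p \<omega>) n))) \<longlonglongrightarrow> f (W \<omega>)"
    using lim by eventually_elim (rule continuous_on_tendsto_compose[OF f], auto)
qed (use bd in auto)

text \<open>Chernoff's bound. Cutting the exponential off at 1 gives a bounded continuous majorant
  of the indicator of \<open>x > a\<close>. Its expectations converge along the partial sums, where
  each is at most the expectation of the full exponential.\<close>

lemma tail_upper:
  assumes s: "s > 0"
  shows "prob {\<omega>\<in>space M. W \<omega> > a} \<le> exp (log_mgf \<kappa> \<beta> \<alpha> s - s * a)"
proof -
  let ?W = "\<lambda>N \<omega>. \<kappa> + (\<Sum>n<N. on_primes (\<lambda>p. Y p \<omega>) n)"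
  define f where "f x = min (exp (- (s * a)) * exp (s * x)) 1" for x
  have fc: "continuous_on UNIV f" unfolding f_def by (intro continuous_intros)
  have f0: "0 \<le> f x" "f x \<le> 1" for x by (auto simp: f_def)
  have fb: "\<bar>f x\<bar> \<le> 1" for x using f0[of x] by simp
  have [measurable]: "f \<in> borel_measurable borel" by (rule borel_measurable_continuous_onI[OF fc])
  have fint: "integrable M (\<lambda>\<omega>. f (g \<omega>))" if [measurable]: "g \<in> borel_measurable M" for g
    by (rule integrable_const_bound[where B = 1]) (use fb in auto)
  have "expectation (\<lambda>\<omega>. f (W \<omega>)) \<le> exp (- (s * a)) * exp (log_mgf \<kappa> \<beta> \<alpha> s)"
  proof (rule LIMSEQ_le[OF partial_bounded_tendsto[OF fc fb] tendsto_mult_left[OF partial_mgf_tendsto[OF s, of \<kappa>]]], intro exI allI impI)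
    fix N
    have "expectation (\<lambda>\<omega>. f (?W N \<omega>)) \<le> expectation (\<lambda>\<omega>. exp (- (s * a)) * exp (s * ?W N \<omega>))"
      by (intro integral_mono fint partial_rv integrable_mult_right partial_mgf(1)) (simp add: f_def)
    thus "expectation (\<lambda>\<omega>. f (?W N \<omega>)) \<le> exp (- (s * a)) * expectation (\<lambda>\<omega>. exp (s * ?W N \<omega>))"
      by simp
  qed
  moreover have "prob {\<omega>\<in>space M. W \<omega> > a} \<le> expectation (\<lambda>\<omega>. f (W \<omega>))"
  proof -
    have "prob {\<omega>\<in>space M. W \<omega> > a} = expectation (indicator {\<omega>\<in>space M. W \<omega> > a})" by simp
    also have "\<dots> \<le> expectation (\<lambda>\<omega>. f (W \<omega>))"
    proof (rule integral_mono)
      show "integrable M (\<lambda>\<omega>. f (W \<omega>))" by (rule fint) measurable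
      show "integrable M (indicator {\<omega>\<in>space M. W \<omega> > a} :: 'a \<Rightarrow> real)"
        by (rule integrable_real_indicator) (auto simp: emeasure_eq_measure)
      fix \<omega> assume "\<omega> \<in> space M"
      have "f x = 1" if "x > a" for x using that s by (simp add: f_def min_def flip: exp_add)
      thus "indicator {\<omega>\<in>space M. W \<omega> > a} \<omega> \<le> f (W \<omega>)" using f0[of "W \<omega>"] by (auto simp: indicator_def)
    qed
    finally show ?thesis .
  qed
  ultimately show ?thesis by (simp add: exp_diff exp_minus divide_inverse mult.commute)
qed

text \<open>Under the measure tilted by \<open>exp (s W)\<close>, Markov's inequality for \<open>exp (-h W)\<close> and \<open>exp (h W)\<close> bounds
  the mass outside \<open>[a, b]\<close>.\<close>

lemma tail_lower:
  assumes h: "0 < h" "h < s" and ab: "a < b"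
  shows "exp (log_mgf \<kappa> \<beta> \<alpha> s) - exp (log_mgf \<kappa> \<beta> \<alpha> (s - h) + h * a) - exp (log_mgf \<kappa> \<beta> \<alpha> (s + h) - h * b)
    \<le> exp (s * b) * prob {\<omega>\<in>space M. W \<omega> > a}"
proof -
  let ?W = "\<lambda>N \<omega>. \<kappa> + (\<Sum>n<N. on_primes (\<lambda>p. Y p \<omega>) n)"
  let ?E = "\<lambda>N t. expectation (\<lambda>\<omega>. exp (t * ?W N \<omega>))"
  \<comment> \<open>\<open>g\<close> is \<open>exp (s * x)\<close> times one minus the two Markov
    terms. Its positive part is continuous, vanishes for \<open>x <= a\<close> and never exceeds
    \<open>exp (s * b)\<close>, so it lies below \<open>exp (s * b)\<close> times the indicator of
    \<open>x > a\<close>.\<close>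
  define g where "g x = exp (s * x) - exp (h * a) * exp ((s - h) * x) - exp (- (h * b)) * exp ((s + h) * x)" for x
  define f where "f x = max 0 (g x)" for x
  have g_eq: "g x = exp (s * x) * (1 - exp (h * (a - x)) - exp (h * (x - b)))" for x
    by (simp add: g_def algebra_simps flip: exp_add)
  have fc: "continuous_on UNIV f" unfolding f_def g_def by (intro continuous_intros)
  have f0: "0 \<le> f x" for x by (simp add: f_def)
  have fa: "f x = 0" if "x \<le> a" for x
  proof -
    have "1 \<le> exp (h * (a - x))" using that h by simp
    hence "1 - exp (h * (a - x)) - exp (h * (x - b)) \<le> 0" using exp_gt_zero[of "h * (x - b)"] by linarith
    hence "g x \<le> 0" unfolding g_eq by (intro mult_nonneg_nonpos) auto
    thus ?thesis by (simp add: f_def)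
  qed
  have fb: "f x \<le> exp (s * b)" for x
  proof (cases "x \<le> b")
    case True
    have "1 - exp (h * (a - x)) - exp (h * (x - b)) \<le> 1" using exp_gt_zero[of "h * (x - b)"] exp_gt_zero[of "h * (a - x)"] by linarith
    hence "g x \<le> exp (s * x) * 1" unfolding g_eq by (intro mult_left_mono) auto
    also have "\<dots> \<le> exp (s * b)" using True h by simp
    finally show ?thesis by (simp add: f_def)
  next
    case False
    have "1 \<le> exp (h * (x - b))" using False h by simp
    hence "1 - exp (h * (a - x)) - exp (h * (x - b)) \<le> 0" using exp_gt_zero[of "h * (a - x)"] by linarith
    hence "g x \<le> 0" unfolding g_eq by (intro mult_nonneg_nonpos) auto
    thus ?thesis by (simp add: f_def)
  qed
  have fb': "\<bar>f x\<bar> \<le> exp (s * b)" for x using f0[of x] fb[of x] by simp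
  have [measurable]: "f \<in> borel_measurable borel" by (rule borel_measurable_continuous_onI[OF fc])
  have fint: "integrable M (\<lambda>\<omega>. f (g \<omega>))" if [measurable]: "g \<in> borel_measurable M" for g
    by (rule integrable_const_bound[where B = "exp (s * b)"]) (use fb' in auto)
  have lg: "(\<lambda>N. ?E N s - exp (h * a) * ?E N (s - h) - exp (- (h * b)) * ?E N (s + h))
      \<longlonglongrightarrow> exp (log_mgf \<kappa> \<beta> \<alpha> s) - exp (h * a) * exp (log_mgf \<kappa> \<beta> \<alpha> (s - h)) - exp (- (h * b)) * exp (log_mgf \<kappa> \<beta> \<alpha> (s + h))"
    by (intro tendsto_diff tendsto_mult_left partial_mgf_tendsto) (use h in auto)
  have "exp (log_mgf \<kappa> \<beta> \<alpha> s) - exp (h * a) * exp (log_mgf \<kappa> \<beta> \<alpha> (s - h)) - exp (- (h * b)) * exp (log_mgf \<kappa> \<beta> \<alpha> (s + h))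
      \<le> expectation (\<lambda>\<omega>. f (W \<omega>))"
  proof (rule LIMSEQ_le[OF lg partial_bounded_tendsto[OF fc fb']], intro exI allI impI)
    fix N
    note i = partial_mgf(1)[of _ \<kappa> N]
    have "expectation (\<lambda>\<omega>. g (?W N \<omega>)) = ?E N s - exp (h * a) * ?E N (s - h) - exp (- (h * b)) * ?E N (s + h)"
      unfolding g_def by (simp only: Bochner_Integration.integral_diff Bochner_Integration.integrable_diff
        integrable_mult_right i integral_mult_right_zero)
    moreover have "expectation (\<lambda>\<omega>. g (?W N \<omega>)) \<le> expectation (\<lambda>\<omega>. f (?W N \<omega>))"
      unfolding g_def[of "?W N _"]
      by (intro integral_mono fint partial_rv Bochner_Integration.integrable_diff integrable_mult_right i) (simp add: f_def g_def)
    ultimately show "?E N s - exp (h * a) * ?E N (s - h) - exp (- (h * b)) * ?E N (s + h)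
      \<le> expectation (\<lambda>\<omega>. f (?W N \<omega>))" by simp
  qed
  also have "\<dots> \<le> expectation (\<lambda>\<omega>. exp (s * b) * indicator {\<omega>\<in>space M. W \<omega> > a} \<omega>)"
  proof (rule integral_mono)
    show "integrable M (\<lambda>\<omega>. f (W \<omega>))" by (rule fint) measurable
    show "integrable M (\<lambda>\<omega>. exp (s * b) * indicator {\<omega>\<in>space M. W \<omega> > a} \<omega>)"
      by (intro integrable_mult_right integrable_real_indicator) (auto simp: emeasure_eq_measure)
    fix \<omega> assume "\<omega> \<in> space M"
    thus "f (W \<omega>) \<le> exp (s * b) * indicator {\<omega>\<in>space M. W \<omega> > a} \<omega>"
      using fb[of "W \<omega>"] fa[of "W \<omega>"] by (auto simp: indicator_def)
  qed
  also have "\<dots> = exp (s * b) * prob {\<omega>\<in>space M. W \<omega> > a}" by simp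
  finally show ?thesis by (simp add: exp_diff exp_add exp_minus divide_inverse mult.commute)
qed

end

end

section \<open>Tail asymptotics\<close>

lemma derivative_bounds_imp_diff_bounds:
  fixes f f' :: "real \<Rightarrow> real"
  assumes "x \<le> y" and der: "\<And>z. x \<le> z \<Longrightarrow> z \<le> y \<Longrightarrow> (f has_real_derivative f' z) (at z)"
  shows "(\<And>z. x \<le> z \<Longrightarrow> z \<le> y \<Longrightarrow> m \<le> f' z) \<Longrightarrow> (y - x) * m \<le> f y - f x"
    and "(\<And>z. x \<le> z \<Longrightarrow> z \<le> y \<Longrightarrow> f' z \<le> m) \<Longrightarrow> f y - f x \<le> (y - x) * m"
proof -
  obtain z where z: "x \<le> z" "z \<le> y" "f y - f x = (y - x) * f' z"
  proof (cases "x < y")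
    case True
    from MVT2[OF True der] obtain z where "x < z" "z < y" "f y - f x = (y - x) * f' z" by blast
    thus ?thesis by (intro that[of z]) auto
  qed (use assms(1) that[of x] in auto)
  show "(y - x) * m \<le> f y - f x" if "\<And>z. x \<le> z \<Longrightarrow> z \<le> y \<Longrightarrow> m \<le> f' z"
    unfolding z(3) using that[OF z(1,2)] assms(1) by (intro mult_left_mono) auto
  show "f y - f x \<le> (y - x) * m" if "\<And>z. x \<le> z \<Longrightarrow> z \<le> y \<Longrightarrow> f' z \<le> m"
    unfolding z(3) using that[OF z(1,2)] assms(1) by (intro mult_left_mono) auto
qed

lemma ln_add_one_ge_half:
  fixes y :: real
  assumes "0 \<le> y" "y \<le> 1/2"
  shows "y / 2 \<le> ln (1 + y)"
proof -
  have "y * y \<le> y * (1/2)" using assms by (intro mult_left_mono) auto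
  moreover have "y - y\<^sup>2 \<le> ln (1 + y)" using assms by (intro ln_one_plus_pos_lower_bound) auto
  ultimately show ?thesis unfolding power2_eq_square by linarith
qed

text \<open>The arguments \<open>s * v\<close> with \<open>v\<close> in \<open>[1, 2]\<close> cover
  the tilting window. Over it \<open>ln (ln x)\<close> moves by at most \<open>1 / ln s\<close> and
  the error term by at most a factor 2, so \<open>K'\<close> at \<open>s * v\<close> is \<tau> plus
  \<open>ln v\<close> up to an error of unchanged order.\<close>

lemma scaled_log_bounds:
  fixes s v x :: real
  assumes s: "ln s \<ge> exp 1" and v: "1 \<le> v" "v \<le> 2" and x: "x = s * v" and s0: "s > 0"
  shows "ln x = ln s + ln v" and "0 \<le> ln (ln x) - ln (ln s)" and "ln (ln x) - ln (ln s) \<le> 1 / ln s"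
    and "ln (ln x) / ln x \<le> 2 * (ln (ln s) / ln s)" "0 \<le> ln v"
proof -
  define L where "L = ln s"
  have e: "exp 1 \<ge> (1::real)" by (rule one_le_exp_iff[THEN iffD2]) simp
  have L: "L \<ge> exp 1" "L \<ge> 1" using s e unfolding L_def by linarith+
  have lv: "0 \<le> ln v" "ln v \<le> 1" using v ln_le_minus_one[of v] by auto
  have "1 \<le> ln L" using L(1) by (subst ln_ge_iff) (use L(2) in auto)
  show 1: "ln x = ln s + ln v" unfolding x using s0 v by (simp add: ln_mult)
  have r: "ln (ln x) = ln L + ln (1 + ln v / L)"
  proof -
    have "ln x = L * (1 + ln v / L)" unfolding 1 L_def[symmetric] using L by (simp add: field_simps)
    moreover have "1 + ln v / L > 0" using L lv by (intro add_pos_nonneg) auto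
    ultimately show ?thesis using L by (simp add: ln_mult)
  qed
  show 2: "0 \<le> ln (ln x) - ln (ln s)" unfolding r L_def[symmetric] using L lv by simp
  have "ln (1 + ln v / L) \<le> ln v / L" using L lv by (intro ln_add_one_self_le_self) auto
  also have "\<dots> \<le> 1 / L" using lv L by (intro divide_right_mono) auto
  finally show 3: "ln (ln x) - ln (ln s) \<le> 1 / ln s" unfolding r L_def[symmetric] by simp
  have "1 / L \<le> 1" using L by simp
  hence "ln (ln x) \<le> 2 * ln L" using 3 \<open>1 \<le> ln L\<close> unfolding L_def[symmetric] by linarith
  moreover have "0 \<le> ln (ln x)" using 2 \<open>1 \<le> ln L\<close> unfolding L_def[symmetric] by linarith
  moreover have "L \<le> ln x" unfolding 1 L_def[symmetric] using lv by simp
  ultimately have "ln (ln x) / ln x \<le> (2 * ln L) / L" using L by (intro frac_le) auto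
  thus "ln (ln x) / ln x \<le> 2 * (ln (ln s) / ln s)" by (simp add: L_def)
  show "0 \<le> ln v" by fact
qed

text \<open>The estimate at one fixed \<tau>, with \<theta> standing for
  \<open>ln \<tau> / \<tau>\<close>. The upper bound is Chernoff's at \<open>s\<close>, since
  \<open>K s - s * \<tau>\<close> is \<open>- s\<close> up to order \<open>s * \<theta>\<close>. For
  the lower bound, \<open>K'\<close> grows like \<open>ln v\<close> along \<open>s * v\<close>, so
  near \<open>s' = s * (1 + b * \<theta>)\<close> with \<open>b\<close> large it exceeds \<tau> by
  more than its own error. Steps of \<open>h = s * \<theta>\<close> to either side then shrink each
  Markov term by a factor \<open>exp (- (h * \<theta>)) <= exp (- 3)\<close>. Going from
  \<open>s\<close> to \<open>s'\<close> lowers \<open>K x - x * \<tau>\<close> by at most order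
  \<open>s * \<theta>\<close>.\<close>

lemma tail_pointwise:
  fixes K K' :: "real \<Rightarrow> real"
  assumes der: "\<And>x. x \<ge> s \<Longrightarrow> (K has_real_derivative K' x) (at x)"
    and s: "s > 0" and \<theta>: "\<theta> > 0" and D: "D \<ge> 0"
    and K': "\<And>v. 1 \<le> v \<Longrightarrow> v \<le> 2 \<Longrightarrow> \<bar>K' (s * v) - (\<tau> + ln v)\<bar> \<le> D * \<theta>"
    and K: "\<bar>K s - s * (\<tau> - 1)\<bar> \<le> c * (s * \<theta>)"
    and small: "(2 * D + 4) * \<theta> \<le> 1/2" and large: "s * \<theta>^2 \<ge> 3"
    and upper: "P \<le> exp (K s - s * \<tau>)"
    and lower: "\<And>s h b. 0 < h \<Longrightarrow> h < s \<Longrightarrow> \<tau> < b \<Longrightarrow>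
      exp (K s) - exp (K (s - h) + h * \<tau>) - exp (K (s + h) - h * b) \<le> exp (s * b) * P"
  shows "P > 0 \<and> \<bar>- ln P / s - 1\<bar> \<le> (c + 7 * D + 11) * \<theta>"
proof -
  \<comment> \<open>\<open>b\<close> satisfies
    \<open>(b - 1) * \<theta> / 2 = D * \<theta> + \<theta>\<close>: on \<open>[s' - h, s']\<close>
    the logarithm outweighs the error with a margin \<theta>. \<open>B\<close> is chosen so that on
    \<open>[s', s' + h]\<close> the derivative stays below
    \<open>\<tau> + (B - 1) * \<theta>\<close>.\<close>
  define b where "b = 2 * D + 3"
  define B where "B = b + 2 + D"
  define h where "h = s * \<theta>"
  define s' where "s' = s * (1 + b * \<theta>)"
  have b0: "b \<ge> 3" "B \<ge> 5" using D by (auto simp: b_def B_def)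
  have h0: "h > 0" using s \<theta> by (simp add: h_def)
  have b1: "b * \<theta> + \<theta> \<le> 1/2" using small by (simp add: b_def algebra_simps)
  have bt: "0 \<le> (b - 1) * \<theta>" "0 \<le> b * \<theta>" "0 \<le> D * \<theta>" using b0 \<theta> D by auto
  have h\<theta>: "h * \<theta> \<ge> 3" using large by (simp add: h_def power2_eq_square)
  have e1: "s' - h = s * (1 + (b - 1) * \<theta>)" "s' + h = s * (1 + (b + 1) * \<theta>)"
    by (simp_all add: s'_def h_def algebra_simps)
  have ord: "s \<le> s' - h" "s' - h \<le> s'" "s' \<le> s' + h" "s \<le> s'"
    using h0 mult_left_mono[of 1 "1 + (b - 1) * \<theta>" s] mult_left_mono[of 1 "1 + b * \<theta>" s] s bt
    unfolding e1(1) s'_def[symmetric] by (auto simp: e1(1)[symmetric])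
  have hs': "h < s'" using ord s by linarith
  have low: "\<tau> + ln (x / s) - D * \<theta> \<le> K' x" and up: "K' x \<le> \<tau> + ln (x / s) + D * \<theta>" if "s \<le> x" "x \<le> s' + h" for x
  proof -
    have "1 \<le> x / s" using that s by simp
    moreover have "x / s \<le> 2"
    proof -
      have "x \<le> s * (1 + (b + 1) * \<theta>)" using that(2) unfolding e1 .
      also have "\<dots> \<le> s * 2" using s b1 by (intro mult_left_mono) (auto simp: algebra_simps)
      finally show ?thesis using s by (simp add: divide_le_eq mult.commute)
    qed
    ultimately have "\<bar>K' (s * (x / s)) - (\<tau> + ln (x / s))\<bar> \<le> D * \<theta>" by (rule K')
    hence "\<bar>K' x - (\<tau> + ln (x / s))\<bar> \<le> D * \<theta>" using s by simp
    thus "\<tau> + ln (x / s) - D * \<theta> \<le> K' x" "K' x \<le> \<tau> + ln (x / s) + D * \<theta>" by linarith+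
  qed
  have d1: "(s' - (s' - h)) * (\<tau> + \<theta>) \<le> K s' - K (s' - h)"
  proof (rule derivative_bounds_imp_diff_bounds(1)[OF ord(2) der])
    fix x assume x: "s' - h \<le> x" "x \<le> s'"
    have "1 + (b - 1) * \<theta> \<le> x / s" using x(1) s unfolding e1 by (simp add: le_divide_eq mult.commute)
    hence "ln (1 + (b - 1) * \<theta>) \<le> ln (x / s)" using bt by (intro ln_mono) auto
    moreover have "(b - 1) * \<theta> / 2 \<le> ln (1 + (b - 1) * \<theta>)"
      using bt b1 \<theta> by (intro ln_add_one_ge_half) (auto simp: algebra_simps)
    moreover have "(b - 1) * \<theta> / 2 = D * \<theta> + \<theta>" by (simp add: b_def algebra_simps)
    ultimately show "\<tau> + \<theta> \<le> K' x" using low[of x] x ord by linarith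
  qed (use ord in linarith)
  have d2: "K (s' + h) - K s' \<le> (s' + h - s') * (\<tau> + (B - 1) * \<theta>)"
  proof (rule derivative_bounds_imp_diff_bounds(2)[OF ord(3) der])
    fix x assume x: "s' \<le> x" "x \<le> s' + h"
    have x0: "x > 0" using x ord s by linarith
    have "ln (x / s) \<le> x / s - 1" using x0 s by (intro ln_le_minus_one) auto
    moreover have "x / s \<le> 1 + (b + 1) * \<theta>" using x(2) s unfolding e1 by (simp add: divide_le_eq mult.commute)
    moreover have "(b + 1) * \<theta> + D * \<theta> = (B - 1) * \<theta>" by (simp add: B_def algebra_simps)
    ultimately show "K' x \<le> \<tau> + (B - 1) * \<theta>" using up[of x] x ord by linarith
  qed (use ord in linarith)
  have d3: "(s' - s) * (\<tau> - D * \<theta>) \<le> K s' - K s"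
  proof (rule derivative_bounds_imp_diff_bounds(1)[OF ord(4) der])
    fix x assume x: "s \<le> x" "x \<le> s'"
    have "0 \<le> ln (x / s)" using x s by simp
    thus "\<tau> - D * \<theta> \<le> K' x" using low[of x] x ord by linarith
  qed
  have E1: "K (s' - h) + h * \<tau> \<le> K s' - 3" using d1 h\<theta> by (simp add: algebra_simps)
  have E2: "K (s' + h) - h * (\<tau> + B * \<theta>) \<le> K s' - 3" using d2 h\<theta> by (simp add: algebra_simps)
  \<comment> \<open>Two losses of at most 1/4 leave half of the tilted mass, and 1/2 is in turn at
    least \<open>exp (- 1)\<close>.\<close>
  have q: "exp (- 3) \<le> (1/4 :: real)"
    using exp_ge_add_one_self[of "3::real"] by (simp add: exp_minus field_simps)
  have q2: "exp (- 1) \<le> (1/2 :: real)"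
    using exp_ge_add_one_self[of "1::real"] by (simp add: exp_minus field_simps)
  have "\<tau> < \<tau> + B * \<theta>" using b0 \<theta> by simp
  from lower[OF h0 hs' this]
  have "exp (s' * (\<tau> + B * \<theta>)) * P \<ge> exp (K s') - exp (K (s' - h) + h * \<tau>) - exp (K (s' + h) - h * (\<tau> + B * \<theta>))" .
  moreover have "exp (K (s' - h) + h * \<tau>) \<le> exp (K s') * (1/4)"
  proof -
    have "exp (K (s' - h) + h * \<tau>) \<le> exp (K s' + (- 3))" using E1 by simp
    also have "\<dots> \<le> exp (K s') * (1/4)" unfolding exp_add using q by (intro mult_left_mono) auto
    finally show ?thesis .
  qed
  moreover have "exp (K (s' + h) - h * (\<tau> + B * \<theta>)) \<le> exp (K s') * (1/4)"
  proof -
    have "exp (K (s' + h) - h * (\<tau> + B * \<theta>)) \<le> exp (K s' + (- 3))" using E2 by simp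
    also have "\<dots> \<le> exp (K s') * (1/4)" unfolding exp_add using q by (intro mult_left_mono) auto
    finally show ?thesis .
  qed
  moreover have "x * (1/2) \<le> w" if "x - y - z \<le> w" "y \<le> x * (1/4)" "z \<le> x * (1/4)" for x y z w :: real
    using that by linarith
  ultimately have "exp (K s') * (1/2) \<le> exp (s' * (\<tau> + B * \<theta>)) * P" by blast
  moreover have "exp (K s' + (- 1)) \<le> exp (K s') * (1/2)"
    unfolding exp_add using q2 by (intro mult_left_mono) auto
  ultimately have "exp (K s' + (- 1)) \<le> exp (s' * (\<tau> + B * \<theta>)) * P" by (rule order_trans[rotated])
  hence "exp (- (s' * (\<tau> + B * \<theta>))) * exp (K s' + (- 1)) \<le> exp (- (s' * (\<tau> + B * \<theta>))) * (exp (s' * (\<tau> + B * \<theta>)) * P)"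
    by (intro mult_left_mono) auto
  hence PL: "exp (K s' - 1 - s' * (\<tau> + B * \<theta>)) \<le> P"
    by (simp add: mult.assoc[symmetric] flip: exp_add)
  hence P0: "P > 0" using less_le_trans[OF exp_gt_zero PL] by simp
  have lnL: "K s' - 1 - s' * (\<tau> + B * \<theta>) \<le> ln P" using PL P0 by (simp add: ln_ge_iff)
  have lnU: "ln P \<le> K s - s * \<tau>" using ln_mono[OF upper P0] by simp
  have st: "s * \<theta> \<ge> 3"
  proof -
    have "\<theta> \<le> 1" using b1 bt by linarith
    hence "h * \<theta> \<le> h * 1" using h0 by (intro mult_left_mono) auto
    thus ?thesis using h\<theta> by (simp add: h_def)
  qed
  have A1: "s' * (B * \<theta>) \<le> 2 * B * (s * \<theta>)"
  proof -
    have "s' \<le> s * 2" unfolding s'_def using s b1 \<theta> by (intro mult_left_mono) auto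
    hence "s' * (B * \<theta>) \<le> s * 2 * (B * \<theta>)" using b0 \<theta> by (intro mult_right_mono) auto
    thus ?thesis by (simp add: mult_ac)
  qed
  have A2: "(s' - s) * (D * \<theta>) \<le> D * (s * \<theta>)"
  proof -
    have "s' - s \<le> s * 1" unfolding s'_def using mult_left_mono[of "b * \<theta>" 1 s] b1 s \<theta> by (simp add: algebra_simps)
    hence "(s' - s) * (D * \<theta>) \<le> s * 1 * (D * \<theta>)" using bt by (intro mult_right_mono) auto
    thus ?thesis by (simp add: mult_ac)
  qed
  have A3: "K s' - s' * \<tau> \<ge> K s - s * \<tau> - (s' - s) * (D * \<theta>)" using d3 by (simp add: algebra_simps)
  have A4: "K s' - 1 - s' * (\<tau> + B * \<theta>) = (K s' - s' * \<tau>) - 1 - s' * (B * \<theta>)" by (simp add: algebra_simps)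
  have A5: "K s - s * \<tau> \<ge> - s - c * (s * \<theta>)" "K s - s * \<tau> \<le> - s + c * (s * \<theta>)"
    using K by (auto simp: algebra_simps abs_le_iff)
  have BD: "2 * B * (s * \<theta>) = (6 * D + 10) * (s * \<theta>)" by (simp add: B_def b_def algebra_simps)
  have "- s - c * (s * \<theta>) - D * (s * \<theta>) - 1 - (6 * D + 10) * (s * \<theta>) \<le> ln P"
    using lnL A1 A2 A3 A5(1) unfolding A4 BD by linarith
  \<comment> \<open>The total consists of \<open>c\<close> from \<open>K s\<close>, \<open>D\<close>
    from the passage to \<open>s'\<close>, \<open>2 * B = 6 * D + 10\<close> from the width of the
    window, and 1 for the lost \<open>exp (- 1)\<close>, absorbed by
    \<open>s * \<theta> >= 3\<close>.\<close>
  moreover have "(c + 7 * D + 11) * (s * \<theta>) = c * (s * \<theta>) + D * (s * \<theta>) + (6 * D + 10) * (s * \<theta>) + s * \<theta>"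
    by (simp add: algebra_simps)
  ultimately have L: "- s - (c + 7 * D + 11) * (s * \<theta>) \<le> ln P" using st by linarith
  have "0 \<le> (7 * D + 11) * (s * \<theta>)" using D st by auto
  moreover have "(c + 7 * D + 11) * (s * \<theta>) = c * (s * \<theta>) + (7 * D + 11) * (s * \<theta>)" by (simp add: algebra_simps)
  ultimately have U: "ln P \<le> - s + (c + 7 * D + 11) * (s * \<theta>)" using lnU A5(2) by linarith
  have "\<bar>- ln P - s\<bar> \<le> ((c + 7 * D + 11) * \<theta>) * s" using L U by (simp add: abs_le_iff mult_ac)
  moreover have "- ln P / s - 1 = (- ln P - s) / s" using s by (simp add: field_simps)
  ultimately show ?thesis using P0 s by (simp add: divide_le_eq)
qed

text \<open>The choice \<open>s = exp (\<tau> - A) / \<tau>\<close> solves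
  \<open>ln s + ln (ln s) + A = \<tau>\<close> up to order \<open>ln \<tau> / \<tau>\<close>,
  because \<open>ln s = \<tau> - A - ln \<tau>\<close> and \<open>ln (ln s)\<close> agrees with
  \<open>ln \<tau>\<close> to that order. So it is close to the saddle point, and \<open>- s\<close>
  is the main term of the exponent.\<close>

lemma tail_asymp:
  fixes K K' P :: "real \<Rightarrow> real"
  assumes der: "\<And>s. s > 0 \<Longrightarrow> (K has_real_derivative K' s) (at s)"
    and C: "C \<ge> 0"
    and as: "\<forall>\<^sub>F s in at_top. \<bar>K' s - (ln s + ln (ln s) + A)\<bar> \<le> C * (ln (ln s) / ln s)"
    and upper: "\<And>s \<tau>. s > 0 \<Longrightarrow> P \<tau> \<le> exp (K s - s * \<tau>)"
    and lower: "\<And>s h a b. 0 < h \<Longrightarrow> h < s \<Longrightarrow> a < b \<Longrightarrow>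
      exp (K s) - exp (K (s - h) + h * a) - exp (K (s + h) - h * b) \<le> exp (s * b) * P a"
  shows "\<exists>E \<in> O[at_top](\<lambda>\<tau>::real. ln \<tau> / \<tau>). \<forall>\<^sub>F \<tau> in at_top. P \<tau> = exp (- (exp (\<tau> - A) / \<tau> * (1 + E \<tau>)))"
proof -
  define \<theta> where "\<theta> \<tau> = ln \<tau> / \<tau>" for \<tau> :: real
  define \<eta> where "\<eta> s = ln (ln s) / ln s" for s :: real
  define s where "s \<tau> = exp (\<tau> - A) / \<tau>" for \<tau> :: real
  \<comment> \<open>In \<open>D\<close>, \<open>4 * C\<close> bounds the error of \<open>K'\<close>
    over the window, 3 comes from \<open>e1\<close> and 1 from the variation of
    \<open>ln (ln x)\<close>. In \<open>c\<close>, \<open>2 * (2 * C + 3)\<close> comes from the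
    antiderivative and 3 again from \<open>e1\<close>.\<close>
  define D where "D = 4 * C + 4"
  define c where "c = 4 * C + 9"
  have D: "D \<ge> 0" using C by (simp add: D_def)
  obtain S where S: "\<And>x. x \<ge> S \<Longrightarrow> \<bar>K' x - (ln x + ln (ln x) + A)\<bar> \<le> C * \<eta> x"
    using as unfolding eventually_at_top_linorder \<eta>_def by blast
  have K: "\<forall>\<^sub>F s in at_top. \<bar>K s - s * (ln s + ln (ln s) + A - 1)\<bar> \<le> (2 * C + 3) * (s * \<eta> s)"
    unfolding \<eta>_def by (rule antiderivative_asymp[OF der C as])
  have st: "filterlim s at_top at_top" unfolding s_def by real_asymp
  have lns: "ln (s \<tau>) = \<tau> - A - ln \<tau>" if "\<tau> > 0" for \<tau> using that by (simp add: s_def ln_div)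
  have e1: "\<forall>\<^sub>F \<tau> in at_top. \<bar>(\<tau> - A - ln \<tau>) + ln (\<tau> - A - ln \<tau>) + A - \<tau>\<bar> \<le> 3 * \<theta> \<tau>"
    unfolding \<theta>_def by real_asymp
  have e2: "\<forall>\<^sub>F \<tau> in at_top. ln (\<tau> - A - ln \<tau>) / (\<tau> - A - ln \<tau>) \<le> 2 * \<theta> \<tau>"
    unfolding \<theta>_def by real_asymp
  have e3: "\<forall>\<^sub>F \<tau> in at_top. 1 / (\<tau> - A - ln \<tau>) \<le> \<theta> \<tau>"
    unfolding \<theta>_def by real_asymp
  have e4: "\<forall>\<^sub>F \<tau> in at_top. s \<tau> * (\<theta> \<tau>)^2 \<ge> 3"
    unfolding \<theta>_def s_def by real_asymp
  have "((\<lambda>\<tau>. (2 * D + 4) * \<theta> \<tau>) \<longlongrightarrow> (2 * D + 4) * 0) at_top"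
    unfolding \<theta>_def by (intro tendsto_mult_left) real_asymp
  hence "\<forall>\<^sub>F \<tau> in at_top. (2 * D + 4) * \<theta> \<tau> < 1/2" by (rule order_tendstoD) simp
  hence e5: "\<forall>\<^sub>F \<tau> in at_top. (2 * D + 4) * \<theta> \<tau> \<le> 1/2" by (rule eventually_mono) simp
  have e6: "\<forall>\<^sub>F \<tau>::real in at_top. \<theta> \<tau> > 0" unfolding \<theta>_def by real_asymp
  have e7: "\<forall>\<^sub>F \<tau> in at_top. \<tau> - A - ln \<tau> \<ge> exp 1" by real_asymp
  have main: "\<forall>\<^sub>F \<tau> in at_top. P \<tau> > 0 \<and> \<bar>- ln (P \<tau>) / s \<tau> - 1\<bar> \<le> (c + 7 * D + 11) * \<theta> \<tau>"
    using e1 e2 e3 e4 e5 e6 e7 filterlim_at_top[THEN iffD1, OF st, rule_format, of S]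
      eventually_compose_filterlim[OF K st] eventually_gt_at_top[of 0]
  proof eventually_elim
    case (elim \<tau>)
    have s0: "s \<tau> > 0" using elim by (simp add: s_def)
    note l = lns[OF elim(10)]
    have l1: "\<bar>ln (s \<tau>) + ln (ln (s \<tau>)) + A - \<tau>\<bar> \<le> 3 * \<theta> \<tau>" and l2: "\<eta> (s \<tau>) \<le> 2 * \<theta> \<tau>"
      and l3: "1 / ln (s \<tau>) \<le> \<theta> \<tau>" and l7: "ln (s \<tau>) \<ge> exp 1"
      using elim(1,2,3,7) unfolding l \<eta>_def by auto
    show ?case
    proof (rule tail_pointwise[where K = K and K' = K'])
      show "(K has_real_derivative K' x) (at x)" if "x \<ge> s \<tau>" for x using der that s0 by auto
      show "\<bar>K' (s \<tau> * v) - (\<tau> + ln v)\<bar> \<le> D * \<theta> \<tau>" if v: "1 \<le> v" "v \<le> 2" for v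
      proof -
        note b = scaled_log_bounds[OF l7 v refl s0]
        have "s \<tau> * v \<ge> s \<tau> * 1" using v s0 by (intro mult_left_mono) auto
        hence "s \<tau> * v \<ge> S" using elim(8) by linarith
        from S[OF this] have "\<bar>K' (s \<tau> * v) - (ln (s \<tau> * v) + ln (ln (s \<tau> * v)) + A)\<bar> \<le> C * \<eta> (s \<tau> * v)" .
        also have "C * \<eta> (s \<tau> * v) \<le> C * (4 * \<theta> \<tau>)" using b(4) l2 C unfolding \<eta>_def by (intro mult_left_mono) auto
        finally have "\<bar>K' (s \<tau> * v) - (ln (s \<tau> * v) + ln (ln (s \<tau> * v)) + A)\<bar> \<le> 4 * C * \<theta> \<tau>" by simp
        moreover have "D * \<theta> \<tau> = 4 * C * \<theta> \<tau> + 4 * \<theta> \<tau>" by (simp add: D_def algebra_simps)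
        ultimately show ?thesis using l1 l3 b(1,2,3) by linarith
      qed
      show "\<bar>K (s \<tau>) - s \<tau> * (\<tau> - 1)\<bar> \<le> c * (s \<tau> * \<theta> \<tau>)"
      proof -
        have "K (s \<tau>) - s \<tau> * (\<tau> - 1) = (K (s \<tau>) - s \<tau> * (ln (s \<tau>) + ln (ln (s \<tau>)) + A - 1))
          + s \<tau> * (ln (s \<tau>) + ln (ln (s \<tau>)) + A - \<tau>)" by (simp add: algebra_simps)
        moreover have "\<bar>s \<tau> * (ln (s \<tau>) + ln (ln (s \<tau>)) + A - \<tau>)\<bar> \<le> s \<tau> * (3 * \<theta> \<tau>)"
          unfolding abs_mult using l1 s0 by (simp add: mult_left_mono)
        moreover have "(2 * C + 3) * (s \<tau> * \<eta> (s \<tau>)) \<le> (2 * C + 3) * (s \<tau> * (2 * \<theta> \<tau>))"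
          using l2 s0 C by (intro mult_left_mono) auto
        moreover have "(2 * C + 3) * (s \<tau> * (2 * \<theta> \<tau>)) + s \<tau> * (3 * \<theta> \<tau>) = c * (s \<tau> * \<theta> \<tau>)"
          by (simp add: c_def algebra_simps)
        ultimately show ?thesis using elim(9) by linarith
      qed
      show "P \<tau> \<le> exp (K (s \<tau>) - s \<tau> * \<tau>)" by (rule upper[OF s0])
      show "exp (K t) - exp (K (t - h) + h * \<tau>) - exp (K (t + h) - h * b) \<le> exp (t * b) * P \<tau>"
        if "0 < h" "h < t" "\<tau> < b" for t h b by (rule lower[OF that])
    qed (fact s0 D elim)+
  qed
  show ?thesis
  \<comment> \<open>The error function is obtained by solving the claimed identity for it, which is
    possible where \<open>P \<tau> > 0\<close>; what remains is to bound its size.\<close>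
  proof (rule bexI[of _ "\<lambda>\<tau>. - ln (P \<tau>) / s \<tau> - 1"])
    show "\<forall>\<^sub>F \<tau> in at_top. P \<tau> = exp (- (exp (\<tau> - A) / \<tau> * (1 + (- ln (P \<tau>) / s \<tau> - 1))))"
      using main eventually_gt_at_top[of 0]
    proof eventually_elim
      case (elim \<tau>)
      have "s \<tau> > 0" using elim by (simp add: s_def)
      thus ?case unfolding s_def[symmetric] using elim by simp
    qed
    show "(\<lambda>\<tau>. - ln (P \<tau>) / s \<tau> - 1) \<in> O(\<lambda>\<tau>. ln \<tau> / \<tau>)"
    proof (rule bigoI)
      show "\<forall>\<^sub>F \<tau> in at_top. norm (- ln (P \<tau>) / s \<tau> - 1) \<le> (c + 7 * D + 11) * norm (ln \<tau> / \<tau>)"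
        using main e6 unfolding \<theta>_def by eventually_elim (simp only: real_norm_def abs_of_pos)
    qed
  qed
qed

theorem (in prime_sum) tail:
  assumes W: "W \<in> borel_measurable M"
    and lim: "AE \<omega> in M. (\<lambda>N. \<kappa> + (\<Sum>n<N. on_primes (\<lambda>p. Y p \<omega>) n)) \<longlonglongrightarrow> W \<omega>"
  shows "\<exists>E \<in> O[at_top](\<lambda>\<tau>::real. ln \<tau> / \<tau>). \<forall>\<^sub>F \<tau> in at_top.
    prob {\<omega>\<in>space M. W \<omega> > \<tau>} = exp (- (exp (\<tau> - (\<kappa> + tail_const \<beta>)) / \<tau> * (1 + E \<tau>)))"
proof -
  obtain C where C: "C \<ge> 0"
    "\<forall>\<^sub>F s in at_top. \<bar>(\<Sum>p. on_primes (\<lambda>p. log_mgf_term \<beta> \<alpha> p s) p) - (ln s + ln (ln s) + tail_const \<beta>)\<bar> \<le> C * (ln (ln s) / ln s)"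
    using log_mgf_term_sum_asymp[OF tail_values] by blast
  have as: "\<forall>\<^sub>F s in at_top. \<bar>\<kappa> + (\<Sum>p. on_primes (\<lambda>p. log_mgf_term \<beta> \<alpha> p s) p) - (ln s + ln (ln s) + (\<kappa> + tail_const \<beta>))\<bar> \<le> C * (ln (ln s) / ln s)"
    using C(2) by eventually_elim (simp add: algebra_simps)
  show ?thesis
    by (rule tail_asymp[OF log_mgf_deriv(1)[OF tail_values] C(1) as]) (simp_all only: tail_upper[OF W lim] tail_lower[OF W lim])
qed

text \<open>The sign \<sigma> selects the tail: \<open>\<sigma> = -1\<close> gives the right tail of
  \<open>gamma_rand\<close>, \<open>\<sigma> = 1\<close> that of its negative. The positive value
  \<open>\<beta> p\<close> of the summand is taken at \<open>X p = \<sigma>\<close>, which decides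
  between \<open>val_plus\<close> and \<open>val_minus\<close>.\<close>

lemma (in prob_space) gamma_rand_tail:
  fixes \<sigma> :: real
  assumes indep: "indep_vars (\<lambda>_. borel) X {p. prime p}"
    and X1: "\<And>p. prime p \<Longrightarrow> prob {\<omega>\<in>space M. X p \<omega> = 1} = real p / (2 * (real p + 1))"
    and Xm1: "\<And>p. prime p \<Longrightarrow> prob {\<omega>\<in>space M. X p \<omega> = -1} = real p / (2 * (real p + 1))"
    and X0: "\<And>p. prime p \<Longrightarrow> prob {\<omega>\<in>space M. X p \<omega> = 0} = 1 / (real p + 1)"
    and \<sigma>: "(\<sigma> = 1 \<and> \<beta> = val_plus \<and> \<alpha> = val_minus) \<or> (\<sigma> = -1 \<and> \<beta> = val_minus \<and> \<alpha> = val_plus)"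
  shows "\<exists>E \<in> O[at_top](\<lambda>\<tau>::real. ln \<tau> / \<tau>). \<forall>\<^sub>F \<tau> in at_top.
    prob {\<omega>\<in>space M. - \<sigma> * gamma_rand X \<omega> > \<tau>} = exp (- (exp (\<tau> - (- \<sigma> * euler_mascheroni + tail_const \<beta>)) / \<tau> * (1 + E \<tau>)))"
proof -
  define g where "g p x = \<sigma> * (ln (real p) * x / (real p - x))" for p x
  have tail_values: "tail_values \<beta> \<alpha>" using \<sigma> by (auto simp: tail_values_def)
  have [measurable]: "g p \<in> borel_measurable borel" for p unfolding g_def by measurable
  have Xrv: "X p \<in> borel_measurable M" if "prime p" for p
    using indep that unfolding indep_vars_def by auto
  have XAE: "AE \<omega> in M. X p \<omega> = 1 \<or> X p \<omega> = -1 \<or> X p \<omega> = 0" if p: "prime p" for p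
  proof (rule AE_three_values)
    show "X p \<in> borel_measurable M" by (rule Xrv[OF p])
    show "prob {\<omega>\<in>space M. X p \<omega> = 1} + (prob {\<omega>\<in>space M. X p \<omega> = -1} + prob {\<omega>\<in>space M. X p \<omega> = 0}) = 1"
      unfolding X1[OF p] Xm1[OF p] X0[OF p] inverse_real_Suc by linarith
  qed auto
  have g: "g p 0 = 0" "{g p 1, g p (-1)} = {\<beta> p, - \<alpha> p}" "\<sigma> = 1 \<Longrightarrow> g p 1 = \<beta> p \<and> g p (-1) = - \<alpha> p"
    "\<sigma> \<noteq> 1 \<Longrightarrow> g p 1 = - \<alpha> p \<and> g p (-1) = \<beta> p" for p
    using \<sigma> by (auto simp: g_def val_plus_def val_minus_def)
  \<comment> \<open>On the values 1, -1 and 0 the map \<open>g p\<close> is injective, so the law of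
    \<open>X p\<close> is carried over value by value.\<close>
  have eq: "prob {\<omega>\<in>space M. g p (X p \<omega>) = g p x} = prob {\<omega>\<in>space M. X p \<omega> = x}"
    if p: "prime p" and x: "x \<in> {1, -1, 0}" for p x
  proof (rule finite_measure_eq_AE)
    note b = tail_values_bounds[OF tail_values p]
    have inj: "g p y = g p x \<longleftrightarrow> y = x" if "y \<in> {1, -1, 0}" for y
      using that x g[of p] b(4,5) by (cases "\<sigma> = 1") auto
    show "AE \<omega> in M. (\<omega> \<in> {\<omega>\<in>space M. g p (X p \<omega>) = g p x}) = (\<omega> \<in> {\<omega>\<in>space M. X p \<omega> = x})"
      using XAE[OF p] by eventually_elim (use inj in auto)
    note [measurable] = Xrv[OF p]
    show "{\<omega>\<in>space M. g p (X p \<omega>) = g p x} \<in> events" "{\<omega>\<in>space M. X p \<omega> = x} \<in> events"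
      by measurable
  qed
  define Y where "Y p \<omega> = g p (X p \<omega>)" for p \<omega>
  interpret prime_sum M Y \<beta> \<alpha>
  proof
    show "indep_vars (\<lambda>_. borel) Y {p. prime p}"
      unfolding Y_def by (rule indep_vars_compose2[OF indep]) measurable
    fix p :: nat assume p: "prime p"
    note e = eq[OF p, of 1] eq[OF p, of "-1"] eq[OF p, of 0]
    show "prob {\<omega>\<in>space M. Y p \<omega> = \<beta> p} = real p / (2 * (real p + 1))"
      and "prob {\<omega>\<in>space M. Y p \<omega> = - \<alpha> p} = real p / (2 * (real p + 1))"
      and "prob {\<omega>\<in>space M. Y p \<omega> = 0} = 1 / (real p + 1)"
      using e g[of p] X1[OF p] Xm1[OF p] X0[OF p] by (cases "\<sigma> = 1"; simp add: Y_def)+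
  qed (fact tail_values)
  let ?f = "\<lambda>\<omega> p. if prime p then ln (real p) * X p \<omega> / (real p - X p \<omega>) else 0"
  show ?thesis
  proof (rule tail)
    have "(\<lambda>\<omega>. ?f \<omega> p) \<in> borel_measurable M" for p
      by (cases "prime p") (use Xrv in \<open>auto intro!: borel_measurable_divide borel_measurable_times borel_measurable_diff\<close>)
    thus "(\<lambda>\<omega>. - \<sigma> * gamma_rand X \<omega>) \<in> borel_measurable M"
      unfolding gamma_rand_def by measurable
    \<comment> \<open>Where the series converges, the infinite sum in \<open>gamma_rand\<close> is
      the limit of its partial sums; the null set on which it has a default value is invisible
      here.\<close>
    show "AE \<omega> in M. (\<lambda>N. - \<sigma> * euler_mascheroni + (\<Sum>n<N. on_primes (\<lambda>p. Y p \<omega>) n)) \<longlonglongrightarrow> - \<sigma> * gamma_rand X \<omega>"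
      using AE_Y_summable
    proof eventually_elim
      case (elim \<omega>)
      have Yf: "on_primes (\<lambda>p. Y p \<omega>) = (\<lambda>p. \<sigma> * ?f \<omega> p)" by (auto simp: Y_def g_def)
      have "\<sigma> \<noteq> 0" using \<sigma> by auto
      hence "summable (?f \<omega>)" using elim unfolding Yf by (simp only: summable_cmult_iff) auto
      hence "(\<lambda>N. - \<sigma> * euler_mascheroni + \<sigma> * (\<Sum>n<N. ?f \<omega> n)) \<longlonglongrightarrow> - \<sigma> * euler_mascheroni + \<sigma> * suminf (?f \<omega>)"
        by (intro tendsto_intros summable_LIMSEQ)
      thus ?case unfolding Yf gamma_rand_def sum_distrib_left[symmetric] by (simp add: algebra_simps)
    qed
  qed
qed

theorem theorem1p2:
  fixes M :: "'a measure" and X :: "nat \<Rightarrow> 'a \<Rightarrow> real"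
  assumes "prob_space M"
    and "prob_space.indep_vars M (\<lambda>_. borel) X {p. prime p}"
    and "\<And>p. prime p \<Longrightarrow> \<P>(\<omega> in M. X p \<omega> = 1) = real p / (2 * (real p + 1))"
    and "\<And>p. prime p \<Longrightarrow> \<P>(\<omega> in M. X p \<omega> = -1) = real p / (2 * (real p + 1))"
    and "\<And>p. prime p \<Longrightarrow> \<P>(\<omega> in M. X p \<omega> = 0) = 1 / (real p + 1)"
  shows "(\<exists>E \<in> O[at_top](\<lambda>\<tau>::real. ln \<tau> / \<tau>). \<forall>\<^sub>F \<tau> in at_top.
            \<P>(\<omega> in M. gamma_rand X \<omega> > \<tau>) = exp (- (exp (\<tau> - A1) / \<tau> * (1 + E \<tau>))))
       \<and> (\<exists>E \<in> O[at_top](\<lambda>\<tau>::real. ln \<tau> / \<tau>). \<forall>\<^sub>F \<tau> in at_top.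
            \<P>(\<omega> in M. gamma_rand X \<omega> < - \<tau>) = exp (- (exp (\<tau> - A2) / \<tau> * (1 + E \<tau>))))"
proof -
  interpret prob_space M by fact
  note tail = gamma_rand_tail[OF assms(2-5)]
  \<comment> \<open>The event \<open>gamma_rand X \<omega> < - \<tau>\<close> is a right-tail event
    of the negated variable, which is the case \<open>\<sigma> = 1\<close>.\<close>
  have neg: "\<tau> < - y \<longleftrightarrow> y < - \<tau>" for \<tau> y :: real by linarith
  show ?thesis
    using tail[of "-1" val_minus val_plus] tail[of 1 val_plus val_minus] tail_const_val_minus tail_const_val_plus by (simp add: neg)
qed

end
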